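(* Let $\varepsilon>0$, $\alpha\in L^\infty(\Omega M)$ with $\alpha(x,\xi)\ge\alpha_0>0$ for all $(x,\xi)\in\Omega M$, $n\in C^1(M)$, and let $f\in L^2(S^m\tau_M')$ be an $m$-tensor field. Let $\phi$ be given boundary data on $\partial_+\Omega M$ and $\hat\phi\in H^1(\Omega M)$ an extension of it, i.e. $\gamma_+\hat\phi=\phi$. If $$\sup_{x\in M}\frac{\|\nabla n(x)\|}{n(x)}<\alpha_0,$$ then there exists a unique $u_\varepsilon\in H_0^1(\Omega M)$ such that $$a_\varepsilon(u_\varepsilon,v)=b_\phi^\varepsilon(v)\qquad\text{for all }v\in H_0^1(\Omega M),$$ where $$a_\varepsilon(u,v)=\int_{\Omega M}\Big(\varepsilon\langle\nabla_xu,\nabla_xv\rangle+\varepsilon\langle\nabla_\xi u,\nabla_\xi v\rangle+\langle\nabla_xu,\xi\rangle v-\Gamma_{ij}^k(x)\xi^i\xi^j\frac{\partial u}{\partial\xi_k}v+\alpha uv\Big)\mathrm d\Sigma,$$ $$b_\phi^\varepsilon(v)=\int_{\Omega M}f_{i_1\dots i_m}(x)\,\xi^{i_1}\cdots\xi^{i_m}\,v\,\mathrm d\Sigma-a_\varepsilon(\hat\phi,v).$$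
   Context: Setting: $M=\{x\in\mathbb R^3:\|x\|_{eucl}\le1\}$; the refractive index $n:M\to\mathbb R$ satisfies $n(x)\ge c_n>0$ for a constant $c_n$; $M$ carries the Riemannian metric $g_{ij}(x)=n^2(x)\delta_{ij}$. Repeated indices are summed over. $\langle u,v\rangle=g_{ij}u_iv_j=n^2(x)\sum_iu_iv_i$ and $\|u\|=n(x)\|u\|_{eucl}$ for tangent vectors; the gradient is $\nabla h=n^{-2}(x)\nabla_{eucl}h$, so $\|\nabla n\|=n^{-1}\|\nabla_{eucl}n\|$. The Christoffel symbols are $$\Gamma_{ij}^k(x)=n^{-1}(x)\Big(\frac{\partial n}{\partial x_j}\delta_{ik}+\frac{\partial n}{\partial x_i}\delta_{jk}-\frac{\partial n}{\partial x_k}\delta_{ij}\Big).$$ $\Omega M=\{(x,\xi)\in TM:\|\xi\|=1\}$ is the unit sphere bundle, and $\partial_+\Omega M=\{(x,\xi)\in\Omega M:x\in\partial M,\ \langle\xi,\nu(x)\rangle\ge0\}$ with $\nu$ the outer unit normal. Points of $\Omega M$ are written $(x,\xi)$ with $\xi=n^{-1}(x)(\cos\varphi\sin\theta,\sin\varphi\sin\theta,\cos\theta)$, $\varphi\in[0,2\pi]$, $\theta\in[0,\pi]$. Derivatives with respect to $\xi$ are $$\tfrac{\partial}{\partial\xi_1}=n(x)\Big(\cos\varphi\cos\theta\tfrac{\partial}{\partial\theta}-\tfrac{\sin\varphi}{\sin\theta}\tfrac{\partial}{\partial\varphi}\Big),\quad\tfrac{\partial}{\partial\xi_2}=n(x)\Big(\sin\varphi\cos\theta\tfrac{\partial}{\partial\theta}+\tfrac{\cos\varphi}{\sin\theta}\tfrac{\partial}{\partial\varphi}\Big),\quad\tfrac{\partial}{\partial\xi_3}=-n(x)\sin\theta\tfrac{\partial}{\partial\theta},$$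 and derivatives $\partial/\partial x_i$ are taken with the angles $(\varphi,\theta)$ fixed (equivalently, functions on $\Omega M$ are extended to be homogeneous of degree $0$ in $\xi$). $\nabla_xu$ and $\nabla_\xi u$ are the vectors with components $n^{-2}\partial u/\partial x_i$, respectively $n^{-2}\partial u/\partial\xi_i$; thus $\langle\nabla_xu,\xi\rangle=\xi_i\,\partial u/\partial x_i$, $\langle\nabla_xu,\nabla_xv\rangle=n^{-2}\sum_i\frac{\partial u}{\partial x_i}\frac{\partial v}{\partial x_i}$, $\langle\nabla_\xi u,\nabla_\xi v\rangle=n^{-2}\sum_i\frac{\partial u}{\partial\xi_i}\frac{\partial v}{\partial\xi_i}$. The measure on $\Omega M$ is $\mathrm d\Sigma=n^3(x)\sin\theta\,\mathrm d\theta\,\mathrm d\varphi\,\mathrm dx$. $H^1(\Omega M)$ is the Sobolev space with norm $\|u\|_{H^1(\Omega M)}^2=\int_{\Omega M}(u^2+\|\nabla_xu\|^2+\|\nabla_\xi u\|^2)\,\mathrm d\Sigma$; $H_0^1(\Omega M)$ is its subspace of functions with zero trace on $\partial\Omega M=\{(x,\xi)\in\Omega M:x\in\partial M\}$. $\gamma_+:H^1(\Omega M)\to L^2(\partial_+\Omega M)$ is the trace operator. $L^2(S^m\tau_M')$ is the space of square-integrable symmetric covariant $m$-tensor fields $f=(f_{i_1\cdots i_m})$ on $M$, $m\ge0$ an integer. The variational problem is the weak form of the viscosity equation $-\varepsilon\Delta u+\langle\nabla_xu,\xi\rangle+\alpha u-\Gamma_{ij}^k\xi_i\xi_j\frac{\partial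 u}{\partial\xi_k}=f_{i_1\dots i_m}\xi^{i_1}\cdots\xi^{i_m}$, and $u_{\phi,\varepsilon}=u_\varepsilon+\hat\phi$ is the viscosity solution. *)

theory Defs
  imports "HOL-Analysis.Analysis"
begin

type_synonym vec3 = "real^3"
type_synonym phase = "vec3 \<times> vec3"

definition MM :: "vec3 set" where
  "MM = cball 0 1"

(* On the sets S used below (the closed ball, the closed ball times punctured space, UNIV) the
   derivative within S is unique, and this is the usual notion "C^1 up to the boundary". *)
definition C1_on :: "'a::euclidean_space set \<Rightarrow> ('a \<Rightarrow> real) \<Rightarrow> bool" where
  "C1_on S f \<longleftrightarrow> (\<forall>z\<in>S. f differentiable (at z within S)) \<and>
     (\<forall>h. continuous_on S (\<lambda>z. frechet_derivative f (at z within S) h))"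

definition L2 :: "'a measure \<Rightarrow> ('a \<Rightarrow> real) set" where
  "L2 N = {u \<in> borel_measurable N. integrable N (\<lambda>z. (u z)\<^sup>2)}"

definition Linfty :: "'a measure \<Rightarrow> ('a \<Rightarrow> real) set" where
  "Linfty N = {u \<in> borel_measurable N. \<exists>C. AE z in N. \<bar>u z\<bar> \<le> C}"

text \<open>Tangent vectors are given by their Cartesian components; the function \<open>n\<close> is the refractive
  index, only its values on the ball are used.\<close>

definition ginner :: "(vec3 \<Rightarrow> real) \<Rightarrow> vec3 \<Rightarrow> vec3 \<Rightarrow> vec3 \<Rightarrow> real" where
  "ginner n x u v = (n x)\<^sup>2 * (u \<bullet> v)"

definition gnorm :: "(vec3 \<Rightarrow> real) \<Rightarrow> vec3 \<Rightarrow> vec3 \<Rightarrow> real" where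
  "gnorm n x u = sqrt (ginner n x u u)"

definition partial :: "(vec3 \<Rightarrow> real) \<Rightarrow> 3 \<Rightarrow> vec3 \<Rightarrow> real" where
  "partial h i x = frechet_derivative h (at x within MM) (axis i 1)"

definition ggrad :: "(vec3 \<Rightarrow> real) \<Rightarrow> (vec3 \<Rightarrow> real) \<Rightarrow> vec3 \<Rightarrow> vec3" where
  "ggrad n h x = (\<chi> i. partial h i x / (n x)\<^sup>2)"

definition kron :: "3 \<Rightarrow> 3 \<Rightarrow> real" where
  "kron i j = (if i = j then 1 else 0)"

definition Christoffel :: "(vec3 \<Rightarrow> real) \<Rightarrow> 3 \<Rightarrow> 3 \<Rightarrow> 3 \<Rightarrow> vec3 \<Rightarrow> real" where
  "Christoffel n i j k x =
     (partial n j x * kron i k + partial n i x * kron j k - partial n k x * kron i j) / n x"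

definition Omega :: "(vec3 \<Rightarrow> real) \<Rightarrow> phase set" where
  "Omega n = {(x, \<xi>). x \<in> MM \<and> gnorm n x \<xi> = 1}"

definition bd_Omega :: "(vec3 \<Rightarrow> real) \<Rightarrow> phase set" where
  "bd_Omega n = {(x, \<xi>) \<in> Omega n. x \<in> frontier MM}"

text \<open>The outer normal of unit length with respect to the metric.\<close>

definition outer_normal :: "(vec3 \<Rightarrow> real) \<Rightarrow> vec3 \<Rightarrow> vec3" where
  "outer_normal n x = x /\<^sub>R n x"

definition bd_Omega_plus :: "(vec3 \<Rightarrow> real) \<Rightarrow> phase set" where
  "bd_Omega_plus n = {(x, \<xi>) \<in> bd_Omega n. ginner n x \<xi> (outer_normal n x) \<ge> 0}"

definition sph :: "real \<times> real \<Rightarrow> vec3" where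
  "sph = (\<lambda>(\<phi>, \<theta>). vector [cos \<phi> * sin \<theta>, sin \<phi> * sin \<theta>, cos \<theta>])"

text \<open>The surface measure \<open>sin \<theta> d\<theta> d\<phi>\<close> of the Euclidean unit sphere.\<close>

definition sphere_measure :: "vec3 measure" where
  "sphere_measure =
     distr (density (restrict_space lborel ({0..2 * pi} \<times> {0..pi})) (\<lambda>(\<phi>, \<theta>). ennreal (sin \<theta>)))
       (restrict_space borel (sphere 0 1)) sph"

text \<open>The measure \<open>d\<Sigma> = n\<^sup>3 sin \<theta> d\<theta> d\<phi> dx\<close>, transported to the sphere bundle by
  \<open>\<xi> = \<omega> / n(x)\<close> with \<open>\<omega>\<close> in the Euclidean unit sphere.\<close>

definition Sigma_measure :: "(vec3 \<Rightarrow> real) \<Rightarrow> phase measure" where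
  "Sigma_measure n =
     distr (density (restrict_space lborel MM \<Otimes>\<^sub>M sphere_measure) (\<lambda>(x, \<omega>). ennreal (n x ^ 3)))
       (restrict_space borel (Omega n)) (\<lambda>(x, \<omega>). (x, \<omega> /\<^sub>R n x))"

text \<open>The induced measure on the boundary of the sphere bundle: the Riemannian surface element of
  the unit sphere as the boundary of the ball is \<open>n\<^sup>2\<close> times the Euclidean one.\<close>

definition bd_measure :: "(vec3 \<Rightarrow> real) \<Rightarrow> phase measure" where
  "bd_measure n =
     distr (density (sphere_measure \<Otimes>\<^sub>M sphere_measure) (\<lambda>(x, \<omega>). ennreal ((n x)\<^sup>2)))
       (restrict_space borel (bd_Omega n)) (\<lambda>(x, \<omega>). (x, \<omega> /\<^sub>R n x))"

text \<open>A function on \<open>Omega n\<close> is extended to be homogeneous of degree \<open>0\<close> in \<open>\<xi>\<close>; the derivatives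
  with respect to \<open>x\<close> and \<open>\<xi>\<close> are those of this extension.\<close>

definition to_Omega :: "(vec3 \<Rightarrow> real) \<Rightarrow> phase \<Rightarrow> phase" where
  "to_Omega n = (\<lambda>(x, \<xi>). (x, \<xi> /\<^sub>R gnorm n x \<xi>))"

definition C1_Omega :: "(vec3 \<Rightarrow> real) \<Rightarrow> (phase \<Rightarrow> real) set" where
  "C1_Omega n = {u. C1_on (MM \<times> (- {0})) (u \<circ> to_Omega n)}"

definition test_dom :: "phase set" where
  "test_dom = interior MM \<times> (- {0})"

definition test_fun :: "(phase \<Rightarrow> real) \<Rightarrow> bool" where
  "test_fun \<psi> \<longleftrightarrow> C1_on UNIV \<psi> \<and> compact (closure {z. \<psi> z \<noteq> 0}) \<and> closure {z. \<psi> z \<noteq> 0} \<subseteq> test_dom"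

text \<open>\<open>p z $ i\<close> and \<open>q z $ i\<close> are the weak derivatives \<open>\<partial>u/\<partial>x\<^sub>i\<close> and \<open>\<partial>u/\<partial>\<xi>\<^sub>i\<close>, i.e. the restrictions to
  \<open>Omega n\<close> of the distributional derivatives of the extension of \<open>u\<close>. The latter are homogeneous
  in \<open>\<xi>\<close> of degree \<open>0\<close> and \<open>-1\<close>, respectively.\<close>

definition weak_derivs ::
  "(vec3 \<Rightarrow> real) \<Rightarrow> (phase \<Rightarrow> real) \<Rightarrow> (phase \<Rightarrow> vec3) \<Rightarrow> (phase \<Rightarrow> vec3) \<Rightarrow> bool" where
  "weak_derivs n u p q \<longleftrightarrow>
     u \<in> L2 (Sigma_measure n) \<and>
     (\<forall>i. (\<lambda>z. p z $ i) \<in> L2 (Sigma_measure n)) \<and>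
     (\<forall>i. (\<lambda>z. q z $ i) \<in> L2 (Sigma_measure n)) \<and>
     (\<forall>\<psi>. test_fun \<psi> \<longrightarrow> (\<forall>i.
        (LINT z:test_dom|lborel. u (to_Omega n z) * frechet_derivative \<psi> (at z) (axis i 1, 0))
          = - (LINT z:test_dom|lborel. p (to_Omega n z) $ i * \<psi> z) \<and>
        (LINT z:test_dom|lborel. u (to_Omega n z) * frechet_derivative \<psi> (at z) (0, axis i 1))
          = - (LINT z:test_dom|lborel.
                 q (to_Omega n z) $ i / gnorm n (fst z) (snd z) * \<psi> z)))"

definition H1 :: "(vec3 \<Rightarrow> real) \<Rightarrow> (phase \<Rightarrow> real) set" where
  "H1 n = {u. \<exists>p q. weak_derivs n u p q}"

text \<open>Weak derivatives are unique up to null sets; an arbitrary version is selected.\<close>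

definition derivs :: "(vec3 \<Rightarrow> real) \<Rightarrow> (phase \<Rightarrow> real) \<Rightarrow> (phase \<Rightarrow> vec3) \<times> (phase \<Rightarrow> vec3)" where
  "derivs n u = (SOME (p, q). weak_derivs n u p q)"

definition dx :: "(vec3 \<Rightarrow> real) \<Rightarrow> (phase \<Rightarrow> real) \<Rightarrow> 3 \<Rightarrow> phase \<Rightarrow> real" where
  "dx n u i z = fst (derivs n u) z $ i"

definition dxi :: "(vec3 \<Rightarrow> real) \<Rightarrow> (phase \<Rightarrow> real) \<Rightarrow> 3 \<Rightarrow> phase \<Rightarrow> real" where
  "dxi n u i z = snd (derivs n u) z $ i"

definition nabla_x :: "(vec3 \<Rightarrow> real) \<Rightarrow> (phase \<Rightarrow> real) \<Rightarrow> phase \<Rightarrow> vec3" where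
  "nabla_x n u z = (\<chi> i. dx n u i z / (n (fst z))\<^sup>2)"

definition nabla_xi :: "(vec3 \<Rightarrow> real) \<Rightarrow> (phase \<Rightarrow> real) \<Rightarrow> phase \<Rightarrow> vec3" where
  "nabla_xi n u z = (\<chi> i. dxi n u i z / (n (fst z))\<^sup>2)"

definition H1_norm :: "(vec3 \<Rightarrow> real) \<Rightarrow> (phase \<Rightarrow> real) \<Rightarrow> real" where
  "H1_norm n u = sqrt (LINT z|Sigma_measure n.
     (u z)\<^sup>2 + (gnorm n (fst z) (nabla_x n u z))\<^sup>2 + (gnorm n (fst z) (nabla_xi n u z))\<^sup>2)"

text \<open>The trace operator \<open>H\<^sup>1 \<rightarrow> L\<^sup>2(A)\<close> for a boundary portion \<open>A\<close> is the continuous extension of the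
  restriction \<open>u \<mapsto> u|A\<close> from the dense subspace of \<open>C\<^sup>1\<close> functions. Its graph, described here, is
  the closure of the graph of the restriction; \<open>has_trace n A u g\<close> says that \<open>g\<close> represents the
  trace of \<open>u\<close> on \<open>A\<close>.\<close>

definition has_trace ::
  "(vec3 \<Rightarrow> real) \<Rightarrow> phase set \<Rightarrow> (phase \<Rightarrow> real) \<Rightarrow> (phase \<Rightarrow> real) \<Rightarrow> bool" where
  "has_trace n A u g \<longleftrightarrow>
     u \<in> H1 n \<and> g \<in> L2 (restrict_space (bd_measure n) A) \<and>
     (\<exists>w. (\<forall>k::nat. w k \<in> C1_Omega n) \<and>
          (\<lambda>k. H1_norm n (\<lambda>z. w k z - u z)) \<longlonglongrightarrow> 0 \<and>
          (\<lambda>k. LINT z|restrict_space (bd_measure n) A. (w k z - g z)\<^sup>2) \<longlonglongrightarrow> 0)"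

definition H10 :: "(vec3 \<Rightarrow> real) \<Rightarrow> (phase \<Rightarrow> real) set" where
  "H10 n = {u \<in> H1 n. has_trace n (bd_Omega n) u (\<lambda>_. 0)}"

text \<open>The component \<open>f\<^bsub>i\<^sub>1 \<dots> i\<^sub>m\<^esub>(x)\<close> is \<open>f x [i\<^sub>1, \<dots>, i\<^sub>m]\<close>.\<close>

definition multi_indices :: "nat \<Rightarrow> 3 list set" where
  "multi_indices m = {I. length I = m}"

definition L2_sym_tensor :: "(vec3 \<Rightarrow> real) \<Rightarrow> nat \<Rightarrow> (vec3 \<Rightarrow> 3 list \<Rightarrow> real) set" where
  "L2_sym_tensor n m = {f.
     (\<forall>x\<in>MM. \<forall>I\<in>multi_indices m. \<forall>J\<in>multi_indices m. mset I = mset J \<longrightarrow> f x I = f x J) \<and>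
     (\<forall>I\<in>multi_indices m. (\<lambda>x. f x I) \<in> borel_measurable (restrict_space lborel MM)) \<and>
     \<comment> \<open>pointwise norm \<open>n\<^bsup>-2m\<^esup> \<Sum> f\<^sub>I\<^sup>2\<close> of a covariant tensor, Riemannian volume \<open>n\<^sup>3 dx\<close>\<close>
     integrable (restrict_space lborel MM)
       (\<lambda>x. (\<Sum>I\<in>multi_indices m. (f x I)\<^sup>2) / n x ^ (2 * m) * n x ^ 3)}"

definition tensor_apply :: "nat \<Rightarrow> (vec3 \<Rightarrow> 3 list \<Rightarrow> real) \<Rightarrow> phase \<Rightarrow> real" where
  "tensor_apply m f = (\<lambda>(x, \<xi>). \<Sum>I\<in>multi_indices m. f x I * prod_list (map (\<lambda>i. \<xi> $ i) I))"

definition a_form ::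
  "(vec3 \<Rightarrow> real) \<Rightarrow> (phase \<Rightarrow> real) \<Rightarrow> real \<Rightarrow> (phase \<Rightarrow> real) \<Rightarrow> (phase \<Rightarrow> real) \<Rightarrow> real" where
  "a_form n \<alpha> \<epsilon> u v =
     (LINT z|Sigma_measure n. (let x = fst z; \<xi> = snd z in
        \<epsilon> * ginner n x (nabla_x n u z) (nabla_x n v z)
        + \<epsilon> * ginner n x (nabla_xi n u z) (nabla_xi n v z)
        + ginner n x (nabla_x n u z) \<xi> * v z
        - (\<Sum>i\<in>UNIV. \<Sum>j\<in>UNIV. \<Sum>k\<in>UNIV.
             Christoffel n i j k x * \<xi> $ i * \<xi> $ j * dxi n u k z) * v z
        + \<alpha> z * u z * v z))"

definition b_form ::
  "(vec3 \<Rightarrow> real) \<Rightarrow> (phase \<Rightarrow> real) \<Rightarrow> real \<Rightarrow> nat \<Rightarrow> (vec3 \<Rightarrow> 3 list \<Rightarrow> real) \<Rightarrow>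
     (phase \<Rightarrow> real) \<Rightarrow> (phase \<Rightarrow> real) \<Rightarrow> real" where
  "b_form n \<alpha> \<epsilon> m f \<phi>h v =
     (LINT z|Sigma_measure n. tensor_apply m f z * v z) - a_form n \<alpha> \<epsilon> \<phi>h v"

end

(* The form is bounded and coercive on the Hilbert space of functions of zero trace, so the result is
   an instance of the Lax-Milgram theorem. Coercivity holds because the first order part of the
   operator is the geodesic vector field, which preserves the measure dSigma: for a C^1 function w one
   integrates a cut-off near the boundary against (Hw) w, integrates by parts, and lets the cut-off
   tend to 1, so that the integral of (Hw) w is bounded by the L^2 norm of w on the boundary.
   By density it vanishes for functions of zero trace, and the quadratic form reduces to its
   elliptic part plus the absorption term, which is positive since alpha >= alpha_0.

   Integrals over the sphere bundle are turned into Lebesgue integrals over R^3 x R^3 by extending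
   functions homogeneously in xi and weighting them with a bump function of |xi|; there integration by
   parts is translation invariance of Lebesgue measure. *)

theory Submission
  imports Defs
begin

section \<open>The Lax-Milgram theorem\<close>

text \<open>\<open>n\<close> is only \<open>C^1\<close>, so the geodesic field has merely continuous
  coefficients and invariance of the measure is not taken from a flow. After multiplication by the
  density \<open>n^3\<close> and use of homogeneity in \<xi>, the field acts on extensions as
  \<open>n^2/r \<xi>\<close> in \<open>x\<close> and \<open>n r grad n\<close> in \<xi>, with
  \<open>r = |\<xi>|\<close>. The former is differentiated only in \<open>x\<close>, the latter only
  in \<xi>, so second derivatives of \<open>n\<close> never occur. Elements of the solution space
  are functions, not classes, and their weak derivatives are an arbitrary choice. The forms are
  therefore moved to triples of a function and a pair of weak derivatives, where they are visibly
  bilinear; the scalar product is then only semidefinite, and Lax-Milgram is proved in that setting.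
  Zero trace is known only through approximating \<open>C^1\<close> functions whose boundary norms
  tend to 0. What passes to the limit is a bound with a constant independent of \<open>w\<close>:
  the gradient of the cut-off has size \<open>1/\<delta>\<close> on a shell of thickness
  proportional to \<delta>, and the integral of \<open>w^2\<close> over that shell is at most of
  order \<delta> times its boundary integral, up to a small error.\<close>

lemma quadratic_nonneg_linear_zero:
  fixes q b :: real
  assumes "\<And>t. 0 \<le> t\<^sup>2 * q + 2 * t * b"
  shows "b = 0"
proof (rule ccontr)
  assume b: "b \<noteq> 0"
  show False
  proof (cases "q \<le> 0")
    case True
    have "0 \<le> b\<^sup>2 * q + 2 * (-b) * b" using assms[of "-b"] by simp
    moreover have "b\<^sup>2 * q \<le> 0" using True by (simp add: mult_nonneg_nonpos)
    moreover have "b * b > 0" using b by (metis not_real_square_gt_zero)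
    ultimately show False by simp
  next
    case False
    then have "(- b / q)\<^sup>2 * q + 2 * (- b / q) * b = - (b\<^sup>2 / q)"
      by (simp add: power2_eq_square field_simps)
    moreover have "b\<^sup>2 / q > 0" using False b by simp
    ultimately show False using assms[of "- b / q"] by linarith
  qed
qed

text \<open>The carrier consists of functions taken pointwise, so \<open>s\<close> may vanish on
  nonzero elements; no quotient is formed. Linear combinations are a parameter \<open>cmb\<close>,
  because the carrier is a set inside a function type. Completeness is asked of sequences with
  summable consecutive distances: this is the form that Riesz-Fischer delivers, and both sequences
  constructed below converge at a geometric rate.\<close>

locale semi_hilbert =
  fixes V :: "'v set" and cmb :: "real \<Rightarrow> 'v \<Rightarrow> real \<Rightarrow> 'v \<Rightarrow> 'v" and s :: "'v \<Rightarrow> 'v \<Rightarrow> real"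
  assumes V_nonempty: "V \<noteq> {}"
    and cmb_in: "u \<in> V \<Longrightarrow> v \<in> V \<Longrightarrow> cmb a u b v \<in> V"
    and s_cmb: "u \<in> V \<Longrightarrow> v \<in> V \<Longrightarrow> w \<in> V \<Longrightarrow> s (cmb a u b v) w = a * s u w + b * s v w"
    and s_sym: "u \<in> V \<Longrightarrow> v \<in> V \<Longrightarrow> s u v = s v u"
    and s_pos: "u \<in> V \<Longrightarrow> 0 \<le> s u u"
    and s_complete: "(\<And>k::nat. x k \<in> V) \<Longrightarrow>
        summable (\<lambda>k. sqrt (s (cmb 1 (x (Suc k)) (-1) (x k)) (cmb 1 (x (Suc k)) (-1) (x k)))) \<Longrightarrow>
        \<exists>l\<in>V. (\<lambda>k. s (cmb 1 (x k) (-1) l) (cmb 1 (x k) (-1) l)) \<longlonglongrightarrow> 0"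
begin

lemma s_cmb_right: "u \<in> V \<Longrightarrow> v \<in> V \<Longrightarrow> w \<in> V \<Longrightarrow> s w (cmb a u b v) = a * s w u + b * s w v"
  using s_cmb[of u v w a b] s_sym cmb_in by metis

lemma s_cmb_self: "u \<in> V \<Longrightarrow> v \<in> V \<Longrightarrow>
    s (cmb a u b v) (cmb a u b v) = a\<^sup>2 * s u u + 2 * a * b * s u v + b\<^sup>2 * s v v"
  by (simp add: s_cmb s_cmb_right cmb_in s_sym[of v u] power2_eq_square algebra_simps)

lemma s_cauchy_schwarz:
  assumes "u \<in> V" "v \<in> V" shows "\<bar>s u v\<bar> \<le> sqrt (s u u) * sqrt (s v v)"
proof (cases "s v v = 0")
  case True
  have "0 \<le> t\<^sup>2 * s u u + 2 * t * s u v" for t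
    using s_pos[OF cmb_in[OF assms, of t 1]] True by (simp add: s_cmb_self assms)
  from quadratic_nonneg_linear_zero[OF this] show ?thesis using True by simp
next
  case False
  then have v: "s v v > 0" using s_pos assms by (simp add: order_less_le)
  \<comment> \<open>The vector is the part of \<open>u\<close> orthogonal to \<open>v\<close>,
    multiplied by \<open>s v v\<close> to avoid a division.\<close>
  have "0 \<le> (s v v)\<^sup>2 * s u u + 2 * s v v * (- s u v) * s u v + (- s u v)\<^sup>2 * s v v"
    using s_pos[OF cmb_in[OF assms, of "s v v" "- s u v"]] by (simp add: s_cmb_self assms)
  also have "\<dots> = s v v * (s v v * s u u - (s u v)\<^sup>2)" by (simp add: power2_eq_square algebra_simps)
  finally have "(s u v)\<^sup>2 \<le> s u u * s v v" using v by (simp add: zero_le_mult_iff mult.commute)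
  then have "sqrt ((s u v)\<^sup>2) \<le> sqrt (s u u * s v v)" by (rule real_sqrt_le_mono)
  then show ?thesis by (simp add: real_sqrt_mult)
qed

text \<open>Direct method: \<open>l\<close> is represented by the minimiser of the quadratic
  functional \<open>J\<close>, because the first variation of \<open>J\<close> at \<open>r\<close>
  is \<open>2 (s r v - l v)\<close>.\<close>

lemma riesz:
  assumes l_cmb: "\<And>u v a b. u \<in> V \<Longrightarrow> v \<in> V \<Longrightarrow> l (cmb a u b v) = a * l u + b * l v"
    and l_bd: "\<And>v. v \<in> V \<Longrightarrow> \<bar>l v\<bar> \<le> K * sqrt (s v v)"
  shows "\<exists>r\<in>V. \<forall>v\<in>V. s r v = (l v :: real)"
proof -
  define J where "J v = s v v - 2 * l v" for v
  have J_low: "- K\<^sup>2 \<le> J v" if "v \<in> V" for v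
  proof -
    have "0 \<le> (sqrt (s v v) - K)\<^sup>2" by simp
    also have "\<dots> = s v v - 2 * (K * sqrt (s v v)) + K\<^sup>2"
      using s_pos[OF that] by (simp add: power2_diff)
    finally show ?thesis using l_bd[OF that] unfolding J_def by linarith
  qed
  define I where "I = (INF v\<in>V. J v)"
  have bdd: "bdd_below (J ` V)" using J_low by (auto intro!: bdd_belowI2)
  have I_le: "I \<le> J v" if "v \<in> V" for v unfolding I_def by (rule cINF_lower[OF bdd that])
  \<comment> \<open>The values of \<open>J\<close> control squared distances, so the rate
    \<open>1/4\<close> yields consecutive distances of at most \<open>2 (1/2)^k\<close>, which are
    summable.\<close>
  have "\<exists>v\<in>V. J v < I + (1/4)^k" for k :: nat
  proof (rule ccontr)
    assume "\<not> (\<exists>v\<in>V. J v < I + (1/4)^k)"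
    then have "I + (1/4)^k \<le> I" unfolding I_def
      by (intro cINF_greatest V_nonempty) (auto simp: not_less I_def)
    then show False using zero_less_power[of "1/4::real" k] by linarith
  qed
  then obtain x where xV: "\<And>k. x k \<in> V" and xJ: "\<And>k. J (x k) < I + (1/4)^k" by metis
  \<comment> \<open>Parallelogram law: the left side is \<open>2 J u + 2 J v\<close> minus four
    times \<open>J\<close> at the midpoint. The linear terms cancel, and \<open>J\<close> at the
    midpoint is at least \<open>I\<close>.\<close>
  have Qd: "s (cmb 1 u (-1) v) (cmb 1 u (-1) v) \<le> 2 * (J u - I) + 2 * (J v - I)"
    if "u \<in> V" "v \<in> V" for u v
    using I_le[OF cmb_in[OF that, of "1/2" "1/2"]] that
    by (simp add: J_def s_cmb_self l_cmb power2_eq_square)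
  have "sqrt (s (cmb 1 (x (Suc k)) (-1) (x k)) (cmb 1 (x (Suc k)) (-1) (x k))) \<le> 2 * (1/2)^k" for k
  proof -
    have "s (cmb 1 (x (Suc k)) (-1) (x k)) (cmb 1 (x (Suc k)) (-1) (x k))
      \<le> 2 * (J (x (Suc k)) - I) + 2 * (J (x k) - I)" by (rule Qd) (rule xV)+
    also have "\<dots> \<le> 2 * (1/4)^Suc k + 2 * (1/4)^k"
      using xJ[of k] xJ[of "Suc k"] by (intro add_mono mult_left_mono) (auto simp del: power_Suc)
    also have "\<dots> \<le> 4 * (1/4)^k" by simp
    also have "\<dots> = (2 * (1/2)^k)\<^sup>2" by (simp add: power_mult_distrib power2_eq_square flip: power_mult_distrib)
    finally show ?thesis by (intro real_le_lsqrt) (auto)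
  qed
  then have "\<forall>k\<ge>0. norm (sqrt (s (cmb 1 (x (Suc k)) (-1) (x k)) (cmb 1 (x (Suc k)) (-1) (x k)))) \<le> 2 * (1/2)^k"
    by (simp only: real_norm_def abs_of_nonneg[OF real_sqrt_ge_zero[OF s_pos[OF cmb_in[OF xV xV]]]]) blast
  then have "summable (\<lambda>k. sqrt (s (cmb 1 (x (Suc k)) (-1) (x k)) (cmb 1 (x (Suc k)) (-1) (x k))))"
    by (rule summable_comparison_test[OF exI]) (rule summable_mult[OF summable_geometric], simp)
  from s_complete[OF xV this] obtain r where r: "r \<in> V"
    and lim: "(\<lambda>k. s (cmb 1 (x k) (-1) r) (cmb 1 (x k) (-1) r)) \<longlonglongrightarrow> 0" by blast
  define d where "d k = cmb 1 (x k) (-1) r" for k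
  have dV: "d k \<in> V" for k unfolding d_def by (intro cmb_in xV r)
  have lim1: "(\<lambda>k. sqrt (s (d k) (d k))) \<longlonglongrightarrow> 0"
    using tendsto_real_sqrt[OF lim] by (simp add: d_def)
  have "(\<lambda>k. s (d k) r) \<longlonglongrightarrow> 0"
  proof (rule Lim_null_comparison)
    show "\<forall>\<^sub>F k in sequentially. norm (s (d k) r) \<le> sqrt (s (d k) (d k)) * sqrt (s r r)"
      using s_cauchy_schwarz[OF dV r] by simp
    show "(\<lambda>k. sqrt (s (d k) (d k)) * sqrt (s r r)) \<longlonglongrightarrow> 0" using tendsto_mult_left_zero[OF lim1] .
  qed
  moreover have "(\<lambda>k. l (d k)) \<longlonglongrightarrow> 0"
  proof (rule Lim_null_comparison)
    show "\<forall>\<^sub>F k in sequentially. norm (l (d k)) \<le> K * sqrt (s (d k) (d k))"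
      using l_bd[OF dV] by simp
    show "(\<lambda>k. K * sqrt (s (d k) (d k))) \<longlonglongrightarrow> 0" using tendsto_mult_right_zero[OF lim1] .
  qed
  \<comment> \<open>This is the expansion of \<open>J\<close> about \<open>r\<close>, evaluated at
    \<open>x k\<close>; it gives continuity of \<open>J\<close> along the minimising
    sequence.\<close>
  ultimately have "(\<lambda>k. s (d k) (d k) + 2 * s (d k) r - 2 * l (d k) + J r) \<longlonglongrightarrow> 0 + 2 * 0 - 2 * 0 + J r"
    using lim unfolding d_def by (intro tendsto_intros)
  moreover have "s (d k) (d k) + 2 * s (d k) r - 2 * l (d k) + J r = J (x k)" for k
    using xV r by (simp add: d_def J_def s_cmb_self s_cmb l_cmb)
  ultimately have Jlim: "(\<lambda>k. J (x k)) \<longlonglongrightarrow> J r" by simp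
  have "(\<lambda>k. I + (1/4)^k) \<longlonglongrightarrow> I + 0" by (intro tendsto_intros) simp
  then have Jr: "J r \<le> I" using LIMSEQ_le[OF Jlim] xJ by (metis add.right_neutral less_imp_le)
  have "s r v - l v = 0" if v: "v \<in> V" for v
  proof (rule quadratic_nonneg_linear_zero)
    fix t :: real
    have "J r \<le> J (cmb 1 r t v)" using I_le[OF cmb_in[OF r v, of 1 t]] Jr by linarith
    then show "0 \<le> t\<^sup>2 * s v v + 2 * t * (s r v - l v)"
      using r v by (simp add: J_def s_cmb_self l_cmb algebra_simps)
  qed
  then show ?thesis using r by auto
qed

text \<open>Since \<open>A\<close> is not symmetric in general, its equation is not the first
  variation of a functional. It is turned into a fixed-point problem: \<open>R u\<close> represents
  the residual \<open>A u - l\<close>, and \<open>T u = u - \<rho> R u\<close> is a contraction by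
  coercivity.\<close>

theorem lax_milgram:
  assumes A_cmb: "\<And>u v w a b. u \<in> V \<Longrightarrow> v \<in> V \<Longrightarrow> w \<in> V \<Longrightarrow> A (cmb a u b v) w = a * A u w + b * A v w"
    and A_cmb_right: "\<And>u v w a b. u \<in> V \<Longrightarrow> v \<in> V \<Longrightarrow> w \<in> V \<Longrightarrow> A w (cmb a u b v) = a * A w u + b * A w v"
    and A_bd: "\<And>u v. u \<in> V \<Longrightarrow> v \<in> V \<Longrightarrow> \<bar>A u v\<bar> \<le> B * (sqrt (s u u) * sqrt (s v v))"
    and A_coerc: "\<And>u. u \<in> V \<Longrightarrow> c * s u u \<le> A u u" and c: "0 < c"
    and l_cmb: "\<And>u v a b. u \<in> V \<Longrightarrow> v \<in> V \<Longrightarrow> l (cmb a u b v) = a * l u + b * l v"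
    and l_bd: "\<And>v. v \<in> V \<Longrightarrow> \<bar>l v\<bar> \<le> K * sqrt (s v v)"
  shows "\<exists>r\<in>V. \<forall>v\<in>V. A r v = (l v :: real)"
proof -
  \<comment> \<open>The maximum makes \<open>C\<close> positive and gives \<open>c \<le> C\<close>,
    so that the number under the root in \<theta> is nonnegative.\<close>
  define C where "C = max B c"
  have C: "C > 0" "c \<le> C" using c by (auto simp: C_def)
  have A_bd': "\<bar>A u v\<bar> \<le> C * (sqrt (s u u) * sqrt (s v v))" if "u \<in> V" "v \<in> V" for u v
  proof -
    have "B * (sqrt (s u u) * sqrt (s v v)) \<le> C * (sqrt (s u u) * sqrt (s v v))"
      using that s_pos by (intro mult_right_mono) (auto simp: C_def)
    then show ?thesis using A_bd[OF that] by linarith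
  qed
  have "\<exists>r\<in>V. \<forall>v\<in>V. s r v = A u v - l v" if u: "u \<in> V" for u
  proof (rule riesz[where K = "C * sqrt (s u u) + K"])
    show "A u (cmb a x b y) - l (cmb a x b y) = a * (A u x - l x) + b * (A u y - l y)"
      if "x \<in> V" "y \<in> V" for x y a b using that u by (simp add: A_cmb_right l_cmb algebra_simps)
    show "\<bar>A u v - l v\<bar> \<le> (C * sqrt (s u u) + K) * sqrt (s v v)" if "v \<in> V" for v
      using A_bd'[OF u that] l_bd[OF that] by (simp add: algebra_simps)
  qed
  then obtain R where RV: "\<And>u. u \<in> V \<Longrightarrow> R u \<in> V"
    and R: "\<And>u v. u \<in> V \<Longrightarrow> v \<in> V \<Longrightarrow> s (R u) v = A u v - l v" by metis
  \<comment> \<open>This value minimises \<open>1 - 2 \<rho> c + \<rho>^2 C^2\<close>, the bound on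
    the squared contraction factor; the minimum is \<open>1 - c^2/C^2\<close>.\<close>
  define \<rho> where "\<rho> = c / C\<^sup>2"
  define T where "T u = cmb 1 u (-\<rho>) (R u)" for u
  define \<theta> where "\<theta> = sqrt (1 - c\<^sup>2 / C\<^sup>2)"
  have cC: "c\<^sup>2 / C\<^sup>2 \<le> 1" "c\<^sup>2 / C\<^sup>2 > 0" using c C by (auto simp: divide_simps power_mono)
  have \<theta>: "0 \<le> \<theta>" "\<theta> < 1" "\<theta>\<^sup>2 = 1 - c\<^sup>2 / C\<^sup>2" using cC c by (auto simp: \<theta>_def)
  have TV: "T u \<in> V" if "u \<in> V" for u using that by (simp add: T_def RV cmb_in)
  define N where "N u v = sqrt (s (cmb 1 u (-1) v) (cmb 1 u (-1) v))" for u v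
  have step: "N (T u) (T w) \<le> \<theta> * N u w" and Rstep: "N (R u) (R w) \<le> C * N u w"
    if u: "u \<in> V" and w: "w \<in> V" for u w
  proof -
    define D where "D = cmb 1 u (-1) w"
    define E where "E = cmb 1 (R u) (-1) (R w)"
    have DV: "D \<in> V" and EV: "E \<in> V" using u w RV by (auto simp: D_def E_def cmb_in)
    \<comment> \<open>\<open>R\<close> is a choice and may fail to be linear, but its pairings
      behave linearly: \<open>l\<close> cancels in the difference of two residuals.\<close>
    have sE: "s E v = A D v" if "v \<in> V" for v
      using that u w by (simp add: E_def D_def s_cmb A_cmb RV R)
    have 1: "s (cmb 1 (T u) (-1) (T w)) (cmb 1 (T u) (-1) (T w))
       = s D D - 2 * \<rho> * s E D + \<rho>\<^sup>2 * s E E"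
      using u w RV TV unfolding T_def D_def E_def
      by (simp add: s_cmb s_cmb_right cmb_in s_sym[of "R u" u] s_sym[of "R u" w] s_sym[of "R w" u]
          s_sym[of "R w" w] s_sym[of "R w" "R u"] s_sym[of w u] power2_eq_square algebra_simps)
    have "s E E \<le> C * (sqrt (s D D) * sqrt (s E E))"
      using A_bd'[OF DV EV] sE[OF EV] by linarith
    then have 2: "sqrt (s E E) \<le> C * sqrt (s D D)"
    proof (cases "s E E = 0")
      case False
      then have "sqrt (s E E) > 0" using s_pos[OF EV] by simp
      moreover have "sqrt (s E E) * sqrt (s E E) \<le> (C * sqrt (s D D)) * sqrt (s E E)"
        using \<open>s E E \<le> _\<close> s_pos[OF EV] by (simp add: mult.assoc)
      ultimately show ?thesis by (simp only: mult_le_cancel_right_pos)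
    qed (use C s_pos[OF DV] in simp)
    then show "N (R u) (R w) \<le> C * N u w" by (simp add: N_def D_def E_def)
    have "(sqrt (s E E))\<^sup>2 \<le> (C * sqrt (s D D))\<^sup>2" using 2 s_pos[OF EV] by (intro power_mono) auto
    then have 3: "s E E \<le> C\<^sup>2 * s D D" using s_pos DV EV by (simp add: power_mult_distrib)
    have "c * s D D \<le> s E D" using A_coerc[OF DV] sE[OF DV] by simp
    then have "2 * \<rho> * (c * s D D) \<le> 2 * \<rho> * s E D" using c C by (intro mult_left_mono) (auto simp: \<rho>_def)
    moreover have "\<rho>\<^sup>2 * s E E \<le> \<rho>\<^sup>2 * (C\<^sup>2 * s D D)" using 3 by (intro mult_left_mono) auto
    ultimately have "s (cmb 1 (T u) (-1) (T w)) (cmb 1 (T u) (-1) (T w))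
       \<le> s D D - 2 * \<rho> * (c * s D D) + \<rho>\<^sup>2 * (C\<^sup>2 * s D D)" using 1 by linarith
    also have "\<dots> = \<theta>\<^sup>2 * s D D" unfolding \<theta>(3) using C by (simp add: \<rho>_def power2_eq_square field_simps)
    finally have "N (T u) (T w) \<le> sqrt (\<theta>\<^sup>2 * s D D)" unfolding N_def by (rule real_sqrt_le_mono)
    then show "N (T u) (T w) \<le> \<theta> * N u w" using \<theta>(1) by (simp add: real_sqrt_mult real_sqrt_abs N_def D_def)
  qed
  obtain u0 where u0: "u0 \<in> V" using V_nonempty by auto
  define x where "x k = (T ^^ k) u0" for k
  have xV: "x k \<in> V" for k by (induction k) (auto simp: x_def u0 TV)
  have x_Suc: "x (Suc k) = T (x k)" for k by (simp add: x_def)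
  have Nx: "N (x (Suc k)) (x k) \<le> \<theta> ^ k * N (x 1) (x 0)" for k
  proof (induction k)
    case (Suc k)
    have "N (x (Suc (Suc k))) (x (Suc k)) \<le> \<theta> * N (x (Suc k)) (x k)"
      using step[OF xV[of "Suc k"] xV[of k]] by (simp only: x_Suc)
    also have "\<dots> \<le> \<theta> * (\<theta> ^ k * N (x 1) (x 0))" using Suc \<theta> by (intro mult_left_mono) auto
    finally show ?case by simp
  qed simp
  have N0: "0 \<le> N u w" if "u \<in> V" "w \<in> V" for u w using that by (simp add: N_def s_pos cmb_in)
  have "summable (\<lambda>k. N (x (Suc k)) (x k))"
    by (rule summable_comparison_test'[where g="\<lambda>k. \<theta> ^ k * N (x 1) (x 0)" and N=0])
       (use \<theta> Nx N0 xV in \<open>auto intro!: summable_mult2 summable_geometric\<close>)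
  from s_complete[OF xV this[unfolded N_def]] obtain r where r: "r \<in> V"
    and lim: "(\<lambda>k. s (cmb 1 (x k) (-1) r) (cmb 1 (x k) (-1) r)) \<longlonglongrightarrow> 0" by blast
  have limN: "(\<lambda>k. N (x k) r) \<longlonglongrightarrow> 0"
    using tendsto_real_sqrt[OF lim] by (simp add: N_def)
  have "A r v = l v" if v: "v \<in> V" for v
  proof -
    \<comment> \<open>A fixed point is available only up to seminorm 0, so the limit is tested
      against \<open>v\<close>. Both terms on the right tend to 0, the first by the consecutive
      distances and the second because \<open>R\<close> is Lipschitz.\<close>
    have e: "\<rho> * (A r v - l v) = s (cmb 1 (x k) (-1) (x (Suc k))) v - \<rho> * s (cmb 1 (R (x k)) (-1) (R r)) v" for k
      using xV[of k] RV r v by (simp add: x_Suc T_def s_cmb cmb_in R algebra_simps)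
    have "\<bar>\<rho> * (A r v - l v)\<bar> \<le> (N (x (Suc k)) (x k) + \<rho> * (C * N (x k) r)) * sqrt (s v v)" for k
    proof -
      have "\<bar>s (cmb 1 (x k) (-1) (x (Suc k))) v\<bar> \<le> N (x (Suc k)) (x k) * sqrt (s v v)"
        using s_cauchy_schwarz[OF cmb_in[OF xV[of "Suc k"] xV[of k]] v, of 1 "-1"] xV v
        by (simp add: N_def s_cmb abs_minus_commute)
      moreover have "\<bar>s (cmb 1 (R (x k)) (-1) (R r)) v\<bar> \<le> N (R (x k)) (R r) * sqrt (s v v)"
        using s_cauchy_schwarz[OF cmb_in[OF RV[OF xV[of k]] RV[OF r]] v] by (simp add: N_def)
      moreover have "N (R (x k)) (R r) * sqrt (s v v) \<le> C * N (x k) r * sqrt (s v v)"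
        using Rstep[OF xV r] s_pos[OF v] by (intro mult_right_mono) auto
      moreover have rho: "\<rho> > 0" using c C by (simp add: \<rho>_def)
      ultimately have "\<rho> * \<bar>s (cmb 1 (R (x k)) (-1) (R r)) v\<bar> \<le> \<rho> * (C * N (x k) r * sqrt (s v v))"
        by (intro mult_left_mono) auto
      then have "\<bar>\<rho> * s (cmb 1 (R (x k)) (-1) (R r)) v\<bar> \<le> \<rho> * (C * N (x k) r * sqrt (s v v))"
        using rho by (simp add: abs_mult)
      with \<open>\<bar>s (cmb 1 (x k) (-1) (x (Suc k))) v\<bar> \<le> _\<close> show ?thesis
        unfolding e[of k] by (simp add: algebra_simps)
    qed
    moreover have "(\<lambda>k. (N (x (Suc k)) (x k) + \<rho> * (C * N (x k) r)) * sqrt (s v v)) \<longlonglongrightarrow> (0 + \<rho> * (C * 0)) * sqrt (s v v)"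
      using summable_LIMSEQ_zero[OF \<open>summable (\<lambda>k. N (x (Suc k)) (x k))\<close>] limN by (intro tendsto_intros)
    ultimately have "\<bar>\<rho> * (A r v - l v)\<bar> \<le> 0"
      by (intro LIMSEQ_le_const[where X="\<lambda>k. (N (x (Suc k)) (x k) + \<rho> * (C * N (x k) r)) * sqrt (s v v)"]) auto
    then have "\<rho> * (A r v - l v) = 0" by simp
    then show ?thesis using c C by (simp add: \<rho>_def)
  qed
  then show ?thesis using r by blast
qed

end

section \<open>Square-integrable vector-valued functions\<close>

text \<open>Values in a Euclidean space let a function and all its first derivatives be one element
  of a single \<open>L^2\<close> space.\<close>

definition L2v :: "'z measure \<Rightarrow> ('z \<Rightarrow> 'e::euclidean_space) set" where
  "L2v N = {U \<in> borel_measurable N. integrable N (\<lambda>z. (norm (U z))\<^sup>2)}"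

definition L2norm :: "'z measure \<Rightarrow> ('z \<Rightarrow> 'e::euclidean_space) \<Rightarrow> real" where
  "L2norm N U = sqrt (LINT z|N. U z \<bullet> U z)"

lemma L2v_measurable [measurable_dest]: "U \<in> L2v N \<Longrightarrow> U \<in> borel_measurable N"
  by (simp add: L2v_def)

lemma integrable_inner_L2v:
  assumes "U \<in> L2v N" "W \<in> L2v N" shows "integrable N (\<lambda>z. U z \<bullet> W z)"
proof (rule Bochner_Integration.integrable_bound)
  show "integrable N (\<lambda>z. (norm (U z))\<^sup>2 + (norm (W z))\<^sup>2)" using assms by (auto simp: L2v_def)
  show "(\<lambda>z. U z \<bullet> W z) \<in> borel_measurable N" using assms[THEN L2v_measurable] by measurable
  have "\<bar>x \<bullet> y\<bar> \<le> (norm x)\<^sup>2 + (norm y)\<^sup>2" for x y :: 'b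
  proof -
    have "\<bar>x \<bullet> y\<bar> \<le> norm x * norm y" by (rule Cauchy_Schwarz_ineq2)
    also have "\<dots> \<le> (norm x)\<^sup>2 + (norm y)\<^sup>2"
      using sum_squares_bound[of "norm x" "norm y"] zero_le_mult_iff[of "norm x" "norm y"]
        zero_le_power2[of "norm x"] zero_le_power2[of "norm y"] norm_ge_zero[of x] norm_ge_zero[of y] by linarith
    finally show ?thesis .
  qed
  then show "AE z in N. norm (U z \<bullet> W z) \<le> norm ((norm (U z))\<^sup>2 + (norm (W z))\<^sup>2)" by simp
qed

lemma L2v_lincomb:
  assumes "U \<in> L2v N" "W \<in> L2v N" shows "(\<lambda>z. a *\<^sub>R U z + b *\<^sub>R W z) \<in> L2v N"
proof -
  have "(norm (a *\<^sub>R x + b *\<^sub>R y))\<^sup>2 = a\<^sup>2 * (x \<bullet> x) + 2 * a * b * (x \<bullet> y) + b\<^sup>2 * (y \<bullet> y)" for x y :: 'b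
    unfolding power2_norm_eq_inner by (simp add: inner_add inner_commute[of y x] power2_eq_square algebra_simps)
  then show ?thesis using assms integrable_inner_L2v[OF assms]
      integrable_inner_L2v[OF assms(1) assms(1)] integrable_inner_L2v[OF assms(2) assms(2)]
    by (auto simp: L2v_def)
qed

lemma L2v_diff: "U \<in> L2v N \<Longrightarrow> W \<in> L2v N \<Longrightarrow> (\<lambda>z. U z - W z) \<in> L2v N"
  using L2v_lincomb[of U N W 1 "-1"] by simp

lemma L2norm_nonneg: "0 \<le> L2norm N U"
  by (simp add: L2norm_def)

lemma L2norm_sq: "(L2norm N U)\<^sup>2 = (LINT z|N. (norm (U z))\<^sup>2)"
  by (simp add: L2norm_def power2_norm_eq_inner)

lemma cauchy_schwarz_L2v:
  assumes "U \<in> L2v N" "W \<in> L2v N"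
  shows "\<bar>LINT z|N. U z \<bullet> W z\<bar> \<le> L2norm N U * L2norm N W"
proof -
  define u where "u = (LINT z|N. U z \<bullet> U z)"
  define v where "v = (LINT z|N. W z \<bullet> W z)"
  define b where "b = (LINT z|N. U z \<bullet> W z)"
  note I = integrable_inner_L2v[OF assms] integrable_inner_L2v[OF assms(1) assms(1)] integrable_inner_L2v[OF assms(2) assms(2)]
  have q: "0 \<le> s\<^sup>2 * u + 2 * s * t * b + t\<^sup>2 * v" for s t
  proof -
    have "0 \<le> (LINT z|N. (s *\<^sub>R U z + t *\<^sub>R W z) \<bullet> (s *\<^sub>R U z + t *\<^sub>R W z))" by simp
    also have "\<dots> = (LINT z|N. s\<^sup>2 * (U z \<bullet> U z) + 2 * s * t * (U z \<bullet> W z) + t\<^sup>2 * (W z \<bullet> W z))"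
      by (intro Bochner_Integration.integral_cong) (simp_all add: inner_add inner_commute power2_eq_square algebra_simps)
    also have "\<dots> = s\<^sup>2 * u + 2 * s * t * b + t\<^sup>2 * v" using I by (simp add: u_def v_def b_def)
    finally show ?thesis .
  qed
  have u: "u \<ge> 0" and v: "v \<ge> 0" by (auto simp: u_def v_def)
  have "b\<^sup>2 \<le> u * v"
  proof (cases "v = 0")
    case True
    have "b = 0" using q[of _ 1] True by (intro quadratic_nonneg_linear_zero[of u]) simp
    then show ?thesis using True by simp
  next
    case False
    have "0 \<le> v * (u * v - b\<^sup>2)" using q[of v "-b"] by (simp add: power2_eq_square algebra_simps)
    then show ?thesis using False v by (simp add: zero_le_mult_iff)
  qed
  then have "sqrt (b\<^sup>2) \<le> sqrt (u * v)" by (rule real_sqrt_le_mono)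
  then show ?thesis by (simp add: real_sqrt_mult u_def v_def b_def L2norm_def)
qed

lemma L2norm_lincomb_le:
  assumes "U \<in> L2v N" "W \<in> L2v N"
  shows "L2norm N (\<lambda>z. a *\<^sub>R U z + b *\<^sub>R W z) \<le> \<bar>a\<bar> * L2norm N U + \<bar>b\<bar> * L2norm N W"
proof -
  note I = integrable_inner_L2v[OF assms] integrable_inner_L2v[OF assms(1) assms(1)] integrable_inner_L2v[OF assms(2) assms(2)]
  have "(L2norm N (\<lambda>z. a *\<^sub>R U z + b *\<^sub>R W z))\<^sup>2
      = (LINT z|N. a\<^sup>2 * (U z \<bullet> U z) + 2 * a * b * (U z \<bullet> W z) + b\<^sup>2 * (W z \<bullet> W z))"
    unfolding L2norm_sq power2_norm_eq_inner
    by (intro Bochner_Integration.integral_cong) (simp_all add: inner_add inner_commute power2_eq_square algebra_simps)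
  also have "\<dots> = a\<^sup>2 * (L2norm N U)\<^sup>2 + 2 * a * b * (LINT z|N. U z \<bullet> W z) + b\<^sup>2 * (L2norm N W)\<^sup>2"
    using I by (simp add: L2norm_sq power2_norm_eq_inner)
  also have "2 * a * b * (LINT z|N. U z \<bullet> W z) \<le> \<bar>2 * a * b * (LINT z|N. U z \<bullet> W z)\<bar>" by simp
  also have "\<dots> \<le> 2 * \<bar>a\<bar> * \<bar>b\<bar> * (L2norm N U * L2norm N W)"
    unfolding abs_mult using cauchy_schwarz_L2v[OF assms] by (intro mult_mono) auto
  also have "a\<^sup>2 * (L2norm N U)\<^sup>2 + 2 * \<bar>a\<bar> * \<bar>b\<bar> * (L2norm N U * L2norm N W) + b\<^sup>2 * (L2norm N W)\<^sup>2
     = (\<bar>a\<bar> * L2norm N U + \<bar>b\<bar> * L2norm N W)\<^sup>2"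
    unfolding power2_sum power_mult_distrib power2_abs by simp
  finally have "(L2norm N (\<lambda>z. a *\<^sub>R U z + b *\<^sub>R W z))\<^sup>2 \<le> (\<bar>a\<bar> * L2norm N U + \<bar>b\<bar> * L2norm N W)\<^sup>2" by simp
  then show ?thesis by (rule power2_le_imp_le) (simp add: L2norm_nonneg)
qed

lemma L2norm_diff_triangle:
  assumes "U \<in> L2v N" "W \<in> L2v N" "X \<in> L2v N"
  shows "L2norm N (\<lambda>z. U z - X z) \<le> L2norm N (\<lambda>z. U z - W z) + L2norm N (\<lambda>z. W z - X z)"
  using L2norm_lincomb_le[OF L2v_diff[OF assms(1,2)] L2v_diff[OF assms(2,3)], of 1 1] by simp

lemma L2norm_mono:
  assumes "U \<in> L2v N" "W \<in> L2v N" "0 \<le> C" "AE z in N. norm (U z) \<le> C * norm (W z)"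
  shows "L2norm N U \<le> C * L2norm N W"
proof -
  have "(L2norm N U)\<^sup>2 \<le> (LINT z|N. C\<^sup>2 * (norm (W z))\<^sup>2)"
    unfolding L2norm_sq
  proof (intro integral_mono_AE)
    show "AE z in N. (norm (U z))\<^sup>2 \<le> C\<^sup>2 * (norm (W z))\<^sup>2"
      using assms(4) by eventually_elim (metis norm_ge_zero power_mono power_mult_distrib)
  qed (use assms in \<open>auto simp: L2v_def\<close>)
  also have "\<dots> = (C * L2norm N W)\<^sup>2" using assms(2) by (simp add: L2norm_sq power_mult_distrib)
  finally show ?thesis by (rule power2_le_imp_le) (simp add: L2norm_nonneg assms)
qed

text \<open>Riesz-Fischer by a telescoping series. On a finite measure space the \<open>L^2\<close>
  norm dominates the \<open>L^1\<close> norm, so the increments are absolutely summable almost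
  everywhere; Fatou's lemma turns the pointwise limit into an \<open>L^2\<close> limit.\<close>

theorem L2v_complete:
  fixes x :: "nat \<Rightarrow> 'z \<Rightarrow> 'e::euclidean_space"
  assumes fin: "finite_measure N" and xL: "\<And>k. x k \<in> L2v N"
    and sm: "summable (\<lambda>k. L2norm N (\<lambda>z. x (Suc k) z - x k z))"
  shows "\<exists>l\<in>L2v N. (\<lambda>k. L2norm N (\<lambda>z. x k z - l z)) \<longlonglongrightarrow> 0"
proof -
  interpret finite_measure N by (rule fin)
  define d where "d k = (\<lambda>z. x (Suc k) z - x k z)" for k
  have dL: "d k \<in> L2v N" for k unfolding d_def by (intro L2v_diff xL)
  note [measurable] = xL[THEN L2v_measurable] dL[THEN L2v_measurable]
  define \<delta> where "\<delta> k = L2norm N (d k)" for k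
  have \<delta>0: "\<delta> k \<ge> 0" for k by (simp add: \<delta>_def L2norm_nonneg)
  have sm\<delta>: "summable \<delta>" using sm by (simp add: \<delta>_def[abs_def] d_def)
  have one: "(\<lambda>_. 1::real) \<in> L2v N" by (simp add: L2v_def)
  have L1: "integrable N (\<lambda>z. norm (d k z)) \<and> (LINT z|N. norm (d k z)) \<le> \<delta> k * L2norm N (\<lambda>_. 1::real)" for k
  proof -
    have nL: "(\<lambda>z. norm (d k z)) \<in> L2v N" using dL[of k] by (auto simp: L2v_def)
    have "L2norm N (\<lambda>z. norm (d k z)) = \<delta> k" by (simp add: L2norm_def \<delta>_def power2_norm_eq_inner[symmetric] flip: power2_eq_square)
    then show ?thesis using integrable_inner_L2v[OF nL one] cauchy_schwarz_L2v[OF nL one] by simp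
  qed
  have "(\<integral>\<^sup>+z. (\<Sum>k. ennreal (norm (d k z))) \<partial>N) = (\<Sum>k. \<integral>\<^sup>+z. ennreal (norm (d k z)) \<partial>N)"
    by (rule nn_integral_suminf) measurable
  also have "\<dots> = (\<Sum>k. ennreal (LINT z|N. norm (d k z)))"
    using L1 by (intro suminf_cong nn_integral_eq_integral) auto
  also have "\<dots> \<le> (\<Sum>k. ennreal (\<delta> k * L2norm N (\<lambda>_. 1::real)))"
    using L1 by (intro suminf_le ennreal_leI) auto
  also have "\<dots> < \<infinity>"
    by (subst suminf_ennreal2) (auto simp: \<delta>0 L2norm_nonneg sm\<delta> summable_mult2 less_top)
  finally have fin_sum: "(\<integral>\<^sup>+z. (\<Sum>k. ennreal (norm (d k z))) \<partial>N) < \<infinity>" .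
  have "AE z in N. (\<Sum>k. ennreal (norm (d k z))) \<noteq> \<infinity>"
    by (rule nn_integral_PInf_AE) (measurable, use fin_sum in simp)
  then have conv: "AE z in N. convergent (\<lambda>k. x k z)"
  proof eventually_elim
    case (elim z)
    then have "summable (\<lambda>k. norm (d k z))" by (intro summable_suminf_not_top) auto
    then have "summable (\<lambda>k. x (Suc k) z - x k z)" unfolding d_def by (rule summable_norm_cancel)
    then have "convergent (\<lambda>n. \<Sum>k<n. x (Suc k) z - x k z)" by (simp add: summable_iff_convergent)
    then have "convergent (\<lambda>n. x n z - x 0 z)" by (simp only: sum_lessThan_telescope[of "\<lambda>k. x k z"])
    then have "convergent (\<lambda>n. (x n z - x 0 z) + x 0 z)" by (intro convergent_add convergent_const)
    then show ?case by simp
  qed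
  define l where "l z = lim (\<lambda>k. x k z)" for z
  have [measurable]: "l \<in> borel_measurable N" unfolding l_def[abs_def] by measurable
  have lim: "AE z in N. (\<lambda>k. x k z) \<longlonglongrightarrow> l z"
    using conv by eventually_elim (simp add: l_def convergent_LIMSEQ_iff)
  have Lsum: "L2norm N (\<lambda>z. x (k + j) z - x k z) \<le> (\<Sum>i=k..<k+j. \<delta> i)" for k j
  proof (induction j)
    case (Suc j)
    have "L2norm N (\<lambda>z. x (k + Suc j) z - x k z) \<le> L2norm N (\<lambda>z. x (Suc (k + j)) z - x (k+j) z) + L2norm N (\<lambda>z. x (k+j) z - x k z)"
      using L2norm_diff_triangle[OF xL xL xL] by simp
    also have "\<dots> \<le> \<delta> (k + j) + (\<Sum>i=k..<k+j. \<delta> i)" using Suc by (simp add: \<delta>_def d_def)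
    finally show ?case by simp
  qed (simp add: L2norm_def)
  define t where "t k = (\<Sum>i. \<delta> (i + k))" for k
  have t_lim: "t \<longlonglongrightarrow> 0" unfolding t_def[abs_def] by (rule suminf_exist_split2[OF sm\<delta>])
  have t0: "0 \<le> t k" for k unfolding t_def by (intro suminf_nonneg summable_ignore_initial_segment sm\<delta> \<delta>0)
  have Lt: "L2norm N (\<lambda>z. x (k + j) z - x k z) \<le> t k" for k j
  proof -
    have "(\<Sum>i=k..<k+j. \<delta> i) = (\<Sum>i<j. \<delta> (i + k))"
      using sum.shift_bounds_nat_ivl[of \<delta> 0 k j] by (simp add: add.commute lessThan_atLeast0)
    also have "\<dots> \<le> t k" unfolding t_def
      by (intro sum_le_suminf summable_ignore_initial_segment sm\<delta>) (auto simp: \<delta>0)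
    finally show ?thesis using Lsum[of k j] by linarith
  qed
  \<comment> \<open>Fatou's lemma is applied in \<open>j\<close>: the norm of
    \<open>x (k + j) - x k\<close> is bounded by the tail \<open>t k\<close> uniformly in
    \<open>j\<close>.\<close>
  have fatou: "(\<integral>\<^sup>+z. ennreal ((norm (x k z - l z))\<^sup>2) \<partial>N) \<le> ennreal ((t k)\<^sup>2)" for k
  proof -
    have "(\<integral>\<^sup>+z. ennreal ((norm (x k z - l z))\<^sup>2) \<partial>N)
       = (\<integral>\<^sup>+z. liminf (\<lambda>j. ennreal ((norm (x (k + j) z - x k z))\<^sup>2)) \<partial>N)"
    proof (rule nn_integral_cong_AE, use lim in eventually_elim)
      case (elim z)
      have "(\<lambda>j. x (j + k) z) \<longlonglongrightarrow> l z" using elim by (rule LIMSEQ_ignore_initial_segment)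
      then have "(\<lambda>j. ennreal ((norm (x (j + k) z - x k z))\<^sup>2)) \<longlonglongrightarrow> ennreal ((norm (l z - x k z))\<^sup>2)"
        by (intro tendsto_intros)
      from lim_imp_Liminf[OF trivial_limit_sequentially this] show ?case
        by (simp add: add.commute[of k] norm_minus_commute)
    qed
    also have "\<dots> \<le> liminf (\<lambda>j. \<integral>\<^sup>+z. ennreal ((norm (x (k + j) z - x k z))\<^sup>2) \<partial>N)"
      by (rule nn_integral_liminf) measurable
    also have "\<dots> \<le> ennreal ((t k)\<^sup>2)"
    proof (rule Liminf_le)
      have "(\<integral>\<^sup>+z. ennreal ((norm (x (k + j) z - x k z))\<^sup>2) \<partial>N) = ennreal ((L2norm N (\<lambda>z. x (k + j) z - x k z))\<^sup>2)" for j
        using L2v_diff[OF xL xL, of "k+j" k] by (subst nn_integral_eq_integral) (auto simp: L2v_def L2norm_sq)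
      then show "\<forall>\<^sub>F j in sequentially. (\<integral>\<^sup>+z. ennreal ((norm (x (k + j) z - x k z))\<^sup>2) \<partial>N) \<le> ennreal ((t k)\<^sup>2)"
        using Lt L2norm_nonneg by (intro always_eventually allI) (auto intro!: ennreal_leI power_mono)
    qed simp
    finally show ?thesis .
  qed
  have xl: "(\<lambda>z. x k z - l z) \<in> L2v N" for k
  proof -
    have "integrable N (\<lambda>z. (norm (x k z - l z))\<^sup>2)"
    proof (rule integrableI_bounded)
      show "(\<integral>\<^sup>+z. ennreal (norm ((norm (x k z - l z))\<^sup>2)) \<partial>N) < \<infinity>"
        using fatou[of k] by (simp add: le_less_trans[OF _ ennreal_less_top])
    qed measurable
    then show ?thesis by (simp add: L2v_def)
  qed
  have "l \<in> L2v N" using L2v_diff[OF xL[of 0] xl[of 0]] by simp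
  moreover have "(\<lambda>k. L2norm N (\<lambda>z. x k z - l z)) \<longlonglongrightarrow> 0"
  proof (rule tendsto_sandwich[OF _ _ tendsto_const t_lim])
    have "L2norm N (\<lambda>z. x k z - l z) \<le> t k" for k
    proof -
      have "ennreal ((L2norm N (\<lambda>z. x k z - l z))\<^sup>2) \<le> ennreal ((t k)\<^sup>2)"
        using fatou[of k] xl[of k] by (subst (asm) nn_integral_eq_integral) (auto simp: L2v_def L2norm_sq)
      then have "(L2norm N (\<lambda>z. x k z - l z))\<^sup>2 \<le> (t k)\<^sup>2" by (simp add: ennreal_le_iff)
      then show ?thesis by (rule power2_le_imp_le) (rule t0)
    qed
    then show "\<forall>\<^sub>F k in sequentially. L2norm N (\<lambda>z. x k z - l z) \<le> t k" by simp
  qed (simp add: L2norm_nonneg)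
  ultimately show ?thesis by blast
qed

section \<open>Polar coordinates\<close>

lemma Basis_vec3: "(Basis :: vec3 set) = {axis 1 1, axis 2 1, axis 3 1}"
  by (auto simp: Basis_vec_def) (metis exhaust_3)

lemma continuous_on_vector3:
  assumes "continuous_on S a" "continuous_on S b" "continuous_on S c"
  shows "continuous_on S (\<lambda>z. vector [a z, b z, c z :: real] :: real^3)"
proof -
  have "(\<lambda>z. vector [a z, b z, c z] :: real^3) = (\<lambda>z. \<chi> i. if i = 1 then a z else if i = 2 then b z else c z)"
    by (auto simp: vec_eq_iff forall_3)
  moreover have "continuous_on S (\<lambda>z. if i = 1 then a z else if i = 2 then b z else c z)" for i :: 3
    using assms by (cases "i = 1"; cases "i = 2") auto
  ultimately show ?thesis by (simp only:) (intro continuous_on_vec_lambda)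
qed

text \<open>Tonelli's theorem speaks of products, the change of variables formula of
  \<open>real^3\<close>; this passes between them. A measure that gives boxes their volume is
  Lebesgue measure.\<close>

lemma lborel_vec3:
  "(lborel :: vec3 measure) =
     distr (lborel :: (real \<times> real \<times> real) measure) borel (\<lambda>(r, \<phi>, \<theta>). vector [r, \<phi>, \<theta>])"
proof (rule lborel_eqI)
  let ?T = "\<lambda>(r, \<phi>, \<theta>). vector [r, \<phi>, \<theta>] :: vec3"
  have "?T \<in> borel_measurable borel"
    unfolding case_prod_beta'
    by (intro borel_measurable_continuous_onI continuous_on_vector3 continuous_intros)
  then have T: "?T \<in> borel_measurable lborel" by simp
  fix l u :: vec3
  assume le: "\<And>b. b \<in> Basis \<Longrightarrow> l \<bullet> b \<le> u \<bullet> b"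
  have le': "l $ i \<le> u $ i" for i using le[of "axis i 1"] by (simp add: inner_axis)
  have "?T -` box l u = {l$1<..<u$1} \<times> {l$2<..<u$2} \<times> {l$3<..<u$3}"
    by (auto simp: mem_box_cart forall_3)
  then have "emeasure (distr lborel borel ?T) (box l u)
      = emeasure (lborel \<Otimes>\<^sub>M (lborel \<Otimes>\<^sub>M lborel)) ({l$1<..<u$1} \<times> {l$2<..<u$2} \<times> {l$3<..<u$3})"
    using T by (simp add: emeasure_distr lborel_prod)
  also have "\<dots> = emeasure lborel {l$1<..<u$1} * (emeasure lborel {l$2<..<u$2} * emeasure lborel {l$3<..<u$3})"
  proof -
    have o: "open ({l$2<..<u$2} \<times> {l$3<..<u$3})" by (intro open_Times) auto
    have "emeasure (lborel \<Otimes>\<^sub>M lborel) ({l$1<..<u$1} \<times> {l$2<..<u$2} \<times> {l$3<..<u$3})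
        = emeasure lborel {l$1<..<u$1} * emeasure lborel ({l$2<..<u$2} \<times> {l$3<..<u$3})"
      by (rule lborel.emeasure_pair_measure_Times) (use o in auto)
    moreover have "emeasure (lborel \<Otimes>\<^sub>M lborel) ({l$2<..<u$2} \<times> {l$3<..<u$3})
        = emeasure lborel {l$2<..<u$2} * emeasure lborel {l$3<..<u$3}"
      by (rule lborel.emeasure_pair_measure_Times) auto
    ultimately show ?thesis by (simp add: lborel_prod)
  qed
  also have "\<dots> = (\<Prod>b\<in>Basis. (u - l) \<bullet> b)"
    using le' by (simp add: Basis_vec3 axis_eq_axis inner_axis ennreal_mult)
  finally show "emeasure (distr lborel borel ?T) (box l u) = (\<Prod>b\<in>Basis. (u - l) \<bullet> b)" .
qed simp

section \<open>Spherical coordinates and their Jacobian\<close>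

definition spherical :: "vec3 \<Rightarrow> vec3" where
  "spherical y = vector [y$1 * (cos (y$2) * sin (y$3)), y$1 * (sin (y$2) * sin (y$3)), y$1 * cos (y$3)]"

definition spherical_dom :: "vec3 set" where
  "spherical_dom = {y. 0 < y$1 \<and> 0 < y$2 \<and> y$2 < 2 * pi \<and> 0 < y$3 \<and> y$3 < pi}"

lemma has_derivative_vector3:
  assumes "(a has_derivative a') F" "(b has_derivative b') F" "(c has_derivative c') F"
  shows "((\<lambda>z. vector [a z, b z, c z :: real] :: real^3) has_derivative (\<lambda>h. vector [a' h, b' h, c' h])) F"
proof -
  have "(vector [x, y, z] :: real^3) = x *\<^sub>R axis 1 1 + y *\<^sub>R axis 2 1 + z *\<^sub>R axis 3 1" for x y z
    by (auto simp: vec_eq_iff forall_3 axis_def)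
  then show ?thesis using assms by (auto intro!: derivative_eq_intros)
qed

definition spherical' :: "vec3 \<Rightarrow> vec3 \<Rightarrow> vec3" where
  "spherical' y h = vector [h$1 * (cos (y$2) * sin (y$3)) + y$1 * (- sin (y$2) * h$2 * sin (y$3) + cos (y$2) * (cos (y$3) * h$3)),
     h$1 * (sin (y$2) * sin (y$3)) + y$1 * (cos (y$2) * h$2 * sin (y$3) + sin (y$2) * (cos (y$3) * h$3)),
     h$1 * cos (y$3) + y$1 * (- sin (y$3) * h$3)]"

lemma spherical_deriv: "(spherical has_derivative spherical' y) (at y within S)"
proof -
  have nth: "((\<lambda>y::vec3. y $ i) has_derivative (\<lambda>h. h $ i)) (at y within S)" for i
    by (rule bounded_linear_imp_has_derivative) (rule bounded_linear_vec_nth)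
  show ?thesis
    unfolding spherical_def[abs_def] spherical'_def[abs_def]
    by (rule has_derivative_vector3) (auto intro!: derivative_eq_intros nth simp: algebra_simps fun_eq_iff)
qed

lemma spherical_det: "det (matrix (spherical' y)) = - ((y$1)\<^sup>2 * sin (y$3))"
proof -
  \<comment> \<open>Sines and cosines are replaced by free variables, so that the determinant
    becomes a polynomial identity; Pythagoras enters only at the end. The sign reflects the order
    radius, longitude, colatitude.\<close>
  have *: "det (matrix (\<lambda>h. vector [h$1 * (a * d) + r * (- b * h$2 * d + a * (c * h$3)),
     h$1 * (b * d) + r * (a * h$2 * d + b * (c * h$3)),
     h$1 * c + r * (- d * h$3)] :: real^3)) = - (r\<^sup>2 * d) * ((d\<^sup>2 + c\<^sup>2) * (b\<^sup>2 + a\<^sup>2))" for a b c d r :: real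
    unfolding det_3 matrix_def by (simp add: axis_def power2_eq_square algebra_simps)
  show ?thesis unfolding spherical'_def[abs_def] * by simp
qed

lemma spherical_inj: "inj_on spherical spherical_dom"
proof (rule inj_onI)
  fix y w assume y: "y \<in> spherical_dom" and w: "w \<in> spherical_dom" and eq: "spherical y = spherical w"
  have e: "y$1 * (cos (y$2) * sin (y$3)) = w$1 * (cos (w$2) * sin (w$3))"
    "y$1 * (sin (y$2) * sin (y$3)) = w$1 * (sin (w$2) * sin (w$3))"
    "y$1 * cos (y$3) = w$1 * cos (w$3)"
    using eq unfolding spherical_def vec_eq_iff forall_3 by simp_all
  have sq: "(y$1 * (cos (y$2) * sin (y$3)))\<^sup>2 + (y$1 * (sin (y$2) * sin (y$3)))\<^sup>2 + (y$1 * cos (y$3))\<^sup>2 = (y$1)\<^sup>2" for y :: vec3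
  proof -
    have *: "(r * (a * d))\<^sup>2 + (r * (b * d))\<^sup>2 + (r * c)\<^sup>2 = r\<^sup>2 * (d\<^sup>2 * (b\<^sup>2 + a\<^sup>2) + c\<^sup>2)" for a b c d r :: real
      by (simp add: power2_eq_square algebra_simps)
    have "(y$1 * (cos (y$2) * sin (y$3)))\<^sup>2 + (y$1 * (sin (y$2) * sin (y$3)))\<^sup>2 + (y$1 * cos (y$3))\<^sup>2
      = (y$1)\<^sup>2 * ((sin (y$3))\<^sup>2 * ((sin (y$2))\<^sup>2 + (cos (y$2))\<^sup>2) + (cos (y$3))\<^sup>2)" by (rule *)
    also have "\<dots> = (y$1)\<^sup>2" by simp
    finally show ?thesis .
  qed
  have "(y$1)\<^sup>2 = (w$1)\<^sup>2" using sq[of y] sq[of w] unfolding e by simp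
  then have 1: "y$1 = w$1" using y w by (auto simp: spherical_dom_def power2_eq_iff)
  then have "cos (y$3) = cos (w$3)" using e(3) w by (simp add: spherical_dom_def)
  then have 3: "y$3 = w$3" using y w cos_inj_pi[of "y$3" "w$3"] by (auto simp: spherical_dom_def)
  have "sin (w$3) > 0" using w by (auto simp: spherical_dom_def intro: sin_gt_zero)
  then have "cos (y$2) = cos (w$2)" "sin (y$2) = sin (w$2)"
    using e(1,2) 1 3 w by (auto simp: spherical_dom_def)
  then obtain k :: int where k: "y$2 = w$2 + 2 * pi * k" using sin_cos_eq_iff[of "y$2" "w$2"] by auto
  have "k = 0"
  proof -
    have "2 * pi * real_of_int k < 2 * pi * 1" "2 * pi * (-1) < 2 * pi * real_of_int k"
      using k y w unfolding spherical_dom_def mem_Collect_eq by linarith+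
    then have "real_of_int k < 1" "-1 < real_of_int k"
      using mult_less_cancel_left_pos[of "2 * pi"] pi_gt_zero by fastforce+
    then show ?thesis by linarith
  qed
  then have "y$2 = w$2" using k by simp
  then show "y = w" using 1 3 by (simp add: vec_eq_iff forall_3)
qed

text \<open>The open parameter domain misses only a half-plane inside \<open>x$2 = 0\<close>.
  Excluding the whole plane costs a null set and rules out longitude 0 and both poles at
  once.\<close>

lemma spherical_surj:
  assumes "x$2 \<noteq> 0" shows "x \<in> spherical ` spherical_dom"
proof -
  define r where "r = sqrt ((x$1)\<^sup>2 + (x$2)\<^sup>2 + (x$3)\<^sup>2)"
  have pos: "(x$2)\<^sup>2 > 0" using assms by simp
  have r2: "r\<^sup>2 = (x$1)\<^sup>2 + (x$2)\<^sup>2 + (x$3)\<^sup>2" unfolding r_def by simp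
  have r: "r > 0" unfolding r_def using pos by (simp add: add_pos_nonneg add_nonneg_pos)
  have "(x$3)\<^sup>2 < r\<^sup>2" unfolding r2 using pos zero_le_power2[of "x$1"] by linarith
  then have "\<bar>x$3\<bar> < r" using r by (metis abs_of_pos power2_abs power_less_imp_less_base abs_ge_zero less_imp_le)
  then have c: "-1 < x$3 / r" "x$3 / r < 1" using r by (auto simp: field_simps abs_less_iff)
  define \<theta> where "\<theta> = arccos (x$3 / r)"
  have \<theta>: "0 < \<theta>" "\<theta> < pi" "cos \<theta> = x$3 / r" using c arccos_lt_bounded[of "x$3 / r"] by (auto simp: \<theta>_def)
  have s: "sin \<theta> > 0" using \<theta> by (simp add: sin_gt_zero)
  have s2: "r\<^sup>2 * (sin \<theta>)\<^sup>2 = (x$1)\<^sup>2 + (x$2)\<^sup>2"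
  proof -
    have "r\<^sup>2 * (sin \<theta>)\<^sup>2 = r\<^sup>2 - (x$3)\<^sup>2"
      unfolding sin_squared_eq \<theta>(3) power_divide using r by (simp add: right_diff_distrib)
    then show ?thesis using r2 by simp
  qed
  have "(x$1 / (r * sin \<theta>))\<^sup>2 + (x$2 / (r * sin \<theta>))\<^sup>2 = 1"
    using s2 pos zero_le_power2[of "x$1"] by (simp add: power_divide power_mult_distrib flip: add_divide_distrib)
  then obtain t where t: "0 \<le> t" "t < 2 * pi" "x$1 / (r * sin \<theta>) = cos t" "x$2 / (r * sin \<theta>) = sin t"
    using sincos_total_2pi by metis
  have "t \<noteq> 0" using t(4) assms r s by auto
  then have "vector [r, t, \<theta>] \<in> spherical_dom" using t \<theta> r by (auto simp: spherical_dom_def)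
  moreover have "spherical (vector [r, t, \<theta>]) = x"
    using t(3,4)[symmetric] \<theta>(3) r s by (simp add: spherical_def vec_eq_iff forall_3)
  ultimately show ?thesis by (metis imageI)
qed

lemma spherical_borel [measurable]: "spherical \<in> borel_measurable borel"
  unfolding spherical_def[abs_def]
  by (intro borel_measurable_continuous_onI continuous_on_vector3 continuous_intros)

lemma spherical_dom_borel [measurable]: "spherical_dom \<in> sets borel"
proof -
  have "spherical_dom = {y. 0 < y$1} \<inter> {y. 0 < y$2} \<inter> {y. y$2 < 2 * pi} \<inter> {y. 0 < y$3} \<inter> {y. y$3 < pi}"
    by (auto simp: spherical_dom_def)
  moreover have "open \<dots>" by (intro open_Int open_Collect_less continuous_intros)
  ultimately show ?thesis by simp
qed

text \<open>Both sides are compared on boxes. There the Jacobian formula for injective maps gives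
  the volume of the image of the parameters, and this image is the box up to a part of the null
  plane \<open>x$2 = 0\<close>.\<close>

lemma lborel_spherical:
  "(lborel :: vec3 measure) =
    distr (density lborel (\<lambda>y. ennreal ((y$1)\<^sup>2 * sin (y$3)) * indicator spherical_dom y)) borel spherical"
proof (rule lborel_eqI)
  let ?d = "\<lambda>y::vec3. ennreal ((y$1)\<^sup>2 * sin (y$3)) * indicator spherical_dom y"
  have [measurable]: "(\<lambda>y::vec3. y $ i) \<in> borel_measurable borel" for i
    by (intro borel_measurable_continuous_onI continuous_intros)
  fix l u :: vec3
  assume le: "\<And>b. b \<in> Basis \<Longrightarrow> l \<bullet> b \<le> u \<bullet> b"
  define S where "S = spherical_dom \<inter> spherical -` box l u"
  have S: "S \<in> sets borel" unfolding S_def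
    using measurable_sets[OF spherical_borel, of "box l u"] by auto
  have neg: "negligible {x::vec3. x$2 = 0}" by (rule negligible_standard_hyperplane_cart)
  have "spherical ` S = box l u \<inter> spherical ` spherical_dom" unfolding S_def by auto
  then have ae: "box l u - {x. x$2 = 0} \<subseteq> spherical ` S" "spherical ` S \<subseteq> box l u"
    using spherical_surj by auto
  have sd: "negligible (sym_diff (spherical ` S) (box l u))"
    by (rule negligible_subset[OF neg]) (use ae in auto)
  have box: "box l u \<in> lmeasurable" by simp
  have im: "spherical ` S \<in> lmeasurable" "measure lebesgue (spherical ` S) = measure lebesgue (box l u)"
    using lmeasurable_negligible_symdiff[OF box] measure_negligible_symdiff[of "box l u" "spherical ` S"] box
      sd by (auto simp: Un_commute)
  have inj: "inj_on spherical S" by (rule inj_on_subset[OF spherical_inj]) (auto simp: S_def)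
  have abs: "\<bar>det (matrix (spherical' y))\<bar> = (y$1)\<^sup>2 * sin (y$3)" if "y \<in> S" for y
    using that by (auto simp: spherical_det S_def spherical_dom_def abs_mult sin_gt_zero intro!: abs_of_pos)
  have "((\<lambda>y. \<bar>det (matrix (spherical' y))\<bar>) has_integral measure lebesgue (box l u)) S"
    using has_measure_differentiable_image[of S spherical spherical' "measure lebesgue (box l u)"] S im inj spherical_deriv
    by auto
  then have hi: "((\<lambda>y. (y$1)\<^sup>2 * sin (y$3)) has_integral measure lebesgue (box l u)) S"
    by (rule has_integral_eq[rotated]) (rule abs)
  have "(\<integral>\<^sup>+y. ennreal ((y$1)\<^sup>2 * sin (y$3)) * indicator S y \<partial>lborel) = ennreal (measure lebesgue (box l u))"
  proof -
    have nn: "0 \<le> (y$1)\<^sup>2 * sin (y$3)" if "y \<in> S" for y using abs[OF that] by simp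
    have "((\<lambda>y. (y$1)\<^sup>2 * sin (y$3) * indicator S y) has_integral measure lebesgue (box l u)) UNIV"
      using hi unfolding has_integral_restrict_UNIV[of S, symmetric]
      by (rule has_integral_eq[rotated]) (simp add: indicator_def)
    then have "(\<integral>\<^sup>+y. ennreal ((y$1)\<^sup>2 * sin (y$3) * indicator S y) \<partial>lborel) = ennreal (measure lebesgue (box l u))"
      using nn S by (intro nn_integral_has_integral_lborel) (auto simp: indicator_def intro!: measurable_If)
    moreover have "ennreal ((y$1)\<^sup>2 * sin (y$3) * indicator S y) = ennreal ((y$1)\<^sup>2 * sin (y$3)) * indicator S y" for y
      by (auto simp: indicator_def)
    ultimately show ?thesis by simp
  qed
  then have "emeasure (distr (density lborel ?d) borel spherical) (box l u) = ennreal (measure lebesgue (box l u))"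
    using measurable_sets[OF spherical_borel, of "box l u"]
    by (simp add: emeasure_distr emeasure_density S_def indicator_inter_arith mult.assoc indicator_vimage cong: nn_integral_cong)
  also have "\<dots> = (\<Prod>b\<in>Basis. (u - l) \<bullet> b)"
    using le by (simp add: measure_lborel_box_eq)
  finally show "emeasure (distr (density lborel ?d) borel spherical) (box l u) = (\<Prod>b\<in>Basis. (u - l) \<bullet> b)" .
qed simp


section \<open>The surface measure of the unit sphere and integration in polar coordinates\<close>

lemma sets_sphere_measure [simp]: "sets sphere_measure = sets (restrict_space borel (sphere 0 1))"
  by (simp add: sphere_measure_def)

lemma space_sphere_measure [simp]: "space sphere_measure = sphere 0 1"
  by (simp add: sphere_measure_def space_restrict_space)

lemma sph_continuous: "continuous_on S sph"
  unfolding sph_def case_prod_beta' by (intro continuous_on_vector3 continuous_intros)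

lemma sph_borel [measurable]: "sph \<in> borel_measurable borel"
  by (intro borel_measurable_continuous_onI sph_continuous)

lemma norm_sph [simp]: "norm (sph z) = 1"
proof -
  have "(cos p * sin t)\<^sup>2 + (sin p * sin t)\<^sup>2 + (cos t)\<^sup>2 = 1" for p t :: real
  proof -
    have "(a * d)\<^sup>2 + (b * d)\<^sup>2 + c\<^sup>2 = d\<^sup>2 * (b\<^sup>2 + a\<^sup>2) + c\<^sup>2" for a b c d :: real
      by (simp add: power2_eq_square algebra_simps)
    from this[of "cos p" "sin t" "sin p" "cos t"] show ?thesis by simp
  qed
  then show ?thesis
    by (simp add: norm_vec_def L2_set_def sum_3 sph_def case_prod_beta')
qed

lemma nn_integral_sphere_measure:
  assumes "F \<in> borel_measurable borel"
  shows "(\<integral>\<^sup>+\<omega>. F \<omega> \<partial>sphere_measure) =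
     (\<integral>\<^sup>+z. ennreal (sin (snd z)) * F (sph z) * indicator ({0..2*pi} \<times> {0..pi}) z \<partial>lborel)"
proof -
  have R: "{0..2*pi} \<times> {0..pi} \<in> sets (borel :: (real \<times> real) measure)"
    by (intro borel_closed closed_Times) auto
  note [measurable] = assms
  have [measurable]: "sph \<in> measurable (density (restrict_space lborel ({0..2 * pi} \<times> {0..pi})) d) (restrict_space borel (sphere 0 1))" for d
    by (intro measurable_restrict_space2) (auto intro!: measurable_restrict_space1)
  have [measurable]: "F \<in> borel_measurable (restrict_space borel A)" for A
    by (intro measurable_restrict_space1) simp
  have sn: "(\<lambda>z::real \<times> real. sin (snd z)) \<in> borel_measurable borel"
    by (intro borel_measurable_continuous_onI continuous_intros)
  have m: "(\<lambda>z. ennreal (sin (snd z))) \<in> borel_measurable (restrict_space lborel ({0..2 * pi} \<times> {0..pi}))"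
     "(\<lambda>z. F (sph z)) \<in> borel_measurable (restrict_space lborel ({0..2 * pi} \<times> {0..pi}))"
    using sn by (auto intro!: measurable_restrict_space1)
  show ?thesis
    unfolding sphere_measure_def
    using m R by (simp add: nn_integral_distr case_prod_beta' nn_integral_density nn_integral_restrict_space)
qed

text \<open>The density \<open>r^2 sin \<theta>\<close> is a product, so Tonelli's theorem separates
  the radius from the two angles that make up \<open>sphere_measure\<close>.\<close>

theorem nn_integral_polar:
  assumes F [measurable]: "F \<in> borel_measurable borel"
  shows "(\<integral>\<^sup>+x. F x \<partial>lborel) =
    (\<integral>\<^sup>+r. ennreal (r\<^sup>2) * indicator {0<..} r * (\<integral>\<^sup>+\<omega>. F (r *\<^sub>R \<omega>) \<partial>sphere_measure) \<partial>lborel)"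
proof -
  have [measurable]: "(\<lambda>y::vec3. y $ i) \<in> borel_measurable borel" for i
    by (intro borel_measurable_continuous_onI continuous_intros)
  let ?T = "\<lambda>(r, \<phi>, \<theta>). vector [r, \<phi>, \<theta>] :: vec3"
  have T [measurable]: "?T \<in> borel_measurable borel"
    unfolding case_prod_beta'
    by (intro borel_measurable_continuous_onI continuous_on_vector3 continuous_intros)
  \<comment> \<open>\<open>sphere_measure\<close> is built on the closed rectangle of angles,
    \<open>spherical_dom\<close> on the open one; the edges form a null set.\<close>
  have ae: "AE z in lborel. z \<in> {0..2*pi} \<times> {0..pi} \<longleftrightarrow> z \<in> {0<..<2*pi} \<times> {0<..<pi}"
  proof (rule AE_I')
    have "emeasure lborel (cbox (0,0) (2*pi,pi) - box (0,0) (2*pi,pi)) = 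
       emeasure lborel (cbox (0,0) (2*pi,pi)) - emeasure lborel (box (0,0) (2*pi,pi))"
      by (intro emeasure_Diff) (auto simp: emeasure_lborel_box_eq box_subset_cbox)
    also have "\<dots> = 0" by (simp add: emeasure_lborel_box_eq emeasure_lborel_cbox_eq)
    finally show "cbox (0,0) (2*pi,pi) - box (0,0) (2*pi,pi) \<in> null_sets lborel" by (intro null_setsI) auto
    show "{z \<in> space lborel. \<not> (z \<in> {0..2*pi} \<times> {0..pi} \<longleftrightarrow> z \<in> {0<..<2*pi} \<times> {0<..<pi})} \<subseteq> cbox (0,0) (2*pi,pi) - box (0,0) (2*pi,pi)"
      by (auto simp: box_def cbox_Pair_eq Basis_prod_def)
  qed
  have "(\<integral>\<^sup>+x. F x \<partial>lborel) = (\<integral>\<^sup>+y. ennreal ((y$1)\<^sup>2 * sin (y$3)) * indicator spherical_dom y * F (spherical y) \<partial>lborel)"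
    by (subst lborel_spherical) (simp add: nn_integral_distr nn_integral_density)
  also have "\<dots> = (\<integral>\<^sup>+z. (\<lambda>y. ennreal ((y$1)\<^sup>2 * sin (y$3)) * indicator spherical_dom y * F (spherical y)) (?T z) \<partial>lborel)"
    by (subst lborel_vec3) (simp add: nn_integral_distr)
  also have "\<dots> = (\<integral>\<^sup>+r. \<integral>\<^sup>+z. ennreal (r\<^sup>2) * indicator {0<..} r * (ennreal (sin (snd z)) * F (r *\<^sub>R sph z) * indicator ({0<..<2*pi} \<times> {0<..<pi}) z) \<partial>lborel \<partial>lborel)"
    (is "_ = (\<integral>\<^sup>+r. \<integral>\<^sup>+z. ?G r z \<partial>lborel \<partial>lborel)")
  proof -
    have "(\<lambda>y. ennreal ((y$1)\<^sup>2 * sin (y$3)) * indicator spherical_dom y * F (spherical y)) (?T w)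
       = case_prod ?G w" for w
    proof -
      obtain r p t where w: "w = (r, p, t)" by (cases w) auto
      have "spherical (vector [r, p, t]) = r *\<^sub>R sph (p, t)"
        by (simp add: spherical_def sph_def vec_eq_iff forall_3)
      then show ?thesis
        by (simp add: w spherical_dom_def indicator_def ennreal_mult') (simp add: mult_ac)
    qed
    then have "(\<integral>\<^sup>+z. (\<lambda>y. ennreal ((y$1)\<^sup>2 * sin (y$3)) * indicator spherical_dom y * F (spherical y)) (?T z) \<partial>lborel)
      = (\<integral>\<^sup>+w. case_prod ?G w \<partial>(lborel \<Otimes>\<^sub>M lborel))" by (simp only: lborel_prod)
    also have "\<dots> = (\<integral>\<^sup>+r. \<integral>\<^sup>+z. ?G r z \<partial>lborel \<partial>lborel)"
    proof (rule lborel.nn_integral_fst[symmetric, of "case_prod ?G", simplified])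
      define Q where "Q = {0<..<2*pi} \<times> {0<..<pi}"
      have "open Q" unfolding Q_def by (intro open_Times) auto
      then have Q [measurable]: "Q \<in> sets borel" by (rule borel_open)
      have [measurable]: "(\<lambda>z::real \<times> real. sin (snd z)) \<in> borel_measurable borel"
        by (intro borel_measurable_continuous_onI continuous_intros)
      have 1: "(\<lambda>w::real \<times> real \<times> real. ennreal (sin (snd (snd w)))) \<in> borel_measurable (lborel \<Otimes>\<^sub>M lborel)"
        by (rule measurable_compose[OF measurable_snd]) simp
      have 2: "(\<lambda>w. indicator Q (snd w) :: ennreal) \<in> borel_measurable (lborel \<Otimes>\<^sub>M lborel)"
        by (rule measurable_compose[OF measurable_snd]) simp
      have 3: "(\<lambda>w. sph (snd w)) \<in> borel_measurable (lborel \<Otimes>\<^sub>M lborel)"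
        by (rule measurable_compose[OF measurable_snd]) simp
      have 4: "(\<lambda>w. F (fst w *\<^sub>R sph (snd w))) \<in> borel_measurable (lborel \<Otimes>\<^sub>M lborel)"
        using 3 by measurable
      have 5: "(\<lambda>w. ennreal ((fst w)\<^sup>2) * indicator {0<..} (fst w)) \<in> borel_measurable (lborel \<Otimes>\<^sub>M lborel)"
        by (rule measurable_compose[OF measurable_fst]) simp
      show "case_prod ?G \<in> borel_measurable (lborel \<Otimes>\<^sub>M lborel)"
        unfolding Q_def[symmetric] case_prod_beta' 
        by (rule borel_measurable_times_ennreal[OF 5 borel_measurable_times_ennreal[OF borel_measurable_times_ennreal[OF 1 4] 2]])
    qed
    finally show ?thesis .
  qed
  also have "\<dots> = (\<integral>\<^sup>+r. ennreal (r\<^sup>2) * indicator {0<..} r * (\<integral>\<^sup>+\<omega>. F (r *\<^sub>R \<omega>) \<partial>sphere_measure) \<partial>lborel)"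
  proof (rule nn_integral_cong)
    fix r :: real
    define Q where "Q = {0<..<2*pi} \<times> {0<..<pi}"
    have "open Q" unfolding Q_def by (intro open_Times) auto
    then have Q [measurable]: "Q \<in> sets borel" by (rule borel_open)
    have [measurable]: "(\<lambda>z::real \<times> real. sin (snd z)) \<in> borel_measurable borel"
      by (intro borel_measurable_continuous_onI continuous_intros)
    have m: "(\<lambda>z. ennreal (sin (snd z)) * F (r *\<^sub>R sph z) * indicator Q z) \<in> borel_measurable lborel"
      by measurable
    have "(\<integral>\<^sup>+\<omega>. F (r *\<^sub>R \<omega>) \<partial>sphere_measure) =
      (\<integral>\<^sup>+z. ennreal (sin (snd z)) * F (r *\<^sub>R sph z) * indicator ({0..2*pi} \<times> {0..pi}) z \<partial>lborel)"
      by (rule nn_integral_sphere_measure) measurable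
    also have "\<dots> = (\<integral>\<^sup>+z. ennreal (sin (snd z)) * F (r *\<^sub>R sph z) * indicator ({0<..<2*pi} \<times> {0<..<pi}) z \<partial>lborel)"
      by (rule nn_integral_cong_AE) (use ae in eventually_elim, simp add: indicator_def)
    finally show "(\<integral>\<^sup>+z. ?G r z \<partial>lborel) = ennreal (r\<^sup>2) * indicator {0<..} r * (\<integral>\<^sup>+\<omega>. F (r *\<^sub>R \<omega>) \<partial>sphere_measure)"
      using m unfolding Q_def[symmetric] by (simp add: nn_integral_cmult)
  qed
  finally show ?thesis .
qed

lemma finite_sphere_measure: "finite_measure sphere_measure"
proof (rule finite_measureI)
  have R: "{0..2*pi} \<times> {0..pi} = cbox (0, 0) (2*pi, pi)" by (auto simp: cbox_Pair_eq)
  have "emeasure sphere_measure (space sphere_measure) = (\<integral>\<^sup>+\<omega>. 1 \<partial>sphere_measure)" by simp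
  also have "\<dots> = (\<integral>\<^sup>+z. ennreal (sin (snd z)) * 1 * indicator ({0..2*pi} \<times> {0..pi}) z \<partial>lborel)"
    by (rule nn_integral_sphere_measure) simp
  also have "\<dots> \<le> (\<integral>\<^sup>+z. indicator (cbox (0, 0) (2*pi, pi)) z \<partial>(lborel :: (real \<times> real) measure))"
    unfolding R by (intro nn_integral_mono) (auto simp: indicator_def)
  also have "\<dots> < \<infinity>" by (simp add: emeasure_lborel_cbox_eq)
  finally show "emeasure sphere_measure (space sphere_measure) \<noteq> \<infinity>" by simp
qed

section \<open>Integration by parts and the fundamental lemma\<close>

lemma integral_lborel_translate:
  fixes g :: "'a::euclidean_space \<Rightarrow> real"
  assumes "integrable lborel g"
  shows "integrable lborel (\<lambda>z. g (z + c))" "(\<integral>z. g (z + c) \<partial>lborel) = (\<integral>z. g z \<partial>lborel)"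
proof -
  have m: "(+) c \<in> measurable lborel borel" and g: "g \<in> borel_measurable borel" using assms by auto
  have d: "distr lborel borel ((+) c) = (lborel :: 'a measure)" by (rule lborel_distr_plus)
  show "integrable lborel (\<lambda>z. g (z + c))"
    using assms integrable_distr_eq[OF m g] unfolding d by (simp add: add.commute)
  show "(\<integral>z. g (z + c) \<partial>lborel) = (\<integral>z. g z \<partial>lborel)"
    using integral_distr[OF m g] unfolding d by (simp add: add.commute)
qed

text \<open>The difference quotients have integral \<open>0\<close> by translation invariance.\<close>

lemma integral_directional_derivative:
  fixes g :: "'a::euclidean_space \<Rightarrow> real"
  assumes der: "\<And>z. ((\<lambda>t. g (z + t *\<^sub>R b)) has_real_derivative g' z) (at 0)"
    and g0: "\<And>z. z \<notin> cball 0 R \<Longrightarrow> g z = 0"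
    and g_bd: "\<And>z. \<bar>g z\<bar> \<le> M" and g'_bd: "\<And>z. \<bar>g' z\<bar> \<le> M"
    and [measurable]: "g \<in> borel_measurable borel"
  shows "integrable lborel g'" "(\<integral>z. g' z \<partial>lborel) = 0"
proof -
  have M: "M \<ge> 0" using g_bd[of 0] by linarith
  have int_bd: "integrable lborel f" if "f \<in> borel_measurable borel" "\<And>z. \<bar>f z\<bar> \<le> M * indicator (cball 0 r) z"
    for f :: "'a \<Rightarrow> real" and r
  proof (rule Bochner_Integration.integrable_bound)
    show "integrable lborel (\<lambda>z::'a. M * indicator (cball 0 r) z)"
      by (intro integrable_mult_right integrable_real_indicator) (use emeasure_lborel_cball_finite in auto)
  qed (use that M in \<open>auto simp: indicator_def\<close>)
  have gi: "integrable lborel g"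
    by (rule int_bd[of _ R]) (use g0 g_bd in \<open>auto simp: indicator_def\<close>)
  define h where "h k = inverse (real (Suc k))" for k
  have h: "0 < h k" "h k \<le> 1" for k by (auto simp: h_def field_simps)
  have h_lim: "h \<longlonglongrightarrow> 0" unfolding h_def[abs_def] by (rule LIMSEQ_inverse_real_of_nat)
  define G where "G k z = (g (z + h k *\<^sub>R b) - g z) / h k" for k z
  have G_int0: "(\<integral>z. G k z \<partial>lborel) = 0" for k
    unfolding G_def using integral_lborel_translate[OF gi, of "h k *\<^sub>R b"] gi by simp
  have der': "((\<lambda>t. g (z + t *\<^sub>R b)) has_real_derivative g' (z + s *\<^sub>R b)) (at s)" for z s
  proof -
    have "((\<lambda>t. t - s) has_real_derivative 1) (at s)" by (auto intro!: derivative_eq_intros)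
    moreover have "((\<lambda>t. g ((z + s *\<^sub>R b) + t *\<^sub>R b)) has_real_derivative g' (z + s *\<^sub>R b)) (at (s - s))"
      using der by simp
    ultimately have "((\<lambda>t. g ((z + s *\<^sub>R b) + (t - s) *\<^sub>R b)) has_real_derivative g' (z + s *\<^sub>R b) * 1) (at s)"
      by (rule DERIV_chain2[rotated])
    then show ?thesis by (simp add: algebra_simps)
  qed
  \<comment> \<open>By the mean value theorem a difference quotient is a value of \<open>g'\<close>,
    hence bounded by \<open>M\<close>. Steps of size at most 1 enlarge the support by at most
    \<open>norm b\<close>, so one function dominates all quotients.\<close>
  have G_bd: "\<bar>G k z\<bar> \<le> M * indicator (cball 0 (R + norm b)) z" for k z
  proof (cases "z \<in> cball 0 (R + norm b)")
    case True
    obtain s where "g (z + h k *\<^sub>R b) - g (z + 0 *\<^sub>R b) = (h k - 0) * g' (z + s *\<^sub>R b)"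
      using MVT2[of 0 "h k" "\<lambda>t. g (z + t *\<^sub>R b)" "\<lambda>s. g' (z + s *\<^sub>R b)"] h(1) der' by blast
    then have "G k z = g' (z + s *\<^sub>R b)" using h(1)[of k] by (simp add: G_def)
    then show ?thesis using True g'_bd by simp
  next
    case False
    then have "z \<notin> cball 0 R" by auto (meson add_increasing2 norm_ge_zero order_trans order_refl)
    moreover have "z + h k *\<^sub>R b \<notin> cball 0 R"
    proof
      assume "z + h k *\<^sub>R b \<in> cball 0 R"
      then have "norm z \<le> R + norm (h k *\<^sub>R b)" using norm_diff_ineq[of z "h k *\<^sub>R b"] by simp
      also have "\<dots> \<le> R + norm b" using h[of k] by (simp add: mult_left_le_one_le)
      finally show False using False by simp
    qed
    ultimately have "G k z = 0" using g0 by (simp add: G_def)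
    then show ?thesis using M by simp
  qed
  have G_lim: "(\<lambda>k. G k z) \<longlonglongrightarrow> g' z" for z
  proof -
    have "((\<lambda>t. (g (z + t *\<^sub>R b) - g z) / t) \<longlongrightarrow> g' z) (at 0)"
      using der[of z] unfolding has_field_derivative_iff by simp
    moreover have "filterlim h (at 0) sequentially"
      unfolding filterlim_at using h_lim h(1) by (auto simp: less_imp_neq[THEN not_sym])
    ultimately show ?thesis unfolding G_def by (rule filterlim_compose)
  qed
  have Gm: "G k \<in> borel_measurable borel" for k unfolding G_def[abs_def] by measurable
  have g'm: "g' \<in> borel_measurable borel" by (rule borel_measurable_LIMSEQ_real[OF G_lim Gm])
  have wi: "integrable lborel (\<lambda>z. M * indicator (cball 0 (R + norm b)) z)"
    by (intro integrable_mult_right integrable_real_indicator) (use emeasure_lborel_cball_finite in auto)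
  show "integrable lborel g'"
    by (rule integrable_dominated_convergence[OF _ _ wi, of g' G]) (use G_lim G_bd Gm g'm in auto)
  have "(\<lambda>k. \<integral>z. G k z \<partial>lborel) \<longlonglongrightarrow> (\<integral>z. g' z \<partial>lborel)"
    by (rule integral_dominated_convergence[OF _ _ wi]) (use G_lim G_bd Gm g'm in auto)
  then show "(\<integral>z. g' z \<partial>lborel) = 0" unfolding G_int0 using LIMSEQ_unique tendsto_const by blast
qed

text \<open>A \<open>C^1\<close> substitute for the positive part, one continuous derivative being
  what \<open>test_fun\<close> asks for. The box bumps, the radial weight and the cut-off near the
  boundary are all built from it.\<close>

definition sqpos :: "real \<Rightarrow> real" where "sqpos t = (max 0 t)\<^sup>2"

lemma sqpos_deriv: "(sqpos has_real_derivative 2 * max 0 t) (at t)"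
proof -
  consider "t > 0" | "t < 0" | "t = 0" by linarith
  then show ?thesis
  proof cases
    case 1
    have "((\<lambda>x. x\<^sup>2) has_real_derivative 2 * t) (at t)" by (auto intro!: derivative_eq_intros)
    then show ?thesis
      using 1 by (auto intro: has_field_derivative_transform_within_open[of _ _ _ "{0<..}"] simp: sqpos_def)
  next
    case 2
    have "((\<lambda>x. 0) has_real_derivative 0) (at t)" by simp
    then have "(sqpos has_real_derivative 0) (at t)"
      by (rule has_field_derivative_transform_within_open[of _ _ _ "{..<0}"]) (use 2 in \<open>auto simp: sqpos_def\<close>)
    then show ?thesis using 2 by simp
  next
    case 3
    have "((\<lambda>h. max 0 h) \<longlongrightarrow> max 0 0) (at (0::real))" by (intro tendsto_intros)
    moreover have "\<forall>\<^sub>F h in at 0. max 0 h = (sqpos (0 + h) - sqpos 0) / h"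
      by (auto simp: eventually_at_filter sqpos_def power2_eq_square max_def)
    ultimately have "((\<lambda>h. (sqpos (0 + h) - sqpos 0) / h) \<longlongrightarrow> max 0 0) (at 0)"
      by (rule Lim_transform_eventually)
    then show ?thesis using 3 by (simp add: DERIV_def)
  qed
qed

lemma sqpos_continuous: "continuous_on S sqpos"
  using DERIV_isCont[OF sqpos_deriv] by (auto intro: continuous_at_imp_continuous_on)

lemma sqpos_simps: "0 \<le> sqpos t" "t \<le> 0 \<Longrightarrow> sqpos t = 0" "0 < t \<Longrightarrow> 0 < sqpos t"
  by (auto simp: sqpos_def)

text \<open>Frees later arguments from the selected \<open>frechet_derivative\<close>: any family of
  derivatives with continuous directional values certifies \<open>C^1\<close>.\<close>

lemma C1_on_UNIV_iff:
  fixes f :: "'a::euclidean_space \<Rightarrow> real"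
  shows "C1_on UNIV f \<longleftrightarrow> (\<exists>f'. (\<forall>z. (f has_derivative f' z) (at z)) \<and> (\<forall>h. continuous_on UNIV (\<lambda>z. f' z h)))"
proof
  assume "C1_on UNIV f"
  then show "\<exists>f'. (\<forall>z. (f has_derivative f' z) (at z)) \<and> (\<forall>h. continuous_on UNIV (\<lambda>z. f' z h))"
    unfolding C1_on_def by (intro exI[of _ "\<lambda>z. frechet_derivative f (at z)"]) (auto simp: frechet_derivative_works)
next
  assume "\<exists>f'. (\<forall>z. (f has_derivative f' z) (at z)) \<and> (\<forall>h. continuous_on UNIV (\<lambda>z. f' z h))"
  then obtain f' where f': "\<And>z. (f has_derivative f' z) (at z)" "\<And>h. continuous_on UNIV (\<lambda>z. f' z h)" by blast
  then have "frechet_derivative f (at z) = f' z" for z by (metis frechet_derivative_at)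
  then show "C1_on UNIV f" unfolding C1_on_def using f' by (auto simp: differentiable_def)
qed

lemma C1_on_UNIV_continuous:
  fixes f :: "'a::euclidean_space \<Rightarrow> real"
  assumes "C1_on UNIV f" shows "continuous_on UNIV f"
  using assms unfolding C1_on_def
  by (auto intro!: continuous_at_imp_continuous_on differentiable_imp_continuous_within)

lemma C1_on_UNIV_mult:
  fixes f g :: "'a::euclidean_space \<Rightarrow> real"
  assumes "C1_on UNIV f" "C1_on UNIV g" shows "C1_on UNIV (\<lambda>z. f z * g z)"
proof -
  note c = assms[THEN C1_on_UNIV_continuous]
  obtain f' g' where d: "\<And>z. (f has_derivative f' z) (at z)" "\<And>h. continuous_on UNIV (\<lambda>z. f' z h)"
    "\<And>z. (g has_derivative g' z) (at z)" "\<And>h. continuous_on UNIV (\<lambda>z. g' z h)"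
    using assms unfolding C1_on_UNIV_iff by blast
  show ?thesis
    unfolding C1_on_UNIV_iff
    by (rule exI[of _ "\<lambda>z h. f z * g' z h + f' z h * g z"])
       (auto intro!: derivative_eq_intros d continuous_intros c)
qed

lemma C1_on_UNIV_compose:
  fixes f :: "'a::euclidean_space \<Rightarrow> real"
  assumes f: "C1_on UNIV f" and h: "\<And>z. (h has_real_derivative h' (f z)) (at (f z))" and h': "continuous_on (range f) h'"
  shows "C1_on UNIV (\<lambda>z. h (f z))"
proof -
  note c = f[THEN C1_on_UNIV_continuous]
  obtain f' where d: "\<And>z. (f has_derivative f' z) (at z)" "\<And>h. continuous_on UNIV (\<lambda>z. f' z h)"
    using assms unfolding C1_on_UNIV_iff by blast
  have "((\<lambda>z. h (f z)) has_derivative (\<lambda>v. h' (f z) * f' z v)) (at z)" for z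
    using has_derivative_compose[OF d(1) h[unfolded has_field_derivative_def]] by (simp add: o_def)
  moreover have "continuous_on UNIV (\<lambda>z. h' (f z))" by (rule continuous_on_compose2[OF h' c]) auto
  ultimately show ?thesis
    unfolding C1_on_UNIV_iff
    by (intro exI[of _ "\<lambda>z v. h' (f z) * f' z v"]) (auto intro!: continuous_intros d)
qed

lemma C1_on_UNIV_affine: "C1_on UNIV (\<lambda>z::'a::euclidean_space. c * (z \<bullet> v) + d)"
  unfolding C1_on_UNIV_iff
  by (rule exI[of _ "\<lambda>z h. c * (h \<bullet> v)"]) (auto intro!: derivative_eq_intros continuous_intros)

lemma C1_on_UNIV_prod:
  fixes f :: "'i \<Rightarrow> 'a::euclidean_space \<Rightarrow> real"
  assumes "finite I" "\<And>i. i \<in> I \<Longrightarrow> C1_on UNIV (f i)"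
  shows "C1_on UNIV (\<lambda>z. \<Prod>i\<in>I. f i z)"
  using assms
proof (induction I rule: finite_induct)
  case empty
  show ?case using C1_on_UNIV_affine[of 0 0 1] by simp
qed (simp add: C1_on_UNIV_mult)

definition box_bump :: "'a::euclidean_space \<Rightarrow> 'a \<Rightarrow> 'a \<Rightarrow> real" where
  "box_bump a b z = (\<Prod>i\<in>Basis. sqpos (z \<bullet> i - a \<bullet> i) * sqpos (b \<bullet> i - z \<bullet> i))"

lemma box_bump_pos: "0 \<le> box_bump a b z" "z \<in> box a b \<Longrightarrow> 0 < box_bump a b z" "z \<notin> box a b \<Longrightarrow> box_bump a b z = 0"
proof -
  show "0 \<le> box_bump a b z" unfolding box_bump_def by (intro prod_nonneg ballI mult_nonneg_nonneg sqpos_simps)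
  show "0 < box_bump a b z" if "z \<in> box a b"
    using that unfolding box_bump_def by (intro prod_pos ballI mult_pos_pos sqpos_simps) (auto simp: box_def)
  show "box_bump a b z = 0" if nb: "z \<notin> box a b"
  proof -
    obtain i where i: "i \<in> Basis" "z \<bullet> i \<le> a \<bullet> i \<or> b \<bullet> i \<le> z \<bullet> i" using nb by (auto simp: box_def not_less)
    then have "sqpos (z \<bullet> i - a \<bullet> i) * sqpos (b \<bullet> i - z \<bullet> i) = 0" by (auto simp: sqpos_simps)
    then show ?thesis unfolding box_bump_def using i(1) by (meson finite_Basis prod_zero)
  qed
qed

lemma box_bump_C1: "C1_on UNIV (box_bump a b)"
  unfolding box_bump_def[abs_def]
proof (intro C1_on_UNIV_prod C1_on_UNIV_mult)
  fix i :: 'a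
  show "C1_on UNIV (\<lambda>z. sqpos (z \<bullet> i - a \<bullet> i))"
    using C1_on_UNIV_compose[OF C1_on_UNIV_affine[of 1 i "- (a \<bullet> i)"], of sqpos "\<lambda>t. 2 * max 0 t"] sqpos_deriv
    by (simp add: continuous_intros)
  show "C1_on UNIV (\<lambda>z. sqpos (b \<bullet> i - z \<bullet> i))"
    using C1_on_UNIV_compose[OF C1_on_UNIV_affine[of "-1" i "b \<bullet> i"], of sqpos "\<lambda>t. 2 * max 0 t"] sqpos_deriv
    by (simp add: continuous_intros)
qed simp

text \<open>This is \<open>k H / (1 + k H)\<close> for the bump \<open>H\<close>; it tends to the indicator of the box.\<close>

definition box_approx :: "'a::euclidean_space \<Rightarrow> 'a \<Rightarrow> nat \<Rightarrow> 'a \<Rightarrow> real" where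
  "box_approx a b k z = 1 - inverse (1 + real k * box_bump a b z)"

lemma box_approx_C1: "C1_on UNIV (box_approx a b k)"
proof -
  have p: "1 + real k * box_bump a b z > 0" for z by (simp add: add_pos_nonneg box_bump_pos)
  show ?thesis unfolding box_approx_def[abs_def]
  proof (rule C1_on_UNIV_compose[OF box_bump_C1])
    fix z
    show "((\<lambda>t. 1 - inverse (1 + real k * t)) has_real_derivative real k * inverse ((1 + real k * box_bump a b z)\<^sup>2)) (at (box_bump a b z))"
      using p[of z] by (auto intro!: derivative_eq_intros simp: power2_eq_square)
    show "continuous_on (range (box_bump a b)) (\<lambda>t. real k * inverse ((1 + real k * t)\<^sup>2))"
      using p by (intro continuous_intros) (auto simp: less_imp_neq[THEN not_sym])
  qed
qed

lemma box_approx_bounds: "0 \<le> box_approx a b k z" "box_approx a b k z \<le> 1" "z \<notin> box a b \<Longrightarrow> box_approx a b k z = 0"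
proof -
  have "1 + real k * box_bump a b z \<ge> 1" by (simp add: box_bump_pos)
  then have "inverse (1 + real k * box_bump a b z) \<le> 1" "inverse (1 + real k * box_bump a b z) \<ge> 0"
    by (auto simp: inverse_le_1_iff)
  then show "0 \<le> box_approx a b k z" "box_approx a b k z \<le> 1" by (auto simp: box_approx_def)
qed (simp add: box_approx_def box_bump_pos)

lemma box_approx_lim: "(\<lambda>k. box_approx a b k z) \<longlonglongrightarrow> indicator (box a b) z"
proof (cases "z \<in> box a b")
  case True
  have "filterlim (\<lambda>k. 1 + real k * box_bump a b z) at_top sequentially"
    by (intro filterlim_tendsto_add_at_top[OF tendsto_const] filterlim_at_top_mult_tendsto_pos[OF tendsto_const box_bump_pos(2)[OF True]]
        filterlim_real_sequentially)
  then have "(\<lambda>k. inverse (1 + real k * box_bump a b z)) \<longlonglongrightarrow> 0" by (rule tendsto_inverse_0_at_top)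
  then have "(\<lambda>k. box_approx a b k z) \<longlonglongrightarrow> 1 - 0" unfolding box_approx_def by (intro tendsto_intros)
  then show ?thesis using True by simp
qed (simp add: box_approx_bounds)

text \<open>The coercion to \<open>ennreal\<close> truncates at 0, so \<open>?M\<close> and
  \<open>?N\<close> have the positive and the negative part of \<open>P\<close> as densities. They
  agree on boxes, an intersection-stable generator, hence everywhere; a real number whose positive
  and negative parts agree is 0.\<close>

lemma AE_zero_if_box_integrals_zero:
  fixes P :: "'a::euclidean_space \<Rightarrow> real"
  assumes P: "integrable lborel P" and zero: "\<And>c d. (\<integral>z. indicator (box c d) z * P z \<partial>lborel) = 0"
  shows "AE z in lborel. P z = 0"
proof -
  have [measurable]: "P \<in> borel_measurable borel" using P by auto
  let ?M = "density lborel (\<lambda>z. ennreal (P z))" and ?N = "density lborel (\<lambda>z. ennreal (- P z))"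
  have gen: "x = y" if "x \<noteq> \<infinity>" "y \<noteq> \<infinity>" "enn2real x = enn2real y" for x y :: ennreal
    using that by (cases x; cases y) auto
  have eq: "emeasure ?M (box c d) = emeasure ?N (box c d) \<and> emeasure ?M (box c d) \<noteq> \<infinity>" for c d
  proof -
    have i: "integrable lborel (\<lambda>z. indicator (box c d) z * P z)"
      using integrable_mult_indicator[OF _ P, of "box c d"] by simp
    have e: "ennreal (indicator (box c d) z * P z) = ennreal (P z) * indicator (box c d) z"
      "ennreal (- (indicator (box c d) z * P z)) = ennreal (- P z) * indicator (box c d) z" for z
      by (auto simp: indicator_def)
    have fin: "(\<integral>\<^sup>+z. ennreal (indicator (box c d) z * P z) \<partial>lborel) \<noteq> \<infinity>"
      "(\<integral>\<^sup>+z. ennreal (- (indicator (box c d) z * P z)) \<partial>lborel) \<noteq> \<infinity>"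
      using i unfolding real_integrable_def by auto
    have "enn2real (\<integral>\<^sup>+z. ennreal (indicator (box c d) z * P z) \<partial>lborel) =
      enn2real (\<integral>\<^sup>+z. ennreal (- (indicator (box c d) z * P z)) \<partial>lborel)"
      using zero[of c d] unfolding real_lebesgue_integral_def[OF i] by simp
    then have "(\<integral>\<^sup>+z. ennreal (indicator (box c d) z * P z) \<partial>lborel) =
      (\<integral>\<^sup>+z. ennreal (- (indicator (box c d) z * P z)) \<partial>lborel)"
      by (rule gen[OF fin])
    moreover have "emeasure ?M (box c d) = (\<integral>\<^sup>+z. ennreal (P z) * indicator (box c d) z \<partial>lborel)"
      "emeasure ?N (box c d) = (\<integral>\<^sup>+z. ennreal (- P z) * indicator (box c d) z \<partial>lborel)"
      by (rule emeasure_density; simp)+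
    ultimately show ?thesis using fin(1) unfolding e by metis
  qed
  have "?M = ?N"
  proof (rule measure_eqI_generator_eq[where E="range (\<lambda>(a, b). box a b)" and \<Omega>=UNIV
        and A="\<lambda>n::nat. box (- (real n *\<^sub>R One)) (real n *\<^sub>R One)"])
    show "Int_stable (range (\<lambda>(a, b). box a b :: 'a set))"
      by (auto simp: Int_stable_def box_Int_box)
    show "sets ?M = sigma_sets UNIV (range (\<lambda>(a, b). box a b))" by (simp add: borel_eq_box)
    show "sets ?N = sigma_sets UNIV (range (\<lambda>(a, b). box a b))" by (simp add: borel_eq_box)
    show "(\<Union>i::nat. box (- (real i *\<^sub>R One)) (real i *\<^sub>R One :: 'a)) = UNIV" by (rule UN_box_eq_UNIV)
  qed (use eq eq[THEN conjunct1, symmetric] in \<open>auto simp del: infinity_ennreal_def\<close>)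
  then have "AE z in lborel. ennreal (P z) = ennreal (- P z)"
    by (subst (asm) sigma_finite_measure.density_unique_iff[OF lborel.sigma_finite_measure_axioms]) auto
  then show ?thesis
  proof eventually_elim
    case (elim z)
    then show ?case by (cases "0 \<le> P z") (auto simp: ennreal_neg ennreal_eq_0_iff)
  qed
qed

text \<open>Integrability is local because extensions homogeneous in \<xi> are in general not
  integrable over the unbounded \<open>test_dom\<close>. \<open>C^1\<close> functions converging to
  the indicator of a box turn the hypothesis into vanishing box integrals, and countably many boxes
  cover \<open>U\<close>.\<close>

lemma fundamental_lemma:
  fixes P :: "'a::euclidean_space \<Rightarrow> real"
  assumes U: "open U" and loc: "\<And>a b. cbox a b \<subseteq> U \<Longrightarrow> integrable lborel (\<lambda>z. indicator (cbox a b) z * P z)"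
    and zero: "\<And>\<psi>. C1_on UNIV \<psi> \<Longrightarrow> compact (closure {z. \<psi> z \<noteq> 0}) \<Longrightarrow> closure {z. \<psi> z \<noteq> 0} \<subseteq> U \<Longrightarrow>
       (LINT z:U|lborel. P z * \<psi> z) = 0"
  shows "AE z in lborel. z \<in> U \<longrightarrow> P z = 0"
proof -
  have box0: "(\<integral>z. indicator (box a b) z * P z \<partial>lborel) = 0" if sub: "cbox a b \<subseteq> U" for a b
  proof -
    let ?f = "\<lambda>k z. indicator (cbox a b) z * P z * box_approx a b k z"
    have "(\<lambda>k. \<integral>z. ?f k z \<partial>lborel) \<longlonglongrightarrow> (\<integral>z. indicator (box a b) z * P z \<partial>lborel)"
    proof (rule integral_dominated_convergence[where w="\<lambda>z. \<bar>indicator (cbox a b) z * P z\<bar>"])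
      have [measurable]: "box_approx a b k \<in> borel_measurable borel" for k
        using C1_on_UNIV_continuous[OF box_approx_C1] by (intro borel_measurable_continuous_onI)
      have m: "(\<lambda>z. indicator (cbox a b) z * P z) \<in> borel_measurable lborel" using loc[OF sub] by auto
      have "(\<lambda>z. indicator (box a b) z * P z) = (\<lambda>z. indicator (box a b) z * (indicator (cbox a b) z * P z))"
        using box_subset_cbox[of a b] by (auto simp: indicator_def fun_eq_iff)
      then show "(\<lambda>z. indicator (box a b) z * P z) \<in> borel_measurable lborel" using m by simp
      show "?f k \<in> borel_measurable lborel" for k using m by measurable
      show "integrable lborel (\<lambda>z. \<bar>indicator (cbox a b) z * P z\<bar>)" using loc[OF sub] by (rule integrable_abs)
      have "(\<lambda>k. ?f k z) \<longlonglongrightarrow> indicator (cbox a b) z * P z * indicator (box a b) z" for z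
        by (intro tendsto_intros box_approx_lim)
      moreover have "indicator (cbox a b) z * P z * indicator (box a b) z = indicator (box a b) z * P z" for z
        using box_subset_cbox[of a b] by (auto simp: indicator_def)
      ultimately show "AE z in lborel. (\<lambda>k. ?f k z) \<longlonglongrightarrow> indicator (box a b) z * P z" by simp
      show "AE z in lborel. norm (?f k z) \<le> \<bar>indicator (cbox a b) z * P z\<bar>" for k
        using box_approx_bounds(1,2)[of a b k] by (auto simp: abs_mult mult_left_le intro!: AE_I2)
    qed
    moreover have "(\<integral>z. ?f k z \<partial>lborel) = 0" for k
    proof -
      have cl: "closure {z. box_approx a b k z \<noteq> 0} \<subseteq> cbox a b"
        using box_approx_bounds(3)[of _ a b k] box_subset_cbox[of a b] by (intro closure_minimal) auto
      have "(LINT z:U|lborel. P z * box_approx a b k z) = 0"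
        by (rule zero[OF box_approx_C1]) (use cl sub compact_closure bounded_subset[OF bounded_cbox] closure_subset in blast)+
      moreover have "indicator U z *\<^sub>R (P z * box_approx a b k z) = ?f k z" for z
        using sub box_subset_cbox[of a b] box_approx_bounds(3)[of z a b k] by (auto simp: indicator_def)
      ultimately show ?thesis unfolding set_lebesgue_integral_def by (simp only:)
    qed
    ultimately have "(\<lambda>k::nat. 0::real) \<longlonglongrightarrow> (\<integral>z. indicator (box a b) z * P z \<partial>lborel)" by (simp only:)
    then show ?thesis by (simp add: LIMSEQ_const_iff)
  qed
  have ae_box: "AE z in lborel. z \<in> box a b \<longrightarrow> P z = 0" if sub: "cbox a b \<subseteq> U" for a b
  proof -
    have "AE z in lborel. indicator (box a b) z * P z = 0"
    proof (rule AE_zero_if_box_integrals_zero)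
      have "integrable lborel (\<lambda>z. indicator (box a b) z *\<^sub>R (indicator (cbox a b) z * P z))"
        by (rule integrable_mult_indicator[OF _ loc[OF sub]]) simp
      moreover have "(\<lambda>z. indicator (box a b) z *\<^sub>R (indicator (cbox a b) z * P z)) = (\<lambda>z. indicator (box a b) z * P z)"
        using box_subset_cbox[of a b] by (auto simp: indicator_def fun_eq_iff)
      ultimately show "integrable lborel (\<lambda>z. indicator (box a b) z * P z)" by simp
      fix c d :: 'a
      \<comment> \<open>The box \<open>box c d\<close> is arbitrary, but cut down to
        \<open>box a b\<close> it becomes a box whose closed counterpart lies in \<open>U\<close>,
        so \<open>box0\<close> applies.\<close>
      obtain e f where ef: "box c d \<inter> box a b = box e f" "cbox c d \<inter> cbox a b = cbox e f"
        by (simp add: box_Int_box Int_interval)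
      have "(\<integral>z. indicator (box e f) z * P z \<partial>lborel) = 0"
        by (rule box0) (use ef sub in auto)
      moreover have "indicator (box c d) z * (indicator (box a b) z * P z) = indicator (box e f) z * P z" for z
        unfolding ef(1)[symmetric] by (auto simp: indicator_def)
      ultimately show "(\<integral>z. indicator (box c d) z * (indicator (box a b) z * P z) \<partial>lborel) = 0" by (simp only:)
    qed
    then show ?thesis by eventually_elim (auto simp: indicator_def)
  qed
  obtain B where B: "countable B" "B \<subseteq> {box a b | a b. cbox a b \<subseteq> U}" "U \<subseteq> \<Union>B"
  proof -
    define F where "F = {box a b | a b. cbox a b \<subseteq> U}"
    have "U \<subseteq> \<Union>F"
    proof
      fix x assume "x \<in> U"
      then obtain e where e: "e > 0" "ball x e \<subseteq> U" using U openE by blast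
      \<comment> \<open>The radius is halved so that the closed box still fits into
        \<open>U\<close>.\<close>
      then obtain a b where "x \<in> box a b" "box a b \<subseteq> ball x (e/2)"
        using rational_boxes[of "e/2" x] by (metis half_gt_zero)
      moreover have "cbox a b \<subseteq> U"
      proof -
        have "cbox a b = closure (box a b)" using \<open>x \<in> box a b\<close> by (subst closure_box) auto
        also have "\<dots> \<subseteq> cball x (e/2)" using \<open>box a b \<subseteq> _\<close> by (intro closure_minimal) auto
        also have "\<dots> \<subseteq> U" using e by (auto simp: subset_iff)
        finally show ?thesis .
      qed
      ultimately show "x \<in> \<Union>F" by (auto simp: F_def)
    qed
    moreover obtain F' where "F' \<subseteq> F" "countable F'" "\<Union>F' = \<Union>F"
      by (rule Lindelof[of F]) (auto simp: F_def)
    ultimately show ?thesis using that[of F'] by (auto simp: F_def)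
  qed
  have "AE z in lborel. \<forall>X\<in>B. z \<in> X \<longrightarrow> P z = 0"
    using B(2) ae_box by (subst AE_ball_countable[OF B(1)]) blast
  then show ?thesis by eventually_elim (use B(3) in blast)
qed

text \<open>Covers boundary points of the ball, where derivatives are one-sided. Along a segment
  from \<open>z\<close> into \<open>C\<close> the one-sided derivative is unique, and the directions
  into a convex set with nonempty interior span the space.\<close>

lemma has_derivative_within_convex_unique:
  fixes f :: "'a::euclidean_space \<Rightarrow> real"
  assumes C: "convex C" "C \<subseteq> S" "interior C \<noteq> {}" "z \<in> C"
    and D: "(f has_derivative D1) (at z within S)" "(f has_derivative D2) (at z within S)"
  shows "D1 = D2"
proof -
  define L where "L h = D1 h - D2 h" for h
  have lin: "linear L"
    unfolding L_def[abs_def] using D by (intro linear_compose_sub) (auto dest: has_derivative_linear)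
  have d0: "((\<lambda>_. 0) has_derivative L) (at z within S)"
    using has_derivative_diff[OF D] by (simp add: L_def[abs_def])
  have L0: "L (c - z) = 0" if c: "c \<in> C" for c
  proof -
    define \<gamma> where "\<gamma> t = z + t *\<^sub>R (c - z)" for t :: real
    have g: "\<gamma> ` {0..1} \<subseteq> S"
    proof (clarsimp simp: \<gamma>_def)
      fix t :: real assume t: "0 \<le> t" "t \<le> 1"
      have "z + t *\<^sub>R (c - z) = (1 - t) *\<^sub>R z + t *\<^sub>R c" by (simp add: algebra_simps)
      then show "z + t *\<^sub>R (c - z) \<in> S" using convexD_alt[OF C(1) C(4) c t] C(2) by auto
    qed
    have "(\<gamma> has_derivative (\<lambda>t. t *\<^sub>R (c - z))) (at 0 within {0..1})"
      unfolding \<gamma>_def by (auto intro!: derivative_eq_intros)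
    moreover have "((\<lambda>_. 0::real) has_derivative L) (at (\<gamma> 0) within \<gamma> ` {0..1})"
      using has_derivative_subset[OF d0 g] by (simp add: \<gamma>_def)
    ultimately have "((\<lambda>_. 0::real) \<circ> \<gamma> has_derivative L \<circ> (\<lambda>t. t *\<^sub>R (c - z))) (at 0 within {0..1})"
      by (rule diff_chain_within)
    then have "((\<lambda>_. 0::real) has_vector_derivative L (c - z)) (at 0 within {0..1})"
      unfolding has_vector_derivative_def by (simp add: o_def linear_scale[OF lin])
    moreover have "((\<lambda>_. 0::real) has_vector_derivative 0) (at 0 within {0..1})" by simp
    ultimately show ?thesis
      using vector_derivative_unique_within_closed_interval[of 0 1 0 "\<lambda>_. 0" "L (c - z)" 0] by simp
  qed
  obtain c0 e where c0: "e > 0" "ball c0 e \<subseteq> C" using C(3) by (meson all_not_in_conv mem_interior)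
  have "L h = 0" for h
  proof (cases "h = 0")
    case False
    define s where "s = e / (2 * norm h)"
    have s: "s > 0" using False c0 by (simp add: s_def)
    have "c0 + s *\<^sub>R h \<in> ball c0 e" using False c0 by (simp add: s_def dist_norm)
    moreover have "c0 \<in> ball c0 e" using c0(1) by simp
    ultimately have "L (c0 + s *\<^sub>R h - z) = 0" "L (c0 - z) = 0" using L0 c0(2) by (meson subsetD)+
    moreover have "c0 + s *\<^sub>R h - z = (c0 - z) + s *\<^sub>R h" by simp
    ultimately have "s *\<^sub>R L h = 0" using linear_add[OF lin] linear_scale[OF lin] by (metis add_0)
    then show ?thesis using s by simp
  qed (simp add: linear_0[OF lin])
  then show ?thesis by (auto simp: L_def fun_eq_iff)
qed


lemma has_real_derivative_line:
  fixes f :: "'a::real_normed_vector \<Rightarrow> real"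
  assumes "(f has_derivative D) (at x)"
  shows "((\<lambda>t. f (x + t *\<^sub>R b)) has_real_derivative D b) (at 0)"
proof -
  have d: "(f has_derivative D) (at (x + 0 *\<^sub>R b))" using assms by simp
  have "((\<lambda>t::real. x + t *\<^sub>R b) has_derivative (\<lambda>t. t *\<^sub>R b)) (at 0)" by (auto intro!: derivative_eq_intros)
  from diff_chain_at[OF this d] have "((\<lambda>t. f (x + t *\<^sub>R b)) has_derivative (\<lambda>t. D (t *\<^sub>R b))) (at 0)"
    by (simp add: o_def)
  moreover have "(\<lambda>t. D (t *\<^sub>R b)) = (*) (D b)"
    using linear_scale[OF has_derivative_linear[OF d]] by (auto simp: fun_eq_iff)
  ultimately show ?thesis by (simp add: has_field_derivative_def)
qed

text \<open>Here \<open>G\<close> is meaningful only on \<open>U\<close>. Since it vanishes there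
  off a compact subset, its extension by 0 remains differentiable along lines, also at points
  outside \<open>U\<close>, and the version on the whole space applies.\<close>

lemma integral_directional_derivative_open:
  fixes G G' :: "'a::euclidean_space \<Rightarrow> real"
  assumes U: "open U" and K: "compact K" "K \<subseteq> U" and G0: "\<And>z. z \<in> U \<Longrightarrow> z \<notin> K \<Longrightarrow> G z = 0"
    and cG: "continuous_on U G" and cG': "continuous_on U G'"
    and der: "\<And>z. z \<in> U \<Longrightarrow> ((\<lambda>t. G (z + t *\<^sub>R b)) has_real_derivative G' z) (at 0)"
  shows "set_integrable lborel U G'" "(LINT z:U|lborel. G' z) = 0"
proof -
  have Kc: "open (- K)" using K compact_imp_closed by auto
  have line_open: "open {t::real. z + t *\<^sub>R b \<in> A}" if "open A" for A z
    using open_vimage[OF that, of "\<lambda>t. z + t *\<^sub>R b"] by (simp add: vimage_def continuous_intros)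
  have G'0: "G' z = 0" if z: "z \<in> U" "z \<notin> K" for z
  proof -
    have "((\<lambda>t. G (z + t *\<^sub>R b)) has_real_derivative 0) (at 0)"
    proof (rule has_field_derivative_transform_within_open[of "\<lambda>_. 0" _ _ "{t. z + t *\<^sub>R b \<in> U - K}"])
      show "open {t. z + t *\<^sub>R b \<in> U - K}" using U Kc by (intro line_open) (simp add: open_Diff K compact_imp_closed)
    qed (use z G0 in auto)
    then show ?thesis using der[OF z(1)] DERIV_unique by blast
  qed
  define g where "g z = (if z \<in> U then G z else 0)" for z
  define g' where "g' z = (if z \<in> U then G' z else 0)" for z
  have g0: "g z = 0" "g' z = 0" if "z \<notin> K" for z using that G0 G'0 by (auto simp: g_def g'_def)
  have "bounded (G ` K)" "bounded (G' ` K)" "bounded K"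
    using compact_continuous_image[OF continuous_on_subset[OF cG K(2)] K(1)]
      compact_continuous_image[OF continuous_on_subset[OF cG' K(2)] K(1)] K(1) compact_imp_bounded by auto
  then obtain M1 M2 R where "\<forall>y\<in>G ` K. norm y \<le> M1" "\<forall>y\<in>G' ` K. norm y \<le> M2" and R: "\<forall>y\<in>K. norm y \<le> R"
    unfolding bounded_iff by blast
  then have MK: "\<bar>G z\<bar> \<le> M1" "\<bar>G' z\<bar> \<le> M2" if "z \<in> K" for z
    using that by (simp_all only: ball_simps real_norm_def)
  have M: "\<bar>g z\<bar> \<le> max 0 (max M1 M2)" "\<bar>g' z\<bar> \<le> max 0 (max M1 M2)" for z
  proof -
    have "\<bar>g z\<bar> \<le> max 0 (max M1 M2) \<and> \<bar>g' z\<bar> \<le> max 0 (max M1 M2)"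
    proof (cases "z \<in> K")
      case True
      then have "z \<in> U" using K(2) by auto
      then show ?thesis using MK[OF True] by (auto simp: g_def g'_def)
    qed (simp add: g0)
    then show "\<bar>g z\<bar> \<le> max 0 (max M1 M2)" "\<bar>g' z\<bar> \<le> max 0 (max M1 M2)" by auto
  qed
  have gm: "g \<in> borel_measurable borel"
    unfolding g_def[abs_def] by (intro borel_measurable_continuous_on_if cG continuous_intros borel_open U)
  have gd: "((\<lambda>t. g (z + t *\<^sub>R b)) has_real_derivative g' z) (at 0)" for z
  proof (cases "z \<in> U")
    case True
    show ?thesis
      by (rule has_field_derivative_transform_within_open[of "\<lambda>t. G (z + t *\<^sub>R b)" _ _ "{t. z + t *\<^sub>R b \<in> U}"])
         (use True der[OF True] line_open[OF U] in \<open>auto simp: g_def g'_def\<close>)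
  next
    case False
    then have "z \<notin> K" using K by auto
    then have g'z: "g' z = 0" by (rule g0(2))
    show ?thesis unfolding g'z
    proof (rule has_field_derivative_transform_within_open[of "\<lambda>t. 0"])
      show "open {t. z + t *\<^sub>R b \<in> - K}" by (rule line_open[OF Kc])
      show "0 \<in> {t. z + t *\<^sub>R b \<in> - K}" using \<open>z \<notin> K\<close> by simp
      show "0 = g (z + t *\<^sub>R b)" if "t \<in> {t. z + t *\<^sub>R b \<in> - K}" for t using that g0(1) by simp
    qed simp
  qed
  have "z \<notin> K" if "z \<notin> cball 0 R" for z using R that by auto
  then have gR: "g z = 0" if "z \<notin> cball 0 R" for z using g0(1) that by blast
  note integral_directional_derivative[OF gd gR M gm]
  moreover have "g' = (\<lambda>z. indicator U z *\<^sub>R G' z)" by (auto simp: g'_def indicator_def fun_eq_iff)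
  ultimately show "set_integrable lborel U G'" "(LINT z:U|lborel. G' z) = 0"
    by (simp_all add: set_integrable_def set_lebesgue_integral_def)
qed

section \<open>The measure on the sphere bundle\<close>

lemma MM_facts: "compact MM" "closed MM" "MM \<in> sets borel" "interior MM = ball 0 1" "frontier MM = sphere 0 1"
  "x \<in> MM \<longleftrightarrow> norm x \<le> 1"
  by (auto simp: MM_def)

text \<open>Bridges the closed ball that carries \<open>Sigma_measure\<close> and its interior, over
  which \<open>test_dom\<close> lies.\<close>

lemma AE_interior_MM: "AE x in lborel. x \<in> interior MM \<longleftrightarrow> x \<in> MM"
proof -
  have "negligible (frontier (cball (0::vec3) 1))" by (rule negligible_convex_frontier) simp
  then have "sphere 0 (1::real) \<in> null_sets (lborel :: vec3 measure)"
    by (simp add: negligible_iff_null_sets null_sets_completion_iff)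
  then have "AE x in lborel. x \<notin> sphere (0::vec3) 1" by (rule AE_not_in)
  then show ?thesis by eventually_elim (auto simp: MM_facts)
qed

locale refractive_index =
  fixes n :: "vec3 \<Rightarrow> real" and c0 :: real
  assumes c0: "0 < c0" and n_ge: "x \<in> MM \<Longrightarrow> c0 \<le> n x" and n_C1: "C1_on MM n"
begin

sublocale S2: finite_measure sphere_measure by (rule finite_sphere_measure)

lemma n_cont: "continuous_on MM n"
  using n_C1 unfolding C1_on_def
  by (meson continuous_on_eq_continuous_within differentiable_imp_continuous_within)

lemma n_pos: "x \<in> MM \<Longrightarrow> 0 < n x"
  using n_ge c0 by fastforce

lemma n_upper: "\<exists>C>0. \<forall>x\<in>MM. n x \<le> C"
proof -
  have "compact (n ` MM)" by (rule compact_continuous_image[OF n_cont MM_facts(1)])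
  then obtain C where "\<forall>y\<in>n ` MM. \<bar>y\<bar> \<le> C" using compact_imp_bounded bounded_real by blast
  then show ?thesis by (intro exI[of _ "max 1 C"]) fastforce
qed

lemma gnorm_eq: "x \<in> MM \<Longrightarrow> gnorm n x v = n x * norm v"
  using n_pos[of x] by (simp add: gnorm_def ginner_def real_sqrt_mult norm_eq_sqrt_inner)

lemma Omega_iff: "(x, \<xi>) \<in> Omega n \<longleftrightarrow> x \<in> MM \<and> n x * norm \<xi> = 1"
  by (auto simp: Omega_def gnorm_eq)

lemma to_Omega_eq: "x \<in> MM \<Longrightarrow> to_Omega n (x, \<xi>) = (x, \<xi> /\<^sub>R (n x * norm \<xi>))"
  by (simp add: to_Omega_def gnorm_eq)

lemma to_Omega_in: "x \<in> MM \<Longrightarrow> \<xi> \<noteq> 0 \<Longrightarrow> to_Omega n (x, \<xi>) \<in> Omega n"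
  using n_pos[of x] by (simp add: to_Omega_eq Omega_iff field_simps)

lemma Omega_eq_image: "Omega n = (\<lambda>(x, \<omega>). (x, \<omega> /\<^sub>R n x)) ` (MM \<times> sphere 0 1)"
proof (intro equalityI subsetI)
  fix z :: phase assume z: "z \<in> Omega n"
  obtain x \<xi> where [simp]: "z = (x, \<xi>)" by (cases z)
  have x: "x \<in> MM" "n x * norm \<xi> = 1" using z by (auto simp: Omega_iff)
  then have "n x *\<^sub>R \<xi> \<in> sphere 0 1" "(n x *\<^sub>R \<xi>) /\<^sub>R n x = \<xi>" using n_pos[of x] by auto
  then show "z \<in> (\<lambda>(x, \<omega>). (x, \<omega> /\<^sub>R n x)) ` (MM \<times> sphere 0 1)"
    using x by (auto intro!: image_eqI[of _ _ "(x, n x *\<^sub>R \<xi>)"])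
next
  fix z :: phase assume "z \<in> (\<lambda>(x, \<omega>). (x, \<omega> /\<^sub>R n x)) ` (MM \<times> sphere 0 1)"
  then show "z \<in> Omega n" using n_pos n_pos[THEN abs_of_pos] by (auto simp: Omega_iff less_imp_neq[THEN not_sym])
qed

lemma Omega_param_continuous: "continuous_on (MM \<times> T) (\<lambda>(x, \<omega> :: vec3). (x, \<omega> /\<^sub>R n x))"
proof -
  have "continuous_on (MM \<times> T) (\<lambda>z. n (fst z))"
    by (rule continuous_on_compose2[OF n_cont]) (auto intro!: continuous_intros)
  then have "continuous_on (MM \<times> T) (\<lambda>z. inverse (n (fst z)))"
    by (rule continuous_on_inverse) (use n_pos in \<open>auto simp: less_imp_neq[THEN not_sym]\<close>)
  then have "continuous_on (MM \<times> T) (\<lambda>z. snd z /\<^sub>R n (fst z))"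
    by (rule continuous_on_scaleR) (intro continuous_intros)
  then show ?thesis unfolding case_prod_beta'
    by (intro continuous_on_Pair continuous_on_fst continuous_on_id)
qed

lemma Omega_compact: "compact (Omega n)"
  unfolding Omega_eq_image
  by (intro compact_continuous_image Omega_param_continuous compact_Times) (auto simp: MM_facts)

lemma Omega_borel [measurable]: "Omega n \<in> sets borel"
  using Omega_compact by (intro borel_closed compact_imp_closed)

text \<open>Nothing is known about \<open>n\<close> outside the ball; in particular it need not be measurable.\<close>

definition N :: "vec3 \<Rightarrow> real" where "N x = (if x \<in> MM then n x else 1)"

lemma N_borel [measurable]: "N \<in> borel_measurable borel"
  unfolding N_def[abs_def]
  by (intro borel_measurable_continuous_on_if n_cont continuous_intros) (simp add: MM_facts)

lemma N_simps: "x \<in> MM \<Longrightarrow> N x = n x" "0 < N x"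
  using n_pos by (auto simp: N_def)

lemma sets_Sigma [simp]: "sets (Sigma_measure n) = sets (restrict_space borel (Omega n))"
  by (simp add: Sigma_measure_def)

lemma space_Sigma [simp]: "space (Sigma_measure n) = Omega n"
  by (simp add: Sigma_measure_def space_restrict_space)

lemma borel_measurable_Sigma_iff:
  "f \<in> borel_measurable (Sigma_measure n) \<longleftrightarrow> f \<in> borel_measurable (restrict_space borel (Omega n))"
  unfolding measurable_cong_sets[OF sets_Sigma refl] ..

lemma phase_fst_borel [measurable]: "(fst :: phase \<Rightarrow> _) \<in> borel_measurable borel" "(snd :: phase \<Rightarrow> _) \<in> borel_measurable borel"
  by (intro borel_measurable_continuous_onI continuous_intros)+

lemma Omega_param_measurable_compose:
  fixes f g :: "'m \<Rightarrow> vec3"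
  assumes [measurable]: "f \<in> borel_measurable M" "g \<in> borel_measurable M"
  shows "(\<lambda>z. (f z, g z /\<^sub>R N (f z))) \<in> borel_measurable M"
  by (rule borel_measurable_Pair) measurable

lemma Omega_param_measurable:
  "(\<lambda>(x, \<omega>). (x, \<omega> /\<^sub>R n x)) \<in> measurable (density (restrict_space lborel MM \<Otimes>\<^sub>M sphere_measure) d) (restrict_space borel (Omega n))"
proof (rule measurable_restrict_space2)
  show "(\<lambda>(x, \<omega>). (x, \<omega> /\<^sub>R n x)) \<in> space (density (restrict_space lborel MM \<Otimes>\<^sub>M sphere_measure) d) \<rightarrow> Omega n"
    by (auto simp: space_pair_measure space_restrict_space Omega_eq_image)
  have f: "fst \<in> restrict_space lborel MM \<Otimes>\<^sub>M sphere_measure \<rightarrow>\<^sub>M (borel :: vec3 measure)"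
    by (rule measurable_compose[OF measurable_fst]) (auto intro: measurable_restrict_space1)
  have s: "snd \<in> restrict_space (lborel :: vec3 measure) MM \<Otimes>\<^sub>M sphere_measure \<rightarrow>\<^sub>M (borel :: vec3 measure)"
    by (rule measurable_compose[OF measurable_snd])
       (auto simp: measurable_cong_sets[OF sets_sphere_measure refl] intro: measurable_restrict_space1)
  have "(\<lambda>z. (fst z, snd z /\<^sub>R N (fst z))) \<in> borel_measurable (restrict_space lborel MM \<Otimes>\<^sub>M sphere_measure)"
    by (rule Omega_param_measurable_compose[OF f s])
  then have "(\<lambda>(x, \<omega>). (x, \<omega> /\<^sub>R n x)) \<in> borel_measurable (restrict_space lborel MM \<Otimes>\<^sub>M sphere_measure)"
    by (subst measurable_cong[where g="\<lambda>z. (fst z, snd z /\<^sub>R N (fst z))"])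
       (auto simp: space_pair_measure space_restrict_space N_simps)
  then show "(\<lambda>(x, \<omega>). (x, \<omega> /\<^sub>R n x)) \<in> borel_measurable (density (restrict_space lborel MM \<Otimes>\<^sub>M sphere_measure) d)"
    by simp
qed

lemma nn_integral_Sigma_borel:
  assumes G [measurable]: "G \<in> borel_measurable borel"
  shows "(\<integral>\<^sup>+z. G z \<partial>Sigma_measure n) =
    (\<integral>\<^sup>+x. indicator MM x * ennreal (N x ^ 3) * (\<integral>\<^sup>+\<omega>. G (x, \<omega> /\<^sub>R N x) \<partial>sphere_measure) \<partial>lborel)"
proof -
  let ?M = "restrict_space lborel MM \<Otimes>\<^sub>M sphere_measure"
  have f [measurable]: "fst \<in> ?M \<rightarrow>\<^sub>M (borel :: vec3 measure)"
    by (rule measurable_compose[OF measurable_fst]) (auto intro: measurable_restrict_space1)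
  have s [measurable]: "snd \<in> ?M \<rightarrow>\<^sub>M (borel :: vec3 measure)"
    by (rule measurable_compose[OF measurable_snd])
       (auto simp: measurable_cong_sets[OF sets_sphere_measure refl] intro: measurable_restrict_space1)
  have p [measurable]: "(\<lambda>z. (fst z, snd z /\<^sub>R N (fst z))) \<in> borel_measurable ?M"
    by (rule Omega_param_measurable_compose[OF f s])
  have d: "(\<lambda>(x, \<omega>). ennreal (n x ^ 3)) \<in> borel_measurable ?M"
    by (subst measurable_cong[where g="\<lambda>z. ennreal (N (fst z) ^ 3)"])
       (auto simp: space_pair_measure space_restrict_space N_simps)
  have g: "(\<lambda>z. G (fst z, snd z /\<^sub>R N (fst z))) \<in> borel_measurable ?M" by measurable
  have "(\<integral>\<^sup>+z. G z \<partial>Sigma_measure n) = (\<integral>\<^sup>+z. G (case z of (x, \<omega>) \<Rightarrow> (x, \<omega> /\<^sub>R n x)) \<partial>density ?M (\<lambda>(x, \<omega>). ennreal (n x ^ 3)))"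
    unfolding Sigma_measure_def
    by (rule nn_integral_distr[OF Omega_param_measurable]) (auto intro: measurable_restrict_space1)
  also have "\<dots> = (\<integral>\<^sup>+z. G (fst z, snd z /\<^sub>R N (fst z)) \<partial>density ?M (\<lambda>(x, \<omega>). ennreal (n x ^ 3)))"
    by (rule nn_integral_cong) (auto simp: space_pair_measure space_restrict_space N_simps)
  also have "\<dots> = (\<integral>\<^sup>+z. (case z of (x, \<omega>) \<Rightarrow> ennreal (n x ^ 3)) * G (fst z, snd z /\<^sub>R N (fst z)) \<partial>?M)"
    by (rule nn_integral_density[OF d g])
  also have "\<dots> = (\<integral>\<^sup>+z. ennreal (N (fst z) ^ 3) * G (fst z, snd z /\<^sub>R N (fst z)) \<partial>?M)"
    by (rule nn_integral_cong) (auto simp: space_pair_measure space_restrict_space N_simps)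
  also have "\<dots> = (\<integral>\<^sup>+x. \<integral>\<^sup>+\<omega>. ennreal (N x ^ 3) * G (x, \<omega> /\<^sub>R N x) \<partial>sphere_measure \<partial>restrict_space lborel MM)"
  proof -
    have "(\<lambda>z. ennreal (N (fst z) ^ 3) * G (fst z, snd z /\<^sub>R N (fst z))) \<in> borel_measurable ?M"
      using g f by (intro borel_measurable_times_ennreal) measurable
    from S2.nn_integral_fst[OF this] show ?thesis by simp
  qed
  also have "\<dots> = (\<integral>\<^sup>+x. (\<integral>\<^sup>+\<omega>. ennreal (N x ^ 3) * G (x, \<omega> /\<^sub>R N x) \<partial>sphere_measure) * indicator MM x \<partial>lborel)"
    by (rule nn_integral_restrict_space) (simp add: MM_facts)
  also have "\<dots> = (\<integral>\<^sup>+x. indicator MM x * ennreal (N x ^ 3) * (\<integral>\<^sup>+\<omega>. G (x, \<omega> /\<^sub>R N x) \<partial>sphere_measure) \<partial>lborel)"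
  proof (rule nn_integral_cong)
    fix x
    have "(\<lambda>\<omega>. (x, \<omega> /\<^sub>R N x)) \<in> borel_measurable sphere_measure"
      unfolding measurable_cong_sets[OF sets_sphere_measure refl]
      by (intro measurable_restrict_space1 borel_measurable_continuous_onI continuous_intros) (use N_simps(2)[of x] in auto)
    then have "(\<lambda>\<omega>. G (x, \<omega> /\<^sub>R N x)) \<in> borel_measurable sphere_measure" by measurable
    then show "(\<integral>\<^sup>+\<omega>. ennreal (N x ^ 3) * G (x, \<omega> /\<^sub>R N x) \<partial>sphere_measure) * indicator MM x =
      indicator MM x * ennreal (N x ^ 3) * (\<integral>\<^sup>+\<omega>. G (x, \<omega> /\<^sub>R N x) \<partial>sphere_measure)"
      by (simp add: nn_integral_cmult mult_ac)
  qed
  finally show ?thesis .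
qed

lemma finite_Sigma: "finite_measure (Sigma_measure n)"
proof (rule finite_measureI)
  obtain C where C: "C > 0" "\<And>x. x \<in> MM \<Longrightarrow> n x \<le> C" using n_upper by blast
  have "emeasure (Sigma_measure n) (space (Sigma_measure n)) = (\<integral>\<^sup>+z. 1 \<partial>Sigma_measure n)" by simp
  also have "\<dots> = (\<integral>\<^sup>+x. indicator MM x * ennreal (N x ^ 3) * (\<integral>\<^sup>+\<omega>. 1 \<partial>sphere_measure) \<partial>lborel)"
    by (rule nn_integral_Sigma_borel) simp
  also have "\<dots> \<le> (\<integral>\<^sup>+x. ennreal (C ^ 3) * (\<integral>\<^sup>+\<omega>. 1 \<partial>sphere_measure) * indicator MM x \<partial>lborel)"
  proof (rule nn_integral_mono)
    fix x
    show "indicator MM x * ennreal (N x ^ 3) * (\<integral>\<^sup>+\<omega>. 1 \<partial>sphere_measure) \<le> ennreal (C ^ 3) * (\<integral>\<^sup>+\<omega>. 1 \<partial>sphere_measure) * indicator MM x"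
      using C(2)[of x] n_pos[of x]
      by (cases "x \<in> MM") (auto simp: N_simps intro!: mult_right_mono ennreal_leI power_mono)
  qed
  also have "\<dots> = ennreal (C ^ 3) * (\<integral>\<^sup>+\<omega>. 1 \<partial>sphere_measure) * emeasure lborel MM"
    by (rule nn_integral_cmult_indicator) (simp add: MM_facts)
  also have "\<dots> < \<infinity>"
    using emeasure_lborel_cball_finite[of "0::vec3" 1] S2.emeasure_finite[of "sphere 0 1", folded infinity_ennreal_def]
    by (simp add: MM_def ennreal_mult_less_top) (simp add: less_top[symmetric])
  finally show "emeasure (Sigma_measure n) (space (Sigma_measure n)) \<noteq> \<infinity>" by simp
qed

sublocale Sig: finite_measure "Sigma_measure n" by (rule finite_Sigma)

text \<open>The Borel version of \<open>to_Omega n\<close>, with which it agrees on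
  \<open>test_dom\<close>. At \<xi> = 0 the convention \<open>inverse 0 = 0\<close> makes it total;
  those points lie outside \<open>test_dom\<close>.\<close>

definition to_Om :: "phase \<Rightarrow> phase" where
  "to_Om z = (fst z, snd z /\<^sub>R (N (fst z) * norm (snd z)))"

lemma to_Om_borel [measurable]: "to_Om \<in> borel_measurable borel"
  unfolding to_Om_def[abs_def] by (rule borel_measurable_Pair) measurable

lemma test_dom_iff: "z \<in> test_dom \<longleftrightarrow> fst z \<in> interior MM \<and> snd z \<noteq> 0"
  by (cases z) (auto simp: test_dom_def)

lemma test_dom_open: "open test_dom"
  unfolding test_dom_def by (intro open_Times) auto

lemma test_dom_borel [measurable]: "test_dom \<in> sets borel"
  using test_dom_open by (rule borel_open)

lemma to_Om_eq: "z \<in> test_dom \<Longrightarrow> to_Omega n z = to_Om z" "z \<in> test_dom \<Longrightarrow> to_Om z \<in> Omega n"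
proof -
  assume "z \<in> test_dom"
  then have z: "fst z \<in> MM" "snd z \<noteq> 0" using interior_subset by (auto simp: test_dom_iff)
  show "to_Omega n z = to_Om z" using z to_Omega_eq[of "fst z" "snd z"] by (simp add: to_Om_def N_simps)
  then show "to_Om z \<in> Omega n" using to_Omega_in[OF z] by simp
qed

text \<open>Polar coordinates in \<open>\<xi>\<close>: any radial weight \<open>\<eta>\<close> turns Lebesgue measure into a multiple of \<open>d\<Sigma>\<close>.\<close>

lemma transfer_borel:
  assumes G [measurable]: "G \<in> borel_measurable borel" and eta [measurable]: "\<eta> \<in> borel_measurable borel"
  shows "(\<integral>\<^sup>+z. indicator test_dom z * ennreal (N (fst z) ^ 3) * \<eta> (norm (snd z)) * G (to_Om z) \<partial>lborel) =
    (\<integral>\<^sup>+r. ennreal (r\<^sup>2) * indicator {0<..} r * \<eta> r \<partial>lborel) * (\<integral>\<^sup>+z. G z \<partial>Sigma_measure n)"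
proof -
  define c where "c = (\<integral>\<^sup>+r. ennreal (r\<^sup>2) * indicator {0<..} r * \<eta> r \<partial>lborel)"
  have i [measurable]: "interior MM \<in> sets borel" by (intro borel_open) simp
  let ?H = "\<lambda>z. indicator test_dom z * ennreal (N (fst z) ^ 3) * \<eta> (norm (snd z)) * G (to_Om z)"
  have Hm: "?H \<in> borel_measurable borel" by measurable
  define I where "I x = (\<integral>\<^sup>+\<omega>. G (x, \<omega> /\<^sub>R N x) \<partial>sphere_measure)" for x :: vec3
  have Gm: "(\<lambda>\<omega>. G (x, \<omega> /\<^sub>R N x)) \<in> borel_measurable sphere_measure" for x
  proof -
    have "(\<lambda>\<omega>. (x, \<omega> /\<^sub>R N x)) \<in> borel_measurable sphere_measure"
      unfolding measurable_cong_sets[OF sets_sphere_measure refl]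
      by (intro measurable_restrict_space1 borel_measurable_continuous_onI continuous_intros) (use N_simps(2)[of x] in auto)
    then show ?thesis by measurable
  qed
  have Im: "I \<in> borel_measurable borel"
  proof -
    have s: "snd \<in> (borel :: vec3 measure) \<Otimes>\<^sub>M sphere_measure \<rightarrow>\<^sub>M (borel :: vec3 measure)"
      by (rule measurable_compose[OF measurable_snd])
         (auto simp: measurable_cong_sets[OF sets_sphere_measure refl] intro: measurable_restrict_space1)
    have f: "fst \<in> (borel :: vec3 measure) \<Otimes>\<^sub>M sphere_measure \<rightarrow>\<^sub>M (borel :: vec3 measure)" by (rule measurable_fst)
    have "(\<lambda>z. (fst z, snd z /\<^sub>R N (fst z))) \<in> borel_measurable (borel \<Otimes>\<^sub>M sphere_measure)"
      by (rule Omega_param_measurable_compose[OF f s])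
    then have "(\<lambda>z. G (fst z, snd z /\<^sub>R N (fst z))) \<in> borel_measurable (borel \<Otimes>\<^sub>M sphere_measure)" by measurable
    then show ?thesis unfolding I_def[abs_def]
      by (intro S2.borel_measurable_nn_integral) (simp add: case_prod_beta')
  qed
  have "(\<integral>\<^sup>+z. ?H z \<partial>lborel) = (\<integral>\<^sup>+z. ?H z \<partial>(lborel \<Otimes>\<^sub>M lborel))" by (simp add: lborel_prod)
  also have "\<dots> = (\<integral>\<^sup>+x. \<integral>\<^sup>+\<xi>. ?H (x, \<xi>) \<partial>lborel \<partial>lborel)"
    by (rule lborel.nn_integral_fst[symmetric]) (use Hm in \<open>simp add: lborel_prod\<close>)
  also have "\<dots> = (\<integral>\<^sup>+x. c * (indicator (interior MM) x * ennreal (N x ^ 3) * I x) \<partial>lborel)"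
  proof (rule nn_integral_cong)
    fix x :: vec3
    have p: "(\<lambda>\<xi>::vec3. (x, \<xi>)) \<in> borel_measurable borel"
      by (intro borel_measurable_continuous_onI continuous_intros)
    have "(\<lambda>\<xi>. ?H (x, \<xi>)) \<in> borel_measurable borel" by (rule measurable_compose[OF p Hm])
    then have "(\<integral>\<^sup>+\<xi>. ?H (x, \<xi>) \<partial>lborel) =
      (\<integral>\<^sup>+r. ennreal (r\<^sup>2) * indicator {0<..} r * (\<integral>\<^sup>+\<omega>. ?H (x, r *\<^sub>R \<omega>) \<partial>sphere_measure) \<partial>lborel)"
      by (rule nn_integral_polar)
    also have "\<dots> = (\<integral>\<^sup>+r. (ennreal (r\<^sup>2) * indicator {0<..} r * \<eta> r) * (indicator (interior MM) x * ennreal (N x ^ 3) * I x) \<partial>lborel)"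
    proof (rule nn_integral_cong)
      fix r :: real
      show "ennreal (r\<^sup>2) * indicator {0<..} r * (\<integral>\<^sup>+\<omega>. ?H (x, r *\<^sub>R \<omega>) \<partial>sphere_measure) =
        (ennreal (r\<^sup>2) * indicator {0<..} r * \<eta> r) * (indicator (interior MM) x * ennreal (N x ^ 3) * I x)"
      proof (cases "r > 0")
        case True
        have "(\<integral>\<^sup>+\<omega>. ?H (x, r *\<^sub>R \<omega>) \<partial>sphere_measure) =
          (\<integral>\<^sup>+\<omega>. (\<eta> r * indicator (interior MM) x * ennreal (N x ^ 3)) * G (x, \<omega> /\<^sub>R N x) \<partial>sphere_measure)"
        proof (rule nn_integral_cong)
          fix \<omega> :: vec3 assume "\<omega> \<in> space sphere_measure"
          then have w: "norm \<omega> = 1" by simp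
          then have "\<omega> \<noteq> 0" by auto
          then have "indicator test_dom (x, r *\<^sub>R \<omega>) = (indicator (interior MM) x :: ennreal)"
            using True by (auto simp: indicator_def test_dom_iff)
          \<comment> \<open>The projection forgets the radius; this is why the integral splits into
            a radial factor and an integral over the unit sphere.\<close>
          moreover have "to_Om (x, r *\<^sub>R \<omega>) = (x, \<omega> /\<^sub>R N x)" using w True by (simp add: to_Om_def)
          ultimately show "?H (x, r *\<^sub>R \<omega>) = (\<eta> r * indicator (interior MM) x * ennreal (N x ^ 3)) * G (x, \<omega> /\<^sub>R N x)"
            using w True by (simp add: mult_ac)
        qed
        also have "\<dots> = (\<eta> r * indicator (interior MM) x * ennreal (N x ^ 3)) * I x"
          unfolding I_def by (rule nn_integral_cmult) (rule Gm)
        finally show ?thesis using True by (simp add: mult_ac)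
      qed simp
    qed
    also have "\<dots> = c * (indicator (interior MM) x * ennreal (N x ^ 3) * I x)"
      unfolding c_def by (rule nn_integral_multc) measurable
    finally show "(\<integral>\<^sup>+\<xi>. ?H (x, \<xi>) \<partial>lborel) = c * (indicator (interior MM) x * ennreal (N x ^ 3) * I x)" .
  qed
  also have "\<dots> = c * (\<integral>\<^sup>+x. indicator (interior MM) x * ennreal (N x ^ 3) * I x \<partial>lborel)"
    by (rule nn_integral_cmult) (use Im in measurable)
  also have "(\<integral>\<^sup>+x. indicator (interior MM) x * ennreal (N x ^ 3) * I x \<partial>lborel) =
      (\<integral>\<^sup>+x. indicator MM x * ennreal (N x ^ 3) * I x \<partial>lborel)"
    by (rule nn_integral_cong_AE) (use AE_interior_MM in eventually_elim, simp add: indicator_def)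
  also have "\<dots> = (\<integral>\<^sup>+z. G z \<partial>Sigma_measure n)" unfolding I_def by (rule nn_integral_Sigma_borel[symmetric]) (rule G)
  finally show ?thesis unfolding c_def .
qed

end

section \<open>Weak derivatives\<close>

context refractive_index begin

text \<open>\<open>F\<close> is measurable only on the sphere bundle. Multiplied by the indicator of
  \<open>Omega n\<close> it becomes Borel on the whole phase space, and the values used are the same
  because \<open>to_Omega n\<close> maps \<open>test_dom\<close> into
  \<open>Omega n\<close>.\<close>

lemma transfer_nn:
  assumes F: "F \<in> borel_measurable (Sigma_measure n)" and eta [measurable]: "\<eta> \<in> borel_measurable borel"
  shows "(\<integral>\<^sup>+z. indicator test_dom z * ennreal (N (fst z) ^ 3) * \<eta> (norm (snd z)) * F (to_Omega n z) \<partial>lborel) =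
    (\<integral>\<^sup>+r. ennreal (r\<^sup>2) * indicator {0<..} r * \<eta> r \<partial>lborel) * (\<integral>\<^sup>+z. F z \<partial>Sigma_measure n)"
proof -
  let ?G = "\<lambda>z. F z * indicator (Omega n) z"
  have G: "?G \<in> borel_measurable borel"
    using F unfolding borel_measurable_Sigma_iff by (subst (asm) borel_measurable_restrict_space_iff_ennreal) auto
  have "(\<integral>\<^sup>+z. indicator test_dom z * ennreal (N (fst z) ^ 3) * \<eta> (norm (snd z)) * F (to_Omega n z) \<partial>lborel)
    = (\<integral>\<^sup>+z. indicator test_dom z * ennreal (N (fst z) ^ 3) * \<eta> (norm (snd z)) * ?G (to_Om z) \<partial>lborel)"
    by (rule nn_integral_cong) (auto simp: indicator_def to_Om_eq)
  also have "\<dots> = (\<integral>\<^sup>+r. ennreal (r\<^sup>2) * indicator {0<..} r * \<eta> r \<partial>lborel) * (\<integral>\<^sup>+z. ?G z \<partial>Sigma_measure n)"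
    by (rule transfer_borel[OF G eta])
  also have "(\<integral>\<^sup>+z. ?G z \<partial>Sigma_measure n) = (\<integral>\<^sup>+z. F z \<partial>Sigma_measure n)"
    by (rule nn_integral_cong) simp
  finally show ?thesis .
qed

lemma to_Omega_measurable:
  fixes f :: "phase \<Rightarrow> real"
  assumes f: "f \<in> borel_measurable (Sigma_measure n)"
  shows "(\<lambda>z. indicator test_dom z * f (to_Omega n z)) \<in> borel_measurable borel"
proof -
  have G [measurable]: "(\<lambda>z. indicator (Omega n) z *\<^sub>R f z) \<in> borel_measurable borel"
    using f unfolding borel_measurable_Sigma_iff by (subst (asm) borel_measurable_restrict_space_iff) auto
  have "(\<lambda>z. indicator test_dom z * f (to_Omega n z)) = (\<lambda>z. indicator test_dom z * (indicator (Omega n) (to_Om z) *\<^sub>R f (to_Om z)))"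
    by (auto simp: indicator_def to_Om_eq fun_eq_iff)
  also have "\<dots> \<in> borel_measurable borel"
    using measurable_compose[OF to_Om_borel G] by measurable
  finally show ?thesis .
qed

text \<open>The exceptional set is lifted with the radial weight \<open>indicator {1..2}\<close>.
  The lifted integral is 0 and the radial mass is not, so the set itself has measure 0.\<close>

lemma AE_Sigma_if_AE_test_dom:
  assumes ae: "AE z in lborel. z \<in> test_dom \<longrightarrow> P (to_Omega n z)"
    and m: "{z \<in> Omega n. \<not> P z} \<in> sets (Sigma_measure n)"
  shows "AE z in Sigma_measure n. P z"
proof -
  let ?A = "{z \<in> Omega n. \<not> P z}"
  let ?F = "indicator ?A :: phase \<Rightarrow> ennreal"
  let ?e = "indicator {1..2} :: real \<Rightarrow> ennreal"
  have "(\<integral>\<^sup>+z. indicator test_dom z * ennreal (N (fst z) ^ 3) * ?e (norm (snd z)) * ?F (to_Omega n z) \<partial>lborel) = (\<integral>\<^sup>+z. 0 \<partial>(lborel :: phase measure))"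
    by (rule nn_integral_cong_AE) (use ae in eventually_elim, auto simp: indicator_def)
  then have "(\<integral>\<^sup>+r. ennreal (r\<^sup>2) * indicator {0<..} r * ?e r \<partial>lborel) * (\<integral>\<^sup>+z. ?F z \<partial>Sigma_measure n) = 0"
    by (subst (asm) transfer_nn[OF borel_measurable_indicator[OF m]]) auto
  moreover have "(\<integral>\<^sup>+r. ennreal (r\<^sup>2) * indicator {0<..} r * ?e r \<partial>lborel) \<noteq> 0"
  proof -
    have "(\<integral>\<^sup>+r. indicator {1..2::real} r \<partial>lborel) \<le> (\<integral>\<^sup>+r. ennreal (r\<^sup>2) * indicator {0<..} r * ?e r \<partial>lborel)"
    proof (rule nn_integral_mono)
      fix r :: real
      have "1 \<le> ennreal (r\<^sup>2)" if "1 \<le> r"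
        using ennreal_leI[OF one_le_power[OF that, of 2]] by simp
      then show "indicator {1..2} r \<le> ennreal (r\<^sup>2) * indicator {0<..} r * ?e r" by (auto simp: indicator_def)
    qed
    then show ?thesis by auto
  qed
  ultimately have "emeasure (Sigma_measure n) ?A = 0" using m by simp
  then show ?thesis using m by (intro AE_I[where N="?A"]) auto
qed

text \<open>The singularity \<open>1 / r\<close>, integrable against \<open>r\<^sup>2 dr\<close>, makes room for the factor \<open>1 / gnorm n x \<xi>\<close>
  in the weak \<open>\<xi>\<close>-derivatives.\<close>

definition \<kappa> :: "real \<Rightarrow> real \<Rightarrow> real" where "\<kappa> b r = (1 + 1 / r) * indicator {..b} r"

lemma kappa_borel [measurable]: "\<kappa> b \<in> borel_measurable borel"
  unfolding \<kappa>_def[abs_def] by measurable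

lemma kappa_integral:
  assumes "0 \<le> b" "0 \<le> K"
  shows "(\<integral>\<^sup>+r. ennreal (r\<^sup>2) * indicator {0<..} r * ennreal (K * \<kappa> b r) \<partial>lborel) \<le> ennreal (K * (b\<^sup>2 + b) * b)"
proof -
  have "(\<integral>\<^sup>+r. ennreal (r\<^sup>2) * indicator {0<..} r * ennreal (K * \<kappa> b r) \<partial>lborel)
    \<le> (\<integral>\<^sup>+r. ennreal (K * (b\<^sup>2 + b)) * indicator {0..b} r \<partial>lborel)"
  proof (rule nn_integral_mono)
    fix r :: real
    show "ennreal (r\<^sup>2) * indicator {0<..} r * ennreal (K * \<kappa> b r) \<le> ennreal (K * (b\<^sup>2 + b)) * indicator {0..b} r"
    proof (cases "0 < r \<and> r \<le> b")
      case True
      have "r\<^sup>2 * (K * \<kappa> b r) = K * (r\<^sup>2 + r)" using True by (simp add: \<kappa>_def power2_eq_square field_simps)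
      also have "\<dots> \<le> K * (b\<^sup>2 + b)" using True assms by (intro mult_left_mono add_mono power_mono) auto
      finally show ?thesis using True by (simp add: ennreal_mult''[symmetric] ennreal_mult'[symmetric] ennreal_leI)
    next
      case False
      then have "ennreal (r\<^sup>2) * indicator {0<..} r * ennreal (K * \<kappa> b r) = 0"
        by (cases "0 < r") (auto simp: \<kappa>_def)
      then show ?thesis by (simp only: zero_le)
    qed
  qed
  also have "\<dots> = ennreal (K * (b\<^sup>2 + b)) * emeasure lborel {0..b}" by (rule nn_integral_cmult_indicator) simp
  also have "\<dots> = ennreal (K * (b\<^sup>2 + b) * b)" using assms by (simp add: ennreal_mult'')
  finally show ?thesis .
qed

text \<open>The weights against which homogeneous extensions are integrated: bounded in the fibre
  direction and with a singularity no worse than \<open>1/|\<xi>|\<close> at the origin. Test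
  functions, their derivatives, and test functions divided by \<open>gnorm\<close> are of this
  kind.\<close>

definition adm :: "(phase \<Rightarrow> real) \<Rightarrow> bool" where
  "adm h \<longleftrightarrow> h \<in> borel_measurable borel \<and> (\<exists>M\<ge>0. \<exists>b\<ge>0. \<forall>z\<in>test_dom. \<bar>h z\<bar> \<le> M * \<kappa> b (norm (snd z)))"

definition pairing :: "(phase \<Rightarrow> real) \<Rightarrow> (phase \<Rightarrow> real) \<Rightarrow> real" where
  "pairing g h = (LINT z:test_dom|lborel. g (to_Omega n z) * h z)"

text \<open>The constant depends on \<open>h\<close> alone. Hence a pairing depends only on the
  almost-everywhere class of \<open>g\<close> and is continuous in it, which makes the identities
  defining weak derivatives stable under limits.\<close>

lemma pairing_L1:
  assumes h: "adm h"
  obtains C where "0 \<le> C" "\<And>g :: phase \<Rightarrow> real. integrable (Sigma_measure n) g \<Longrightarrow>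
    set_integrable lborel test_dom (\<lambda>z. g (to_Omega n z) * h z) \<and> \<bar>pairing g h\<bar> \<le> C * (LINT z|Sigma_measure n. \<bar>g z\<bar>)"
proof -
  obtain M b where Mb: "M \<ge> 0" "b \<ge> 0" "\<And>z. z \<in> test_dom \<Longrightarrow> \<bar>h z\<bar> \<le> M * \<kappa> b (norm (snd z))"
    and [measurable]: "h \<in> borel_measurable borel"
    using h unfolding adm_def by blast
  \<comment> \<open>Dividing by \<open>c0 ^ 3\<close> makes room for the density
    \<open>N ^ 3 \<ge> c0 ^ 3\<close> that \<open>transfer_nn\<close> requires under the
    integral.\<close>
  define K where "K = M / c0 ^ 3"
  have K: "K \<ge> 0" using Mb c0 by (simp add: K_def)
  define C where "C = K * (b\<^sup>2 + b) * b"
  have C: "C \<ge> 0" using K Mb by (simp add: C_def)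
  show ?thesis
  proof (rule that[OF C])
    fix g :: "phase \<Rightarrow> real" assume g: "integrable (Sigma_measure n) g"
    have gm: "g \<in> borel_measurable (Sigma_measure n)" using g by auto
    let ?f = "\<lambda>z. indicator test_dom z *\<^sub>R (g (to_Omega n z) * h z)"
    have "?f = (\<lambda>z. (indicator test_dom z * g (to_Omega n z)) * h z)" by (auto simp: fun_eq_iff)
    then have fm: "?f \<in> borel_measurable lborel" using to_Omega_measurable[OF gm] by simp
    have "(\<integral>\<^sup>+z. ennreal (norm (?f z)) \<partial>lborel) \<le>
      (\<integral>\<^sup>+z. indicator test_dom z * ennreal (N (fst z) ^ 3) * ennreal (K * \<kappa> b (norm (snd z))) * ennreal \<bar>g (to_Omega n z)\<bar> \<partial>lborel)"
    proof (rule nn_integral_mono)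
      fix z :: phase
      show "ennreal (norm (?f z)) \<le> indicator test_dom z * ennreal (N (fst z) ^ 3) * ennreal (K * \<kappa> b (norm (snd z))) * ennreal \<bar>g (to_Omega n z)\<bar>"
      proof (cases "z \<in> test_dom")
        case True
        then have "fst z \<in> MM" using interior_subset by (auto simp: test_dom_iff)
        then have N: "N (fst z) \<ge> c0" using n_ge by (simp add: N_simps)
        have k0: "0 \<le> M * \<kappa> b (norm (snd z))" using Mb(3)[OF True] by linarith
        have "\<bar>h z\<bar> \<le> M * \<kappa> b (norm (snd z))" by (rule Mb(3)[OF True])
        also have "\<dots> \<le> (M * \<kappa> b (norm (snd z))) * (N (fst z) ^ 3 / c0 ^ 3)"
          using N c0 k0 by (intro mult_left_le[where c="M * \<kappa> b (norm (snd z))", THEN order_trans] mult_le_cancel_left1[THEN iffD2]) 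
            (auto simp: power_mono)
        also have "\<dots> = N (fst z) ^ 3 * (K * \<kappa> b (norm (snd z)))" by (simp add: K_def)
        finally have "\<bar>h z\<bar> * \<bar>g (to_Omega n z)\<bar> \<le> N (fst z) ^ 3 * (K * \<kappa> b (norm (snd z))) * \<bar>g (to_Omega n z)\<bar>"
          by (rule mult_right_mono) simp
        then have "norm (?f z) \<le> N (fst z) ^ 3 * (K * \<kappa> b (norm (snd z))) * \<bar>g (to_Omega n z)\<bar>"
          using True by (simp add: abs_mult mult.commute)
        then have "ennreal (norm (?f z)) \<le> ennreal (N (fst z) ^ 3 * (K * \<kappa> b (norm (snd z))) * \<bar>g (to_Omega n z)\<bar>)"
          by (rule ennreal_leI)
        also have "\<dots> = indicator test_dom z * ennreal (N (fst z) ^ 3) * ennreal (K * \<kappa> b (norm (snd z))) * ennreal \<bar>g (to_Omega n z)\<bar>"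
          using True N_simps(2)[of "fst z"] by (simp add: ennreal_mult'' ennreal_mult')
        finally show ?thesis .
      qed simp
    qed
    also have "\<dots> = (\<integral>\<^sup>+r. ennreal (r\<^sup>2) * indicator {0<..} r * ennreal (K * \<kappa> b r) \<partial>lborel) * (\<integral>\<^sup>+z. ennreal \<bar>g z\<bar> \<partial>Sigma_measure n)"
    proof (rule transfer_nn)
      show "(\<lambda>z. ennreal \<bar>g z\<bar>) \<in> borel_measurable (Sigma_measure n)" using gm by measurable
      show "(\<lambda>r. ennreal (K * \<kappa> b r)) \<in> borel_measurable borel" using kappa_borel[of b] by simp
    qed
    also have "\<dots> \<le> ennreal C * (\<integral>\<^sup>+z. ennreal \<bar>g z\<bar> \<partial>Sigma_measure n)"
      unfolding C_def by (intro mult_right_mono kappa_integral Mb K) simp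
    also have "(\<integral>\<^sup>+z. ennreal \<bar>g z\<bar> \<partial>Sigma_measure n) = ennreal (LINT z|Sigma_measure n. \<bar>g z\<bar>)"
      using g by (intro nn_integral_eq_integral) auto
    also have "ennreal C * \<dots> = ennreal (C * (LINT z|Sigma_measure n. \<bar>g z\<bar>))" using C by (simp add: ennreal_mult'')
    finally have le: "(\<integral>\<^sup>+z. ennreal (norm (?f z)) \<partial>lborel) \<le> ennreal (C * (LINT z|Sigma_measure n. \<bar>g z\<bar>))" .
    have i: "integrable lborel ?f"
      using le_less_trans[OF le ennreal_less_top] by (intro integrableI_bounded[OF fm]) (simp only: infinity_ennreal_def)
    have "ennreal (LINT z|lborel. norm (?f z)) \<le> ennreal (C * (LINT z|Sigma_measure n. \<bar>g z\<bar>))"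
      using le by (subst (asm) nn_integral_eq_integral[OF integrable_norm[OF i]]) auto
    then have "(LINT z|lborel. norm (?f z)) \<le> C * (LINT z|Sigma_measure n. \<bar>g z\<bar>)"
      using C by (subst (asm) ennreal_le_iff) auto
    then have "norm (LINT z|lborel. ?f z) \<le> C * (LINT z|Sigma_measure n. \<bar>g z\<bar>)"
      by (rule order_trans[OF integral_norm_bound])
    then have "\<bar>pairing g h\<bar> \<le> C * (LINT z|Sigma_measure n. \<bar>g z\<bar>)"
      unfolding pairing_def set_lebesgue_integral_def real_norm_def .
    then show "set_integrable lborel test_dom (\<lambda>z. g (to_Omega n z) * h z) \<and> \<bar>pairing g h\<bar> \<le> C * (LINT z|Sigma_measure n. \<bar>g z\<bar>)"
      using i by (simp add: set_integrable_def)
  qed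
qed

lemma const_L2v: "(\<lambda>_. c) \<in> L2v (Sigma_measure n)"
  by (simp add: L2v_def)

lemma L2v_integrable:
  fixes g :: "phase \<Rightarrow> real"
  assumes "g \<in> L2v (Sigma_measure n)"
  shows "integrable (Sigma_measure n) g" "(LINT z|Sigma_measure n. \<bar>g z\<bar>) \<le> L2norm (Sigma_measure n) g * L2norm (Sigma_measure n) (\<lambda>_. 1::real)"
proof -
  have a: "(\<lambda>z. \<bar>g z\<bar>) \<in> L2v (Sigma_measure n)" using assms by (auto simp: L2v_def)
  show "integrable (Sigma_measure n) g" using integrable_inner_L2v[OF assms const_L2v[of 1]] by simp
  show "(LINT z|Sigma_measure n. \<bar>g z\<bar>) \<le> L2norm (Sigma_measure n) g * L2norm (Sigma_measure n) (\<lambda>_. 1::real)"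
    using cauchy_schwarz_L2v[OF a const_L2v[of 1]] by (simp add: L2norm_def)
qed

lemma pairing_L2:
  assumes h: "adm h"
  obtains C where "0 \<le> C" "\<And>g. g \<in> L2v (Sigma_measure n) \<Longrightarrow> \<bar>pairing g h\<bar> \<le> C * L2norm (Sigma_measure n) g"
proof -
  obtain C where C: "0 \<le> C" "\<And>g. integrable (Sigma_measure n) g \<Longrightarrow> \<bar>pairing g h\<bar> \<le> C * (LINT z|Sigma_measure n. \<bar>g z\<bar>)"
    using pairing_L1[OF h] by metis
  have "\<bar>pairing g h\<bar> \<le> (C * L2norm (Sigma_measure n) (\<lambda>_. 1::real)) * L2norm (Sigma_measure n) g"
    if g: "g \<in> L2v (Sigma_measure n)" for g
  proof -
    have "\<bar>pairing g h\<bar> \<le> C * (LINT z|Sigma_measure n. \<bar>g z\<bar>)" by (rule C(2)[OF L2v_integrable(1)[OF g]])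
    also have "\<dots> \<le> C * (L2norm (Sigma_measure n) g * L2norm (Sigma_measure n) (\<lambda>_. 1::real))"
      by (rule mult_left_mono[OF L2v_integrable(2)[OF g] C(1)])
    finally show ?thesis by (simp add: mult_ac)
  qed
  then show ?thesis using that[of "C * L2norm (Sigma_measure n) (\<lambda>_. 1::real)"] C(1) L2norm_nonneg by (metis mult_nonneg_nonneg)
qed

lemma pairing_lincomb:
  assumes h: "adm h" and g: "g1 \<in> L2v (Sigma_measure n)" "g2 \<in> L2v (Sigma_measure n)"
  shows "pairing (\<lambda>z. a * g1 z + b * g2 z) h = a * pairing g1 h + b * pairing g2 h"
proof -
  have i: "set_integrable lborel test_dom (\<lambda>z. g1 (to_Omega n z) * h z)" "set_integrable lborel test_dom (\<lambda>z. g2 (to_Omega n z) * h z)"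
    using pairing_L1[OF h] L2v_integrable(1)[OF g(1)] L2v_integrable(1)[OF g(2)] by metis+
  have "pairing (\<lambda>z. a * g1 z + b * g2 z) h = (LINT z:test_dom|lborel. a * (g1 (to_Omega n z) * h z) + b * (g2 (to_Omega n z) * h z))"
    unfolding pairing_def by (simp add: algebra_simps)
  also have "\<dots> = a * pairing g1 h + b * pairing g2 h"
    unfolding pairing_def using i by (subst set_integral_add) (auto intro: set_integrable_mult_right simp: set_integral_mult_right)
  finally show ?thesis .
qed

lemma test_fun_bounds:
  assumes t: "test_fun \<psi>"
  obtains M b where "0 \<le> M" "0 \<le> b" "\<And>z. \<bar>\<psi> z\<bar> \<le> M * indicator {..b} (norm (snd z))"
    "\<And>z. \<bar>frechet_derivative \<psi> (at z) h\<bar> \<le> M * indicator {..b} (norm (snd z))"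
proof -
  define K where "K = closure {z. \<psi> z \<noteq> 0}"
  have K: "compact K" using t by (simp add: test_fun_def K_def)
  have C: "C1_on UNIV \<psi>" using t by (simp add: test_fun_def)
  have c1: "continuous_on K \<psi>" using C1_on_UNIV_continuous[OF C] continuous_on_subset by blast
  have c2: "continuous_on K (\<lambda>z. frechet_derivative \<psi> (at z) h)"
    using C continuous_on_subset unfolding C1_on_def by blast
  have "bounded (\<psi> ` K)" "bounded ((\<lambda>z. frechet_derivative \<psi> (at z) h) ` K)" "bounded (snd ` K)"
    using compact_continuous_image[OF c1 K] compact_continuous_image[OF c2 K]
      compact_continuous_image[OF continuous_on_snd[OF continuous_on_id] K] compact_imp_bounded by auto
  then obtain M1 M2 b where "\<forall>y\<in>\<psi> ` K. norm y \<le> M1" "\<forall>y\<in>(\<lambda>z. frechet_derivative \<psi> (at z) h) ` K. norm y \<le> M2"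
    "\<forall>y\<in>snd ` K. norm y \<le> b"
    unfolding bounded_iff by blast
  then have B: "\<bar>\<psi> z\<bar> \<le> M1" "\<bar>frechet_derivative \<psi> (at z) h\<bar> \<le> M2" "norm (snd z) \<le> b" if "z \<in> K" for z
    using that by (simp_all only: ball_simps real_norm_def)
  have out: "\<psi> z = 0" "frechet_derivative \<psi> (at z) h = 0" if "z \<notin> K" for z
  proof -
    have z: "\<psi> w = 0" if "w \<notin> K" for w using that closure_subset[of "{z. \<psi> z \<noteq> 0}"] unfolding K_def by blast
    show "\<psi> z = 0" using z that .
    have "(\<psi> has_derivative (\<lambda>_. 0)) (at z)"
      by (rule has_derivative_transform_within_open[of "\<lambda>_. 0" _ _ UNIV "- K"])
         (use K that z in \<open>auto intro: compact_imp_closed\<close>)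
    from frechet_derivative_at[OF this, symmetric] show "frechet_derivative \<psi> (at z) h = 0" by simp
  qed
  define M where "M = max 0 (max M1 M2)"
  show ?thesis
  proof (rule that[of M "max 0 b"])
    show "\<bar>\<psi> z\<bar> \<le> M * indicator {..max 0 b} (norm (snd z))" for z
      using B[of z] out[of z] by (cases "z \<in> K") (auto simp: M_def)
    show "\<bar>frechet_derivative \<psi> (at z) h\<bar> \<le> M * indicator {..max 0 b} (norm (snd z))" for z
      using B[of z] out[of z] by (cases "z \<in> K") (auto simp: M_def)
  qed (auto simp: M_def)
qed

lemma adm_bounded:
  assumes m [measurable]: "h \<in> borel_measurable borel" and Mb: "0 \<le> M" "0 \<le> b"
    and h: "\<And>z. \<bar>h z\<bar> \<le> M * indicator {..b} (norm (snd z))"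
  shows "adm h" "adm (\<lambda>z. h z / (N (fst z) * norm (snd z)))"
proof -
  \<comment> \<open>For positive \<open>r\<close> the function \<open>\<kappa> b\<close> dominates
    both 1 and \<open>1/r\<close> up to \<open>b\<close>, so one class of weights serves with and
    without the singular factor.\<close>
  have k: "M * indicator {..b} r \<le> M * \<kappa> b r" if "0 < r" for r
    using that Mb(1) by (intro mult_left_mono) (auto simp: \<kappa>_def indicator_def)
  show "adm h" unfolding adm_def
    using order_trans[OF h k] by (intro conjI m exI[of _ M] exI[of _ b] Mb(1,2) ballI) (simp add: test_dom_iff)
  have *: "\<bar>h z / (N (fst z) * norm (snd z))\<bar> \<le> M / c0 * \<kappa> b (norm (snd z))" if z: "z \<in> test_dom" for z
  proof -
    have r: "norm (snd z) > 0" using z by (simp add: test_dom_iff)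
    have "fst z \<in> MM" using z interior_subset by (auto simp: test_dom_iff)
    then have N: "N (fst z) \<ge> c0" using n_ge by (simp add: N_simps)
    have "\<bar>h z / (N (fst z) * norm (snd z))\<bar> = \<bar>h z\<bar> / (N (fst z) * norm (snd z))"
      using N_simps(2)[of "fst z"] by (simp add: abs_mult)
    also have "\<dots> \<le> (M * indicator {..b} (norm (snd z))) / (c0 * norm (snd z))"
      using h[of z] N c0 r by (intro frac_le mult_right_mono) (auto simp: Mb(1))
    also have "\<dots> \<le> M / c0 * \<kappa> b (norm (snd z))"
      using Mb(1) c0 r by (auto simp: \<kappa>_def indicator_def field_simps)
    finally show ?thesis .
  qed
  have "0 \<le> M / c0" using Mb(1) c0 by simp
  with Mb(2) * have "\<exists>M\<ge>0. \<exists>b\<ge>0. \<forall>z\<in>test_dom. \<bar>h z / (N (fst z) * norm (snd z))\<bar> \<le> M * \<kappa> b (norm (snd z))"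
    by blast
  then show "adm (\<lambda>z. h z / (N (fst z) * norm (snd z)))" unfolding adm_def by (intro conjI) measurable
qed

lemma test_fun_adm:
  assumes t: "test_fun \<psi>"
  shows "adm \<psi>" "adm (\<lambda>z. frechet_derivative \<psi> (at z) v)" "adm (\<lambda>z. \<psi> z / (N (fst z) * norm (snd z)))"
proof -
  obtain M b where Mb: "0 \<le> M" "0 \<le> b" "\<And>z. \<bar>\<psi> z\<bar> \<le> M * indicator {..b} (norm (snd z))"
    "\<And>z. \<bar>frechet_derivative \<psi> (at z) v\<bar> \<le> M * indicator {..b} (norm (snd z))"
    using test_fun_bounds[OF t] by metis
  have C: "C1_on UNIV \<psi>" using t by (simp add: test_fun_def)
  have m: "\<psi> \<in> borel_measurable borel"
    using C1_on_UNIV_continuous[OF C] by (rule borel_measurable_continuous_onI)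
  have m': "(\<lambda>z. frechet_derivative \<psi> (at z) v) \<in> borel_measurable borel"
    using C unfolding C1_on_def by (blast intro: borel_measurable_continuous_onI)
  show "adm \<psi>" "adm (\<lambda>z. \<psi> z / (N (fst z) * norm (snd z)))" by (rule adm_bounded[OF m Mb(1,2,3)])+
  show "adm (\<lambda>z. frechet_derivative \<psi> (at z) v)" by (rule adm_bounded(1)[OF m' Mb(1,2,4)])
qed

section \<open>Triples of a function and its weak derivatives\<close>

lemma sq_norm_triple: "(norm (U :: real \<times> vec3 \<times> vec3))\<^sup>2 = (fst U)\<^sup>2 + (norm (fst (snd U)))\<^sup>2 + (norm (snd (snd U)))\<^sup>2"
  by (cases U) (simp add: norm_Pair)

lemma sq_norm_vec3: "(norm (p :: vec3))\<^sup>2 = (\<Sum>i\<in>UNIV. (p $ i)\<^sup>2)"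
  by (simp add: norm_vec_def L2_set_def sum_nonneg)

lemma borel_measurable_vec3_iff:
  fixes p :: "'m \<Rightarrow> vec3"
  shows "p \<in> borel_measurable M \<longleftrightarrow> (\<forall>i. (\<lambda>z. p z $ i) \<in> borel_measurable M)"
proof
  assume "p \<in> borel_measurable M"
  then show "\<forall>i. (\<lambda>z. p z $ i) \<in> borel_measurable M"
    using borel_measurable_inner[of p M "\<lambda>_. axis i 1" for i] by (simp add: inner_axis)
next
  assume a: "\<forall>i. (\<lambda>z. p z $ i) \<in> borel_measurable M"
  show "p \<in> borel_measurable M"
    by (subst borel_measurable_euclidean_space) (use a in \<open>auto simp: Basis_vec3 inner_axis\<close>)
qed

lemma triple_norms_le: "norm (fst (snd x)) \<le> norm x" "norm (snd (snd x)) \<le> norm x" "\<bar>fst x\<bar> \<le> norm (x :: real \<times> vec3 \<times> vec3)"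
proof -
  have "norm (snd x) \<le> norm x" using norm_snd_le[of "snd x" "fst x"] by simp
  moreover have "norm (fst (snd x)) \<le> norm (snd x)" using norm_fst_le[of "fst (snd x)" "snd (snd x)"] by simp
  moreover have "norm (snd (snd x)) \<le> norm (snd x)" using norm_snd_le[of "snd (snd x)" "fst (snd x)"] by simp
  ultimately show "norm (fst (snd x)) \<le> norm x" "norm (snd (snd x)) \<le> norm x" by linarith+
  show "\<bar>fst x\<bar> \<le> norm x" using norm_fst_le[of "fst x" "snd x"] by simp
qed

lemma triple_component_le:
  "\<bar>fst x\<bar> \<le> norm x" "\<bar>fst (snd x) $ i\<bar> \<le> norm x" "\<bar>snd (snd x) $ i\<bar> \<le> norm (x :: real \<times> vec3 \<times> vec3)"
  using triple_norms_le[of x] component_le_norm_cart[of "fst (snd x)" i] component_le_norm_cart[of "snd (snd x)" i] by linarith+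

lemma L2v_triple_iff:
  fixes U :: "'m \<Rightarrow> real \<times> vec3 \<times> vec3"
  shows "U \<in> L2v M \<longleftrightarrow> (\<lambda>z. fst (U z)) \<in> L2 M \<and> (\<forall>i. (\<lambda>z. fst (snd (U z)) $ i) \<in> L2 M) \<and> (\<forall>i. (\<lambda>z. snd (snd (U z)) $ i) \<in> L2 M)"
    (is "_ \<longleftrightarrow> ?R")
proof
  assume U: "U \<in> L2v M"
  then have [measurable]: "U \<in> borel_measurable M" by auto
  have i: "integrable M (\<lambda>z. (norm (U z))\<^sup>2)" using U by (simp add: L2v_def)
  have L: "f \<in> L2 M" if "f \<in> borel_measurable M" "\<And>z. \<bar>f z\<bar> \<le> norm (U z)" for f :: "'m \<Rightarrow> real"
  proof -
    have "integrable M (\<lambda>z. (f z)\<^sup>2)"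
      by (rule Bochner_Integration.integrable_bound[OF i]) (use that in \<open>auto simp: abs_le_square_iff[symmetric]\<close>)
    then show ?thesis using that by (simp add: L2_def)
  qed
  have m: "(\<lambda>z. fst (U z)) \<in> borel_measurable M" "(\<lambda>z. fst (snd (U z))) \<in> borel_measurable M" "(\<lambda>z. snd (snd (U z))) \<in> borel_measurable M"
    by (auto intro!: measurable_compose[OF \<open>U \<in> borel_measurable M\<close>] borel_measurable_continuous_onI continuous_intros)
  show ?R
    by (intro conjI allI L triple_component_le m m(2)[THEN borel_measurable_vec3_iff[THEN iffD1], rule_format]
        m(3)[THEN borel_measurable_vec3_iff[THEN iffD1], rule_format])
next
  assume R: ?R
  then have "(\<lambda>z. (fst (U z), fst (snd (U z)), snd (snd (U z)))) \<in> borel_measurable M"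
    by (intro borel_measurable_Pair) (auto simp: L2_def borel_measurable_vec3_iff)
  moreover have "integrable M (\<lambda>z. (norm (U z))\<^sup>2)"
    unfolding sq_norm_triple sq_norm_vec3 using R by (auto simp: L2_def)
  ultimately show "U \<in> L2v M" by (simp add: L2v_def)
qed

lemma L2_eq_L2v: "L2 M = (L2v M :: ('m \<Rightarrow> real) set)"
  by (simp add: L2_def L2v_def)

lemma L2v_components:
  fixes U :: "'m \<Rightarrow> real \<times> vec3 \<times> vec3"
  assumes "U \<in> L2v M"
  shows "(\<lambda>z. fst (U z)) \<in> L2v M" "(\<lambda>z. fst (snd (U z)) $ i) \<in> L2v M" "(\<lambda>z. snd (snd (U z)) $ i) \<in> L2v M"
  using assms unfolding L2v_triple_iff L2_eq_L2v by blast+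

text \<open>A function is carried along with its weak derivatives as a triple \<open>(u, \<nabla>\<^sub>x u, \<nabla>\<^sub>\<xi> u)\<close>. On triples the
  forms are bilinear, which is not clear for the choice of derivatives made by \<^const>\<open>derivs\<close>.\<close>

definition WD :: "(phase \<Rightarrow> real \<times> vec3 \<times> vec3) \<Rightarrow> bool" where
  "WD U \<longleftrightarrow> weak_derivs n (\<lambda>z. fst (U z)) (\<lambda>z. fst (snd (U z))) (\<lambda>z. snd (snd (U z)))"

text \<open>The factor \<open>1 / gnorm\<close> is moved from the weak derivative to the test
  function, so that every term is a pairing of a square-integrable function with an admissible
  weight.\<close>

lemma WD_iff: "WD U \<longleftrightarrow> U \<in> L2v (Sigma_measure n) \<and> (\<forall>\<psi> i. test_fun \<psi> \<longrightarrow>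
     pairing (\<lambda>z. fst (U z)) (\<lambda>z. frechet_derivative \<psi> (at z) (axis i 1, 0)) = - pairing (\<lambda>z. fst (snd (U z)) $ i) \<psi> \<and>
     pairing (\<lambda>z. fst (U z)) (\<lambda>z. frechet_derivative \<psi> (at z) (0, axis i 1)) =
        - pairing (\<lambda>z. snd (snd (U z)) $ i) (\<lambda>z. \<psi> z / (N (fst z) * norm (snd z))))"
proof -
  have "(LINT z:test_dom|lborel. snd (snd (U (to_Omega n z))) $ i / gnorm n (fst z) (snd z) * \<psi> z) =
     (LINT z:test_dom|lborel. snd (snd (U (to_Omega n z))) $ i * (\<psi> z / (N (fst z) * norm (snd z))))" for \<psi> i
    using interior_subset[of MM]
    by (intro set_lebesgue_integral_cong) (auto simp: test_dom_iff gnorm_eq N_simps subset_iff)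
  then show ?thesis
    unfolding WD_def weak_derivs_def L2v_triple_iff pairing_def by auto
qed

lemma WD_L2v: "WD U \<Longrightarrow> U \<in> L2v (Sigma_measure n)"
  by (simp add: WD_iff)

lemma WD_lincomb:
  assumes "WD U" "WD W" shows "WD (\<lambda>z. a *\<^sub>R U z + b *\<^sub>R W z)"
proof -
  have L: "U \<in> L2v (Sigma_measure n)" "W \<in> L2v (Sigma_measure n)" using assms by (auto simp: WD_iff)
  note L' = L[unfolded L2v_triple_iff L2_eq_L2v]
  have s: "fst (a *\<^sub>R x + b *\<^sub>R y) = a * fst x + b * fst y" "fst (snd (a *\<^sub>R x + b *\<^sub>R y)) $ i = a * fst (snd x) $ i + b * fst (snd y) $ i"
    "snd (snd (a *\<^sub>R x + b *\<^sub>R y)) $ i = a * snd (snd x) $ i + b * snd (snd y) $ i" for x y :: "real \<times> vec3 \<times> vec3" and i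
    by simp_all
  show ?thesis
    unfolding WD_iff s
  proof (intro conjI allI impI L2v_lincomb L)
    fix \<psi> i assume t: "test_fun \<psi>"
    note P = pairing_lincomb[OF test_fun_adm(1)[OF t]] pairing_lincomb[OF test_fun_adm(2)[OF t]] pairing_lincomb[OF test_fun_adm(3)[OF t]]
    show "pairing (\<lambda>z. a * fst (U z) + b * fst (W z)) (\<lambda>z. frechet_derivative \<psi> (at z) (axis i 1, 0)) =
       - pairing (\<lambda>z. a * fst (snd (U z)) $ i + b * fst (snd (W z)) $ i) \<psi>"
      using assms t L' by (simp add: P WD_iff)
    show "pairing (\<lambda>z. a * fst (U z) + b * fst (W z)) (\<lambda>z. frechet_derivative \<psi> (at z) (0, axis i 1)) =
        - pairing (\<lambda>z. a * snd (snd (U z)) $ i + b * snd (snd (W z)) $ i) (\<lambda>z. \<psi> z / (N (fst z) * norm (snd z)))"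
      using assms t L' by (simp add: P WD_iff)
  qed
qed

text \<open>For a fixed test function every term of the defining identities is
  \<open>L^2\<close>-continuous by \<open>pairing_L2\<close>. This is what makes the space of
  triples complete.\<close>

lemma WD_closed:
  assumes X: "\<And>k::nat. WD (X k)" and U: "U \<in> L2v (Sigma_measure n)"
    and lim: "(\<lambda>k. L2norm (Sigma_measure n) (\<lambda>z. X k z - U z)) \<longlonglongrightarrow> 0"
  shows "WD U"
proof -
  let ?S = "Sigma_measure n"
  have XL: "X k \<in> L2v ?S" for k using X by (rule WD_L2v)
  \<comment> \<open>\<open>f\<close> stands for a component of the triple: it respects differences
    and is bounded by the norm, so one argument serves all three kinds of component.\<close>
  have lim_pair: "(\<lambda>k. pairing (\<lambda>z. f (X k z)) h) \<longlonglongrightarrow> pairing (\<lambda>z. f (U z)) h"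
    if h: "adm h" and f: "\<And>W. W \<in> L2v ?S \<Longrightarrow> (\<lambda>z. f (W z)) \<in> L2v ?S" and flin: "\<And>x y. f (x - y) = f x - f y" and fb: "\<And>x. \<bar>f x\<bar> \<le> norm x" for f h
  proof -
    obtain C where C: "0 \<le> C" "\<And>g. g \<in> L2v ?S \<Longrightarrow> \<bar>pairing g h\<bar> \<le> C * L2norm ?S g" using pairing_L2[OF h] by metis
    have "\<bar>pairing (\<lambda>z. f (X k z)) h - pairing (\<lambda>z. f (U z)) h\<bar> \<le> C * L2norm ?S (\<lambda>z. X k z - U z)" for k
    proof -
      have d: "(\<lambda>z. X k z - U z) \<in> L2v ?S" by (rule L2v_diff[OF XL U])
      have "pairing (\<lambda>z. f (X k z)) h - pairing (\<lambda>z. f (U z)) h = pairing (\<lambda>z. f (X k z - U z)) h"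
        using pairing_lincomb[OF h f[OF XL] f[OF U], of 1 k "-1"] by (simp add: flin)
      also have "\<bar>\<dots>\<bar> \<le> C * L2norm ?S (\<lambda>z. f (X k z - U z))" by (rule C(2)[OF f[OF d]])
      also have "\<dots> \<le> C * (1 * L2norm ?S (\<lambda>z. X k z - U z))"
        by (intro mult_left_mono L2norm_mono f d C) (auto simp: fb)
      finally show ?thesis by simp
    qed
    then have "(\<lambda>k. pairing (\<lambda>z. f (X k z)) h - pairing (\<lambda>z. f (U z)) h) \<longlonglongrightarrow> 0"
      by (intro Lim_null_comparison[OF always_eventually tendsto_mult_right_zero[OF lim, of C]])  simp
    then show ?thesis by (simp add: LIM_zero_iff)
  qed
  show ?thesis
    unfolding WD_iff
  proof (intro conjI allI impI U)
    fix \<psi> i assume t: "test_fun \<psi>"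
    note adm = test_fun_adm[OF t]
    have l0: "(\<lambda>k. pairing (\<lambda>z. fst (X k z)) (\<lambda>z. frechet_derivative \<psi> (at z) v)) \<longlonglongrightarrow> pairing (\<lambda>z. fst (U z)) (\<lambda>z. frechet_derivative \<psi> (at z) v)" for v
      by (rule lim_pair[where f=fst, OF adm(2)]) (auto intro: L2v_components triple_component_le simp del: split_paired_All split_paired_Ex)
    have l1: "(\<lambda>k. - pairing (\<lambda>z. fst (snd (X k z)) $ i) \<psi>) \<longlonglongrightarrow> - pairing (\<lambda>z. fst (snd (U z)) $ i) \<psi>"
      by (rule tendsto_minus[OF lim_pair[where f="\<lambda>x. fst (snd x) $ i", OF adm(1)]]) (auto intro: L2v_components triple_component_le simp del: split_paired_All split_paired_Ex)
    have l2: "(\<lambda>k. - pairing (\<lambda>z. snd (snd (X k z)) $ i) (\<lambda>z. \<psi> z / (N (fst z) * norm (snd z)))) \<longlonglongrightarrow>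
        - pairing (\<lambda>z. snd (snd (U z)) $ i) (\<lambda>z. \<psi> z / (N (fst z) * norm (snd z)))"
      by (rule tendsto_minus[OF lim_pair[where f="\<lambda>x. snd (snd x) $ i", OF adm(3)]]) (auto intro: L2v_components triple_component_le simp del: split_paired_All split_paired_Ex)
    have e1: "(\<lambda>k. pairing (\<lambda>z. fst (X k z)) (\<lambda>z. frechet_derivative \<psi> (at z) (axis i 1, 0))) = (\<lambda>k. - pairing (\<lambda>z. fst (snd (X k z)) $ i) \<psi>)"
      using X t by (simp add: WD_iff)
    have e2: "(\<lambda>k. pairing (\<lambda>z. fst (X k z)) (\<lambda>z. frechet_derivative \<psi> (at z) (0, axis i 1))) =
      (\<lambda>k. - pairing (\<lambda>z. snd (snd (X k z)) $ i) (\<lambda>z. \<psi> z / (N (fst z) * norm (snd z))))"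
      using X t by (simp add: WD_iff)
    show "pairing (\<lambda>z. fst (U z)) (\<lambda>z. frechet_derivative \<psi> (at z) (axis i 1, 0)) = - pairing (\<lambda>z. fst (snd (U z)) $ i) \<psi>"
      using LIMSEQ_unique[OF l0 l1[folded e1]] .
    show "pairing (\<lambda>z. fst (U z)) (\<lambda>z. frechet_derivative \<psi> (at z) (0, axis i 1)) =
        - pairing (\<lambda>z. snd (snd (U z)) $ i) (\<lambda>z. \<psi> z / (N (fst z) * norm (snd z)))"
      using LIMSEQ_unique[OF l0 l2[folded e2]] .
  qed
qed


lemma pairing_integrable:
  fixes g :: "phase \<Rightarrow> real"
  assumes h: "adm h" and g: "integrable (Sigma_measure n) g"
  shows "set_integrable lborel test_dom (\<lambda>z. g (to_Omega n z) * h z)"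
proof -
  obtain C where "\<And>g :: phase \<Rightarrow> real. integrable (Sigma_measure n) g \<Longrightarrow>
    set_integrable lborel test_dom (\<lambda>z. g (to_Omega n z) * h z) \<and> \<bar>pairing g h\<bar> \<le> C * (LINT z|Sigma_measure n. \<bar>g z\<bar>)"
    using pairing_L1[OF h] by blast
  with g show ?thesis by blast
qed

text \<open>If the function vanishes almost everywhere, its lifted derivatives integrate to 0
  against all test functions. The fundamental lemma makes them vanish on \<open>test_dom\<close>,
  and a radial weight carries this back to the sphere bundle.\<close>

lemma WD_unique:
  assumes U: "WD U" and z0: "AE z in Sigma_measure n. fst (U z) = 0"
  shows "AE z in Sigma_measure n. U z = 0"
proof -
  let ?S = "Sigma_measure n"
  have UL: "U \<in> L2v ?S" using U by (rule WD_L2v)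
  note comp = L2v_components[OF UL]
  have pair0: "pairing (\<lambda>z. fst (U z)) h = 0" if h: "adm h" for h
  proof -
    obtain C where C: "\<And>g. integrable ?S g \<Longrightarrow> \<bar>pairing g h\<bar> \<le> C * (LINT z|?S. \<bar>g z\<bar>)" using pairing_L1[OF h] by metis
    have "\<bar>pairing (\<lambda>z. fst (U z)) h\<bar> \<le> C * (LINT z|?S. \<bar>fst (U z)\<bar>)" by (rule C[OF L2v_integrable(1)[OF comp(1)]])
    also have "(LINT z|?S. \<bar>fst (U z)\<bar>) = 0"
      by (rule integral_eq_zero_AE) (use z0 in eventually_elim, simp)
    finally show ?thesis by simp
  qed
  \<comment> \<open>The two kinds of derivative differ only in the nonvanishing factor
    \<open>w\<close>, which is 1 for \<open>x\<close> and \<open>1 / (N |\<xi>|)\<close> for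
    \<xi>.\<close>
  have key: "AE z in ?S. g z = 0"
    if gL: "g \<in> L2v ?S" and w: "\<And>z. z \<in> test_dom \<Longrightarrow> w z \<noteq> 0"
      and zero: "\<And>\<psi>. test_fun \<psi> \<Longrightarrow> pairing g (\<lambda>z. \<psi> z * w z) = 0"
      and adm: "\<And>h M b. h \<in> borel_measurable borel \<Longrightarrow> 0 \<le> M \<Longrightarrow> 0 \<le> b \<Longrightarrow> (\<And>z. \<bar>h z\<bar> \<le> M * indicator {..b} (norm (snd z))) \<Longrightarrow> adm (\<lambda>z. h z * w z)"
    for g :: "phase \<Rightarrow> real" and w :: "phase \<Rightarrow> real"
  proof -
    have "AE z in lborel. z \<in> test_dom \<longrightarrow> g (to_Omega n z) * w z = 0"
    proof (rule fundamental_lemma[OF test_dom_open])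
      fix a b :: phase assume sub: "cbox a b \<subseteq> test_dom"
      obtain R where R: "\<And>z. z \<in> cbox a b \<Longrightarrow> norm z \<le> R" using bounded_cbox[of a b] unfolding bounded_iff by blast
      have "\<bar>indicator (cbox a b) z :: real\<bar> \<le> 1 * indicator {..max 0 R} (norm (snd z))" for z :: phase
        using R[of z] norm_snd_le[of "snd z" "fst z"] by (auto simp: indicator_def)
      then have "adm (\<lambda>z. indicator (cbox a b) z * w z)" by (intro adm[of _ 1 "max 0 R"]) auto
      then have "set_integrable lborel test_dom (\<lambda>z. g (to_Omega n z) * (indicator (cbox a b) z * w z))"
        by (rule pairing_integrable[OF _ L2v_integrable(1)[OF gL]])
      moreover have "indicator test_dom z *\<^sub>R (g (to_Omega n z) * (indicator (cbox a b) z * w z)) = indicator (cbox a b) z * (g (to_Omega n z) * w z)" for z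
        using sub by (auto simp: indicator_def)
      ultimately show "integrable lborel (\<lambda>z. indicator (cbox a b) z * (g (to_Omega n z) * w z))"
        by (simp only: set_integrable_def)
    next
      fix \<psi> :: "phase \<Rightarrow> real" assume "C1_on UNIV \<psi>" "compact (closure {z. \<psi> z \<noteq> 0})" "closure {z. \<psi> z \<noteq> 0} \<subseteq> test_dom"
      then have "pairing g (\<lambda>z. \<psi> z * w z) = 0" by (intro zero) (simp add: test_fun_def)
      then show "(LINT z:test_dom|lborel. g (to_Omega n z) * w z * \<psi> z) = 0"
        unfolding pairing_def by (simp add: mult_ac)
    qed
    then have "AE z in lborel. z \<in> test_dom \<longrightarrow> g (to_Omega n z) = 0"
      by eventually_elim (use w in auto)
    moreover have "{z \<in> Omega n. g z \<noteq> 0} \<in> sets ?S"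
    proof -
      have [measurable]: "g \<in> borel_measurable ?S" using gL by auto
      have "{z \<in> space ?S. g z \<noteq> 0} \<in> sets ?S" by measurable
      then show ?thesis by simp
    qed
    ultimately show ?thesis by (rule AE_Sigma_if_AE_test_dom)
  qed
  have p: "AE z in ?S. fst (snd (U z)) $ i = 0" for i
  proof (rule key[of _ "\<lambda>_. 1", OF comp(2)])
    show "pairing (\<lambda>z. fst (snd (U z)) $ i) (\<lambda>z. \<psi> z * 1) = 0" if "test_fun \<psi>" for \<psi>
    proof -
      have "pairing (\<lambda>z. fst (U z)) (\<lambda>z. frechet_derivative \<psi> (at z) (axis i 1, 0)) = - pairing (\<lambda>z. fst (snd (U z)) $ i) \<psi>"
        using U that unfolding WD_iff by blast
      then show ?thesis using pair0[OF test_fun_adm(2)[OF that]] by simp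
    qed
  qed (use adm_bounded(1) in auto)
  have q: "AE z in ?S. snd (snd (U z)) $ i = 0" for i
  proof (rule key[of _ "\<lambda>z. 1 / (N (fst z) * norm (snd z))", OF comp(3)])
    show "1 / (N (fst z) * norm (snd z)) \<noteq> 0" if "z \<in> test_dom" for z
      using that N_simps(2)[of "fst z"] by (simp add: test_dom_iff)
    show "pairing (\<lambda>z. snd (snd (U z)) $ i) (\<lambda>z. \<psi> z * (1 / (N (fst z) * norm (snd z)))) = 0" if "test_fun \<psi>" for \<psi>
    proof -
      have "pairing (\<lambda>z. fst (U z)) (\<lambda>z. frechet_derivative \<psi> (at z) (0, axis i 1)) =
        - pairing (\<lambda>z. snd (snd (U z)) $ i) (\<lambda>z. \<psi> z / (N (fst z) * norm (snd z)))"
        using U that unfolding WD_iff by blast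
      then show ?thesis using pair0[OF test_fun_adm(2)[OF that]] by simp
    qed
    show "adm (\<lambda>z. h z * (1 / (N (fst z) * norm (snd z))))" if "h \<in> borel_measurable borel" "0 \<le> M" "0 \<le> b" "\<And>z. \<bar>h z\<bar> \<le> M * indicator {..b} (norm (snd z))" for h M b
      using adm_bounded(2)[OF that] by simp
  qed
  have "AE z in ?S. \<forall>i. fst (snd (U z)) $ i = 0" "AE z in ?S. \<forall>i. snd (snd (U z)) $ i = 0"
    using p q by (simp_all add: AE_all_countable)
  then show ?thesis using z0 by eventually_elim (simp add: prod_eq_iff vec_eq_iff)
qed

lemma WD_unique_diff:
  assumes "WD U" "WD W" "AE z in Sigma_measure n. fst (U z) = fst (W z)"
  shows "AE z in Sigma_measure n. U z = W z"
proof -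
  have "AE z in Sigma_measure n. 1 *\<^sub>R U z + (-1) *\<^sub>R W z = 0"
    by (rule WD_unique[OF WD_lincomb[OF assms(1,2)]]) (use assms(3) in eventually_elim, simp)
  then show ?thesis by eventually_elim simp
qed

lemma H1_iff: "u \<in> H1 n \<longleftrightarrow> (\<exists>U. WD U \<and> (\<forall>z. fst (U z) = u z))"
proof
  assume "u \<in> H1 n"
  then obtain p q where "weak_derivs n u p q" by (auto simp: H1_def)
  then have "WD (\<lambda>z. (u z, p z, q z))" by (simp add: WD_def)
  then show "\<exists>U. WD U \<and> (\<forall>z. fst (U z) = u z)" by (intro exI[of _ "\<lambda>z. (u z, p z, q z)"]) simp
next
  assume "\<exists>U. WD U \<and> (\<forall>z. fst (U z) = u z)"
  then obtain U where "WD U" "u = (\<lambda>z. fst (U z))" by (auto simp: fun_eq_iff)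
  then show "u \<in> H1 n" unfolding WD_def H1_def by blast
qed

definition triple :: "(phase \<Rightarrow> real) \<Rightarrow> phase \<Rightarrow> real \<times> vec3 \<times> vec3" where
  "triple u z = (u z, fst (derivs n u) z, snd (derivs n u) z)"

lemma triple_WD: assumes "u \<in> H1 n" shows "WD (triple u)"
proof -
  obtain p q where "weak_derivs n u p q" using assms by (auto simp: H1_def)
  then have "case (p, q) of (p, q) \<Rightarrow> weak_derivs n u p q" by simp
  then have "case derivs n u of (p, q) \<Rightarrow> weak_derivs n u p q" unfolding derivs_def by (rule someI)
  then show ?thesis by (simp add: WD_def triple_def case_prod_beta)
qed

text \<open>By uniqueness the version selected by \<open>derivs\<close> can be replaced under an
  integral by any other, in particular by a linear combination of versions.\<close>

lemma triple_eq_AE: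
  assumes "WD U" "\<And>z. fst (U z) = u z" shows "AE z in Sigma_measure n. triple u z = U z"
proof (rule WD_unique_diff)
  show "WD (triple u)" by (rule triple_WD) (use assms H1_iff in blast)
qed (use assms in \<open>auto simp: triple_def\<close>)

lemma L2norm_cong_AE:
  assumes "U \<in> L2v M" "W \<in> L2v M" "AE z in M. U z = W z" shows "L2norm M U = L2norm M W"
  unfolding L2norm_def
proof (intro arg_cong[where f=sqrt] integral_cong_AE)
  note [measurable] = assms(1,2)
  show "(\<lambda>z. U z \<bullet> U z) \<in> borel_measurable M" "(\<lambda>z. W z \<bullet> W z) \<in> borel_measurable M" by measurable
  show "AE z in M. U z \<bullet> U z = W z \<bullet> W z" using assms(3) by eventually_elim simp
qed

text \<open>\<open>nabla_x\<close> and \<open>nabla_xi\<close> carry \<open>n^-2\<close> and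
  \<open>gnorm\<close> carries \<open>n\<close>, so the squared derivative terms are divided by
  \<open>n^2\<close>, which lies between positive constants. Limits in \<open>H1_norm\<close> are
  thus \<open>L^2\<close> limits of triples.\<close>

lemma H1_norm_equiv:
  obtains c C where "0 < c" "0 < C"
    "\<And>U u. WD U \<Longrightarrow> (\<And>z. fst (U z) = u z) \<Longrightarrow> c * L2norm (Sigma_measure n) U \<le> H1_norm n u \<and> H1_norm n u \<le> C * L2norm (Sigma_measure n) U"
proof -
  let ?S = "Sigma_measure n"
  obtain K where K: "K > 0" "\<And>x. x \<in> MM \<Longrightarrow> n x \<le> K" using n_upper by blast
  \<comment> \<open>\<open>K\<close> bounds \<open>n\<close> from above and \<open>c0\<close> from
    below; the 1 accounts for the undifferentiated term, which has no weight.\<close>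
  define c where "c = min 1 (1 / K)"
  define C where "C = max 1 (1 / c0)"
  have cC: "0 < c" "0 < C" using K by (auto simp: c_def C_def)
  show ?thesis
  proof (rule that[OF cC])
    fix U u assume U: "WD U" "\<And>z. fst (U z) = u z"
    define T where "T = triple u"
    have T: "WD T" unfolding T_def by (rule triple_WD) (use U H1_iff in blast)
    have TL: "T \<in> L2v ?S" and UL: "U \<in> L2v ?S" using T U WD_L2v by auto
    have eq: "L2norm ?S T = L2norm ?S U"
      unfolding T_def by (rule L2norm_cong_AE[OF TL[unfolded T_def] UL triple_eq_AE[OF U]])
    define Q where "Q z = (u z)\<^sup>2 + (gnorm n (fst z) (nabla_x n u z))\<^sup>2 + (gnorm n (fst z) (nabla_xi n u z))\<^sup>2" for z
    have Q: "Q z = (fst (T z))\<^sup>2 + ((norm (fst (snd (T z))))\<^sup>2 + (norm (snd (snd (T z))))\<^sup>2) / (N (fst z))\<^sup>2" if "z \<in> Omega n" for z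
    proof -
      have x: "fst z \<in> MM" using that by (auto simp: Omega_def)
      have "nabla_x n u z = fst (snd (T z)) /\<^sub>R (N (fst z))\<^sup>2" "nabla_xi n u z = snd (snd (T z)) /\<^sub>R (N (fst z))\<^sup>2"
        using x by (auto simp: nabla_x_def nabla_xi_def T_def triple_def dx_def dxi_def N_simps vec_eq_iff divide_inverse)
      moreover have "(gnorm n (fst z) (p /\<^sub>R (N (fst z))\<^sup>2))\<^sup>2 = (norm p)\<^sup>2 / (N (fst z))\<^sup>2" for p
        using x n_pos[OF x] by (simp add: gnorm_eq N_simps field_simps power2_eq_square)
      ultimately show ?thesis by (simp add: Q_def T_def triple_def add_divide_distrib)
    qed
    have lo: "c\<^sup>2 * (norm (T z))\<^sup>2 \<le> Q z" and hi: "Q z \<le> C\<^sup>2 * (norm (T z))\<^sup>2" if z: "z \<in> Omega n" for z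
    proof -
      have x: "fst z \<in> MM" using z by (auto simp: Omega_def)
      have N: "c0 \<le> N (fst z)" "N (fst z) \<le> K" "0 < N (fst z)" using x n_ge K N_simps(1) N_simps(2)[of "fst z"] by auto
      let ?a = "(fst (T z))\<^sup>2" and ?b = "(norm (fst (snd (T z))))\<^sup>2 + (norm (snd (snd (T z))))\<^sup>2"
      have c1: "c\<^sup>2 \<le> 1" "1 \<le> C\<^sup>2" using K by (auto simp: c_def C_def power_le_one one_le_power)
      have "c * N (fst z) \<le> (1 / K) * K" unfolding c_def using N K by (intro mult_mono) auto
      then have "(c * N (fst z))\<^sup>2 \<le> 1" using N cC K by (intro power_le_one) auto
      then have c2: "c\<^sup>2 \<le> 1 / (N (fst z))\<^sup>2" using N by (simp add: power_mult_distrib field_simps)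
      have "(1 / c0) * c0 \<le> C * N (fst z)" unfolding C_def using N c0 by (intro mult_mono) auto
      then have "1 \<le> (C * N (fst z))\<^sup>2" using c0 by (intro one_le_power) auto
      then have c3: "1 / (N (fst z))\<^sup>2 \<le> C\<^sup>2" using N by (simp add: power_mult_distrib field_simps)
      have b: "0 \<le> ?b" by simp
      have e: "(norm (T z))\<^sup>2 = ?a + ?b" unfolding sq_norm_triple by simp
      have "c\<^sup>2 * ?a \<le> 1 * ?a" "c\<^sup>2 * ?b \<le> 1 / (N (fst z))\<^sup>2 * ?b" by (rule mult_right_mono[OF c1(1)], simp, rule mult_right_mono[OF c2 b])
      then show "c\<^sup>2 * (norm (T z))\<^sup>2 \<le> Q z" unfolding Q[OF z] e by (simp add: algebra_simps add_divide_distrib)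
      have "1 * ?a \<le> C\<^sup>2 * ?a" "1 / (N (fst z))\<^sup>2 * ?b \<le> C\<^sup>2 * ?b" by (rule mult_right_mono[OF c1(2)], simp, rule mult_right_mono[OF c3 b])
      then show "Q z \<le> C\<^sup>2 * (norm (T z))\<^sup>2" unfolding Q[OF z] e by (simp add: algebra_simps add_divide_distrib)
    qed
    have iT: "integrable ?S (\<lambda>z. (norm (T z))\<^sup>2)" using TL by (simp add: L2v_def)
    have iQ: "integrable ?S Q"
    proof (rule Bochner_Integration.integrable_bound)
      show "integrable ?S (\<lambda>z. C\<^sup>2 * (norm (T z))\<^sup>2)" using iT by simp
      have [measurable]: "(\<lambda>z. fst (T z)) \<in> borel_measurable ?S" "(\<lambda>z. fst (snd (T z))) \<in> borel_measurable ?S" "(\<lambda>z. snd (snd (T z))) \<in> borel_measurable ?S"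
        using L2v_components[OF TL, THEN L2v_measurable] by (auto simp: borel_measurable_vec3_iff)
      have [measurable]: "(\<lambda>z. N (fst z)) \<in> borel_measurable ?S"
        unfolding measurable_cong_sets[OF sets_Sigma refl] by (intro measurable_restrict_space1) measurable
      show "Q \<in> borel_measurable ?S"
        by (subst measurable_cong[OF Q]) (simp, measurable)
      show "AE z in ?S. norm (Q z) \<le> norm (C\<^sup>2 * (norm (T z))\<^sup>2)"
      proof (rule AE_I2)
        fix z assume "z \<in> space ?S"
        moreover have "0 \<le> Q z" by (simp add: Q_def)
        ultimately show "norm (Q z) \<le> norm (C\<^sup>2 * (norm (T z))\<^sup>2)" using hi[of z] by simp
      qed
    qed
    have H: "H1_norm n u = sqrt (LINT z|?S. Q z)" by (simp add: H1_norm_def Q_def)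
    have "c\<^sup>2 * (LINT z|?S. (norm (T z))\<^sup>2) \<le> (LINT z|?S. Q z)" "(LINT z|?S. Q z) \<le> C\<^sup>2 * (LINT z|?S. (norm (T z))\<^sup>2)"
      unfolding integral_mult_right_zero[symmetric]
      by (rule integral_mono; use iT iQ lo hi in simp)+
    then have "sqrt (c\<^sup>2 * (L2norm ?S T)\<^sup>2) \<le> H1_norm n u" "H1_norm n u \<le> sqrt (C\<^sup>2 * (L2norm ?S T)\<^sup>2)"
      unfolding H L2norm_sq by (auto intro: real_sqrt_le_mono)
    then show "c * L2norm ?S U \<le> H1_norm n u \<and> H1_norm n u \<le> C * L2norm ?S U"
      unfolding eq using cC L2norm_nonneg[of ?S U] by (simp add: real_sqrt_mult)
  qed
qed

section \<open>Functions of class \<open>C^1\<close> on the sphere bundle\<close>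

definition S0 :: "phase set" where "S0 = MM \<times> (- {0})"

definition hat :: "(phase \<Rightarrow> real) \<Rightarrow> phase \<Rightarrow> real" where "hat w = w \<circ> to_Omega n"

definition hatD :: "(phase \<Rightarrow> real) \<Rightarrow> phase \<Rightarrow> phase \<Rightarrow> real" where
  "hatD w z = frechet_derivative (hat w) (at z within S0)"

definition C1T :: "(phase \<Rightarrow> real) \<Rightarrow> phase \<Rightarrow> real \<times> vec3 \<times> vec3" where
  "C1T w z = (w z, \<chi> i. hatD w z (axis i 1, 0), \<chi> i. hatD w z (0, axis i 1))"

lemma C1_Omega_iff: "w \<in> C1_Omega n \<longleftrightarrow> (\<forall>z\<in>S0. (hat w has_derivative hatD w z) (at z within S0)) \<and> (\<forall>h. continuous_on S0 (\<lambda>z. hatD w z h))"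
  unfolding C1_Omega_def C1_on_def hatD_def hat_def S0_def by (simp add: frechet_derivative_works)

lemma C1_OmegaD:
  assumes "w \<in> C1_Omega n"
  shows "z \<in> S0 \<Longrightarrow> (hat w has_derivative hatD w z) (at z within S0)" "continuous_on S0 (\<lambda>z. hatD w z h)"
  using assms unfolding C1_Omega_iff by blast+

lemma S0_deriv_unique:
  assumes z: "z \<in> S0" and D: "(f has_derivative D1) (at z within S0)" "(f has_derivative (D2 :: phase \<Rightarrow> real)) (at z within S0)"
  shows "D1 = D2"
proof (rule has_derivative_within_convex_unique[OF _ _ _ _ D])
  \<comment> \<open>The ball about \<open>snd z\<close> of radius \<open>norm (snd z)\<close> is a
    convex neighbourhood in the fibre that misses 0.\<close>
  let ?C = "MM \<times> ball (snd z) (norm (snd z))"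
  have n0: "snd z \<noteq> 0" "fst z \<in> MM" using z by (auto simp: S0_def)
  show "convex ?C" by (intro convex_Times) (auto simp: MM_def)
  show "?C \<subseteq> S0" by (auto simp: S0_def dist_norm)
  show "interior ?C \<noteq> {}" using n0 by (simp add: interior_Times MM_facts)
  show "z \<in> ?C" using n0 by (cases z) simp
qed

lemma C1_Omega_lincomb:
  assumes "u \<in> C1_Omega n" "v \<in> C1_Omega n"
  shows "(\<lambda>z. a * u z + b * v z) \<in> C1_Omega n"
    "z \<in> S0 \<Longrightarrow> hatD (\<lambda>z. a * u z + b * v z) z h = a * hatD u z h + b * hatD v z h"
proof -
  let ?w = "\<lambda>z. a * u z + b * v z"
  have hw: "hat ?w = (\<lambda>z. a * hat u z + b * hat v z)" by (simp add: hat_def fun_eq_iff)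
  have d: "(hat ?w has_derivative (\<lambda>h. a * hatD u z h + b * hatD v z h)) (at z within S0)" if "z \<in> S0" for z
    unfolding hw using assms that by (auto simp: C1_Omega_iff intro!: derivative_eq_intros)
  have e: "hatD ?w z = (\<lambda>h. a * hatD u z h + b * hatD v z h)" if "z \<in> S0" for z
  proof (rule S0_deriv_unique[OF that _ d[OF that]])
    show "(hat ?w has_derivative hatD ?w z) (at z within S0)"
      unfolding hatD_def using d[OF that] frechet_derivative_works differentiable_def by blast
  qed
  then show "z \<in> S0 \<Longrightarrow> hatD ?w z h = a * hatD u z h + b * hatD v z h" by simp
  have "continuous_on S0 (\<lambda>z. hatD ?w z h)" for h
    using e assms by (subst continuous_on_cong[OF refl, of _ _ "\<lambda>z. a * hatD u z h + b * hatD v z h"])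
      (auto intro!: continuous_intros C1_OmegaD(2) assms)
  then show "?w \<in> C1_Omega n" unfolding C1_Omega_iff using d e by auto
qed

lemma Omega_S0: "Omega n \<subseteq> S0"
  by (auto simp: Omega_iff S0_def)

lemma hat_Omega: "z \<in> Omega n \<Longrightarrow> hat w z = w z"
  by (cases z) (auto simp: hat_def to_Omega_eq Omega_iff)

lemma C1T_lincomb:
  assumes "u \<in> C1_Omega n" "v \<in> C1_Omega n" "z \<in> Omega n"
  shows "C1T (\<lambda>z. a * u z + b * v z) z = a *\<^sub>R C1T u z + b *\<^sub>R C1T v z"
  using C1_Omega_lincomb(2)[OF assms(1,2), of z] assms(3) Omega_S0
  by (auto simp: C1T_def prod_eq_iff vec_eq_iff)

lemma hat_continuous: "w \<in> C1_Omega n \<Longrightarrow> continuous_on S0 (hat w)"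
  unfolding C1_Omega_iff by (meson continuous_on_eq_continuous_within differentiable_def differentiable_imp_continuous_within)

lemma C1_continuous_Omega: "w \<in> C1_Omega n \<Longrightarrow> continuous_on (Omega n) w"
  using continuous_on_subset[OF hat_continuous Omega_S0] hat_Omega by (subst continuous_on_cong[OF refl hat_Omega[symmetric]]) auto

lemma C1T_continuous: assumes "w \<in> C1_Omega n" shows "continuous_on (Omega n) (C1T w)"
  unfolding C1T_def[abs_def]
  by (intro continuous_on_Pair C1_continuous_Omega continuous_on_vec_lambda assms
      continuous_on_subset[OF C1_OmegaD(2)[OF assms] Omega_S0])

lemma continuous_Omega_L2v:
  fixes U :: "phase \<Rightarrow> 'e::euclidean_space"
  assumes c: "continuous_on (Omega n) U" shows "U \<in> L2v (Sigma_measure n)"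
proof -
  have m: "U \<in> borel_measurable (Sigma_measure n)"
    unfolding measurable_cong_sets[OF sets_Sigma refl] by (rule borel_measurable_continuous_on_restrict[OF c])
  obtain B where B: "\<forall>y\<in>U ` Omega n. norm y \<le> B"
    using compact_imp_bounded[OF compact_continuous_image[OF c Omega_compact]] unfolding bounded_iff by blast
  have "integrable (Sigma_measure n) (\<lambda>z. (norm (U z))\<^sup>2)"
    by (rule Sig.integrable_const_bound[of _ "B\<^sup>2"]) (use B m in \<open>auto intro!: power_mono\<close>)
  then show ?thesis using m by (simp add: L2v_def)
qed

lemma test_dom_S0: "test_dom \<subseteq> S0" "z \<in> test_dom \<Longrightarrow> at z within S0 = at z"
proof -
  show s: "test_dom \<subseteq> S0" using interior_subset by (auto simp: test_dom_def S0_def)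
  show "z \<in> test_dom \<Longrightarrow> at z within S0 = at z"
    by (rule at_within_interior) (use interior_maximal[OF s test_dom_open] in blast)
qed

lemma hat_scale: "x \<in> MM \<Longrightarrow> 0 < t \<Longrightarrow> hat w (x, t *\<^sub>R \<xi>) = hat w (x, \<xi>)"
proof -
  assume x: "x \<in> MM" and t: "0 < t"
  have "inverse (n x * (t * r)) * t = inverse (n x * r) * (t * inverse t)" for r :: real
    unfolding inverse_mult_distrib by (simp only: mult_ac)
  then have "inverse (n x * (t * r)) * t = inverse (n x * r)" for r :: real using t by simp
  then have "(t *\<^sub>R \<xi>) /\<^sub>R (n x * norm (t *\<^sub>R \<xi>)) = \<xi> /\<^sub>R (n x * norm \<xi>)" using t by (simp only: scaleR_scaleR norm_scaleR abs_of_pos)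
  then show ?thesis using x by (simp only: hat_def o_def to_Omega_eq)
qed

text \<open>Degree 0 in \<xi> makes the \<open>x\<close>-derivatives homogeneous of degree 0 and the
  \<xi>-derivatives of degree -1; here lies the origin of the factor \<open>1 / gnorm\<close> in
  \<open>weak_derivs\<close>.\<close>

lemma hatD_homogeneous:
  assumes w: "w \<in> C1_Omega n" and z: "z \<in> test_dom"
  shows "hatD w z (v, h) = hatD w (to_Omega n z) (v, h /\<^sub>R (N (fst z) * norm (snd z)))"
proof -
  define t where "t = inverse (N (fst z) * norm (snd z))"
  have zz: "fst z \<in> interior MM" "snd z \<noteq> 0" and x: "fst z \<in> MM"
    using z interior_subset by (auto simp: test_dom_iff)
  have t: "t > 0" using zz N_simps(2)[of "fst z"] by (simp add: t_def)
  \<comment> \<open>The factor \<open>t\<close> is frozen at its value for \<open>z\<close>, so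
    \<open>m\<close> is linear and leaves \<open>hat w\<close> invariant. Differentiating through
    \<open>to_Omega n\<close> instead would bring in the dependence of its scaling on
    \<open>x\<close>.\<close>
  define m where "m y = (fst y, t *\<^sub>R snd y)" for y :: phase
  have mz: "m z = to_Omega n z" using to_Om_eq(1)[OF z] by (simp add: m_def to_Om_def t_def)
  have mtd: "m z \<in> test_dom" using zz t by (simp add: m_def test_dom_iff)
  have dm: "(m has_derivative m) (at z)"
    unfolding m_def[abs_def] by (auto intro!: derivative_eq_intros)
  have "(hat w has_derivative hatD w (m z)) (at (m z))"
    using w mtd test_dom_S0 unfolding C1_Omega_iff by (metis subsetD)
  then have "(hat w \<circ> m has_derivative hatD w (m z) \<circ> m) (at z)"
    using diff_chain_at[OF dm] by blast
  then have "(hat w has_derivative hatD w (m z) \<circ> m) (at z)"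
  proof (rule has_derivative_transform_within_open[OF _ test_dom_open z])
    fix y assume "y \<in> test_dom"
    then have "fst y \<in> MM" using interior_subset by (auto simp: test_dom_iff)
    then show "(hat w \<circ> m) y = hat w y" using hat_scale[OF _ t, of "fst y" w "snd y"] by (simp add: m_def)
  qed
  moreover have "(hat w has_derivative hatD w z) (at z)"
    using w z test_dom_S0 unfolding C1_Omega_iff by (metis subsetD)
  ultimately have "hatD w z = hatD w (m z) \<circ> m" by (rule has_derivative_unique[symmetric])
  then show ?thesis by (simp add: mz) (simp add: m_def t_def)
qed

lemma hat_line_deriv:
  assumes w: "w \<in> C1_Omega n" and z: "z \<in> test_dom"
  shows "((\<lambda>t. hat w (z + t *\<^sub>R b)) has_real_derivative hatD w z b) (at 0)"
proof (rule has_real_derivative_line)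
  show "(hat w has_derivative hatD w z) (at z)"
    using w z test_dom_S0 unfolding C1_Omega_iff by (metis subsetD)
qed

text \<open>Integration by parts for \<open>hat w * \<psi>\<close>, whose support is compact in
  \<open>test_dom\<close>; homogeneity then expresses the derivatives through their values on
  \<open>Omega n\<close>.\<close>

lemma C1T_WD: assumes w: "w \<in> C1_Omega n" shows "WD (C1T w)"
  unfolding WD_iff
proof (intro conjI allI impI)
  show L: "C1T w \<in> L2v (Sigma_measure n)" by (rule continuous_Omega_L2v[OF C1T_continuous[OF w]])
  note comp = L2v_components[OF L, THEN L2v_integrable(1)]
  fix \<psi> i assume t: "test_fun \<psi>"
  have C: "C1_on UNIV \<psi>" and K: "compact (closure {z. \<psi> z \<noteq> 0})" "closure {z. \<psi> z \<noteq> 0} \<subseteq> test_dom"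
    using t by (auto simp: test_fun_def)
  have zero: "(LINT z:test_dom|lborel. hat w z * frechet_derivative \<psi> (at z) b + hatD w z b * \<psi> z) = 0" for b
  proof (rule integral_directional_derivative_open(2)[OF test_dom_open K])
    show "hat w z * \<psi> z = 0" if "z \<notin> closure {z. \<psi> z \<noteq> 0}" for z
      using that closure_subset[of "{z. \<psi> z \<noteq> 0}"] by auto
    have c: "continuous_on test_dom \<psi>" "continuous_on test_dom (hat w)" "continuous_on test_dom (\<lambda>z. hatD w z b)"
      using continuous_on_subset[OF C1_on_UNIV_continuous[OF C]] continuous_on_subset[OF hat_continuous[OF w] test_dom_S0(1)]
        continuous_on_subset[OF C1_OmegaD(2)[OF w] test_dom_S0(1)] by auto
    have c': "continuous_on test_dom (\<lambda>z. frechet_derivative \<psi> (at z) b)"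
      using C unfolding C1_on_def by (blast intro: continuous_on_subset)
    show "continuous_on test_dom (\<lambda>z. hat w z * \<psi> z)" using c by (intro continuous_intros)
    show "continuous_on test_dom (\<lambda>z. hat w z * frechet_derivative \<psi> (at z) b + hatD w z b * \<psi> z)"
      using c c' by (intro continuous_intros)
    show "((\<lambda>s. hat w (z + s *\<^sub>R b) * \<psi> (z + s *\<^sub>R b)) has_real_derivative hat w z * frechet_derivative \<psi> (at z) b + hatD w z b * \<psi> z) (at 0)"
      if z: "z \<in> test_dom" for z
    proof -
      have "\<psi> differentiable (at z)" using C unfolding C1_on_def by blast
      then have "(\<psi> has_derivative frechet_derivative \<psi> (at z)) (at z)" by (simp add: frechet_derivative_works)
      note has_real_derivative_line[OF this]
      from DERIV_mult[OF hat_line_deriv[OF w z] this] show ?thesis by (simp add: algebra_simps)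
    qed
  qed
  have sum0: "pairing f g + pairing f' g' = 0"
    if adm: "adm g" "adm g'" and int: "integrable (Sigma_measure n) f" "integrable (Sigma_measure n) f'"
      and eq: "\<And>z. z \<in> test_dom \<Longrightarrow> f (to_Omega n z) * g z + f' (to_Omega n z) * g' z = hat w z * frechet_derivative \<psi> (at z) b + hatD w z b * \<psi> z"
    for f g f' g' b
  proof -
    have "pairing f g + pairing f' g' = (LINT z:test_dom|lborel. f (to_Omega n z) * g z + f' (to_Omega n z) * g' z)"
    proof -
      have "set_integrable lborel test_dom (\<lambda>z. f (to_Omega n z) * g z)" by (rule pairing_integrable[OF adm(1) int(1)])
      moreover have "set_integrable lborel test_dom (\<lambda>z. f' (to_Omega n z) * g' z)" by (rule pairing_integrable[OF adm(2) int(2)])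
      ultimately show ?thesis unfolding pairing_def by (rule set_integral_add(2)[symmetric])
    qed
    also have "\<dots> = (LINT z:test_dom|lborel. hat w z * frechet_derivative \<psi> (at z) b + hatD w z b * \<psi> z)"
      by (rule set_lebesgue_integral_cong) (use eq in auto)
    finally show ?thesis using zero by simp
  qed
  have sc: "hatD w y (t *\<^sub>R v) = t * hatD w y v" if "y \<in> S0" for y t v
  proof -
    have "linear (hatD w y)" using w that unfolding C1_Omega_iff by (metis has_derivative_linear)
    then show ?thesis using linear_scale by fastforce
  qed
  have td: "to_Omega n z \<in> S0" if "z \<in> test_dom" for z using to_Om_eq[OF that] Omega_S0 by auto
  have "pairing (\<lambda>z. fst (C1T w z)) (\<lambda>z. frechet_derivative \<psi> (at z) (axis i 1, 0)) + pairing (\<lambda>z. fst (snd (C1T w z)) $ i) \<psi> = 0"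
    by (rule sum0[OF test_fun_adm(2,1)[OF t] comp(1,2), where b="(axis i 1, 0)"])
       (simp add: C1T_def hatD_homogeneous[OF w] hat_def)
  then show "pairing (\<lambda>z. fst (C1T w z)) (\<lambda>z. frechet_derivative \<psi> (at z) (axis i 1, 0)) = - pairing (\<lambda>z. fst (snd (C1T w z)) $ i) \<psi>"
    by linarith
  have "pairing (\<lambda>z. fst (C1T w z)) (\<lambda>z. frechet_derivative \<psi> (at z) (0, axis i 1)) + pairing (\<lambda>z. snd (snd (C1T w z)) $ i) (\<lambda>z. \<psi> z / (N (fst z) * norm (snd z))) = 0"
  proof (rule sum0[OF test_fun_adm(2,3)[OF t] comp(1,3), where b="(0, axis i 1)"])
    fix z assume z: "z \<in> test_dom"
    have "hatD w z (0, axis i 1) = hatD w (to_Omega n z) (inverse (N (fst z) * norm (snd z)) *\<^sub>R (0, axis i 1))"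
      by (simp add: hatD_homogeneous[OF w z])
    also have "\<dots> = hatD w (to_Omega n z) (0, axis i 1) / (N (fst z) * norm (snd z))"
      unfolding sc[OF td[OF z]] by (simp add: divide_inverse)
    finally show "fst (C1T w (to_Omega n z)) * frechet_derivative \<psi> (at z) (0, axis i 1) +
        snd (snd (C1T w (to_Omega n z))) $ i * (\<psi> z / (N (fst z) * norm (snd z))) =
      hat w z * frechet_derivative \<psi> (at z) (0, axis i 1) + hatD w z (0, axis i 1) * \<psi> z"
      by (simp add: C1T_def hat_def)
  qed
  then show "pairing (\<lambda>z. fst (C1T w z)) (\<lambda>z. frechet_derivative \<psi> (at z) (0, axis i 1)) =
        - pairing (\<lambda>z. snd (snd (C1T w z)) $ i) (\<lambda>z. \<psi> z / (N (fst z) * norm (snd z)))" by linarith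
qed

end

section \<open>Liouville's theorem for the geodesic field\<close>

context refractive_index begin

lemma transfer_integral_nonneg:
  assumes f: "integrable (Sigma_measure n) f" "\<And>z. 0 \<le> f z"
    and e: "\<eta> \<in> borel_measurable borel" "integrable lborel (\<lambda>r. r\<^sup>2 * indicator {0<..} r * \<eta> r)" "\<And>r. 0 \<le> \<eta> r"
  shows "has_bochner_integral lborel (\<lambda>z. indicator test_dom z * (N (fst z) ^ 3 * \<eta> (norm (snd z)) * f (to_Omega n z)))
     ((LINT r|lborel. r\<^sup>2 * indicator {0<..} r * \<eta> r) * (LINT z|Sigma_measure n. f z))"
proof -
  let ?f = "\<lambda>z. indicator test_dom z * (N (fst z) ^ 3 * \<eta> (norm (snd z)) * f (to_Omega n z))"
  note [measurable] = e(1)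
  have fm: "f \<in> borel_measurable (Sigma_measure n)" using f by auto
  have [measurable]: "(\<lambda>z. indicator test_dom z * f (to_Omega n z)) \<in> borel_measurable borel" by (rule to_Omega_measurable[OF fm])
  have eq: "?f = (\<lambda>z. N (fst z) ^ 3 * \<eta> (norm (snd z)) * (indicator test_dom z * f (to_Omega n z)))" by (rule ext) (simp only: mult_ac)
  have m: "?f \<in> borel_measurable lborel" unfolding eq by measurable
  have nn: "0 \<le> ?f z" for z using f(2) e(3) N_simps(2)[of "fst z"] by simp
  have "(\<integral>\<^sup>+z. ennreal (?f z) \<partial>lborel) = (\<integral>\<^sup>+z. indicator test_dom z * ennreal (N (fst z) ^ 3) * ennreal (\<eta> (norm (snd z))) * ennreal (f (to_Omega n z)) \<partial>lborel)"
  proof (rule nn_integral_cong)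
    fix z :: phase
    have "0 \<le> N (fst z) ^ 3" using N_simps(2)[of "fst z"] by simp
    then show "ennreal (?f z) = indicator test_dom z * ennreal (N (fst z) ^ 3) * ennreal (\<eta> (norm (snd z))) * ennreal (f (to_Omega n z))"
      using f(2) e(3) by (cases "z \<in> test_dom") (simp_all add: ennreal_mult)
  qed
  also have "\<dots> = (\<integral>\<^sup>+r. ennreal (r\<^sup>2) * indicator {0<..} r * ennreal (\<eta> r) \<partial>lborel) * (\<integral>\<^sup>+z. ennreal (f z) \<partial>Sigma_measure n)"
    by (rule transfer_nn) (use fm in auto)
  also have "(\<integral>\<^sup>+r. ennreal (r\<^sup>2) * indicator {0<..} r * ennreal (\<eta> r) \<partial>lborel) = (\<integral>\<^sup>+r. ennreal (r\<^sup>2 * indicator {0<..} r * \<eta> r) \<partial>lborel)"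
    by (rule nn_integral_cong) (auto simp: indicator_def ennreal_mult')
  also have "\<dots> = ennreal (LINT r|lborel. r\<^sup>2 * indicator {0<..} r * \<eta> r)"
    using e by (intro nn_integral_eq_integral) auto
  also have "(\<integral>\<^sup>+z. ennreal (f z) \<partial>Sigma_measure n) = ennreal (LINT z|Sigma_measure n. f z)"
    using f by (intro nn_integral_eq_integral) auto
  also have "ennreal (LINT r|lborel. r\<^sup>2 * indicator {0<..} r * \<eta> r) * ennreal (LINT z|Sigma_measure n. f z) =
    ennreal ((LINT r|lborel. r\<^sup>2 * indicator {0<..} r * \<eta> r) * (LINT z|Sigma_measure n. f z))"
    using f(2) e(3) by (intro ennreal_mult[symmetric] integral_nonneg_AE) auto
  finally show ?thesis
    by (intro has_bochner_integral_nn_integral[OF m] AE_I2 nn mult_nonneg_nonneg integral_nonneg_AE)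
       (use f(2) e(3) in simp_all)
qed

text \<open>Both \<open>f\<close> and the weight are split into positive and negative parts, because
  a weight of changing sign, with radial mass 0, is inserted later.\<close>

lemma transfer_integral:
  assumes f: "integrable (Sigma_measure n) f"
    and e: "\<eta> \<in> borel_measurable borel" "integrable lborel (\<lambda>r. r\<^sup>2 * indicator {0<..} r * \<eta> r)"
  shows "has_bochner_integral lborel (\<lambda>z. indicator test_dom z * (N (fst z) ^ 3 * \<eta> (norm (snd z)) * f (to_Omega n z)))
     ((LINT r|lborel. r\<^sup>2 * indicator {0<..} r * \<eta> r) * (LINT z|Sigma_measure n. f z))"
proof -
  define I where "I \<eta> = (LINT r|lborel. r\<^sup>2 * indicator {0<..} r * \<eta> r)" for \<eta> :: "real \<Rightarrow> real"
  define J where "J f = (LINT z|Sigma_measure n. f z)" for f :: "phase \<Rightarrow> real"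
  define T where "T \<eta> f z = indicator test_dom z * (N (fst z) ^ 3 * \<eta> (norm (snd z)) * f (to_Omega n z))" for \<eta> f z
  let ?fp = "\<lambda>z. max 0 (f z)" and ?fm = "\<lambda>z. max 0 (- f z)" and ?ep = "\<lambda>r. max 0 (\<eta> r)" and ?em = "\<lambda>r. max 0 (- \<eta> r)"
  note [measurable] = e(1)
  have fi: "integrable (Sigma_measure n) ?fp" "integrable (Sigma_measure n) ?fm" using f by auto
  have ei: "integrable lborel (\<lambda>r. r\<^sup>2 * indicator {0<..} r * ?ep r)" "integrable lborel (\<lambda>r. r\<^sup>2 * indicator {0<..} r * ?em r)"
    by (rule Bochner_Integration.integrable_bound[OF e(2)]; auto simp: abs_mult intro!: mult_left_mono)+
  have *: "has_bochner_integral lborel (T \<mu> g) (I \<mu> * J g)" if "\<mu> \<in> {?ep, ?em}" "g \<in> {?fp, ?fm}" for \<mu> g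
    unfolding T_def I_def J_def using that fi ei
    by (intro transfer_integral_nonneg) auto
  have "has_bochner_integral lborel (\<lambda>z. (T ?ep ?fp z - T ?ep ?fm z) - (T ?em ?fp z - T ?em ?fm z))
     ((I ?ep * J ?fp - I ?ep * J ?fm) - (I ?em * J ?fp - I ?em * J ?fm))"
    by (intro has_bochner_integral_diff *) auto
  moreover have "(T ?ep ?fp z - T ?ep ?fm z) - (T ?em ?fp z - T ?em ?fm z) = T \<eta> f z" for z
  proof -
    have dec: "max 0 x - max 0 (- x) = x" for x :: real by simp
    have "T \<eta> f z = indicator test_dom z * (N (fst z) ^ 3 * (?ep (norm (snd z)) - ?em (norm (snd z))) * (?fp (to_Omega n z) - ?fm (to_Omega n z)))"
      by (simp only: T_def dec)
    then show ?thesis by (simp add: T_def algebra_simps)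
  qed
  moreover have "(I ?ep * J ?fp - I ?ep * J ?fm) - (I ?em * J ?fp - I ?em * J ?fm) = (I ?ep - I ?em) * (J ?fp - J ?fm)"
    by (simp add: algebra_simps)
  moreover have "J ?fp - J ?fm = J f"
    unfolding J_def by (subst Bochner_Integration.integral_diff[OF fi, symmetric]) (intro Bochner_Integration.integral_cong, auto)
  moreover have "I ?ep - I ?em = I \<eta>"
    unfolding I_def by (subst Bochner_Integration.integral_diff[OF ei, symmetric]) (intro Bochner_Integration.integral_cong, auto simp: indicator_def max_def)
  ultimately show ?thesis by (simp add: T_def I_def J_def)
qed

section \<open>The geodesic vector field on homogeneous extensions\<close>

definition grad :: "vec3 \<Rightarrow> vec3" where "grad x = (\<chi> i. partial n i x)"

lemma grad_continuous: "continuous_on MM grad"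
  unfolding grad_def[abs_def] partial_def
  using n_C1 unfolding C1_on_def by (intro continuous_on_vec_lambda) blast

text \<open>\<open>Hop\<close> is the geodesic vector field \<open>\<xi>\<^sub>i \<partial>u/\<partial>x\<^sub>i - \<Gamma>\<^sub>i\<^sub>j\<^sup>k \<xi>\<^sub>i \<xi>\<^sub>j \<partial>u/\<partial>\<xi>\<^sub>k\<close> acting on triples.\<close>

definition ccoef :: "phase \<Rightarrow> vec3" where
  "ccoef z = ((snd z \<bullet> snd z) *\<^sub>R grad (fst z) - (2 * (grad (fst z) \<bullet> snd z)) *\<^sub>R snd z) /\<^sub>R n (fst z)"

definition Hop :: "phase \<Rightarrow> real \<times> vec3 \<times> vec3 \<Rightarrow> real" where
  "Hop z T = fst (snd T) \<bullet> snd z + snd (snd T) \<bullet> ccoef z"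

text \<open>Contracting the Christoffel symbols twice with \<xi> gives
  \<open>(2 (grad n . \<xi>) \<xi> - |\<xi>|^2 grad n) / n\<close>, which is the negative of
  \<open>ccoef\<close>.\<close>

lemma Christoffel_contract:
  "(\<Sum>i\<in>UNIV. \<Sum>j\<in>UNIV. \<Sum>k\<in>UNIV. Christoffel n i j k (fst z) * snd z $ i * snd z $ j * q $ k) = - (q \<bullet> ccoef z)"
  unfolding Christoffel_def ccoef_def grad_def kron_def sum_3 inner_vec_def
  by (simp add: divide_inverse algebra_simps)

lemma ccoef_continuous: "continuous_on (Omega n) ccoef"
proof -
  have "continuous_on (Omega n) (\<lambda>z. grad (fst z))" "continuous_on (Omega n) (\<lambda>z. n (fst z))"
    by (rule continuous_on_compose2[OF grad_continuous] continuous_on_compose2[OF n_cont];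
        auto intro!: continuous_intros simp: Omega_iff)+
  then show ?thesis unfolding ccoef_def[abs_def]
    by (intro continuous_intros) (use n_pos in \<open>auto simp: Omega_iff less_imp_neq[THEN not_sym]\<close>)
qed

lemma hatD_linear: "w \<in> C1_Omega n \<Longrightarrow> z \<in> S0 \<Longrightarrow> linear (hatD w z)"
  using C1_OmegaD(1) has_derivative_linear by blast

lemma vec3_expand: "(v :: vec3) = (\<Sum>i\<in>UNIV. v $ i *\<^sub>R axis i 1)"
  by (simp add: vec_eq_iff axis_def if_distrib cong: if_cong)

lemma hatD_sum:
  assumes w: "w \<in> C1_Omega n" and z: "z \<in> S0"
  shows "(\<Sum>i\<in>UNIV. v $ i * hatD w z (axis i 1, 0)) = hatD w z (v, 0)"
    "(\<Sum>i\<in>UNIV. v $ i * hatD w z (0, axis i 1)) = hatD w z (0, v)"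
proof -
  note L = hatD_linear[OF w z]
  have "(v, 0) = (\<Sum>i\<in>UNIV. v $ i *\<^sub>R (axis i 1, 0 :: vec3))"
    by (simp add: sum_prod prod_eq_iff fst_sum snd_sum vec3_expand[symmetric])
  then show "(\<Sum>i\<in>UNIV. v $ i * hatD w z (axis i 1, 0)) = hatD w z (v, 0)"
    by (simp only: linear_sum[OF L] linear_scale[OF L] real_scaleR_def)
  have "(0, v) = (\<Sum>i\<in>UNIV. v $ i *\<^sub>R (0 :: vec3, axis i 1))"
    by (simp add: sum_prod prod_eq_iff fst_sum snd_sum vec3_expand[symmetric])
  then show "(\<Sum>i\<in>UNIV. v $ i * hatD w z (0, axis i 1)) = hatD w z (0, v)"
    by (simp only: linear_sum[OF L] linear_scale[OF L] real_scaleR_def)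
qed

text \<open>Euler's relation for degree 0: \<open>hat w\<close> is constant along rays in the
  fibre.\<close>

lemma hatD_Euler:
  assumes w: "w \<in> C1_Omega n" and z: "z \<in> test_dom"
  shows "hatD w z (0, snd z) = 0"
proof -
  have x: "fst z \<in> MM" using z interior_subset by (auto simp: test_dom_iff)
  have "((\<lambda>t. hat w (z + t *\<^sub>R (0, snd z))) has_real_derivative 0) (at 0)"
  proof (rule has_field_derivative_transform_within_open[of "\<lambda>_. hat w z" _ _ "{-1<..}"])
    fix t :: real assume "t \<in> {-1<..}"
    then have "hat w (fst z, (1 + t) *\<^sub>R snd z) = hat w (fst z, snd z)" using x by (intro hat_scale) auto
    moreover have "z + t *\<^sub>R (0, snd z) = (fst z, (1 + t) *\<^sub>R snd z)" by (simp add: prod_eq_iff algebra_simps)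
    ultimately show "hat w z = hat w (z + t *\<^sub>R (0, snd z))" by simp
  qed auto
  then show ?thesis using hat_line_deriv[OF w z, of "(0, snd z)"] DERIV_unique by blast
qed

text \<open>The component of \<open>ccoef\<close> along \<xi> is killed by Euler's relation. After
  multiplication by the density of \<open>Sigma_measure\<close>, the \<open>x\<close>-part of the
  remaining field involves \<open>n\<close> but not its gradient, so each part can be differentiated
  in its own variable.\<close>

lemma Hop_to_Omega:
  assumes w: "w \<in> C1_Omega n" and z: "z \<in> test_dom"
  shows "N (fst z) ^ 3 * Hop (to_Omega n z) (C1T w (to_Omega n z)) =
    (n (fst z))\<^sup>2 / norm (snd z) * hatD w z (snd z, 0) + n (fst z) * norm (snd z) * hatD w z (0, grad (fst z))"
proof -
  define x where "x = fst z"
  define \<xi> where "\<xi> = snd z"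
  define r where "r = norm \<xi>"
  define y where "y = to_Omega n z"
  have x: "x \<in> MM" and xi: "\<xi> \<noteq> 0" using z interior_subset by (auto simp: test_dom_iff x_def \<xi>_def)
  have n0: "n x > 0" "N x = n x" using n_pos x N_simps by auto
  have r: "r > 0" using xi by (simp add: r_def)
  have y: "y = (x, \<xi> /\<^sub>R (n x * r))" using to_Om_eq(1)[OF z] n0 by (simp add: y_def to_Om_def x_def \<xi>_def r_def)
  have yS: "y \<in> S0" "z \<in> S0" using to_Om_eq[OF z] Omega_S0 test_dom_S0(1) z by (auto simp: y_def)
  note L = hatD_linear[OF w yS(1)] and Lz = hatD_linear[OF w yS(2)]
  have hom1: "hatD w y (v, 0) = hatD w z (v, 0)" for v
    using hatD_homogeneous[OF w z, of v 0] by (simp add: y_def)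
  have hom2: "hatD w y (0, v) = n x * r * hatD w z (0, v)" for v
  proof -
    have "hatD w z (0, v) = hatD w y (inverse (n x * r) *\<^sub>R (0, v))"
      using hatD_homogeneous[OF w z, of 0 v] n0 by (simp add: y_def x_def \<xi>_def r_def)
    also have "\<dots> = inverse (n x * r) * hatD w y (0, v)" by (simp only: linear_scale[OF L] real_scaleR_def)
    finally show ?thesis using n0 r by (simp add: field_simps)
  qed
  have p: "fst (snd (C1T w y)) \<bullet> v = hatD w y (v, 0)" for v
    using hatD_sum(1)[OF w yS(1), of v] by (simp add: C1T_def inner_vec_def mult.commute)
  have q: "snd (snd (C1T w y)) \<bullet> v = hatD w y (0, v)" for v
    using hatD_sum(2)[OF w yS(1), of v] by (simp add: C1T_def inner_vec_def mult.commute)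
  have sz1: "hatD w z (v /\<^sub>R c, 0) = hatD w z (v, 0) / c" for v c
    using linear_scale[OF Lz, of "inverse c" "(v, 0)"] by (simp add: divide_inverse mult.commute)
  have sy: "snd y = \<xi> /\<^sub>R (n x * r)" by (simp add: y)
  have "snd y \<bullet> snd y = 1 / (n x)\<^sup>2"
    using n0 r by (simp add: y flip: power2_norm_eq_inner) (simp add: r_def field_simps power2_eq_square)
  then have c: "ccoef y = (inverse (n x) ^ 3) *\<^sub>R grad x - (2 * (grad x \<bullet> snd y) / (n x * (n x * r))) *\<^sub>R \<xi>"
    unfolding ccoef_def by (simp add: y scaleR_diff_right divide_inverse power3_eq_cube power2_eq_square mult_ac)
  have "hatD w z (0, ccoef y) = hatD w z ((inverse (n x) ^ 3) *\<^sub>R (0, grad x) - (2 * (grad x \<bullet> snd y) / (n x * (n x * r))) *\<^sub>R (0, \<xi>))"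
    by (simp add: c)
  also have "\<dots> = inverse (n x) ^ 3 * hatD w z (0, grad x)"
    using hatD_Euler[OF w z] by (simp only: linear_diff[OF Lz] linear_scale[OF Lz] \<xi>_def[symmetric] real_scaleR_def mult_zero_right diff_zero)
  finally have c': "hatD w z (0, ccoef y) = inverse (n x) ^ 3 * hatD w z (0, grad x)" .
  have "Hop y (C1T w y) = hatD w z (\<xi>, 0) / (n x * r) + n x * r * (inverse (n x) ^ 3 * hatD w z (0, grad x))"
    by (simp only: Hop_def p q hom2 c' hom1 sy sz1)
  moreover have "(n x) ^ 3 * (A / (n x * r) + n x * r * (inverse (n x) ^ 3 * B)) = (n x)\<^sup>2 / r * A + n x * r * B" for A B
    using n0(1) r by (simp add: field_simps power2_eq_square power3_eq_cube)
  ultimately have "N x ^ 3 * Hop y (C1T w y) = (n x)\<^sup>2 / r * hatD w z (\<xi>, 0) + n x * r * hatD w z (0, grad x)"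
    by (simp only: n0(2))
  then show ?thesis unfolding x_def y_def \<xi>_def r_def .
qed

text \<open>A weight living on the annulus \<open>1 \<le> r \<le> 2\<close>, which keeps integrands
  compactly supported in \<xi> and away from the singularity at \<xi> = 0.\<close>

definition eta :: "real \<Rightarrow> real" where "eta r = sqpos (r - 1) * sqpos (2 - r)"

definition eta' :: "real \<Rightarrow> real" where
  "eta' r = 2 * max 0 (r - 1) * sqpos (2 - r) - sqpos (r - 1) * (2 * max 0 (2 - r))"

lemma eta_deriv: "(eta has_real_derivative eta' r) (at r)"
proof -
  have 1: "((\<lambda>r. sqpos (r - 1)) has_real_derivative 2 * max 0 (r - 1) * 1) (at r)"
    by (rule DERIV_chain2[OF sqpos_deriv]) (auto intro!: derivative_eq_intros)
  have 2: "((\<lambda>r. sqpos (2 - r)) has_real_derivative 2 * max 0 (2 - r) * (-1)) (at r)"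
    by (rule DERIV_chain2[OF sqpos_deriv]) (auto intro!: derivative_eq_intros)
  show ?thesis
    using DERIV_mult[OF 1 2] unfolding eta_def[abs_def] eta'_def by (simp add: algebra_simps)
qed

lemma eta_cont: "continuous_on S eta" "continuous_on S eta'"
  unfolding eta_def[abs_def] eta'_def[abs_def]
  by (intro continuous_intros continuous_on_compose2[OF sqpos_continuous[of UNIV]]; simp)+

lemma eta_supp: "r \<notin> {1..2} \<Longrightarrow> eta r = 0" "r \<notin> {1..2} \<Longrightarrow> eta' r = 0" "0 \<le> eta r"
  by (auto simp: eta_def eta'_def sqpos_simps not_le max_def)

lemma integrable_continuous_supp:
  fixes f :: "real \<Rightarrow> real"
  assumes "continuous_on UNIV f" "\<And>r. r \<notin> {1..2} \<Longrightarrow> f r = 0"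
  shows "integrable lborel f"
proof -
  have "integrable lborel (\<lambda>r. indicator {1..2} r *\<^sub>R f r)"
    by (rule borel_integrable_compact) (use continuous_on_subset[OF assms(1)] in auto)
  moreover have "(\<lambda>r. indicator {1..2} r *\<^sub>R f r) = f" using assms(2) by (auto simp: indicator_def fun_eq_iff)
  ultimately show ?thesis by simp
qed

lemma eta_mass: "0 < (LINT r|lborel. r\<^sup>2 * indicator {0<..} r * eta r)"
  "integrable lborel (\<lambda>r. r\<^sup>2 * indicator {0<..} r * eta r)"
proof -
  have e: "(\<lambda>r. r\<^sup>2 * indicator {0<..} r * eta r) = (\<lambda>r. r\<^sup>2 * eta r)"
    using eta_supp(1) by (auto simp: fun_eq_iff indicator_def)
  have i: "integrable lborel (\<lambda>r. r\<^sup>2 * eta r)"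
    by (rule integrable_continuous_supp) (auto intro!: continuous_intros eta_cont simp: eta_supp(1))
  then show "integrable lborel (\<lambda>r. r\<^sup>2 * indicator {0<..} r * eta r)" unfolding e .
  have "(LINT r|lborel. r\<^sup>2 * eta r) \<noteq> 0"
  proof
    assume "(LINT r|lborel. r\<^sup>2 * eta r) = 0"
    then have "AE r in lborel. r\<^sup>2 * eta r = 0"
      using integral_nonneg_eq_0_iff_AE[OF i] eta_supp(3) by auto
    then have "AE r in lborel. r \<notin> {1<..<2::real}"
      by eventually_elim (auto simp: eta_def sqpos_def)
    then have "{1<..<2::real} \<in> null_sets lborel" by (subst AE_iff_null_sets) auto
    then have "emeasure lborel {1<..<2::real} = 0" by blast
    then show False by simp
  qed
  moreover have "0 \<le> (LINT r|lborel. r\<^sup>2 * eta r)" by (intro integral_nonneg_AE) (simp add: eta_supp(3))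
  ultimately show "0 < (LINT r|lborel. r\<^sup>2 * indicator {0<..} r * eta r)" unfolding e by linarith
qed

text \<open>The integrand is \<open>(r\<^sup>3 eta r)'\<close>.\<close>

lemma eta_cancel: "(LINT r|lborel. r\<^sup>2 * indicator {0<..} r * (3 * eta r + r * eta' r)) = 0"
  "integrable lborel (\<lambda>r. r\<^sup>2 * indicator {0<..} r * (3 * eta r + r * eta' r))"
proof -
  have e: "(\<lambda>r. r\<^sup>2 * indicator {0<..} r * (3 * eta r + r * eta' r)) = (\<lambda>r. r\<^sup>2 * (3 * eta r + r * eta' r))"
    using eta_supp(1,2) by (auto simp: fun_eq_iff indicator_def)
  have d: "((\<lambda>t. (r + t) ^ 3 * eta (r + t)) has_real_derivative r\<^sup>2 * (3 * eta r + r * eta' r)) (at 0)" for r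
  proof -
    have "((\<lambda>t. eta (r + t)) has_real_derivative eta' (r + 0) * 1) (at 0)"
      by (rule DERIV_chain2[OF eta_deriv]) (auto intro!: derivative_eq_intros)
    moreover have "((\<lambda>t. (r + t) ^ 3) has_real_derivative 3 * r\<^sup>2) (at 0)" by (auto intro!: derivative_eq_intros)
    ultimately show ?thesis by (auto intro!: derivative_eq_intros simp: algebra_simps power3_eq_cube power2_eq_square)
  qed
  have "set_integrable lborel UNIV (\<lambda>r. r\<^sup>2 * (3 * eta r + r * eta' r)) \<and> (LINT r:UNIV|lborel. r\<^sup>2 * (3 * eta r + r * eta' r)) = 0"
    by (intro conjI integral_directional_derivative_open[where K="{1..2}" and G="\<lambda>r. r ^ 3 * eta r" and b=1])
       (auto intro!: d continuous_intros eta_cont simp: eta_supp)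
  then show "(LINT r|lborel. r\<^sup>2 * indicator {0<..} r * (3 * eta r + r * eta' r)) = 0"
    "integrable lborel (\<lambda>r. r\<^sup>2 * indicator {0<..} r * (3 * eta r + r * eta' r))"
    unfolding e by (simp_all add: set_integrable_def set_lebesgue_integral_def)
qed


text \<open>This is the invariance of \<open>d\<Sigma>\<close> under the geodesic flow. Integration by parts in \<open>x\<close> of \<open>G\<close> and in
  \<open>\<xi>\<close> of \<open>L\<close> differentiates the coefficients as well; the terms with the gradient of \<open>n\<close> have the radial
  weights \<open>2 eta r\<close> and \<open>eta r + r eta' r\<close>, whose sum has integral \<open>0\<close> by \<open>eta_cancel\<close>.\<close>

lemma cut_identity:
  assumes w: "w \<in> C1_Omega n" and chi: "\<And>x. (\<chi>' has_derivative (\<lambda>h. g x \<bullet> h)) (at x)" and g: "continuous_on UNIV g"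
    and del: "0 < \<delta>" and supp: "\<And>x. 1 - \<delta> < norm x \<Longrightarrow> \<chi>' x = 0"
  shows "(LINT z|Sigma_measure n. \<chi>' (fst z) * (Hop z (C1T w z) * w z)) =
    - (LINT z|Sigma_measure n. (snd z \<bullet> g (fst z)) * (w z)\<^sup>2) / 2"
proof -
  \<comment> \<open>\<open>\<chi>'\<close> is the cut-off itself and \<open>g\<close> its gradient;
    the prime does not denote a derivative.\<close>
  let ?S = "Sigma_measure n"
  let ?x = "\<lambda>z::phase. fst z" and ?k = "\<lambda>z::phase. snd z" and ?r = "\<lambda>z::phase. norm (snd z)"
  define ex where "ex i = (axis i 1 :: vec3, 0 :: vec3)" for i
  define ek where "ek i = (0 :: vec3, axis i 1 :: vec3)" for i
  \<comment> \<open>\<open>G\<close> and \<open>L\<close> are the components in \<open>x\<close> and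
    in \<xi> of the field from \<open>Hop_to_Omega\<close>, multiplied by the radial weight, the
    cut-off and \<open>w^2 / 2\<close>; the half comes from \<open>w dw = d(w^2) / 2\<close>.
    \<open>G'\<close> and \<open>L'\<close> are their derivatives in the matching
    coordinate.\<close>
  define G where "G i z = eta (?r z) / ?r z * ?k z $ i / 2 * (\<chi>' (?x z) * (n (?x z))\<^sup>2 * (hat w z)\<^sup>2)" for i z
  define G' where "G' i z = eta (?r z) / ?r z * ?k z $ i / 2 * ((g (?x z) $ i * (n (?x z))\<^sup>2 + 2 * \<chi>' (?x z) * n (?x z) * grad (?x z) $ i) * (hat w z)\<^sup>2
      + \<chi>' (?x z) * (n (?x z))\<^sup>2 * (2 * hat w z * hatD w z (ex i)))" for i z
  define L where "L i z = \<chi>' (?x z) * n (?x z) * grad (?x z) $ i / 2 * (?r z * eta (?r z) * (hat w z)\<^sup>2)" for i z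
  define L' where "L' i z = \<chi>' (?x z) * n (?x z) * grad (?x z) $ i / 2 * ((?k z $ i / ?r z * eta (?r z) + ?r z * (eta' (?r z) * (?k z $ i / ?r z))) * (hat w z)\<^sup>2
      + ?r z * eta (?r z) * (2 * hat w z * hatD w z (ek i)))" for i z
  \<comment> \<open>The cut-off confines \<open>x\<close> to a smaller ball and \<open>eta\<close>
    confines \<xi> to an annulus, so the products have compact support inside
    \<open>test_dom\<close>.\<close>
  define K where "K = cball (0::vec3) (1 - \<delta>) \<times> (cball (0::vec3) 2 - ball 0 1)"
  have K: "compact K" "K \<subseteq> test_dom"
  proof -
    show "compact K" unfolding K_def by (intro compact_Times compact_cball compact_diff) auto
    show "K \<subseteq> test_dom" using del by (auto simp: K_def test_dom_iff MM_facts)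
  qed
  have notK: "\<chi>' (?x z) = 0 \<or> eta (?r z) = 0" if "z \<notin> K" for z
    using that supp[of "?x z"] eta_supp(1)[of "?r z"] by (cases z) (auto simp: K_def not_le not_less)
  have tdx: "?x z \<in> MM" "?x z \<in> interior MM" "?k z \<noteq> 0" if "z \<in> test_dom" for z
    using that interior_subset by (auto simp: test_dom_iff)
  have cn: "continuous_on test_dom (\<lambda>z. n (?x z))" "continuous_on test_dom (\<lambda>z. grad (?x z))"
    by (rule continuous_on_compose2[OF n_cont] continuous_on_compose2[OF grad_continuous]; use tdx in \<open>auto intro!: continuous_intros\<close>)+
  have cchi: "continuous_on UNIV \<chi>'"
    using chi has_derivative_continuous continuous_at_imp_continuous_on by blast
  have cx: "continuous_on test_dom (\<lambda>z. g (?x z))" "continuous_on test_dom (\<lambda>z. \<chi>' (?x z))"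
    by (rule continuous_on_compose2[OF g] continuous_on_compose2[OF cchi]; auto intro!: continuous_intros)+
  have ce: "continuous_on test_dom (\<lambda>z. eta (?r z))" "continuous_on test_dom (\<lambda>z. eta' (?r z))"
    by (rule continuous_on_compose2[OF eta_cont(1)[of UNIV]] continuous_on_compose2[OF eta_cont(2)[of UNIV]]; auto intro!: continuous_intros)+
  have ch: "continuous_on test_dom (hat w)" "continuous_on test_dom (\<lambda>z. hatD w z b)" for b
    by (rule continuous_on_subset[OF hat_continuous[OF w] test_dom_S0(1)] continuous_on_subset[OF C1_OmegaD(2)[OF w] test_dom_S0(1)])+
  have r0: "\<forall>z\<in>test_dom. ?r z \<noteq> 0" using tdx by auto
  have three: "((\<lambda>t. k * (a t * (b t)\<^sup>2 * (c t)\<^sup>2)) has_real_derivative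
       k * ((a' * (b 0)\<^sup>2 + 2 * a 0 * b 0 * b') * (c 0)\<^sup>2 + a 0 * (b 0)\<^sup>2 * (2 * c 0 * c'))) (at 0)"
    if "(a has_real_derivative a') (at 0)" "(b has_real_derivative b') (at 0)" "(c has_real_derivative c') (at 0)" for a b c a' b' c' k
    using that by (auto intro!: derivative_eq_intros simp: algebra_simps)
  have three': "((\<lambda>t. k * (a t * b t * (c t)\<^sup>2)) has_real_derivative
       k * ((a' * b 0 + a 0 * b') * (c 0)\<^sup>2 + a 0 * b 0 * (2 * c 0 * c'))) (at 0)"
    if "(a has_real_derivative a') (at 0)" "(b has_real_derivative b') (at 0)" "(c has_real_derivative c') (at 0)" for a b c a' b' c' k
    using that by (auto intro!: derivative_eq_intros simp: algebra_simps)
  have IG: "set_integrable lborel test_dom (G' i)" "(LINT z:test_dom|lborel. G' i z) = 0" for i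
  proof -
    have G0: "G i z = 0" if "z \<in> test_dom" "z \<notin> K" for z using notK[OF that(2)] by (auto simp: G_def)
    have cG: "continuous_on test_dom (G i)" "continuous_on test_dom (G' i)"
      unfolding G_def[abs_def] G'_def[abs_def]
      by (intro continuous_intros cn cx ce ch r0; simp)+
    have dG: "((\<lambda>t. G i (z + t *\<^sub>R ex i)) has_real_derivative G' i z) (at 0)" if z: "z \<in> test_dom" for z
    proof -
      have "(n has_derivative frechet_derivative n (at (?x z) within MM)) (at (?x z) within MM)"
        using n_C1 tdx(1)[OF z] unfolding C1_on_def by (simp add: frechet_derivative_works)
      then have "(n has_derivative frechet_derivative n (at (?x z) within MM)) (at (?x z))"
        using at_within_interior[OF tdx(2)[OF z]] by simp
      from has_real_derivative_line[OF this] have dn: "((\<lambda>t. n (?x z + t *\<^sub>R axis i 1)) has_real_derivative grad (?x z) $ i) (at 0)"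
        by (simp add: grad_def partial_def)
      have dc: "((\<lambda>t. \<chi>' (?x z + t *\<^sub>R axis i 1)) has_real_derivative g (?x z) $ i) (at 0)"
        using has_real_derivative_line[OF chi, of "?x z" "axis i 1"] by (simp add: inner_axis)
      show ?thesis
        using three[OF dc dn hat_line_deriv[OF w z, of "ex i"], of "eta (?r z) / ?r z * ?k z $ i / 2"]
        by (simp add: G_def G'_def ex_def zero_prod_def[symmetric])
    qed
    show "set_integrable lborel test_dom (G' i)" "(LINT z:test_dom|lborel. G' i z) = 0"
      using integral_directional_derivative_open[OF test_dom_open K G0 cG dG] by auto
  qed
  have IL: "set_integrable lborel test_dom (L' i)" "(LINT z:test_dom|lborel. L' i z) = 0" for i
  proof -
    have L0: "L i z = 0" if "z \<in> test_dom" "z \<notin> K" for z using notK[OF that(2)] by (auto simp: L_def)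
    have cL: "continuous_on test_dom (L i)" "continuous_on test_dom (L' i)"
      unfolding L_def[abs_def] L'_def[abs_def]
      by (intro continuous_intros cn cx ce ch r0; simp)+
    have dL: "((\<lambda>t. L i (z + t *\<^sub>R ek i)) has_real_derivative L' i z) (at 0)" if z: "z \<in> test_dom" for z
    proof -
      have dr: "((\<lambda>t. norm (?k z + t *\<^sub>R axis i 1)) has_real_derivative ?k z $ i / ?r z) (at 0)"
        using has_real_derivative_line[OF has_derivative_norm[OF tdx(3)[OF z]], of "axis i 1"]
        by (simp add: sgn_div_norm inner_axis inner_axis' divide_inverse mult.commute)
      have de: "((\<lambda>t. eta (norm (?k z + t *\<^sub>R axis i 1))) has_real_derivative eta' (?r z) * (?k z $ i / ?r z)) (at 0)"
        by (rule DERIV_chain2[OF _ dr]) (use eta_deriv[of "?r z"] in simp)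
      show ?thesis
        using three'[OF dr de hat_line_deriv[OF w z, of "ek i"], of "\<chi>' (?x z) * n (?x z) * grad (?x z) $ i / 2"]
        by (simp add: L_def L'_def ek_def zero_prod_def[symmetric])
    qed
    show "set_integrable lborel test_dom (L' i)" "(LINT z:test_dom|lborel. L' i z) = 0"
      using integral_directional_derivative_open[OF test_dom_open K L0 cL dL] by auto
  qed
  define f0 where "f0 z = \<chi>' (?x z) * (Hop z (C1T w z) * w z)" for z
  define f1 where "f1 z = (?k z \<bullet> g (?x z)) * (w z)\<^sup>2" for z
  \<comment> \<open>\<open>f2\<close> gathers the terms in which a derivative falls on a coefficient
    other than the cut-off, that is, on \<open>n^2\<close> in \<open>G\<close> or on the radial
    factor in \<open>L\<close>.\<close>
  define f2 where "f2 z = \<chi>' (?x z) * (grad (?x z) \<bullet> ?k z) / n (?x z) * (w z)\<^sup>2" for z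
  have OM: "?x z \<in> MM" "n (?x z) \<noteq> 0" if "z \<in> Omega n" for z using that n_pos[of "?x z"] by (cases z; auto simp: Omega_iff)+
  have cO: "continuous_on (Omega n) (\<lambda>z. n (?x z))" "continuous_on (Omega n) (\<lambda>z. grad (?x z))"
    "continuous_on (Omega n) (\<lambda>z. g (?x z))" "continuous_on (Omega n) (\<lambda>z. \<chi>' (?x z))"
    by (rule continuous_on_compose2[OF n_cont] continuous_on_compose2[OF grad_continuous]
        continuous_on_compose2[OF g] continuous_on_compose2[OF cchi]; use OM in \<open>auto intro!: continuous_intros\<close>)+
  have int: "integrable ?S f0" "integrable ?S f1" "integrable ?S f2"
    unfolding f0_def[abs_def] f1_def[abs_def] f2_def[abs_def] Hop_def
    by (intro L2v_integrable(1) continuous_Omega_L2v continuous_intros cO C1T_continuous[OF w] C1_continuous_Omega[OF w] ccoef_continuous ballI OM)+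
  define c where "c = (LINT r|lborel. r\<^sup>2 * indicator {0<..} r * eta r)"
  have em: "eta \<in> borel_measurable borel" "(\<lambda>r. 3 * eta r + r * eta' r) \<in> borel_measurable borel"
    by (intro borel_measurable_continuous_onI continuous_intros eta_cont)+
  note T0 = transfer_integral[OF int(1) em(1) eta_mass(2), folded c_def]
  note T1 = transfer_integral[OF int(2) em(1) eta_mass(2), folded c_def]
  \<comment> \<open>The weight \<open>3 eta r + r eta' r\<close> has radial mass 0, so the terms
    gathered in \<open>f2\<close> integrate to 0 although they need not vanish pointwise.\<close>
  note T2 = transfer_integral[OF int(3) em(2) eta_cancel(2), unfolded eta_cancel(1)]
  have pt: "N (?x z) ^ 3 * eta (?r z) * f0 (to_Omega n z) =
     (\<Sum>i\<in>UNIV. G' i z + L' i z) - N (?x z) ^ 3 * eta (?r z) * f1 (to_Omega n z) / 2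
       - N (?x z) ^ 3 * (3 * eta (?r z) + ?r z * eta' (?r z)) * f2 (to_Omega n z) / 2" if z: "z \<in> test_dom" for z
  proof -
    define x where "x = ?x z"
    define r where "r = ?r z"
    have r: "r > 0" and n0: "n x > 0" and Nn: "N x = n x" using tdx[OF z] n_pos N_simps by (auto simp: r_def x_def)
    have tO: "to_Omega n z = (x, ?k z /\<^sub>R (n x * r))" using to_Om_eq(1)[OF z] by (simp add: to_Om_def x_def r_def Nn[unfolded x_def])
    have wh: "w (to_Omega n z) = hat w z" by (simp add: hat_def)
    have zS: "z \<in> S0" using z test_dom_S0(1) by auto
    have e0: "N x ^ 3 * eta r * f0 (to_Omega n z) = (\<Sum>i\<in>UNIV. eta r * \<chi>' x * hat w z *
         ((n x)\<^sup>2 / r * (?k z $ i * hatD w z (ex i)) + n x * r * (grad x $ i * hatD w z (ek i))))"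
    proof -
      have "N x ^ 3 * eta r * f0 (to_Omega n z) = eta r * \<chi>' x * hat w z * (N x ^ 3 * Hop (to_Omega n z) (C1T w (to_Omega n z)))"
        by (simp add: f0_def wh) (simp add: tO)
      also have "\<dots> = eta r * \<chi>' x * hat w z * ((n x)\<^sup>2 / r * hatD w z (?k z, 0) + n x * r * hatD w z (0, grad x))"
        using Hop_to_Omega[OF w z] by (simp only: x_def r_def)
      also have "\<dots> = eta r * \<chi>' x * hat w z * ((n x)\<^sup>2 / r * (\<Sum>i\<in>UNIV. ?k z $ i * hatD w z (ex i)) + n x * r * (\<Sum>i\<in>UNIV. grad x $ i * hatD w z (ek i)))"
        by (simp only: hatD_sum[OF w zS, folded ex_def ek_def])
      finally show ?thesis by (simp only: sum_distrib_left sum.distrib[symmetric])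
    qed
    have e1: "N x ^ 3 * eta r * f1 (to_Omega n z) = (\<Sum>i\<in>UNIV. eta r * ((n x)\<^sup>2 / r) * (?k z $ i * g x $ i) * (hat w z)\<^sup>2)"
    proof -
      have "N x ^ 3 * eta r * f1 (to_Omega n z) = eta r * ((n x)\<^sup>2 / r) * (?k z \<bullet> g x) * (hat w z)\<^sup>2"
        unfolding f1_def wh Nn using n0 r by (simp add: tO) (simp add: field_simps power2_eq_square power3_eq_cube)
      then show ?thesis by (simp add: inner_vec_def sum_distrib_left sum_distrib_right)
    qed
    have e2: "N x ^ 3 * (3 * eta r + r * eta' r) * f2 (to_Omega n z) =
       (\<Sum>i\<in>UNIV. (3 * eta r + r * eta' r) * (\<chi>' x * n x / r) * (grad x $ i * ?k z $ i) * (hat w z)\<^sup>2)"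
    proof -
      have "N x ^ 3 * (3 * eta r + r * eta' r) * f2 (to_Omega n z) = (3 * eta r + r * eta' r) * (\<chi>' x * n x / r) * (grad x \<bullet> ?k z) * (hat w z)\<^sup>2"
        unfolding f2_def wh Nn using n0 r by (simp add: tO) (simp add: field_simps power2_eq_square power3_eq_cube)
      then show ?thesis by (simp add: inner_vec_def sum_distrib_left sum_distrib_right)
    qed
    \<comment> \<open>The product rule for a single coordinate, as an identity in free real
      variables: \<open>2 e\<close> from \<open>G'\<close> and \<open>e + s e'\<close> from
      \<open>L'\<close> add up to \<open>3 e + s e'\<close>.\<close>
    have alg: "e * X * h * (m\<^sup>2 / s * (v * p) + m * s * (d * q)) =
      (e / s * v / 2 * ((y * m\<^sup>2 + 2 * X * m * d) * h\<^sup>2 + X * m\<^sup>2 * (2 * h * p))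
        + X * m * d / 2 * ((v / s * e + s * (e' * (v / s))) * h\<^sup>2 + s * e * (2 * h * q)))
      - e * (m\<^sup>2 / s) * (v * y) * h\<^sup>2 / 2 - (3 * e + s * e') * (X * m / s) * (d * v) * h\<^sup>2 / 2"
      if "s > 0" for e e' X h m s v p d q y :: real
      using that by (simp add: field_simps power2_eq_square)
    show ?thesis
      unfolding x_def[symmetric] r_def[symmetric] e0 e1 e2 sum_divide_distrib sum_subtractf[symmetric] G'_def L'_def
      by (rule sum.cong[OF refl]) (rule alg[OF r])
  qed
  have "has_bochner_integral lborel (\<lambda>z. (\<Sum>i\<in>UNIV. indicator test_dom z *\<^sub>R G' i z + indicator test_dom z *\<^sub>R L' i z)
      - indicator test_dom z * (N (?x z) ^ 3 * eta (?r z) * f1 (to_Omega n z)) / 2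
      - indicator test_dom z * (N (?x z) ^ 3 * (3 * eta (?r z) + ?r z * eta' (?r z)) * f2 (to_Omega n z)) / 2)
    ((\<Sum>i\<in>(UNIV::3 set). 0 + 0) - c * (LINT z|?S. f1 z) / 2 - 0 * (LINT z|?S. f2 z) / 2)"
  proof (intro has_bochner_integral_diff has_bochner_integral_sum has_bochner_integral_add has_bochner_integral_divide_zero T1 T2)
    show "has_bochner_integral lborel (\<lambda>z. indicator test_dom z *\<^sub>R G' i z) 0" for i
      using IG[of i] by (simp add: has_bochner_integral_iff set_integrable_def set_lebesgue_integral_def)
    show "has_bochner_integral lborel (\<lambda>z. indicator test_dom z *\<^sub>R L' i z) 0" for i
      using IL[of i] by (simp add: has_bochner_integral_iff set_integrable_def set_lebesgue_integral_def)
  qed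
  moreover have "(\<Sum>i\<in>UNIV. indicator test_dom z *\<^sub>R G' i z + indicator test_dom z *\<^sub>R L' i z)
      - indicator test_dom z * (N (?x z) ^ 3 * eta (?r z) * f1 (to_Omega n z)) / 2
      - indicator test_dom z * (N (?x z) ^ 3 * (3 * eta (?r z) + ?r z * eta' (?r z)) * f2 (to_Omega n z)) / 2
     = indicator test_dom z * (N (?x z) ^ 3 * eta (?r z) * f0 (to_Omega n z))" for z
    using pt[of z] by (cases "z \<in> test_dom") simp_all
  ultimately have "has_bochner_integral lborel (\<lambda>z. indicator test_dom z * (N (?x z) ^ 3 * eta (?r z) * f0 (to_Omega n z)))
    (- c * (LINT z|?S. f1 z) / 2)" by simp
  from has_bochner_integral_eq[OF this T0] have "- c * (LINT z|?S. f1 z) / 2 = c * (LINT z|?S. f0 z)" .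
  moreover have "c \<noteq> 0" using eta_mass(1) by (simp add: c_def)
  ultimately have "c * ((LINT z|?S. f1 z) + 2 * (LINT z|?S. f0 z)) = 0" "c \<noteq> 0" by (simp_all add: algebra_simps)
  then have "(LINT z|?S. f0 z) = - (LINT z|?S. f1 z) / 2" by simp
  then show ?thesis unfolding f0_def f1_def .
qed

end

section \<open>Cut-off functions near the boundary of the ball\<close>

definition smoothstep :: "real \<Rightarrow> real" where "smoothstep t = sqpos t / (sqpos t + sqpos (1 - t))"

definition smoothstep' :: "real \<Rightarrow> real" where
  "smoothstep' t = (2 * max 0 t * sqpos (1 - t) + sqpos t * (2 * max 0 (1 - t))) / (sqpos t + sqpos (1 - t))\<^sup>2"

lemma smoothstep_denom: "0 < sqpos t + sqpos (1 - t)"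
  using sqpos_simps(1,3)[of t] sqpos_simps(1,3)[of "1 - t"] by (cases "0 < t") auto

lemma smoothstep_deriv: "(smoothstep has_real_derivative smoothstep' t) (at t)"
proof -
  have 1: "((\<lambda>t. sqpos (1 - t)) has_real_derivative 2 * max 0 (1 - t) * (-1)) (at t)"
    by (rule DERIV_chain2[OF sqpos_deriv]) (auto intro!: derivative_eq_intros)
  have ne: "sqpos t + sqpos (1 - t) \<noteq> 0" using smoothstep_denom[of t] by simp
  show ?thesis
    unfolding smoothstep_def[abs_def] smoothstep'_def
    by (rule DERIV_cong[OF DERIV_divide[OF sqpos_deriv DERIV_add[OF sqpos_deriv 1] ne]])
       (simp add: power2_eq_square algebra_simps)
qed

lemma smoothstep'_continuous: "continuous_on UNIV smoothstep'"
proof -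
  have "\<forall>t. sqpos t + sqpos (1 - t) \<noteq> 0" using smoothstep_denom by (metis less_irrefl)
  moreover have "continuous_on UNIV (\<lambda>t. sqpos (1 - t))"
    by (intro continuous_on_compose2[OF sqpos_continuous[of UNIV]] continuous_intros) auto
  ultimately show ?thesis
    unfolding smoothstep'_def[abs_def] by (intro continuous_intros sqpos_continuous) auto
qed

lemma smoothstep_simps:
  "t \<le> 0 \<Longrightarrow> smoothstep t = 0" "1 \<le> t \<Longrightarrow> smoothstep t = 1" "0 \<le> smoothstep t" "smoothstep t \<le> 1"
  "1 \<le> t \<Longrightarrow> smoothstep' t = 0" "\<bar>smoothstep' t\<bar> \<le> 16"
proof -
  show "t \<le> 0 \<Longrightarrow> smoothstep t = 0" by (simp add: smoothstep_def sqpos_simps)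
  show "1 \<le> t \<Longrightarrow> smoothstep t = 1"
    using sqpos_simps(3)[of t] by (simp add: smoothstep_def sqpos_simps(2))
  show "0 \<le> smoothstep t" using smoothstep_denom[of t] by (simp add: smoothstep_def sqpos_simps)
  show "smoothstep t \<le> 1" using smoothstep_denom[of t] by (simp add: smoothstep_def sqpos_simps)
  show z1: "smoothstep' t = 0" if "1 \<le> t" for t using that by (simp add: smoothstep'_def sqpos_simps)
  show "\<bar>smoothstep' t\<bar> \<le> 16"
  proof (cases "0 < t \<and> t < 1")
    case True
    then have s: "sqpos t = t\<^sup>2" "sqpos (1 - t) = (1 - t)\<^sup>2" by (auto simp: sqpos_def)
    \<comment> \<open>Completing the square bounds the denominator below by \<open>(1/2)^2\<close>;
      with a numerator of at most 4 this yields the constant 16.\<close>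
    have "t\<^sup>2 + (1 - t)\<^sup>2 = 1/2 + 2 * (t - 1/2)\<^sup>2" by (simp add: power2_eq_square algebra_simps)
    then have d: "1/2 \<le> t\<^sup>2 + (1 - t)\<^sup>2" by simp
    have d2: "(1/2)\<^sup>2 \<le> (t\<^sup>2 + (1 - t)\<^sup>2)\<^sup>2" by (rule power_mono[OF d]) simp
    have "t * (1 - t)\<^sup>2 \<le> 1 * 1" "t\<^sup>2 * (1 - t) \<le> 1 * 1"
      using True by (intro mult_mono power_le_one; simp)+
    then have nu: "2 * t * (1 - t)\<^sup>2 + t\<^sup>2 * (2 * (1 - t)) \<le> 4" by linarith
    have nn: "0 \<le> 2 * t * (1 - t)\<^sup>2 + t\<^sup>2 * (2 * (1 - t))" using True by simp
    have "smoothstep' t = (2 * t * (1 - t)\<^sup>2 + t\<^sup>2 * (2 * (1 - t))) / (t\<^sup>2 + (1 - t)\<^sup>2)\<^sup>2"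
      using True by (simp add: smoothstep'_def s)
    moreover have "\<dots> \<le> 4 / (1/2)\<^sup>2" using nu nn d2 by (intro frac_le) auto
    moreover have "0 \<le> \<dots>" by simp
    ultimately show ?thesis using nn by (simp add: power2_eq_square)
  next
    case False
    then have "smoothstep' t = 0" using z1[of t] by (auto simp: not_less smoothstep'_def sqpos_simps)
    then show ?thesis by simp
  qed
qed

text \<open>Built from \<open>|x|^2\<close>, which is differentiable at the origin. The shift by 1
  makes it vanish for \<open>|x|^2 \<ge> 1 - \<delta>\<close> and equal 1 for
  \<open>|x|^2 \<le> 1 - 2 \<delta>\<close>, so for positive \<delta> its support stays inside the
  open ball.\<close>

definition cutoff :: "real \<Rightarrow> vec3 \<Rightarrow> real" where "cutoff \<delta> x = smoothstep ((1 - x \<bullet> x) / \<delta> - 1)"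

definition cutoff_grad :: "real \<Rightarrow> vec3 \<Rightarrow> vec3" where
  "cutoff_grad \<delta> x = (smoothstep' ((1 - x \<bullet> x) / \<delta> - 1) * (- 2 / \<delta>)) *\<^sub>R x"

lemma cutoff_deriv: "0 < \<delta> \<Longrightarrow> (cutoff \<delta> has_derivative (\<lambda>h. cutoff_grad \<delta> x \<bullet> h)) (at x)"
proof -
  assume d: "0 < \<delta>"
  have 1: "((\<lambda>x. (1 - x \<bullet> x) / \<delta> - 1) has_derivative (\<lambda>h. - 2 / \<delta> * (x \<bullet> h))) (at x)"
    using d by (auto intro!: derivative_eq_intros simp: inner_commute field_simps)
  have 2: "(smoothstep has_derivative (*) (smoothstep' ((1 - x \<bullet> x) / \<delta> - 1))) (at ((1 - x \<bullet> x) / \<delta> - 1))"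
    using smoothstep_deriv unfolding has_field_derivative_def .
  show ?thesis
    using has_derivative_compose[OF 1 2] unfolding cutoff_def[abs_def] cutoff_grad_def by (simp add: mult.assoc)
qed

lemma cutoff_grad_continuous: "0 < \<delta> \<Longrightarrow> continuous_on UNIV (cutoff_grad \<delta>)"
  unfolding cutoff_grad_def[abs_def]
  by (intro continuous_intros continuous_on_compose2[OF smoothstep'_continuous]) auto

lemma cutoff_supp:
  assumes d: "0 < \<delta>" "\<delta> < 1" and x: "1 - \<delta> / 2 < norm x" shows "cutoff \<delta> x = 0"
proof -
  have "(1 - \<delta> / 2)\<^sup>2 \<le> (norm x)\<^sup>2" using d x by (intro power_mono) auto
  moreover have "(1 - \<delta> / 2)\<^sup>2 = 1 - \<delta> + \<delta>\<^sup>2 / 4" by (simp add: power2_eq_square algebra_simps)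
  ultimately have "1 - \<delta> \<le> x \<bullet> x" by (simp add: power2_norm_eq_inner) (metis add.commute add_increasing2 order_trans divide_nonneg_pos less_eq_real_def zero_le_power2 zero_less_numeral linorder_le_less_linear not_le le_add_same_cancel1)
  then show ?thesis using d unfolding cutoff_def by (intro smoothstep_simps(1)) (simp add: field_simps)
qed

text \<open>The gradient is of order \<open>1/\<delta>\<close>, but only on a shell of thickness
  \<open>2 \<delta>\<close>, so the product of size and thickness stays bounded. The constant is
  twice the bound on \<open>smoothstep'\<close>.\<close>

lemma cutoff_grad_bound:
  assumes d: "0 < \<delta>" and x: "norm x \<le> 1"
  shows "norm (cutoff_grad \<delta> x) \<le> 32 / \<delta> * indicator {1 - 2 * \<delta>..} (norm x)"
proof (cases "1 - 2 * \<delta> \<le> norm x")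
  case True
  have "norm (cutoff_grad \<delta> x) = \<bar>smoothstep' ((1 - x \<bullet> x) / \<delta> - 1)\<bar> * (2 / \<delta>) * norm x"
    using d by (simp add: cutoff_grad_def abs_mult)
  also have "\<dots> \<le> 16 * (2 / \<delta>) * 1" using d x smoothstep_simps(6) by (intro mult_mono) auto
  finally show ?thesis using True by simp
next
  case False
  have "x \<bullet> x = norm x * norm x" by (simp add: power2_norm_eq_inner[symmetric] power2_eq_square)
  also have "\<dots> \<le> norm x * 1" using x by (intro mult_left_mono) auto
  finally have "x \<bullet> x \<le> 1 - 2 * \<delta>" using False by simp
  then have "1 \<le> (1 - x \<bullet> x) / \<delta> - 1" using d by (simp add: field_simps)
  then show ?thesis using False by (simp add: cutoff_grad_def smoothstep_simps(5))
qed

context refractive_index begin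

section \<open>The boundary measure and integrals over thin shells\<close>

lemma bd_Omega_iff: "z \<in> bd_Omega n \<longleftrightarrow> z \<in> Omega n \<and> norm (fst z) = 1"
  by (cases z) (auto simp: bd_Omega_def MM_facts)

lemma sets_bd [simp]: "sets (bd_measure n) = sets (restrict_space borel (bd_Omega n))"
  by (simp add: bd_measure_def)

lemma space_bd [simp]: "space (bd_measure n) = bd_Omega n"
  by (simp add: bd_measure_def space_restrict_space)

lemma sphere_snd_measurable: "snd \<in> (M :: vec3 measure) \<Otimes>\<^sub>M sphere_measure \<rightarrow>\<^sub>M (borel :: vec3 measure)"
  by (rule measurable_compose[OF measurable_snd])
     (auto simp: measurable_cong_sets[OF sets_sphere_measure refl] intro: measurable_restrict_space1)

lemma sphere_fst_measurable: "fst \<in> sphere_measure \<Otimes>\<^sub>M (M :: vec3 measure) \<rightarrow>\<^sub>M (borel :: vec3 measure)"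
  by (rule measurable_compose[OF measurable_fst])
     (auto simp: measurable_cong_sets[OF sets_sphere_measure refl] intro: measurable_restrict_space1)

lemma nn_integral_bd_borel:
  assumes G [measurable]: "G \<in> borel_measurable borel"
  shows "(\<integral>\<^sup>+z. G z \<partial>bd_measure n) =
    (\<integral>\<^sup>+x. \<integral>\<^sup>+\<omega>. ennreal ((N x)\<^sup>2) * G (x, \<omega> /\<^sub>R N x) \<partial>sphere_measure \<partial>sphere_measure)"
proof -
  let ?M = "sphere_measure \<Otimes>\<^sub>M sphere_measure"
  have f [measurable]: "fst \<in> borel_measurable ?M" by (rule sphere_fst_measurable)
  have s [measurable]: "snd \<in> borel_measurable ?M" by (rule sphere_snd_measurable)
  have sp: "N x = n x" "x \<in> MM" if "norm x = 1" for x using that by (auto simp: MM_facts N_simps)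
  have p: "(\<lambda>z. (fst z, snd z /\<^sub>R N (fst z))) \<in> borel_measurable ?M"
    by (rule Omega_param_measurable_compose[OF f s])
  have d: "(\<lambda>(x, \<omega>). ennreal ((n x)\<^sup>2)) \<in> borel_measurable ?M"
    by (subst measurable_cong[where g="\<lambda>z. ennreal ((N (fst z))\<^sup>2)"]) (auto simp: space_pair_measure sp)
  have g: "(\<lambda>z. G (fst z, snd z /\<^sub>R N (fst z))) \<in> borel_measurable ?M" using p by measurable
  have m: "(\<lambda>(x, \<omega>). (x, \<omega> /\<^sub>R n x)) \<in> measurable (density ?M (\<lambda>(x, \<omega>). ennreal ((n x)\<^sup>2))) (restrict_space borel (bd_Omega n))"
  proof (rule measurable_restrict_space2)
    show "(\<lambda>(x, \<omega>). (x, \<omega> /\<^sub>R n x)) \<in> space (density ?M (\<lambda>(x, \<omega>). ennreal ((n x)\<^sup>2))) \<rightarrow> bd_Omega n"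
      using sp(2)[THEN n_pos] by (auto simp: space_pair_measure bd_Omega_iff Omega_iff sp(2) less_imp_neq[THEN not_sym] abs_of_pos)
    have "(\<lambda>(x, \<omega>). (x, \<omega> /\<^sub>R n x)) \<in> borel_measurable ?M"
      by (subst measurable_cong[where g="\<lambda>z. (fst z, snd z /\<^sub>R N (fst z))"]) (auto simp: space_pair_measure sp p)
    then show "(\<lambda>(x, \<omega>). (x, \<omega> /\<^sub>R n x)) \<in> borel_measurable (density ?M (\<lambda>(x, \<omega>). ennreal ((n x)\<^sup>2)))" by simp
  qed
  have "(\<integral>\<^sup>+z. G z \<partial>bd_measure n) = (\<integral>\<^sup>+z. G (case z of (x, \<omega>) \<Rightarrow> (x, \<omega> /\<^sub>R n x)) \<partial>density ?M (\<lambda>(x, \<omega>). ennreal ((n x)\<^sup>2)))"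
    unfolding bd_measure_def by (rule nn_integral_distr[OF m]) (auto intro: measurable_restrict_space1)
  also have "\<dots> = (\<integral>\<^sup>+z. G (fst z, snd z /\<^sub>R N (fst z)) \<partial>density ?M (\<lambda>(x, \<omega>). ennreal ((n x)\<^sup>2)))"
    by (rule nn_integral_cong) (auto simp: space_pair_measure sp)
  also have "\<dots> = (\<integral>\<^sup>+z. (case z of (x, \<omega>) \<Rightarrow> ennreal ((n x)\<^sup>2)) * G (fst z, snd z /\<^sub>R N (fst z)) \<partial>?M)"
    by (rule nn_integral_density[OF d g])
  also have "\<dots> = (\<integral>\<^sup>+z. ennreal ((N (fst z))\<^sup>2) * G (fst z, snd z /\<^sub>R N (fst z)) \<partial>?M)"
    by (rule nn_integral_cong) (auto simp: space_pair_measure sp)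
  also have "\<dots> = (\<integral>\<^sup>+x. \<integral>\<^sup>+\<omega>. ennreal ((N x)\<^sup>2) * G (x, \<omega> /\<^sub>R N x) \<partial>sphere_measure \<partial>sphere_measure)"
  proof -
    have "(\<lambda>z. ennreal ((N (fst z))\<^sup>2) * G (fst z, snd z /\<^sub>R N (fst z))) \<in> borel_measurable ?M"
      using g f by (intro borel_measurable_times_ennreal) measurable
    from S2.nn_integral_fst[OF this] show ?thesis by simp
  qed
  finally show ?thesis .
qed

lemma continuous_Omega_bd:
  fixes f :: "phase \<Rightarrow> real"
  assumes c: "continuous_on (Omega n) f"
  shows "f \<in> borel_measurable (bd_measure n)" "integrable (bd_measure n) f"
proof -
  have sub: "bd_Omega n \<subseteq> Omega n" by (auto simp: bd_Omega_iff)
  show m: "f \<in> borel_measurable (bd_measure n)"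
    unfolding measurable_cong_sets[OF sets_bd refl]
    by (rule borel_measurable_continuous_on_restrict[OF continuous_on_subset[OF c sub]])
  obtain C where C: "C > 0" "\<And>x. x \<in> MM \<Longrightarrow> n x \<le> C" using n_upper by blast
  have "finite_measure (bd_measure n)"
  proof (rule finite_measureI)
    have "emeasure (bd_measure n) (space (bd_measure n)) = (\<integral>\<^sup>+z. 1 \<partial>bd_measure n)" by simp
    also have "\<dots> = (\<integral>\<^sup>+x. \<integral>\<^sup>+\<omega>. ennreal ((N x)\<^sup>2) * 1 \<partial>sphere_measure \<partial>sphere_measure)"
      by (rule nn_integral_bd_borel) simp
    also have "\<dots> \<le> (\<integral>\<^sup>+x. \<integral>\<^sup>+\<omega>. ennreal (C\<^sup>2) \<partial>sphere_measure \<partial>sphere_measure)"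
      using C(2) n_pos by (intro nn_integral_mono) (auto simp: N_simps MM_facts less_imp_le intro!: ennreal_leI power_mono)
    also have "\<dots> < \<infinity>"
      using S2.emeasure_finite[of "sphere 0 1", folded infinity_ennreal_def]
      by (simp add: ennreal_mult_less_top) (simp add: less_top[symmetric])
    finally show "emeasure (bd_measure n) (space (bd_measure n)) \<noteq> \<infinity>" by simp
  qed
  then interpret bd: finite_measure "bd_measure n" .
  obtain B where B: "\<forall>y\<in>f ` Omega n. norm y \<le> B"
    using compact_imp_bounded[OF compact_continuous_image[OF c Omega_compact]] unfolding bounded_iff by blast
  show "integrable (bd_measure n) f"
    by (rule bd.integrable_const_bound[of _ B]) (use B m sub in \<open>auto intro!: AE_I2\<close>)
qed


text \<open>In polar coordinates for \<open>x\<close> the shell is a family of spheres, and uniform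
  continuity compares the integrand at \<open>r \<sigma>\<close> with its value at the boundary
  point \<sigma>. The factor \<open>C\<close> appears because \<open>Sigma_measure\<close> has
  density \<open>n^3\<close> and \<open>bd_measure\<close> has density \<open>n^2\<close>.\<close>

lemma shell_estimate:
  assumes w: "continuous_on (Omega n) w" and C: "C > 0" "\<And>x. x \<in> MM \<Longrightarrow> n x \<le> C" and e: "0 < e"
  shows "\<exists>d>0. d < 1 \<and> (\<forall>a. 1 - d < a \<longrightarrow> a < 1 \<longrightarrow>
     (\<integral>\<^sup>+z. indicator {a..} (norm (fst z)) * ennreal ((w z)\<^sup>2) \<partial>Sigma_measure n) \<le>
       ennreal (1 - a) * (ennreal C * (\<integral>\<^sup>+z. ennreal ((w z)\<^sup>2) \<partial>bd_measure n) + ennreal e))"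
proof -
  define V where "V = measure sphere_measure (sphere 0 1)"
  have V: "V \<ge> 0" "emeasure sphere_measure (sphere 0 1) = ennreal V" by (simp_all add: V_def S2.emeasure_eq_measure)
  \<comment> \<open>The pointwise error is integrated over two spheres and so multiplied by
    \<open>V^2\<close>; the 1 keeps the denominator positive.\<close>
  define e' where "e' = e / (V\<^sup>2 + 1)"
  have V1: "0 < V\<^sup>2 + 1" by (simp add: add_nonneg_pos)
  have e': "e' > 0" "e' * V\<^sup>2 \<le> e"
    using e V1 by (auto simp: e'_def field_simps)
  define G where "G z = ennreal ((w z)\<^sup>2) * indicator (Omega n) z" for z
  have wm: "w \<in> borel_measurable (restrict_space borel (Omega n))" by (rule borel_measurable_continuous_on_restrict[OF w])
  have G [measurable]: "G \<in> borel_measurable borel"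
  proof -
    have "(\<lambda>z. ennreal ((w z)\<^sup>2)) \<in> borel_measurable (restrict_space borel (Omega n))" using wm by measurable
    then show ?thesis unfolding G_def[abs_def] by (subst (asm) borel_measurable_restrict_space_iff_ennreal) auto
  qed
  define W where "W x \<omega> = n x ^ 3 * (w (x, \<omega> /\<^sub>R n x))\<^sup>2" for x \<omega>
  define Wb where "Wb z = ennreal (N (fst z) ^ 3) * G (fst z, snd z /\<^sub>R N (fst z))" for z
  have Wb [measurable]: "Wb \<in> borel_measurable borel"
    unfolding Wb_def[abs_def] using Omega_param_measurable_compose[OF phase_fst_borel]
    by (intro borel_measurable_times_ennreal) measurable
  have WbW: "Wb (x, \<omega>) = ennreal (W x \<omega>)" if "x \<in> MM" "norm \<omega> = 1" for x \<omega>
  proof -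
    have "(x, \<omega> /\<^sub>R n x) \<in> Omega n" unfolding Omega_eq_image using that by (auto intro!: image_eqI[of _ _ "(x, \<omega>)"])
    then show ?thesis using that n_pos[of x] by (simp add: Wb_def G_def W_def N_simps ennreal_mult)
  qed
  have "continuous_on (MM \<times> sphere 0 1) (\<lambda>z. case_prod W z)"
  proof -
    have 1: "continuous_on (MM \<times> sphere 0 1) (\<lambda>z. n (fst z))"
      by (rule continuous_on_compose2[OF n_cont]) (auto intro!: continuous_intros)
    have 2: "continuous_on (MM \<times> sphere 0 1) (\<lambda>z. w (case z of (x, \<omega>) \<Rightarrow> (x, \<omega> /\<^sub>R n x)))"
      by (rule continuous_on_compose2[OF w Omega_param_continuous]) (auto simp: Omega_eq_image)
    have "continuous_on (MM \<times> sphere 0 1) (\<lambda>z. n (fst z) ^ 3 * (w (case z of (x, \<omega>) \<Rightarrow> (x, \<omega> /\<^sub>R n x)))\<^sup>2)"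
      by (intro continuous_intros 1 2)
    then show ?thesis by (simp add: W_def case_prod_beta')
  qed
  then have "uniformly_continuous_on (MM \<times> sphere 0 1) (\<lambda>z. case_prod W z)"
    by (rule compact_uniformly_continuous) (auto intro!: compact_Times simp: MM_facts)
  then obtain d where d: "d > 0" "\<And>z z'. z \<in> MM \<times> sphere 0 1 \<Longrightarrow> z' \<in> MM \<times> sphere 0 1 \<Longrightarrow> dist z' z < d \<Longrightarrow>
     dist (case_prod W z') (case_prod W z) < e'"
    unfolding uniformly_continuous_on_def using e'(1) by metis
  define D where "D = (\<integral>\<^sup>+\<sigma>. \<integral>\<^sup>+\<omega>. Wb (\<sigma>, \<omega>) + ennreal e' \<partial>sphere_measure \<partial>sphere_measure)"
  have pm: "(\<lambda>\<omega>. (x, \<omega>)) \<in> sphere_measure \<rightarrow>\<^sub>M borel" for x :: vec3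
    unfolding measurable_cong_sets[OF sets_sphere_measure refl]
    by (intro measurable_restrict_space1 borel_measurable_continuous_onI continuous_intros)
  have Wm: "(\<lambda>\<omega>. Wb (x, \<omega>)) \<in> borel_measurable sphere_measure" for x using pm[of x] by measurable
  have ip: "(\<lambda>z. (fst z, snd z)) \<in> (M :: vec3 measure) \<Otimes>\<^sub>M sphere_measure \<rightarrow>\<^sub>M (borel :: phase measure)"
    if "fst \<in> M \<Otimes>\<^sub>M sphere_measure \<rightarrow>\<^sub>M (borel :: vec3 measure)" for M
    by (rule borel_measurable_Pair[OF that sphere_snd_measurable])
  have WI: "(\<lambda>x. \<integral>\<^sup>+\<omega>. Wb (x, \<omega>) \<partial>sphere_measure) \<in> borel_measurable borel"
    using measurable_compose[OF ip[OF measurable_fst] Wb]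
    by (intro S2.borel_measurable_nn_integral) (simp add: case_prod_beta')
  have WI2: "(\<lambda>x. \<integral>\<^sup>+\<omega>. Wb (x, \<omega>) \<partial>sphere_measure) \<in> borel_measurable sphere_measure"
    unfolding measurable_cong_sets[OF sets_sphere_measure refl] by (rule measurable_restrict_space1[OF WI])
  have Dle: "D \<le> ennreal C * (\<integral>\<^sup>+z. ennreal ((w z)\<^sup>2) \<partial>bd_measure n) + ennreal e"
  proof -
    have "D = (\<integral>\<^sup>+\<sigma>. (\<integral>\<^sup>+\<omega>. Wb (\<sigma>, \<omega>) \<partial>sphere_measure) + ennreal e' * ennreal V \<partial>sphere_measure)"
      unfolding D_def using Wm by (intro nn_integral_cong) (simp add: nn_integral_add V)
    also have "\<dots> = (\<integral>\<^sup>+\<sigma>. \<integral>\<^sup>+\<omega>. Wb (\<sigma>, \<omega>) \<partial>sphere_measure \<partial>sphere_measure) + ennreal e' * ennreal V * ennreal V"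
      using WI2 by (simp add: nn_integral_add V)
    also have "ennreal e' * ennreal V * ennreal V = ennreal (e' * V\<^sup>2)"
      using V e' by (simp add: ennreal_mult power2_eq_square mult.assoc)
    also have "\<dots> \<le> ennreal e" using e' by (intro ennreal_leI)
    also have "(\<integral>\<^sup>+\<sigma>. \<integral>\<^sup>+\<omega>. Wb (\<sigma>, \<omega>) \<partial>sphere_measure \<partial>sphere_measure) \<le>
       (\<integral>\<^sup>+\<sigma>. ennreal C * (\<integral>\<^sup>+\<omega>. ennreal ((N \<sigma>)\<^sup>2) * G (\<sigma>, \<omega> /\<^sub>R N \<sigma>) \<partial>sphere_measure) \<partial>sphere_measure)"
    proof (rule nn_integral_mono)
      fix \<sigma> assume "\<sigma> \<in> space sphere_measure"
      then have s: "\<sigma> \<in> MM" by (simp add: MM_facts)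
      have gm: "(\<lambda>\<omega>. G (\<sigma>, \<omega> /\<^sub>R N \<sigma>)) \<in> borel_measurable sphere_measure"
        using measurable_compose[OF pm[of \<sigma>] measurable_compose[OF Omega_param_measurable_compose[OF phase_fst_borel] G]] by simp
      have "(\<integral>\<^sup>+\<omega>. Wb (\<sigma>, \<omega>) \<partial>sphere_measure) \<le> (\<integral>\<^sup>+\<omega>. ennreal C * (ennreal ((N \<sigma>)\<^sup>2) * G (\<sigma>, \<omega> /\<^sub>R N \<sigma>)) \<partial>sphere_measure)"
      proof (rule nn_integral_mono)
        fix \<omega>
        have "N \<sigma> ^ 3 \<le> C * (N \<sigma>)\<^sup>2"
          using mult_right_mono[OF C(2)[OF s], of "n \<sigma> * n \<sigma>"] N_simps(1)[OF s]
          by (simp add: power3_eq_cube power2_eq_square mult.assoc)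
        then have "ennreal (N \<sigma> ^ 3) \<le> ennreal C * ennreal ((N \<sigma>)\<^sup>2)"
          using C(1) by (simp add: ennreal_mult[symmetric] ennreal_leI)
        then show "Wb (\<sigma>, \<omega>) \<le> ennreal C * (ennreal ((N \<sigma>)\<^sup>2) * G (\<sigma>, \<omega> /\<^sub>R N \<sigma>))"
          unfolding Wb_def by (simp add: mult.assoc[symmetric] mult_right_mono)
      qed
      also have "\<dots> = ennreal C * (\<integral>\<^sup>+\<omega>. ennreal ((N \<sigma>)\<^sup>2) * G (\<sigma>, \<omega> /\<^sub>R N \<sigma>) \<partial>sphere_measure)"
        by (rule nn_integral_cmult) (use gm in measurable)
      finally show "(\<integral>\<^sup>+\<omega>. Wb (\<sigma>, \<omega>) \<partial>sphere_measure) \<le> ennreal C * (\<integral>\<^sup>+\<omega>. ennreal ((N \<sigma>)\<^sup>2) * G (\<sigma>, \<omega> /\<^sub>R N \<sigma>) \<partial>sphere_measure)" .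
    qed
    also have "\<dots> = ennreal C * (\<integral>\<^sup>+\<sigma>. \<integral>\<^sup>+\<omega>. ennreal ((N \<sigma>)\<^sup>2) * G (\<sigma>, \<omega> /\<^sub>R N \<sigma>) \<partial>sphere_measure \<partial>sphere_measure)"
    proof (rule nn_integral_cmult)
      have m: "(\<lambda>z. ennreal ((N (fst z))\<^sup>2) * G (fst z, snd z /\<^sub>R N (fst z))) \<in> borel_measurable (sphere_measure \<Otimes>\<^sub>M sphere_measure)"
      proof (rule borel_measurable_times_ennreal)
        show "(\<lambda>z. ennreal ((N (fst z))\<^sup>2)) \<in> borel_measurable (sphere_measure \<Otimes>\<^sub>M sphere_measure)"
          by (rule measurable_compose[OF sphere_fst_measurable]) measurable
        show "(\<lambda>z. G (fst z, snd z /\<^sub>R N (fst z))) \<in> borel_measurable (sphere_measure \<Otimes>\<^sub>M sphere_measure)"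
          by (rule measurable_compose[OF Omega_param_measurable_compose[OF sphere_fst_measurable sphere_snd_measurable] G])
      qed
      show "(\<lambda>\<sigma>. \<integral>\<^sup>+\<omega>. ennreal ((N \<sigma>)\<^sup>2) * G (\<sigma>, \<omega> /\<^sub>R N \<sigma>) \<partial>sphere_measure) \<in> borel_measurable sphere_measure"
        by (rule S2.borel_measurable_nn_integral) (use m in \<open>simp add: case_prod_beta'\<close>)
    qed
    also have "(\<integral>\<^sup>+\<sigma>. \<integral>\<^sup>+\<omega>. ennreal ((N \<sigma>)\<^sup>2) * G (\<sigma>, \<omega> /\<^sub>R N \<sigma>) \<partial>sphere_measure \<partial>sphere_measure) = (\<integral>\<^sup>+z. G z \<partial>bd_measure n)"
      by (rule nn_integral_bd_borel[symmetric]) (rule G)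
    also have "\<dots> = (\<integral>\<^sup>+z. ennreal ((w z)\<^sup>2) \<partial>bd_measure n)"
      by (rule nn_integral_cong) (simp add: G_def bd_Omega_iff)
    finally show ?thesis by (simp add: add_mono)
  qed
  have "(\<integral>\<^sup>+z. indicator {a..} (norm (fst z)) * ennreal ((w z)\<^sup>2) \<partial>Sigma_measure n) \<le> ennreal (1 - a) * D"
    if a: "1 - min d (1/2) < a" "a < 1" for a
  proof -
    \<comment> \<open>The minimum with \<open>1/2\<close> keeps \<open>a\<close> positive, so the
      shell avoids the origin of the polar coordinates.\<close>
    have a0: "a > 0" "1 - a < d" using a by auto
    define J where "J x = indicator MM x * indicator {a..} (norm x) * (\<integral>\<^sup>+\<omega>. Wb (x, \<omega>) \<partial>sphere_measure)" for x
    have J: "J \<in> borel_measurable borel" unfolding J_def[abs_def] using WI MM_facts(3) by measurable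
    have "(\<integral>\<^sup>+z. indicator {a..} (norm (fst z)) * ennreal ((w z)\<^sup>2) \<partial>Sigma_measure n) =
      (\<integral>\<^sup>+z. indicator {a..} (norm (fst z)) * G z \<partial>Sigma_measure n)"
      by (rule nn_integral_cong) (simp add: G_def)
    also have "\<dots> = (\<integral>\<^sup>+x. indicator MM x * ennreal (N x ^ 3) * (\<integral>\<^sup>+\<omega>. indicator {a..} (norm x) * G (x, \<omega> /\<^sub>R N x) \<partial>sphere_measure) \<partial>lborel)"
    proof -
      have "(\<lambda>z::phase. norm (fst z)) \<in> borel_measurable borel" by (intro borel_measurable_continuous_onI continuous_intros)
      then have "(\<lambda>z::phase. indicator {a..} (norm (fst z)) :: ennreal) \<in> borel_measurable borel"
        by (rule measurable_compose) simp
      from nn_integral_Sigma_borel[OF borel_measurable_times_ennreal[OF this G]] show ?thesis by simp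
    qed
    also have "\<dots> = (\<integral>\<^sup>+x. J x \<partial>lborel)"
    proof (rule nn_integral_cong)
      fix x :: vec3
      have gm: "(\<lambda>\<omega>. G (x, \<omega> /\<^sub>R N x)) \<in> borel_measurable sphere_measure"
        using measurable_compose[OF pm[of x] measurable_compose[OF Omega_param_measurable_compose[OF phase_fst_borel] G]] by simp
      show "indicator MM x * ennreal (N x ^ 3) * (\<integral>\<^sup>+\<omega>. indicator {a..} (norm x) * G (x, \<omega> /\<^sub>R N x) \<partial>sphere_measure) = J x"
        unfolding J_def Wb_def using gm by (simp add: nn_integral_cmult mult_ac)
    qed
    also have "\<dots> = (\<integral>\<^sup>+r. ennreal (r\<^sup>2) * indicator {0<..} r * (\<integral>\<^sup>+\<sigma>. J (r *\<^sub>R \<sigma>) \<partial>sphere_measure) \<partial>lborel)"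
      by (rule nn_integral_polar[OF J])
    also have "\<dots> \<le> (\<integral>\<^sup>+r. D * indicator {a..1} r \<partial>lborel)"
    proof (rule nn_integral_mono)
      fix r :: real
      show "ennreal (r\<^sup>2) * indicator {0<..} r * (\<integral>\<^sup>+\<sigma>. J (r *\<^sub>R \<sigma>) \<partial>sphere_measure) \<le> D * indicator {a..1} r"
      proof (cases "r \<in> {a..1}")
        case True
        have "(\<integral>\<^sup>+\<sigma>. J (r *\<^sub>R \<sigma>) \<partial>sphere_measure) \<le> D" unfolding D_def
        proof (rule nn_integral_mono)
          fix \<sigma> assume "\<sigma> \<in> space sphere_measure"
          then have s: "norm \<sigma> = 1" by simp
          have mem: "r *\<^sub>R \<sigma> \<in> MM" "\<sigma> \<in> MM" using s True a0 by (auto simp: MM_facts)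
          have "J (r *\<^sub>R \<sigma>) = (\<integral>\<^sup>+\<omega>. Wb (r *\<^sub>R \<sigma>, \<omega>) \<partial>sphere_measure)"
            using mem s True a0 by (simp add: J_def)
          also have "\<dots> \<le> (\<integral>\<^sup>+\<omega>. Wb (\<sigma>, \<omega>) + ennreal e' \<partial>sphere_measure)"
          proof (rule nn_integral_mono)
            fix \<omega> assume "\<omega> \<in> space sphere_measure"
            then have o: "norm \<omega> = 1" by simp
            have "r *\<^sub>R \<sigma> - \<sigma> = (r - 1) *\<^sub>R \<sigma>" by (simp add: algebra_simps)
            then have "dist (r *\<^sub>R \<sigma>, \<omega>) (\<sigma>, \<omega>) < d" using s True a0 by (simp add: dist_Pair_Pair dist_norm)
            then have "dist (W (r *\<^sub>R \<sigma>) \<omega>) (W \<sigma> \<omega>) < e'" using d(2)[of "(\<sigma>, \<omega>)" "(r *\<^sub>R \<sigma>, \<omega>)"] mem o by simp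
            then have "W (r *\<^sub>R \<sigma>) \<omega> \<le> W \<sigma> \<omega> + e'" by (simp add: dist_real_def)
            moreover have "0 \<le> W \<sigma> \<omega>" using n_pos[OF mem(2)] by (simp add: W_def)
            ultimately have "ennreal (W (r *\<^sub>R \<sigma>) \<omega>) \<le> ennreal (W \<sigma> \<omega>) + ennreal e'"
              using e'(1) by (simp add: ennreal_plus[symmetric] ennreal_leI del: ennreal_plus)
            then show "Wb (r *\<^sub>R \<sigma>, \<omega>) \<le> Wb (\<sigma>, \<omega>) + ennreal e'" using WbW mem o by simp
          qed
          finally show "J (r *\<^sub>R \<sigma>) \<le> (\<integral>\<^sup>+\<omega>. Wb (\<sigma>, \<omega>) + ennreal e' \<partial>sphere_measure)" .
        qed
        moreover have "ennreal (r\<^sup>2) \<le> 1" using True a0 by (simp add: power_le_one)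
        ultimately have "ennreal (r\<^sup>2) * (\<integral>\<^sup>+\<sigma>. J (r *\<^sub>R \<sigma>) \<partial>sphere_measure) \<le> 1 * D" by (intro mult_mono) auto
        then show ?thesis using True a0 by simp
      next
        case False
        have "ennreal (r\<^sup>2) * indicator {0<..} r * (\<integral>\<^sup>+\<sigma>. J (r *\<^sub>R \<sigma>) \<partial>sphere_measure) = 0"
        proof (cases "r > 0")
          case True
          have "(\<integral>\<^sup>+\<sigma>. J (r *\<^sub>R \<sigma>) \<partial>sphere_measure) = (\<integral>\<^sup>+\<sigma>. 0 \<partial>sphere_measure)"
            by (rule nn_integral_cong) (use True False in \<open>auto simp: J_def MM_facts indicator_def\<close>)
          then show ?thesis by simp
        qed simp
        then show ?thesis by (simp only: zero_le)
      qed
    qed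
    also have "\<dots> = D * ennreal (1 - a)" using a by (subst nn_integral_cmult_indicator) auto
    finally show ?thesis by (simp add: mult.commute)
  qed
  moreover have "ennreal (1 - a) * D \<le> ennreal (1 - a) * (ennreal C * (\<integral>\<^sup>+z. ennreal ((w z)\<^sup>2) \<partial>bd_measure n) + ennreal e)" for a
    using Dle by (rule mult_left_mono) simp
  ultimately show ?thesis using d(1)
    by (intro exI[of _ "min d (1/2)"]) (auto intro: order_trans)
qed

lemma Hop_continuous: "w \<in> C1_Omega n \<Longrightarrow> continuous_on (Omega n) (\<lambda>z. Hop z (C1T w z) * w z)"
  unfolding Hop_def
  by (intro continuous_intros C1T_continuous C1_continuous_Omega ccoef_continuous)

lemma AE_interior_Sigma: "AE z in Sigma_measure n. norm (fst z) < 1"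
proof -
  have "(\<integral>\<^sup>+z. indicator {1..} (norm (fst z)) \<partial>Sigma_measure n) =
    (\<integral>\<^sup>+x. indicator MM x * ennreal (N x ^ 3) * (\<integral>\<^sup>+\<omega>. indicator {1..} (norm x) \<partial>sphere_measure) \<partial>lborel)"
    by (subst nn_integral_Sigma_borel) auto
  also have "\<dots> = (\<integral>\<^sup>+x. 0 \<partial>(lborel :: vec3 measure))"
    by (rule nn_integral_cong_AE) (use AE_interior_MM in eventually_elim, auto simp: MM_facts indicator_def)
  finally have "(\<integral>\<^sup>+z. indicator {1..} (norm (fst z)) \<partial>Sigma_measure n) = 0" by simp
  moreover have "(\<lambda>z. indicator {1..} (norm (fst z)) :: ennreal) \<in> borel_measurable (Sigma_measure n)"
    unfolding borel_measurable_Sigma_iff measurable_cong_sets[OF sets_Sigma refl] by (intro measurable_restrict_space1) measurable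
  ultimately have "AE z in Sigma_measure n. (indicator {1..} (norm (fst z)) :: ennreal) = 0"
    by (simp add: nn_integral_0_iff_AE)
  then show ?thesis by eventually_elim (auto simp: indicator_def split: if_splits)
qed

text \<open>The gradient bound \<open>32/\<delta>\<close>, the factor \<open>2 \<delta>\<close> from
  the shell and the half from \<open>cut_identity\<close> combine to a constant free of \<delta>;
  \<open>1/c0\<close> bounds \<open>|\<xi>|\<close> on the sphere bundle, and \<open>K\<close> comes
  from the shell estimate. The boundary flux is only estimated, which suffices along sequences whose
  boundary norms tend to 0.\<close>

lemma Liouville_boundary:
  obtains C where "0 \<le> C" "\<And>w. w \<in> C1_Omega n \<Longrightarrow>
    \<bar>LINT z|Sigma_measure n. Hop z (C1T w z) * w z\<bar> \<le> C * (LINT z|bd_measure n. (w z)\<^sup>2)"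
proof -
  obtain K where K: "K > 0" "\<And>x. x \<in> MM \<Longrightarrow> n x \<le> K" using n_upper by blast
  let ?S = "Sigma_measure n"
  have "\<bar>LINT z|?S. Hop z (C1T w z) * w z\<bar> \<le> 32 / c0 * K * (LINT z|bd_measure n. (w z)\<^sup>2)" if w: "w \<in> C1_Omega n" for w
  proof -
    define B where "B = (LINT z|bd_measure n. (w z)\<^sup>2)"
    define f where "f z = Hop z (C1T w z) * w z" for z
    have wc: "continuous_on (Omega n) w" by (rule C1_continuous_Omega[OF w])
    have B: "(\<integral>\<^sup>+z. ennreal ((w z)\<^sup>2) \<partial>bd_measure n) = ennreal B" "B \<ge> 0"
      unfolding B_def by (intro nn_integral_eq_integral continuous_Omega_bd continuous_intros wc) auto
    have fi: "integrable ?S f" unfolding f_def[abs_def]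
      by (intro L2v_integrable(1) continuous_Omega_L2v Hop_continuous w)
    have [measurable]: "(\<lambda>z. fst z) \<in> ?S \<rightarrow>\<^sub>M borel"
      unfolding measurable_cong_sets[OF sets_Sigma refl] by (intro measurable_restrict_space1) measurable
    have [measurable]: "w \<in> borel_measurable ?S" using continuous_Omega_L2v[OF wc] by auto
    have bound: "\<bar>LINT z|?S. f z\<bar> \<le> 32 / c0 * (K * B + e)" if e: "0 < e" for e
    proof -
      obtain d where d: "0 < d" "d < 1" and sh: "\<And>a. 1 - d < a \<Longrightarrow> a < 1 \<Longrightarrow>
         (\<integral>\<^sup>+z. indicator {a..} (norm (fst z)) * ennreal ((w z)\<^sup>2) \<partial>?S) \<le> ennreal (1 - a) * (ennreal K * ennreal B + ennreal e)"
        using shell_estimate[OF wc K e] unfolding B(1) by blast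
      \<comment> \<open>Chosen so that \<open>2 \<delta> k < d\<close>: the shell that supports the
        gradient of the cut-off then lies in the range where \<open>sh\<close> applies.\<close>
      define \<delta> where "\<delta> k = d / (2 * (real k + 2))" for k :: nat
      have del_eq: "\<delta> k = d / 2 * inverse (real (Suc (k + 1)))" for k by (simp add: \<delta>_def field_simps)
      have del: "0 < \<delta> k" "2 * \<delta> k < d" "\<delta> k < 1" for k
      proof -
        show p: "0 < \<delta> k" unfolding del_eq using d by simp
        have "inverse (real (Suc (k + 1))) < inverse 1" by (rule less_imp_inverse_less) simp_all
        then have "d * inverse (real (Suc (k + 1))) < d * 1" using d by (intro mult_strict_left_mono) simp_all
        then show "2 * \<delta> k < d" unfolding del_eq by simp
        then show "\<delta> k < 1" using d p by linarith
      qed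
      have del0: "\<delta> \<longlonglongrightarrow> 0" unfolding del_eq[abs_def]
        by (rule tendsto_mult_right_zero) (rule LIMSEQ_ignore_initial_segment[OF LIMSEQ_inverse_real_of_nat])
      have cb: "0 \<le> cutoff \<delta> x" "cutoff \<delta> x \<le> 1" for \<delta> x by (auto simp: cutoff_def smoothstep_simps)
      have est: "\<bar>LINT z|?S. cutoff (\<delta> k) (fst z) * f z\<bar> \<le> 32 / c0 * (K * B + e)" for k
      proof -
        note dk = del[of k]
        have cg: "continuous_on (Omega n) (\<lambda>z. cutoff_grad (\<delta> k) (fst z))"
          by (rule continuous_on_compose2[OF cutoff_grad_continuous[OF dk(1)]]) (auto intro!: continuous_intros)
        have id: "(LINT z|?S. cutoff (\<delta> k) (fst z) * f z) = - (LINT z|?S. (snd z \<bullet> cutoff_grad (\<delta> k) (fst z)) * (w z)\<^sup>2) / 2"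
          unfolding f_def
          by (rule cut_identity[OF w cutoff_deriv[OF dk(1)] cutoff_grad_continuous[OF dk(1)], of "\<delta> k / 2"])
             (use dk cutoff_supp[OF dk(1,3)] in auto)
        let ?h = "\<lambda>z. indicator {1 - 2 * \<delta> k..} (norm (fst z)) * (w z)\<^sup>2"
        have hi: "integrable ?S ?h"
        proof (rule Bochner_Integration.integrable_bound)
          show "integrable ?S (\<lambda>z. (w z)\<^sup>2)" by (intro L2v_integrable(1) continuous_Omega_L2v continuous_intros wc)
        qed (measurable, auto simp: indicator_def)
        have pw: "\<bar>(snd z \<bullet> cutoff_grad (\<delta> k) (fst z)) * (w z)\<^sup>2\<bar> \<le> 1 / c0 * (32 / \<delta> k) * ?h z" if z: "z \<in> Omega n" for z
        proof -
          have x: "fst z \<in> MM" "n (fst z) * norm (snd z) = 1" using z by (cases z; auto simp: Omega_iff)+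
          have "c0 * norm (snd z) \<le> n (fst z) * norm (snd z)" using n_ge[OF x(1)] by (rule mult_right_mono) simp
          then have 1: "norm (snd z) \<le> 1 / c0" using c0 x by (simp add: field_simps)
          have "\<bar>snd z \<bullet> cutoff_grad (\<delta> k) (fst z)\<bar> \<le> norm (snd z) * norm (cutoff_grad (\<delta> k) (fst z))" by (rule Cauchy_Schwarz_ineq2)
          also have "\<dots> \<le> 1 / c0 * (32 / \<delta> k * indicator {1 - 2 * \<delta> k..} (norm (fst z)))"
            using 1 cutoff_grad_bound[OF dk(1), of "fst z"] x(1) c0 by (intro mult_mono) (auto simp: MM_facts)
          finally have "\<bar>snd z \<bullet> cutoff_grad (\<delta> k) (fst z)\<bar> * (w z)\<^sup>2 \<le> 1 / c0 * (32 / \<delta> k * indicator {1 - 2 * \<delta> k..} (norm (fst z))) * (w z)\<^sup>2"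
            by (rule mult_right_mono) simp
          then show ?thesis by (simp add: abs_mult mult_ac)
        qed
        have "\<bar>LINT z|?S. (snd z \<bullet> cutoff_grad (\<delta> k) (fst z)) * (w z)\<^sup>2\<bar> \<le> (LINT z|?S. \<bar>(snd z \<bullet> cutoff_grad (\<delta> k) (fst z)) * (w z)\<^sup>2\<bar>)"
          by (rule integral_abs_bound)
        also have "\<dots> \<le> (LINT z|?S. 1 / c0 * (32 / \<delta> k) * ?h z)"
          by (intro integral_mono integrable_abs L2v_integrable(1) continuous_Omega_L2v continuous_intros cg wc integrable_mult_right hi) (use pw in simp)
        also have "\<dots> = 1 / c0 * (32 / \<delta> k) * (LINT z|?S. ?h z)" by simp
        also have "(LINT z|?S. ?h z) \<le> 2 * \<delta> k * (K * B + e)"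
        proof -
          have "ennreal (LINT z|?S. ?h z) = (\<integral>\<^sup>+z. ennreal (?h z) \<partial>?S)"
            by (rule nn_integral_eq_integral[symmetric, OF hi]) simp
          also have "\<dots> = (\<integral>\<^sup>+z. indicator {1 - 2 * \<delta> k..} (norm (fst z)) * ennreal ((w z)\<^sup>2) \<partial>?S)"
            by (rule nn_integral_cong) (simp add: indicator_def)
          also have "\<dots> \<le> ennreal (1 - (1 - 2 * \<delta> k)) * (ennreal K * ennreal B + ennreal e)"
            by (rule sh) (use dk in auto)
          also have "\<dots> = ennreal (2 * \<delta> k * (K * B + e))"
            using K(1) B(2) e dk by (simp add: ennreal_mult ennreal_plus)
          finally show ?thesis using K(1) B(2) e dk by (subst (asm) ennreal_le_iff) auto
        qed
        finally have "\<bar>LINT z|?S. (snd z \<bullet> cutoff_grad (\<delta> k) (fst z)) * (w z)\<^sup>2\<bar> \<le> 1 / c0 * (32 / \<delta> k) * (2 * \<delta> k * (K * B + e))"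
          using c0 dk by (simp add: mult_left_mono divide_right_mono)
        also have "\<dots> = 2 * (32 / c0 * (K * B + e))" using dk(1) by simp
        finally show ?thesis unfolding id by simp
      qed
      have "(\<lambda>k. LINT z|?S. cutoff (\<delta> k) (fst z) * f z) \<longlonglongrightarrow> (LINT z|?S. f z)"
      proof (rule integral_dominated_convergence[where w="\<lambda>z. \<bar>f z\<bar>"])
        have fm: "f \<in> borel_measurable ?S" using fi by auto
        then show "f \<in> borel_measurable ?S" .
        have cm: "cutoff (\<delta> k) \<in> borel_measurable borel" for k
          using cutoff_deriv[OF del(1)[of k]] has_derivative_continuous continuous_at_imp_continuous_on
          by (intro borel_measurable_continuous_onI) blast
        show "(\<lambda>z. cutoff (\<delta> k) (fst z) * f z) \<in> borel_measurable ?S" for k using cm[of k] fm by measurable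
        show "integrable ?S (\<lambda>z. \<bar>f z\<bar>)" using fi by (rule integrable_abs)
        show "AE z in ?S. norm (cutoff (\<delta> k) (fst z) * f z) \<le> \<bar>f z\<bar>" for k
          using cb[of "\<delta> k"] by (auto simp: abs_mult intro!: AE_I2 mult_left_le_one_le)
        \<comment> \<open>At an interior point the cut-off eventually equals 1, and the boundary
          points form a null set.\<close>
        show "AE z in ?S. (\<lambda>k. cutoff (\<delta> k) (fst z) * f z) \<longlonglongrightarrow> f z"
          using AE_interior_Sigma
        proof eventually_elim
          case (elim z)
          define m where "m = 1 - fst z \<bullet> fst z"
          have "(norm (fst z))\<^sup>2 < 1" using elim by (simp add: power_less_one_iff abs_square_less_1)
          then have m: "m > 0" by (simp add: m_def power2_norm_eq_inner)
          have "\<forall>\<^sub>F k in sequentially. \<delta> k < m / 2" using order_tendstoD(2)[OF del0, of "m / 2"] m by simp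
          then have "\<forall>\<^sub>F k in sequentially. cutoff (\<delta> k) (fst z) * f z = f z"
          proof eventually_elim
            case (elim k)
            have "1 \<le> m / \<delta> k - 1" using elim del(1)[of k] by (simp add: field_simps)
            then show ?case by (simp add: cutoff_def m_def smoothstep_simps(2))
          qed
          then show ?case by (rule tendsto_eventually)
        qed
      qed
      then have "(\<lambda>k. \<bar>LINT z|?S. cutoff (\<delta> k) (fst z) * f z\<bar>) \<longlonglongrightarrow> \<bar>LINT z|?S. f z\<bar>" by (rule tendsto_rabs)
      then show ?thesis by (rule LIMSEQ_le_const2) (use est in auto)
    qed
    have "\<bar>LINT z|?S. f z\<bar> \<le> 32 / c0 * (K * B)"
    proof (rule field_le_epsilon)
      fix e :: real assume e: "0 < e"
      have "\<bar>LINT z|?S. f z\<bar> \<le> 32 / c0 * (K * B + e * c0 / 32)" by (rule bound) (use e c0 in simp)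
      also have "\<dots> = 32 / c0 * (K * B) + e" using c0 by (simp add: field_simps)
      finally show "\<bar>LINT z|?S. f z\<bar> \<le> 32 / c0 * (K * B) + e" .
    qed
    then show ?thesis by (simp add: f_def B_def mult.assoc)
  qed
  then show ?thesis using that[of "32 / c0 * K"] K c0 by simp
qed

end

section \<open>The variational problem\<close>

lemma tendsto_zero_le:
  fixes f g :: "nat \<Rightarrow> real"
  assumes "\<And>k. 0 \<le> f k" "\<And>k. f k \<le> g k" "g \<longlonglongrightarrow> 0" shows "f \<longlonglongrightarrow> 0"
  by (rule tendsto_sandwich[OF _ _ tendsto_const assms(3)]) (simp_all add: assms(1,2))

context refractive_index begin

abbreviation \<Sigma> :: "phase measure" where "\<Sigma> \<equiv> Sigma_measure n"

text \<open>The triples of the functions in \<^const>\<open>H10\<close>.\<close>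

definition V0 :: "(phase \<Rightarrow> real \<times> vec3 \<times> vec3) set" where
  "V0 = {U. WD U \<and> (\<exists>w. (\<forall>k::nat. w k \<in> C1_Omega n) \<and> (\<lambda>k. L2norm \<Sigma> (\<lambda>z. C1T (w k) z - U z)) \<longlonglongrightarrow> 0 \<and>
     (\<lambda>k. LINT z|bd_measure n. (w k z)\<^sup>2) \<longlonglongrightarrow> 0)}"

lemma L2norm_cong: "(\<And>z. z \<in> space M \<Longrightarrow> U z = W z) \<Longrightarrow> L2norm M U = L2norm M W"
  unfolding L2norm_def by (intro arg_cong[where f=sqrt] Bochner_Integration.integral_cong) auto

lemma C1T_L2v: "w \<in> C1_Omega n \<Longrightarrow> C1T w \<in> L2v \<Sigma>"
  by (intro continuous_Omega_L2v C1T_continuous)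

text \<open>Trades \<open>H1_norm\<close>, which refers to selected derivatives, for the equivalent
  \<open>L^2\<close> norm of triples, so any version of the weak derivatives can represent a
  function of zero trace.\<close>

lemma V0_iff_H10:
  assumes U: "WD U" shows "U \<in> V0 \<longleftrightarrow> (\<lambda>z. fst (U z)) \<in> H10 n"
proof -
  define u where "u z = fst (U z)" for z
  have u1: "u \<in> H1 n" unfolding H1_iff using U by (intro exI[of _ U]) (simp add: u_def)
  have r: "(LINT z|restrict_space (bd_measure n) (bd_Omega n). f z) = (LINT z|bd_measure n. f z)" for f :: "phase \<Rightarrow> real"
  proof -
    have "bd_Omega n \<inter> space (bd_measure n) \<in> sets (bd_measure n)" using sets.top[of "bd_measure n"] by simp
    then have "(LINT z|restrict_space (bd_measure n) (bd_Omega n). f z) = (LINT z|bd_measure n. indicator (bd_Omega n) z *\<^sub>R f z)"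
      by (rule integral_restrict_space)
    also have "\<dots> = (LINT z|bd_measure n. f z)" by (rule Bochner_Integration.integral_cong) auto
    finally show ?thesis .
  qed
  obtain c C where cC: "0 < c" "0 < C" and eq: "\<And>U u. WD U \<Longrightarrow> (\<And>z. fst (U z) = u z) \<Longrightarrow>
     c * L2norm \<Sigma> U \<le> H1_norm n u \<and> H1_norm n u \<le> C * L2norm \<Sigma> U"
    using H1_norm_equiv by metis
  have conv: "(\<lambda>k. L2norm \<Sigma> (\<lambda>z. C1T (w k) z - U z)) \<longlonglongrightarrow> 0 \<longleftrightarrow> (\<lambda>k. H1_norm n (\<lambda>z. w k z - u z)) \<longlonglongrightarrow> 0"
    if w: "\<And>k::nat. w k \<in> C1_Omega n" for w
  proof -
    have WD: "WD (\<lambda>z. C1T (w k) z - U z)" for k using WD_lincomb[OF C1T_WD[OF w[of k]] U, of 1 "-1"] by simp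
    have b: "c * L2norm \<Sigma> (\<lambda>z. C1T (w k) z - U z) \<le> H1_norm n (\<lambda>z. w k z - u z)"
       "H1_norm n (\<lambda>z. w k z - u z) \<le> C * L2norm \<Sigma> (\<lambda>z. C1T (w k) z - U z)" for k
      using eq[OF WD[of k], of "\<lambda>z. w k z - u z"] by (auto simp: C1T_def u_def)
    have nn: "0 \<le> H1_norm n (\<lambda>z. w k z - u z)" for k
      using b(1)[of k] L2norm_nonneg[of \<Sigma> "\<lambda>z. C1T (w k) z - U z"] cC(1) by (meson mult_nonneg_nonneg less_imp_le order_trans)
    show ?thesis
    proof
      assume l: "(\<lambda>k. L2norm \<Sigma> (\<lambda>z. C1T (w k) z - U z)) \<longlonglongrightarrow> 0"
      show "(\<lambda>k. H1_norm n (\<lambda>z. w k z - u z)) \<longlonglongrightarrow> 0"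
        by (rule tendsto_zero_le[OF nn b(2) tendsto_mult_right_zero[OF l]])
    next
      assume l: "(\<lambda>k. H1_norm n (\<lambda>z. w k z - u z)) \<longlonglongrightarrow> 0"
      have "L2norm \<Sigma> (\<lambda>z. C1T (w k) z - U z) \<le> 1 / c * H1_norm n (\<lambda>z. w k z - u z)" for k
        using b(1)[of k] cC(1) by (simp add: field_simps)
      from tendsto_zero_le[OF L2norm_nonneg this tendsto_mult_right_zero[OF l]]
      show "(\<lambda>k. L2norm \<Sigma> (\<lambda>z. C1T (w k) z - U z)) \<longlonglongrightarrow> 0" .
    qed
  qed
  have "u \<in> H10 n \<longleftrightarrow> (\<exists>w. (\<forall>k::nat. w k \<in> C1_Omega n) \<and> (\<lambda>k. H1_norm n (\<lambda>z. w k z - u z)) \<longlonglongrightarrow> 0 \<and> (\<lambda>k. LINT z|bd_measure n. (w k z)\<^sup>2) \<longlonglongrightarrow> 0)"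
    unfolding H10_def has_trace_def r using u1 by (simp add: L2_def)
  also have "\<dots> \<longleftrightarrow> U \<in> V0" unfolding V0_def using U conv by auto
  finally show ?thesis by (simp add: u_def[abs_def])
qed

lemma V0_lincomb:
  assumes "U \<in> V0" "W \<in> V0" shows "(\<lambda>z. a *\<^sub>R U z + b *\<^sub>R W z) \<in> V0"
proof -
  obtain u where u: "\<And>k::nat. u k \<in> C1_Omega n" "(\<lambda>k. L2norm \<Sigma> (\<lambda>z. C1T (u k) z - U z)) \<longlonglongrightarrow> 0" "(\<lambda>k. LINT z|bd_measure n. (u k z)\<^sup>2) \<longlonglongrightarrow> 0"
    and U: "WD U" using assms(1) unfolding V0_def by blast
  obtain v where v: "\<And>k::nat. v k \<in> C1_Omega n" "(\<lambda>k. L2norm \<Sigma> (\<lambda>z. C1T (v k) z - W z)) \<longlonglongrightarrow> 0" "(\<lambda>k. LINT z|bd_measure n. (v k z)\<^sup>2) \<longlonglongrightarrow> 0"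
    and W: "WD W" using assms(2) unfolding V0_def by blast
  define w where "w k z = a * u k z + b * v k z" for k z
  have wC: "w k \<in> C1_Omega n" for k unfolding w_def[abs_def] by (rule C1_Omega_lincomb(1)[OF u(1) v(1)])
  have le: "L2norm \<Sigma> (\<lambda>z. C1T (w k) z - (a *\<^sub>R U z + b *\<^sub>R W z)) \<le>
      \<bar>a\<bar> * L2norm \<Sigma> (\<lambda>z. C1T (u k) z - U z) + \<bar>b\<bar> * L2norm \<Sigma> (\<lambda>z. C1T (v k) z - W z)" for k
  proof -
    have "L2norm \<Sigma> (\<lambda>z. C1T (w k) z - (a *\<^sub>R U z + b *\<^sub>R W z)) =
      L2norm \<Sigma> (\<lambda>z. a *\<^sub>R (C1T (u k) z - U z) + b *\<^sub>R (C1T (v k) z - W z))"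
      by (rule L2norm_cong) (simp add: w_def[abs_def] C1T_lincomb[OF u(1) v(1)] algebra_simps)
    also have "\<dots> \<le> \<bar>a\<bar> * L2norm \<Sigma> (\<lambda>z. C1T (u k) z - U z) + \<bar>b\<bar> * L2norm \<Sigma> (\<lambda>z. C1T (v k) z - W z)"
      by (intro L2norm_lincomb_le L2v_diff C1T_L2v u v WD_L2v U W)
    finally show ?thesis .
  qed
  have "(\<lambda>k. \<bar>a\<bar> * L2norm \<Sigma> (\<lambda>z. C1T (u k) z - U z) + \<bar>b\<bar> * L2norm \<Sigma> (\<lambda>z. C1T (v k) z - W z)) \<longlonglongrightarrow> 0"
    by (intro tendsto_add_zero tendsto_mult_right_zero u(2) v(2))
  from tendsto_zero_le[OF L2norm_nonneg le this]
  have "(\<lambda>k. L2norm \<Sigma> (\<lambda>z. C1T (w k) z - (a *\<^sub>R U z + b *\<^sub>R W z))) \<longlonglongrightarrow> 0" .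
  moreover have "(\<lambda>k. LINT z|bd_measure n. (w k z)\<^sup>2) \<longlonglongrightarrow> 0"
  proof (rule tendsto_zero_le)
    have i: "integrable (bd_measure n) (\<lambda>z. (f z)\<^sup>2)" if "f \<in> C1_Omega n" for f
      by (intro continuous_Omega_bd continuous_intros C1_continuous_Omega that)
    have sq: "(a * x + b * y)\<^sup>2 \<le> 2 * a\<^sup>2 * x\<^sup>2 + 2 * b\<^sup>2 * y\<^sup>2" for x y
    proof -
      have "0 \<le> (a * x - b * y)\<^sup>2" by simp
      then show ?thesis by (simp add: power2_eq_square algebra_simps)
    qed
    fix k
    have "(LINT z|bd_measure n. (w k z)\<^sup>2) \<le> (LINT z|bd_measure n. 2 * a\<^sup>2 * (u k z)\<^sup>2 + 2 * b\<^sup>2 * (v k z)\<^sup>2)"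
      by (intro integral_mono i wC Bochner_Integration.integrable_add integrable_mult_right u v) (simp add: w_def sq)
    also have "\<dots> = 2 * a\<^sup>2 * (LINT z|bd_measure n. (u k z)\<^sup>2) + 2 * b\<^sup>2 * (LINT z|bd_measure n. (v k z)\<^sup>2)"
      using i[OF u(1)] i[OF v(1)] by simp
    finally show "(LINT z|bd_measure n. (w k z)\<^sup>2) \<le> 2 * a\<^sup>2 * (LINT z|bd_measure n. (u k z)\<^sup>2) + 2 * b\<^sup>2 * (LINT z|bd_measure n. (v k z)\<^sup>2)" .
    show "0 \<le> (LINT z|bd_measure n. (w k z)\<^sup>2)" by simp
  next
    show "(\<lambda>k. 2 * a\<^sup>2 * (LINT z|bd_measure n. (u k z)\<^sup>2) + 2 * b\<^sup>2 * (LINT z|bd_measure n. (v k z)\<^sup>2)) \<longlonglongrightarrow> 0"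
      by (intro tendsto_add_zero tendsto_mult_right_zero u(3) v(3))
  qed
  ultimately show ?thesis unfolding V0_def using wC WD_lincomb[OF U W] by blast
qed

lemma V0_nonempty: "V0 \<noteq> {}"
proof -
  have h: "hat (\<lambda>_. 0) = (\<lambda>_. 0)" by (simp add: hat_def fun_eq_iff)
  have "hatD (\<lambda>_. 0) z = (\<lambda>_. 0)" if "z \<in> S0" for z
  proof (rule S0_deriv_unique[OF that])
    show "((\<lambda>_. 0) has_derivative hatD (\<lambda>_. 0) z) (at z within S0)"
      unfolding hatD_def h by (simp add: frechet_derivative_works[symmetric])
  qed simp
  then have "(\<lambda>_. 0) \<in> C1_Omega n"
    unfolding C1_Omega_iff h by (auto cong: continuous_on_cong)
  then have "C1T (\<lambda>_. 0) \<in> V0"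
    unfolding V0_def by (auto intro!: C1T_WD exI[of _ "\<lambda>_ _. 0"] simp: L2norm_def)
  then show ?thesis by blast
qed

text \<open>Diagonal argument: for each \<open>k\<close> a \<open>C^1\<close> function is taken that
  is within \<open>1/(k+1)\<close> of \<open>X k\<close> in the norm of triples and has boundary
  integral below \<open>1/(k+1)\<close>.\<close>

lemma V0_closed:
  assumes X: "\<And>k::nat. X k \<in> V0" and U: "U \<in> L2v \<Sigma>" and lim: "(\<lambda>k. L2norm \<Sigma> (\<lambda>z. X k z - U z)) \<longlonglongrightarrow> 0"
  shows "U \<in> V0"
proof -
  have XW: "WD (X k)" for k using X[of k] by (simp add: V0_def)
  have UW: "WD U" by (rule WD_closed[OF XW U lim])
  have ex: "\<exists>w. w \<in> C1_Omega n \<and> L2norm \<Sigma> (\<lambda>z. C1T w z - X k z) < inverse (real (Suc k)) \<and> (LINT z|bd_measure n. (w z)\<^sup>2) < inverse (real (Suc k))" for k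
  proof -
    obtain u where u: "\<And>k::nat. u k \<in> C1_Omega n" "(\<lambda>j. L2norm \<Sigma> (\<lambda>z. C1T (u j) z - X k z)) \<longlonglongrightarrow> 0" "(\<lambda>k. LINT z|bd_measure n. (u k z)\<^sup>2) \<longlonglongrightarrow> 0"
      using X[of k] unfolding V0_def by blast
    have p: "0 < inverse (real (Suc k))" by simp
    have "\<forall>\<^sub>F j in sequentially. L2norm \<Sigma> (\<lambda>z. C1T (u j) z - X k z) < inverse (real (Suc k)) \<and> (LINT z|bd_measure n. (u j z)\<^sup>2) < inverse (real (Suc k))"
      using order_tendstoD(2)[OF u(2) p] order_tendstoD(2)[OF u(3) p] by eventually_elim simp
    then obtain j where "L2norm \<Sigma> (\<lambda>z. C1T (u j) z - X k z) < inverse (real (Suc k)) \<and> (LINT z|bd_measure n. (u j z)\<^sup>2) < inverse (real (Suc k))"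
      using eventually_happens'[OF sequentially_bot] by blast
    then show ?thesis using u(1) by blast
  qed
  from choice[OF allI[OF ex]] obtain w where w': "\<forall>k. w k \<in> C1_Omega n \<and> L2norm \<Sigma> (\<lambda>z. C1T (w k) z - X k z) < inverse (real (Suc k)) \<and> (LINT z|bd_measure n. (w k z)\<^sup>2) < inverse (real (Suc k))" ..
  note w = w'[rule_format, THEN conjunct1] w'[rule_format, THEN conjunct2, THEN conjunct1] w'[rule_format, THEN conjunct2, THEN conjunct2]
  have le: "L2norm \<Sigma> (\<lambda>z. C1T (w k) z - U z) \<le> inverse (real (Suc k)) + L2norm \<Sigma> (\<lambda>z. X k z - U z)" for k
    using L2norm_diff_triangle[OF C1T_L2v[OF w(1)[of k]] WD_L2v[OF XW[of k]] U] w(2)[of k] by linarith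
  have "(\<lambda>k. inverse (real (Suc k)) + L2norm \<Sigma> (\<lambda>z. X k z - U z)) \<longlonglongrightarrow> 0"
    by (intro tendsto_add_zero LIMSEQ_inverse_real_of_nat lim)
  from tendsto_zero_le[OF L2norm_nonneg le this]
  have "(\<lambda>k. L2norm \<Sigma> (\<lambda>z. C1T (w k) z - U z)) \<longlonglongrightarrow> 0" .
  moreover have "(\<lambda>k. LINT z|bd_measure n. (w k z)\<^sup>2) \<longlonglongrightarrow> 0"
    by (rule tendsto_zero_le[OF _ less_imp_le[OF w(3)] LIMSEQ_inverse_real_of_nat]) simp
  ultimately show ?thesis unfolding V0_def using UW w(1) by blast
qed

lemma V0_L2v: "U \<in> V0 \<Longrightarrow> U \<in> L2v \<Sigma>"
  by (simp add: V0_def WD_L2v)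

text \<open>The scalar product is the unweighted \<open>L^2\<close> product of triples; by
  \<open>H1_norm_equiv\<close> it gives the same convergence as \<open>H1_norm\<close>.\<close>

sublocale V0: semi_hilbert V0 "\<lambda>a U b W z. a *\<^sub>R U z + b *\<^sub>R W z" "\<lambda>U W. LINT z|\<Sigma>. U z \<bullet> W z"
proof
  show "V0 \<noteq> {}" by (rule V0_nonempty)
  show "(\<lambda>z. a *\<^sub>R U z + b *\<^sub>R W z) \<in> V0" if "U \<in> V0" "W \<in> V0" for U W a b using that by (rule V0_lincomb)
  show "(LINT z|\<Sigma>. (a *\<^sub>R U z + b *\<^sub>R W z) \<bullet> X z) = a * (LINT z|\<Sigma>. U z \<bullet> X z) + b * (LINT z|\<Sigma>. W z \<bullet> X z)"
    if "U \<in> V0" "W \<in> V0" "X \<in> V0" for U W X a b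
    using integrable_inner_L2v[OF V0_L2v[OF that(1)] V0_L2v[OF that(3)]] integrable_inner_L2v[OF V0_L2v[OF that(2)] V0_L2v[OF that(3)]]
    by (simp add: inner_add_left)
  show "(LINT z|\<Sigma>. U z \<bullet> W z) = (LINT z|\<Sigma>. W z \<bullet> U z)" for U W :: "phase \<Rightarrow> real \<times> vec3 \<times> vec3" by (simp add: inner_commute)
  show "0 \<le> (LINT z|\<Sigma>. U z \<bullet> U z)" for U :: "phase \<Rightarrow> real \<times> vec3 \<times> vec3" by simp
next
  fix x :: "nat \<Rightarrow> phase \<Rightarrow> real \<times> vec3 \<times> vec3"
  assume x: "\<And>k. x k \<in> V0"
    and sm: "summable (\<lambda>k. sqrt (LINT z|\<Sigma>. (1 *\<^sub>R x (Suc k) z + (-1) *\<^sub>R x k z) \<bullet> (1 *\<^sub>R x (Suc k) z + (-1) *\<^sub>R x k z)))"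
  have "summable (\<lambda>k. L2norm \<Sigma> (\<lambda>z. x (Suc k) z - x k z))" using sm by (simp add: L2norm_def)
  from L2v_complete[OF finite_Sigma V0_L2v[OF x] this] obtain l where l: "l \<in> L2v \<Sigma>" "(\<lambda>k. L2norm \<Sigma> (\<lambda>z. x k z - l z)) \<longlonglongrightarrow> 0" by blast
  have "(\<lambda>k. (L2norm \<Sigma> (\<lambda>z. x k z - l z))\<^sup>2) \<longlonglongrightarrow> 0\<^sup>2" by (intro tendsto_intros l)
  then show "\<exists>l\<in>V0. (\<lambda>k. LINT z|\<Sigma>. (1 *\<^sub>R x k z + (-1) *\<^sub>R l z) \<bullet> (1 *\<^sub>R x k z + (-1) *\<^sub>R l z)) \<longlonglongrightarrow> 0"
    using V0_closed[OF x l] by (intro bexI[of _ l]) (simp_all add: L2norm_def)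
qed

text \<open>The integrand of \<open>a_form\<close> on triples, with the Christoffel terms absorbed
  into \<open>Hop\<close>. For \<open>e = 0\<close> and \<beta> = 0 it is the transport part alone,
  which is isolated in this way below.\<close>

definition af :: "real \<Rightarrow> (phase \<Rightarrow> real) \<Rightarrow> phase \<Rightarrow> real \<times> vec3 \<times> vec3 \<Rightarrow> real \<times> vec3 \<times> vec3 \<Rightarrow> real" where
  "af e \<beta> z S T = e / (N (fst z))\<^sup>2 * (fst (snd S) \<bullet> fst (snd T) + snd (snd S) \<bullet> snd (snd T)) + Hop z S * fst T + \<beta> z * fst S * fst T"

definition Af :: "real \<Rightarrow> (phase \<Rightarrow> real) \<Rightarrow> (phase \<Rightarrow> real \<times> vec3 \<times> vec3) \<Rightarrow> (phase \<Rightarrow> real \<times> vec3 \<times> vec3) \<Rightarrow> real" where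
  "Af e \<beta> U W = (LINT z|\<Sigma>. af e \<beta> z (U z) (W z))"

lemma af_measurable:
  assumes U: "U \<in> L2v \<Sigma>" and W: "W \<in> L2v \<Sigma>" and b: "\<beta> \<in> borel_measurable \<Sigma>"
  shows "(\<lambda>z. af e \<beta> z (U z) (W z)) \<in> borel_measurable \<Sigma>"
proof -
  note [measurable] = b
  have [measurable]: "(\<lambda>z. fst (X z)) \<in> borel_measurable \<Sigma>" "(\<lambda>z. fst (snd (X z))) \<in> borel_measurable \<Sigma>" "(\<lambda>z. snd (snd (X z))) \<in> borel_measurable \<Sigma>"
    if "X \<in> L2v \<Sigma>" for X :: "phase \<Rightarrow> real \<times> vec3 \<times> vec3"
    using L2v_components[OF that, THEN L2v_measurable] by (auto simp: borel_measurable_vec3_iff)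
  note [measurable] = this[OF U] this[OF W]
  have [measurable]: "(\<lambda>z. N (fst z)) \<in> borel_measurable \<Sigma>" "(\<lambda>z. snd z) \<in> borel_measurable \<Sigma>"
    unfolding measurable_cong_sets[OF sets_Sigma refl] by (intro measurable_restrict_space1; measurable)+
  have [measurable]: "ccoef \<in> borel_measurable \<Sigma>" using continuous_Omega_L2v[OF ccoef_continuous] by auto
  show ?thesis unfolding af_def Hop_def by measurable
qed

text \<open>On the sphere bundle \<open>|\<xi>| \<le> 1/c0\<close>, and \<open>ccoef\<close> is
  bounded by compactness; only the bound on \<beta> holds almost everywhere. Quantifying over
  \<open>S\<close> and \<open>T\<close> inside gives one null set for all triples.\<close>

lemma af_bound:
  assumes b: "\<beta> \<in> Linfty \<Sigma>"
  obtains C where "0 \<le> C" "AE z in \<Sigma>. \<forall>S T. \<bar>af e \<beta> z S T\<bar> \<le> C * (norm S * norm T)"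
proof -
  obtain B where B: "AE z in \<Sigma>. \<bar>\<beta> z\<bar> \<le> B" using b unfolding Linfty_def by blast
  obtain D where D: "\<And>z. z \<in> Omega n \<Longrightarrow> norm (ccoef z) \<le> D"
    using compact_imp_bounded[OF compact_continuous_image[OF ccoef_continuous Omega_compact]] unfolding bounded_iff by blast
  define C where "C = \<bar>e\<bar> / c0\<^sup>2 * 2 + (1 / c0 + max 0 D) + max 0 B"
  have C: "0 \<le> C" using c0 by (simp add: C_def)
  have bd: "\<bar>af e \<beta> z S T\<bar> \<le> C * (norm S * norm T)" if z: "z \<in> Omega n" and bz: "\<bar>\<beta> z\<bar> \<le> B" for z S T
  proof -
    have x: "fst z \<in> MM" "n (fst z) * norm (snd z) = 1" using z by (cases z; auto simp: Omega_iff)+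
    have "c0 * norm (snd z) \<le> n (fst z) * norm (snd z)" using n_ge[OF x(1)] by (rule mult_right_mono) simp
    then have xi: "norm (snd z) \<le> 1 / c0" using c0 x by (simp add: field_simps)
    have "c0\<^sup>2 \<le> (N (fst z))\<^sup>2" using n_ge[OF x(1)] c0 x by (intro power_mono) (auto simp: N_simps)
    then have N: "\<bar>e / (N (fst z))\<^sup>2\<bar> \<le> \<bar>e\<bar> / c0\<^sup>2" using c0 by (simp add: frac_le)
    note st = triple_norms_le[of S] triple_norms_le[of T]
    let ?P = "norm S * norm T"
    have "\<bar>fst (snd S) \<bullet> fst (snd T)\<bar> \<le> ?P" "\<bar>snd (snd S) \<bullet> snd (snd T)\<bar> \<le> ?P"
      using order_trans[OF Cauchy_Schwarz_ineq2 mult_mono[OF st(1) st(4)]] order_trans[OF Cauchy_Schwarz_ineq2 mult_mono[OF st(2) st(5)]] by auto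
    then have 1: "\<bar>fst (snd S) \<bullet> fst (snd T) + snd (snd S) \<bullet> snd (snd T)\<bar> \<le> 2 * ?P" by linarith
    have "\<bar>e / (N (fst z))\<^sup>2 * (fst (snd S) \<bullet> fst (snd T) + snd (snd S) \<bullet> snd (snd T))\<bar> \<le> \<bar>e\<bar> / c0\<^sup>2 * (2 * ?P)"
      unfolding abs_mult by (rule mult_mono[OF N 1]) auto
    moreover have "\<bar>Hop z S * fst T\<bar> \<le> (1 / c0 + max 0 D) * ?P"
    proof -
      have "\<bar>fst (snd S) \<bullet> snd z\<bar> \<le> norm S * (1 / c0)"
        by (rule order_trans[OF Cauchy_Schwarz_ineq2 mult_mono[OF st(1) xi]]) auto
      moreover have "\<bar>snd (snd S) \<bullet> ccoef z\<bar> \<le> norm S * max 0 D"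
        by (rule order_trans[OF Cauchy_Schwarz_ineq2 mult_mono[OF st(2)]]) (use D[OF z] in auto)
      ultimately have "\<bar>Hop z S\<bar> \<le> norm S * (1 / c0 + max 0 D)" unfolding Hop_def by (simp add: algebra_simps)
      then have "\<bar>Hop z S\<bar> * \<bar>fst T\<bar> \<le> (norm S * (1 / c0 + max 0 D)) * norm T"
        using st(6) c0 by (intro mult_mono) auto
      then show ?thesis by (simp add: abs_mult mult_ac)
    qed
    moreover have "\<bar>\<beta> z * fst S * fst T\<bar> \<le> max 0 B * ?P"
    proof -
      have "\<bar>\<beta> z\<bar> * (\<bar>fst S\<bar> * \<bar>fst T\<bar>) \<le> max 0 B * ?P" using bz st(3,6) by (intro mult_mono) auto
      then show ?thesis by (simp add: abs_mult mult_ac)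
    qed
    ultimately have "\<bar>af e \<beta> z S T\<bar> \<le> \<bar>e\<bar> / c0\<^sup>2 * (2 * ?P) + (1 / c0 + max 0 D) * ?P + max 0 B * ?P"
      unfolding af_def by linarith
    also have "\<dots> = C * ?P" unfolding C_def by (simp only: distrib_right mult.assoc)
    finally show ?thesis .
  qed
  have "AE z in \<Sigma>. \<forall>S T. \<bar>af e \<beta> z S T\<bar> \<le> C * (norm S * norm T)"
    using B AE_space by eventually_elim (use bd in simp)
  then show ?thesis using that C by blast
qed

lemma Af_bounded:
  assumes b: "\<beta> \<in> Linfty \<Sigma>"
  obtains C where "0 \<le> C" "\<And>U W. U \<in> L2v \<Sigma> \<Longrightarrow> W \<in> L2v \<Sigma> \<Longrightarrow>
    integrable \<Sigma> (\<lambda>z. af e \<beta> z (U z) (W z)) \<and> \<bar>Af e \<beta> U W\<bar> \<le> C * (L2norm \<Sigma> U * L2norm \<Sigma> W)"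
proof -
  obtain C where C: "0 \<le> C" "AE z in \<Sigma>. \<forall>S T. \<bar>af e \<beta> z S T\<bar> \<le> C * (norm S * norm T)" using af_bound[OF b] by blast
  have bm: "\<beta> \<in> borel_measurable \<Sigma>" using b by (simp add: Linfty_def)
  show ?thesis
  proof (rule that[OF C(1)])
    fix U W :: "phase \<Rightarrow> real \<times> vec3 \<times> vec3" assume U: "U \<in> L2v \<Sigma>" and W: "W \<in> L2v \<Sigma>"
    have n: "(\<lambda>z. norm (U z)) \<in> L2v \<Sigma>" "(\<lambda>z. norm (W z)) \<in> L2v \<Sigma>" using U W by (auto simp: L2v_def)
    have nn: "L2norm \<Sigma> (\<lambda>z. norm (X z)) = L2norm \<Sigma> X" for X :: "phase \<Rightarrow> real \<times> vec3 \<times> vec3"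
      by (simp add: L2norm_def power2_norm_eq_inner flip: power2_eq_square)
    have i: "integrable \<Sigma> (\<lambda>z. C * (norm (U z) * norm (W z)))" using integrable_inner_L2v[OF n] by simp
    have ae: "AE z in \<Sigma>. \<bar>af e \<beta> z (U z) (W z)\<bar> \<le> C * (norm (U z) * norm (W z))" using C(2) by eventually_elim blast
    have ia: "integrable \<Sigma> (\<lambda>z. af e \<beta> z (U z) (W z))"
    proof (rule Bochner_Integration.integrable_bound[OF i af_measurable[OF U W bm]])
      show "AE z in \<Sigma>. norm (af e \<beta> z (U z) (W z)) \<le> norm (C * (norm (U z) * norm (W z)))"
        using ae by eventually_elim (use C(1) in simp)
    qed
    have "\<bar>Af e \<beta> U W\<bar> \<le> (LINT z|\<Sigma>. \<bar>af e \<beta> z (U z) (W z)\<bar>)" unfolding Af_def by (rule integral_abs_bound)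
    also have "\<dots> \<le> (LINT z|\<Sigma>. C * (norm (U z) * norm (W z)))" by (rule integral_mono_AE[OF integrable_abs[OF ia] i ae])
    also have "\<dots> = C * (LINT z|\<Sigma>. norm (U z) \<bullet> norm (W z))" by simp
    also have "\<dots> \<le> C * (L2norm \<Sigma> U * L2norm \<Sigma> W)"
      using cauchy_schwarz_L2v[OF n] unfolding nn by (intro mult_left_mono C(1)) linarith
    finally show "integrable \<Sigma> (\<lambda>z. af e \<beta> z (U z) (W z)) \<and> \<bar>Af e \<beta> U W\<bar> \<le> C * (L2norm \<Sigma> U * L2norm \<Sigma> W)" using ia by simp
  qed
qed

lemma af_lincomb:
  "af e \<beta> z (a *\<^sub>R S + b *\<^sub>R T) X = a * af e \<beta> z S X + b * af e \<beta> z T X"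
  "af e \<beta> z X (a *\<^sub>R S + b *\<^sub>R T) = a * af e \<beta> z X S + b * af e \<beta> z X T"
  by (simp_all add: af_def Hop_def inner_add algebra_simps)

lemma af_integrable:
  assumes b: "\<beta> \<in> Linfty \<Sigma>" and L: "U \<in> L2v \<Sigma>" "W \<in> L2v \<Sigma>"
  shows "integrable \<Sigma> (\<lambda>z. af e \<beta> z (U z) (W z))"
proof -
  obtain C where "\<And>U W. U \<in> L2v \<Sigma> \<Longrightarrow> W \<in> L2v \<Sigma> \<Longrightarrow> integrable \<Sigma> (\<lambda>z. af e \<beta> z (U z) (W z)) \<and> \<bar>Af e \<beta> U W\<bar> \<le> C * (L2norm \<Sigma> U * L2norm \<Sigma> W)"
    using Af_bounded[OF b] by blast
  then show ?thesis using L by blast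
qed

lemma Af_lincomb:
  assumes b: "\<beta> \<in> Linfty \<Sigma>" and L: "U \<in> L2v \<Sigma>" "W \<in> L2v \<Sigma>" "X \<in> L2v \<Sigma>"
  shows "Af e \<beta> (\<lambda>z. c *\<^sub>R U z + d *\<^sub>R W z) X = c * Af e \<beta> U X + d * Af e \<beta> W X"
    "Af e \<beta> X (\<lambda>z. c *\<^sub>R U z + d *\<^sub>R W z) = c * Af e \<beta> X U + d * Af e \<beta> X W"
proof -
  show "Af e \<beta> (\<lambda>z. c *\<^sub>R U z + d *\<^sub>R W z) X = c * Af e \<beta> U X + d * Af e \<beta> W X"
    "Af e \<beta> X (\<lambda>z. c *\<^sub>R U z + d *\<^sub>R W z) = c * Af e \<beta> X U + d * Af e \<beta> X W"
    unfolding Af_def af_lincomb using af_integrable[OF b L(1,3)] af_integrable[OF b L(2,3)] af_integrable[OF b L(3,1)] af_integrable[OF b L(3,2)] by simp_all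
qed

lemma zero_Linfty: "(\<lambda>_. 0) \<in> Linfty \<Sigma>"
  by (auto simp: Linfty_def intro!: exI[of _ 0])

lemma Af_geodesic_zero:
  assumes U: "U \<in> V0" shows "Af 0 (\<lambda>_. 0) U U = 0"
proof -
  let ?H = "Af 0 (\<lambda>_. 0)"
  obtain C where C: "0 \<le> C" "\<And>U W. U \<in> L2v \<Sigma> \<Longrightarrow> W \<in> L2v \<Sigma> \<Longrightarrow>
    integrable \<Sigma> (\<lambda>z. af 0 (\<lambda>_. 0) z (U z) (W z)) \<and> \<bar>?H U W\<bar> \<le> C * (L2norm \<Sigma> U * L2norm \<Sigma> W)"
    using Af_bounded[OF zero_Linfty] by blast
  obtain D where D: "0 \<le> D" "\<And>w. w \<in> C1_Omega n \<Longrightarrow> \<bar>LINT z|\<Sigma>. Hop z (C1T w z) * w z\<bar> \<le> D * (LINT z|bd_measure n. (w z)\<^sup>2)"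
    using Liouville_boundary by blast
  obtain w where w: "\<And>k::nat. w k \<in> C1_Omega n" "(\<lambda>k. L2norm \<Sigma> (\<lambda>z. C1T (w k) z - U z)) \<longlonglongrightarrow> 0" "(\<lambda>k. LINT z|bd_measure n. (w k z)\<^sup>2) \<longlonglongrightarrow> 0"
    using U unfolding V0_def by blast
  define X where "X k = C1T (w k)" for k
  define \<delta> where "\<delta> k = L2norm \<Sigma> (\<lambda>z. X k z - U z)" for k
  have UL: "U \<in> L2v \<Sigma>" and XL: "X k \<in> L2v \<Sigma>" for k using V0_L2v[OF U] C1T_L2v[OF w(1)] by (auto simp: X_def)
  have d: "(\<lambda>z. X k z - U z) \<in> L2v \<Sigma>" for k by (rule L2v_diff[OF XL UL])
  have dl: "\<delta> \<longlonglongrightarrow> 0" using w(2) by (simp add: \<delta>_def[abs_def] X_def)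
  \<comment> \<open>The form is expanded at \<open>X k = U + (X k - U)\<close>: the mixed and
    quadratic terms are small by boundedness, and its value at \<open>X k\<close> is controlled by
    the boundary integral of \<open>w k\<close>.\<close>
  have bnd: "\<bar>?H U U\<bar> \<le> D * (LINT z|bd_measure n. (w k z)\<^sup>2) + C * (\<delta> k * (\<delta> k + 2 * L2norm \<Sigma> U))" for k
  proof -
    have "?H (X k) (X k) = ?H U U + ?H U (\<lambda>z. X k z - U z) + ?H (\<lambda>z. X k z - U z) U + ?H (\<lambda>z. X k z - U z) (\<lambda>z. X k z - U z)"
      using Af_lincomb(1)[OF zero_Linfty XL[of k] UL, of _ 0 1 "-1"] Af_lincomb(2)[OF zero_Linfty XL[of k] UL, of _ 0 1 "-1"] XL UL d by simp
    moreover have "\<bar>?H U (\<lambda>z. X k z - U z)\<bar> \<le> C * (L2norm \<Sigma> U * \<delta> k)" "\<bar>?H (\<lambda>z. X k z - U z) U\<bar> \<le> C * (\<delta> k * L2norm \<Sigma> U)"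
      "\<bar>?H (\<lambda>z. X k z - U z) (\<lambda>z. X k z - U z)\<bar> \<le> C * (\<delta> k * \<delta> k)"
      unfolding \<delta>_def using C(2) UL d by blast+
    moreover have "?H (X k) (X k) = (LINT z|\<Sigma>. Hop z (C1T (w k) z) * w k z)"
      by (simp add: Af_def af_def X_def) (simp add: C1T_def)
    moreover note D(2)[OF w(1)[of k]]
    ultimately have "\<bar>?H U U\<bar> \<le> D * (LINT z|bd_measure n. (w k z)\<^sup>2) + (C * (L2norm \<Sigma> U * \<delta> k) + C * (\<delta> k * L2norm \<Sigma> U) + C * (\<delta> k * \<delta> k))"
      by linarith
    then show ?thesis by (simp add: algebra_simps)
  qed
  have "(\<lambda>k. D * (LINT z|bd_measure n. (w k z)\<^sup>2) + C * (\<delta> k * (\<delta> k + 2 * L2norm \<Sigma> U))) \<longlonglongrightarrow> D * 0 + C * (0 * (0 + 2 * L2norm \<Sigma> U))"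
    by (intro tendsto_intros w dl)
  then have "\<bar>?H U U\<bar> \<le> D * 0 + C * (0 * (0 + 2 * L2norm \<Sigma> U))" by (rule LIMSEQ_le_const) (use bnd in blast)
  then show ?thesis by simp
qed

lemma Af_coercive:
  assumes b: "\<beta> \<in> Linfty \<Sigma>" and e: "0 < e" and a0: "0 < a0" "\<And>z. z \<in> Omega n \<Longrightarrow> a0 \<le> \<beta> z"
  obtains c where "0 < c" "\<And>U. U \<in> V0 \<Longrightarrow> c * (LINT z|\<Sigma>. U z \<bullet> U z) \<le> Af e \<beta> U U"
proof -
  obtain K where K: "K > 0" "\<And>x. x \<in> MM \<Longrightarrow> n x \<le> K" using n_upper by blast
  \<comment> \<open>\<open>K\<close> bounds \<open>n\<close> from above, so \<open>e / K^2\<close>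
    is a lower bound for the elliptic coefficient \<open>e / N^2\<close>; \<open>a0\<close> takes
    care of the absorption term.\<close>
  define c where "c = min (e / K\<^sup>2) a0"
  have c: "0 < c" using e a0 K by (simp add: c_def)
  show ?thesis
  proof (rule that[OF c])
    fix U assume U: "U \<in> V0"
    have UL: "U \<in> L2v \<Sigma>" by (rule V0_L2v[OF U])
    have i: "integrable \<Sigma> (\<lambda>z. af e \<beta> z (U z) (U z))" "integrable \<Sigma> (\<lambda>z. af 0 (\<lambda>_. 0) z (U z) (U z))"
      by (rule af_integrable[OF b UL UL] af_integrable[OF zero_Linfty UL UL])+
    have "c * (LINT z|\<Sigma>. U z \<bullet> U z) = (LINT z|\<Sigma>. c * (U z \<bullet> U z))" by simp
    \<comment> \<open>Subtracting the transport form, whose integral is 0, leaves an integrand that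
      is bounded below pointwise.\<close>
    also have "\<dots> \<le> (LINT z|\<Sigma>. af e \<beta> z (U z) (U z) - af 0 (\<lambda>_. 0) z (U z) (U z))"
    proof (intro integral_mono integrable_mult_right integrable_inner_L2v UL Bochner_Integration.integrable_diff i)
      fix z assume "z \<in> space \<Sigma>"
      then have z: "z \<in> Omega n" by simp
      have x: "fst z \<in> MM" using z by (cases z) (auto simp: Omega_iff)
      obtain u p q where UZ: "U z = (u, p, q)" by (metis surj_pair)
      have "(N (fst z))\<^sup>2 \<le> K\<^sup>2" using K(2)[OF x] n_pos[OF x] x by (intro power_mono) (auto simp: N_simps)
      then have "e / K\<^sup>2 \<le> e / (N (fst z))\<^sup>2" using e N_simps(2)[of "fst z"] K(1) by (intro divide_left_mono) auto
      then have "c \<le> e / (N (fst z))\<^sup>2" by (simp add: c_def)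
      then have 1: "c * (p \<bullet> p + q \<bullet> q) \<le> e / (N (fst z))\<^sup>2 * (p \<bullet> p + q \<bullet> q)" by (rule mult_right_mono) simp
      have "c \<le> \<beta> z" using a0(2)[OF z] by (simp add: c_def)
      then have 2: "c * (u * u) \<le> \<beta> z * (u * u)" by (rule mult_right_mono) simp
      show "c * (U z \<bullet> U z) \<le> af e \<beta> z (U z) (U z) - af 0 (\<lambda>_. 0) z (U z) (U z)"
        using 1 2 by (simp add: UZ af_def algebra_simps)
    qed
    also have "\<dots> = Af e \<beta> U U - Af 0 (\<lambda>_. 0) U U" unfolding Af_def using i by simp
    finally show "c * (LINT z|\<Sigma>. U z \<bullet> U z) \<le> Af e \<beta> U U" using Af_geodesic_zero[OF U] by simp
  qed
qed

text \<open>The selected derivatives agree almost everywhere with those of any triple, so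
  \<open>a_form\<close> inherits bilinearity and boundedness from \<open>Af\<close>.\<close>

lemma a_form_eq:
  assumes b: "\<beta> \<in> Linfty \<Sigma>" and U: "WD U" "\<And>z. fst (U z) = u z" and W: "WD W" "\<And>z. fst (W z) = v z"
  shows "a_form n \<beta> e u v = Af e \<beta> U W"
proof -
  have bm: "\<beta> \<in> borel_measurable \<Sigma>" using b by (simp add: Linfty_def)
  have uH: "u \<in> H1 n" "v \<in> H1 n" using U W H1_iff by blast+
  have L: "triple u \<in> L2v \<Sigma>" "triple v \<in> L2v \<Sigma>" "U \<in> L2v \<Sigma>" "W \<in> L2v \<Sigma>"
    using uH U W by (auto intro: WD_L2v triple_WD)
  have "a_form n \<beta> e u v = (LINT z|\<Sigma>. af e \<beta> z (triple u z) (triple v z))"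
    unfolding a_form_def Let_def
  proof (rule Bochner_Integration.integral_cong[OF refl])
    fix z assume "z \<in> space \<Sigma>"
    then have x: "fst z \<in> MM" by (cases z) (auto simp: Omega_iff)
    have nz: "n (fst z) \<noteq> 0" "N (fst z) = n (fst z)" using n_pos[OF x] N_simps x by auto
    have nx: "nabla_x n u z = fst (snd (triple u z)) /\<^sub>R (n (fst z))\<^sup>2" "nabla_xi n u z = snd (snd (triple u z)) /\<^sub>R (n (fst z))\<^sup>2" for u
      by (auto simp: nabla_x_def nabla_xi_def triple_def dx_def dxi_def vec_eq_iff divide_inverse)
    have Gam: "(\<Sum>i\<in>UNIV. \<Sum>j\<in>UNIV. \<Sum>k\<in>UNIV. Christoffel n i j k (fst z) * snd z $ i * snd z $ j * dxi n u k z) = - (snd (snd (triple u z)) \<bullet> ccoef z)"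
      using Christoffel_contract[of z "snd (snd (triple u z))"] by (simp add: triple_def dxi_def)
    have g: "ginner n (fst z) (p /\<^sub>R (n (fst z))\<^sup>2) (q /\<^sub>R (n (fst z))\<^sup>2) = (p \<bullet> q) / (n (fst z))\<^sup>2"
      "ginner n (fst z) (p /\<^sub>R (n (fst z))\<^sup>2) q = p \<bullet> q" for p q
      using nz by (simp_all add: ginner_def field_simps)
    have t: "fst (triple u z) = u z" for u by (simp add: triple_def)
    show "e * ginner n (fst z) (nabla_x n u z) (nabla_x n v z) + e * ginner n (fst z) (nabla_xi n u z) (nabla_xi n v z)
        + ginner n (fst z) (nabla_x n u z) (snd z) * v z
        - (\<Sum>i\<in>UNIV. \<Sum>j\<in>UNIV. \<Sum>k\<in>UNIV. Christoffel n i j k (fst z) * snd z $ i * snd z $ j * dxi n u k z) * v z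
        + \<beta> z * u z * v z = af e \<beta> z (triple u z) (triple v z)"
      unfolding nx g Gam af_def Hop_def t nz(2) by (simp add: algebra_simps divide_inverse)
  qed
  also have "\<dots> = Af e \<beta> U W"
    unfolding Af_def
  proof (rule integral_cong_AE)
    show "AE z in \<Sigma>. af e \<beta> z (triple u z) (triple v z) = af e \<beta> z (U z) (W z)"
      using triple_eq_AE[OF U] triple_eq_AE[OF W] by eventually_elim simp
  qed (intro af_measurable L bm)+
  finally show ?thesis .
qed

text \<open>Cauchy-Schwarz over the multi-indices bounds the square by the sum of the squared
  components times a power of \<open>|\<xi>| \<le> 1/c0\<close>. The fibres have finite measure, so
  integrability in \<open>x\<close> is enough.\<close>

lemma tensor_apply_L2v:
  assumes f: "f \<in> L2_sym_tensor n m" shows "tensor_apply m f \<in> L2v \<Sigma>"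
proof -
  obtain K where K: "K > 0" "\<And>x. x \<in> MM \<Longrightarrow> n x \<le> K" using n_upper by blast
  have fin: "finite (multi_indices m)"
    using finite_lists_length_eq[of "UNIV :: 3 set" m] by (simp add: multi_indices_def)
  have fm: "(\<lambda>x. f x I) \<in> borel_measurable (restrict_space lborel MM)" if "I \<in> multi_indices m" for I
    using f that by (simp add: L2_sym_tensor_def)
  have fi: "integrable (restrict_space lborel MM) (\<lambda>x. (\<Sum>I\<in>multi_indices m. (f x I)\<^sup>2) / n x ^ (2 * m) * n x ^ 3)"
    using f by (simp add: L2_sym_tensor_def)
  have fst_m: "fst \<in> \<Sigma> \<rightarrow>\<^sub>M restrict_space lborel MM"
  proof (rule measurable_restrict_space2)
    show "fst \<in> space \<Sigma> \<rightarrow> MM" by (auto simp: Omega_iff)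
    have "fst \<in> \<Sigma> \<rightarrow>\<^sub>M borel"
      unfolding measurable_cong_sets[OF sets_Sigma refl] by (intro measurable_restrict_space1) measurable
    then show "fst \<in> \<Sigma> \<rightarrow>\<^sub>M lborel" by simp
  qed
  have snd_m: "(\<lambda>z. snd z $ i) \<in> borel_measurable \<Sigma>" for i
  proof -
    have "snd \<in> borel_measurable \<Sigma>"
      unfolding measurable_cong_sets[OF sets_Sigma refl] by (intro measurable_restrict_space1) measurable
    then show ?thesis by (simp add: borel_measurable_vec3_iff)
  qed
  have pm: "(\<lambda>z. prod_list (map (\<lambda>i. snd z $ i) I)) \<in> borel_measurable \<Sigma>" for I
    by (induction I) (use snd_m in \<open>auto intro: borel_measurable_times\<close>)
  have m: "tensor_apply m f \<in> borel_measurable \<Sigma>"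
    unfolding tensor_apply_def case_prod_beta'
    by (intro borel_measurable_sum borel_measurable_times pm measurable_compose[OF fst_m fm])
  define h where "h x = (\<Sum>I\<in>multi_indices m. (f x I)\<^sup>2)" for x
  have h0: "0 \<le> h x" for x by (simp add: h_def sum_nonneg)
  have hm: "h \<in> borel_measurable (restrict_space lborel MM)"
    unfolding h_def[abs_def] by (intro borel_measurable_sum borel_measurable_power fm)
  define hb where "hb x = ennreal (h x) * indicator MM x" for x
  have hbm: "hb \<in> borel_measurable borel"
  proof -
    have "(\<lambda>x. ennreal (h x)) \<in> borel_measurable (restrict_space lborel MM)" using hm by measurable
    then show ?thesis unfolding hb_def[abs_def]
      by (subst (asm) borel_measurable_restrict_space_iff_ennreal) (auto simp: MM_facts)
  qed
  \<comment> \<open>The number of multi-indices times a bound for the square of one monomial of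
    degree \<open>m\<close> in \<xi>.\<close>
  define M where "M = real (card (multi_indices m)) * ((1 / c0) ^ m)\<^sup>2"
  have M: "M \<ge> 0" by (simp add: M_def)
  have pb: "(tensor_apply m f z)\<^sup>2 \<le> M * h (fst z)" if z: "z \<in> Omega n" for z
  proof -
    have x: "fst z \<in> MM" "n (fst z) * norm (snd z) = 1" using z by (cases z; auto simp: Omega_iff)+
    have "c0 * norm (snd z) \<le> n (fst z) * norm (snd z)" using n_ge[OF x(1)] by (rule mult_right_mono) simp
    then have xi: "norm (snd z) \<le> 1 / c0" using c0 x by (simp add: field_simps)
    have pl: "\<bar>prod_list (map (\<lambda>i. snd z $ i) I)\<bar> \<le> (1 / c0) ^ length I" for I
    proof (induction I)
      case (Cons i I)
      have "\<bar>snd z $ i\<bar> \<le> 1 / c0" using component_le_norm_cart[of "snd z" i] xi by linarith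
      then have "\<bar>snd z $ i\<bar> * \<bar>prod_list (map (\<lambda>i. snd z $ i) I)\<bar> \<le> (1 / c0) * (1 / c0) ^ length I"
        using Cons c0 by (intro mult_mono) auto
      then show ?case by (simp add: abs_mult)
    qed simp
    let ?P = "\<lambda>I. prod_list (map (\<lambda>i. snd z $ i) I)"
    have "(tensor_apply m f z)\<^sup>2 = (\<Sum>I\<in>multi_indices m. f (fst z) I * ?P I)\<^sup>2"
      by (simp add: tensor_apply_def case_prod_beta')
    also have "\<dots> \<le> (\<Sum>I\<in>multi_indices m. (f (fst z) I)\<^sup>2) * (\<Sum>I\<in>multi_indices m. (?P I)\<^sup>2)"
      by (rule Cauchy_Schwarz_ineq_sum)
    finally have le: "(tensor_apply m f z)\<^sup>2 \<le> (\<Sum>I\<in>multi_indices m. (f (fst z) I)\<^sup>2) * (\<Sum>I\<in>multi_indices m. (?P I)\<^sup>2)" .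
    have "(\<Sum>I\<in>multi_indices m. (?P I)\<^sup>2) \<le> (\<Sum>I\<in>multi_indices m. ((1 / c0) ^ m)\<^sup>2)"
    proof (rule sum_mono)
      fix I assume "I \<in> multi_indices m"
      then have "\<bar>?P I\<bar> \<le> (1 / c0) ^ m" using pl[of I] by (simp add: multi_indices_def)
      then have "\<bar>?P I\<bar>\<^sup>2 \<le> ((1 / c0) ^ m)\<^sup>2" by (rule power_mono) simp
      then show "(?P I)\<^sup>2 \<le> ((1 / c0) ^ m)\<^sup>2" by simp
    qed
    then have "(\<Sum>I\<in>multi_indices m. (?P I)\<^sup>2) \<le> M" by (simp add: M_def)
    then have "h (fst z) * (\<Sum>I\<in>multi_indices m. (?P I)\<^sup>2) \<le> h (fst z) * M" using h0 by (rule mult_left_mono)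
    then show ?thesis using le unfolding h_def by (simp only: mult.commute[of M])
  qed
  have "(\<integral>\<^sup>+z. ennreal (norm ((norm (tensor_apply m f z))\<^sup>2)) \<partial>\<Sigma>) \<le> (\<integral>\<^sup>+z. ennreal M * hb (fst z) \<partial>\<Sigma>)"
  proof (rule nn_integral_mono)
    fix z assume "z \<in> space \<Sigma>"
    then have z: "z \<in> Omega n" by simp
    have x: "fst z \<in> MM" using z by (cases z) (auto simp: Omega_iff)
    have "ennreal (norm ((norm (tensor_apply m f z))\<^sup>2)) \<le> ennreal (M * h (fst z))" using pb[OF z] by (intro ennreal_leI) simp
    then show "ennreal (norm ((norm (tensor_apply m f z))\<^sup>2)) \<le> ennreal M * hb (fst z)"
      using x M h0 by (simp add: hb_def ennreal_mult)
  qed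
  also have "\<dots> = (\<integral>\<^sup>+x. indicator MM x * ennreal (N x ^ 3) * (\<integral>\<^sup>+\<omega>. ennreal M * hb x \<partial>sphere_measure) \<partial>lborel)"
    by (subst nn_integral_Sigma_borel) (use measurable_compose[OF phase_fst_borel(1) hbm] in auto)
  \<comment> \<open>\<open>K ^ (2 * m)\<close> compensates the weight \<open>n^(-2m)\<close> in the
    pointwise norm of covariant tensors.\<close>
  also have "\<dots> \<le> (\<integral>\<^sup>+x. (ennreal M * emeasure sphere_measure (sphere 0 1) * ennreal (K ^ (2 * m))) * (ennreal (h x / n x ^ (2 * m) * n x ^ 3) * indicator MM x) \<partial>lborel)"
  proof (rule nn_integral_mono)
    fix x
    show "indicator MM x * ennreal (N x ^ 3) * (\<integral>\<^sup>+\<omega>. ennreal M * hb x \<partial>sphere_measure) \<le>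
      (ennreal M * emeasure sphere_measure (sphere 0 1) * ennreal (K ^ (2 * m))) * (ennreal (h x / n x ^ (2 * m) * n x ^ 3) * indicator MM x)"
    proof (cases "x \<in> MM")
      case True
      note nx = n_pos[OF True] K(2)[OF True]
      have "n x ^ (2 * m) \<le> K ^ (2 * m)" using nx by (intro power_mono) auto
      then have "1 \<le> K ^ (2 * m) / n x ^ (2 * m)" using nx by simp
      then have "h x * n x ^ 3 * 1 \<le> h x * n x ^ 3 * (K ^ (2 * m) / n x ^ (2 * m))" using h0 nx by (intro mult_left_mono) auto
      then have "n x ^ 3 * h x \<le> K ^ (2 * m) * (h x / n x ^ (2 * m) * n x ^ 3)" by (simp add: mult_ac)
      then have "ennreal (n x ^ 3 * h x) \<le> ennreal (K ^ (2 * m) * (h x / n x ^ (2 * m) * n x ^ 3))" by (rule ennreal_leI)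
      then have "ennreal (n x ^ 3) * ennreal (h x) \<le> ennreal (K ^ (2 * m)) * ennreal (h x / n x ^ (2 * m) * n x ^ 3)"
        using h0[of x] nx K(1) by (subst (1 2) ennreal_mult[symmetric]) auto
      then have "(ennreal M * emeasure sphere_measure (sphere 0 1)) * (ennreal (n x ^ 3) * ennreal (h x)) \<le>
        (ennreal M * emeasure sphere_measure (sphere 0 1)) * (ennreal (K ^ (2 * m)) * ennreal (h x / n x ^ (2 * m) * n x ^ 3))"
        by (rule mult_left_mono) simp
      then show ?thesis using True by (simp add: N_simps hb_def mult_ac)
    qed simp
  qed
  also have "\<dots> = (ennreal M * emeasure sphere_measure (sphere 0 1) * ennreal (K ^ (2 * m))) * (\<integral>\<^sup>+x. ennreal (h x / n x ^ (2 * m) * n x ^ 3) * indicator MM x \<partial>lborel)"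
  proof (rule nn_integral_cmult)
    have "(\<lambda>x. ennreal (h x / n x ^ (2 * m) * n x ^ 3)) \<in> borel_measurable (restrict_space lborel MM)"
      using borel_measurable_integrable[OF fi, folded h_def] by measurable
    then show "(\<lambda>x. ennreal (h x / n x ^ (2 * m) * n x ^ 3) * indicator MM x) \<in> borel_measurable lborel"
      by (subst (asm) borel_measurable_restrict_space_iff_ennreal) (auto simp: MM_facts)
  qed
  also have "(\<integral>\<^sup>+x. ennreal (h x / n x ^ (2 * m) * n x ^ 3) * indicator MM x \<partial>lborel) = (\<integral>\<^sup>+x. ennreal (h x / n x ^ (2 * m) * n x ^ 3) \<partial>restrict_space lborel MM)"
    by (rule nn_integral_restrict_space[symmetric]) (simp add: MM_facts)
  also have "\<dots> = ennreal (LINT x|restrict_space lborel MM. h x / n x ^ (2 * m) * n x ^ 3)"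
    using h0 n_pos by (intro nn_integral_eq_integral fi[folded h_def] AE_I2) (auto simp: space_restrict_space less_imp_le)
  also have "(ennreal M * emeasure sphere_measure (sphere 0 1) * ennreal (K ^ (2 * m))) * \<dots> < \<infinity>"
    by (simp add: S2.emeasure_eq_measure ennreal_mult_less_top)
  finally have "integrable \<Sigma> (\<lambda>z. (norm (tensor_apply m f z))\<^sup>2)"
    using m by (intro integrableI_bounded) auto
  then show ?thesis using m by (simp add: L2v_def)
qed

theorem variational_problem:
  assumes e: "0 < e" and b: "\<beta> \<in> Linfty \<Sigma>" and a0: "0 < a0" "\<And>z. z \<in> Omega n \<Longrightarrow> a0 \<le> \<beta> z"
    and f: "f \<in> L2_sym_tensor n m" and ph: "\<phi>h \<in> H1 n"
  shows "\<exists>u\<in>H10 n. (\<forall>v\<in>H10 n. a_form n \<beta> e u v = b_form n \<beta> e m f \<phi>h v) \<and>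
           (\<forall>w\<in>H10 n. (\<forall>v\<in>H10 n. a_form n \<beta> e w v = b_form n \<beta> e m f \<phi>h v) \<longrightarrow> (AE z in \<Sigma>. w z = u z))"
proof -
  obtain c where c: "0 < c" "\<And>U. U \<in> V0 \<Longrightarrow> c * (LINT z|\<Sigma>. U z \<bullet> U z) \<le> Af e \<beta> U U"
    using Af_coercive[OF b e a0] by blast
  obtain C where C: "0 \<le> C" "\<And>U W. U \<in> L2v \<Sigma> \<Longrightarrow> W \<in> L2v \<Sigma> \<Longrightarrow>
    integrable \<Sigma> (\<lambda>z. af e \<beta> z (U z) (W z)) \<and> \<bar>Af e \<beta> U W\<bar> \<le> C * (L2norm \<Sigma> U * L2norm \<Sigma> W)"
    using Af_bounded[OF b] by blast
  define F where "F = tensor_apply m f"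
  have F: "F \<in> L2v \<Sigma>" unfolding F_def by (rule tensor_apply_L2v[OF f])
  define P where "P = triple \<phi>h"
  have P: "WD P" "P \<in> L2v \<Sigma>" "\<And>z. fst (P z) = \<phi>h z"
    using triple_WD[OF ph] WD_L2v by (auto simp: P_def triple_def)
  \<comment> \<open>\<open>P\<close> carries the extension \<open>\<phi>h\<close>, which may be
    nonzero on the boundary. It enters only through this functional, so the solution and the test
    triples stay in \<open>V0\<close>.\<close>
  define l where "l W = (LINT z|\<Sigma>. F z \<bullet> fst (W z)) - Af e \<beta> P W" for W
  have b_eq: "b_form n \<beta> e m f \<phi>h v = l W" if "WD W" "\<And>z. fst (W z) = v z" for W v
    unfolding b_form_def l_def using a_form_eq[OF b P(1,3) that] that(2) by (simp add: F_def)
  have V0D: "WD W" "W \<in> L2v \<Sigma>" "(\<lambda>z. fst (W z)) \<in> L2v \<Sigma>" if "W \<in> V0" for W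
    using that V0_L2v[OF that] L2v_components(1)[OF V0_L2v[OF that]] by (auto simp: V0_def)
  have "\<exists>R\<in>V0. \<forall>W\<in>V0. Af e \<beta> R W = l W"
  proof (rule V0.lax_milgram[where B=C and c=c and K="L2norm \<Sigma> F + C * L2norm \<Sigma> P"])
    show "Af e \<beta> (\<lambda>z. s *\<^sub>R U z + t *\<^sub>R W z) X = s * Af e \<beta> U X + t * Af e \<beta> W X" if "U \<in> V0" "W \<in> V0" "X \<in> V0" for U W X s t
      using that by (intro Af_lincomb b V0D)
    show "Af e \<beta> X (\<lambda>z. s *\<^sub>R U z + t *\<^sub>R W z) = s * Af e \<beta> X U + t * Af e \<beta> X W" if "U \<in> V0" "W \<in> V0" "X \<in> V0" for U W X s t
      using that by (intro Af_lincomb b V0D)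
    show "\<bar>Af e \<beta> U W\<bar> \<le> C * (sqrt (LINT z|\<Sigma>. U z \<bullet> U z) * sqrt (LINT z|\<Sigma>. W z \<bullet> W z))" if "U \<in> V0" "W \<in> V0" for U W
      using C(2)[OF V0D(2)[OF that(1)] V0D(2)[OF that(2)]] by (simp add: L2norm_def)
    show "c * (LINT z|\<Sigma>. U z \<bullet> U z) \<le> Af e \<beta> U U" if "U \<in> V0" for U by (rule c(2)[OF that])
    show "0 < c" by (rule c(1))
    show "l (\<lambda>z. s *\<^sub>R U z + t *\<^sub>R W z) = s * l U + t * l W" if "U \<in> V0" "W \<in> V0" for U W s t
    proof -
      have "Af e \<beta> P (\<lambda>z. s *\<^sub>R U z + t *\<^sub>R W z) = s * Af e \<beta> P U + t * Af e \<beta> P W"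
        using that by (intro Af_lincomb b V0D P)
      moreover have "(LINT z|\<Sigma>. F z \<bullet> fst (s *\<^sub>R U z + t *\<^sub>R W z)) = s * (LINT z|\<Sigma>. F z \<bullet> fst (U z)) + t * (LINT z|\<Sigma>. F z \<bullet> fst (W z))"
        using integrable_inner_L2v[OF F V0D(3)[OF that(1)]] integrable_inner_L2v[OF F V0D(3)[OF that(2)]]
        by (simp add: algebra_simps)
      ultimately show ?thesis unfolding l_def by (simp add: algebra_simps)
    qed
    show "\<bar>l W\<bar> \<le> (L2norm \<Sigma> F + C * L2norm \<Sigma> P) * sqrt (LINT z|\<Sigma>. W z \<bullet> W z)" if W: "W \<in> V0" for W
    proof -
      have "\<bar>LINT z|\<Sigma>. F z \<bullet> fst (W z)\<bar> \<le> L2norm \<Sigma> F * L2norm \<Sigma> (\<lambda>z. fst (W z))"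
        by (rule cauchy_schwarz_L2v[OF F V0D(3)[OF W]])
      also have "\<dots> \<le> L2norm \<Sigma> F * (1 * L2norm \<Sigma> W)"
        by (intro mult_left_mono L2norm_mono V0D W) (auto simp: L2norm_nonneg triple_component_le)
      finally have "\<bar>LINT z|\<Sigma>. F z \<bullet> fst (W z)\<bar> \<le> L2norm \<Sigma> F * L2norm \<Sigma> W" by simp
      moreover have "\<bar>Af e \<beta> P W\<bar> \<le> C * (L2norm \<Sigma> P * L2norm \<Sigma> W)" using C(2)[OF P(2) V0D(2)[OF W]] by blast
      ultimately have "\<bar>l W\<bar> \<le> (L2norm \<Sigma> F + C * L2norm \<Sigma> P) * L2norm \<Sigma> W"
        unfolding l_def distrib_right mult.assoc by linarith
      then show ?thesis by (simp add: L2norm_def)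
    qed
  qed
  then obtain R where R: "R \<in> V0" "\<And>W. W \<in> V0 \<Longrightarrow> Af e \<beta> R W = l W" by blast
  define u where "u z = fst (R z)" for z
  have tr: "triple v \<in> V0" "WD (triple v)" "fst (triple v z) = v z" if "v \<in> H10 n" for v z
  proof -
    show W: "WD (triple v)" by (rule triple_WD) (use that in \<open>simp add: H10_def\<close>)
    show "triple v \<in> V0" using V0_iff_H10[OF W] that by (simp add: triple_def)
    show "fst (triple v z) = v z" by (simp add: triple_def)
  qed
  have uH: "u \<in> H10 n" using V0_iff_H10[OF V0D(1)[OF R(1)]] R(1) by (simp add: u_def[abs_def])
  show ?thesis
  proof (intro bexI[OF _ uH] conjI ballI impI)
    fix v assume v: "v \<in> H10 n"
    have "a_form n \<beta> e u v = Af e \<beta> R (triple v)"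
      by (rule a_form_eq[OF b V0D(1)[OF R(1)] _ tr(2,3)[OF v]]) (simp add: u_def)
    also have "\<dots> = l (triple v)" by (rule R(2)[OF tr(1)[OF v]])
    also have "\<dots> = b_form n \<beta> e m f \<phi>h v" by (rule b_eq[symmetric, OF tr(2,3)[OF v]])
    finally show "a_form n \<beta> e u v = b_form n \<beta> e m f \<phi>h v" .
  next
    fix w assume w: "w \<in> H10 n" and sol: "\<forall>v\<in>H10 n. a_form n \<beta> e w v = b_form n \<beta> e m f \<phi>h v"
    \<comment> \<open>The difference of two solutions is itself an admissible test triple, and
      coercivity forces its norm to be 0; for functions this means equality almost
      everywhere.\<close>
    define D where "D z = 1 *\<^sub>R triple w z + (-1) *\<^sub>R R z" for z
    have D: "D \<in> V0" unfolding D_def[abs_def] by (rule V0_lincomb[OF tr(1)[OF w] R(1)])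
    have dH: "(\<lambda>z. fst (D z)) \<in> H10 n" using V0_iff_H10[OF V0D(1)[OF D]] D by simp
    have "Af e \<beta> (triple w) D = a_form n \<beta> e w (\<lambda>z. fst (D z))"
      by (rule a_form_eq[symmetric, OF b tr(2,3)[OF w] V0D(1)[OF D]]) simp
    also have "\<dots> = b_form n \<beta> e m f \<phi>h (\<lambda>z. fst (D z))" using sol dH by blast
    also have "\<dots> = l D" by (rule b_eq[OF V0D(1)[OF D]]) simp
    also have "\<dots> = Af e \<beta> R D" by (rule R(2)[OF D, symmetric])
    finally have "Af e \<beta> D D = 0"
      unfolding D_def[abs_def] using Af_lincomb(1)[OF b V0D(2)[OF tr(1)[OF w]] V0D(2)[OF R(1)] V0D(2)[OF D], of e 1 "-1"]
      by (simp add: D_def[abs_def])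
    then have "(LINT z|\<Sigma>. D z \<bullet> D z) \<le> 0" using c(2)[OF D] c(1) by (simp add: mult_le_0_iff)
    then have "(LINT z|\<Sigma>. D z \<bullet> D z) = 0" by (simp add: order_antisym)
    then have "AE z in \<Sigma>. D z \<bullet> D z = 0"
      using integral_nonneg_eq_0_iff_AE[OF integrable_inner_L2v[OF V0D(2)[OF D] V0D(2)[OF D]]] by simp
    then show "AE z in \<Sigma>. w z = u z"
      by eventually_elim (simp add: D_def u_def triple_def prod_eq_iff)
  qed
qed

end

theorem theorem3p2:
  fixes n :: "real^3 \<Rightarrow> real" and c\<^sub>n \<epsilon> \<alpha>\<^sub>0 :: real and m :: nat
    and \<alpha> \<phi> \<phi>h :: "(real^3) \<times> (real^3) \<Rightarrow> real"
    and f :: "real^3 \<Rightarrow> 3 list \<Rightarrow> real"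
  assumes "c\<^sub>n > 0" and "\<And>x. x \<in> MM \<Longrightarrow> n x \<ge> c\<^sub>n"
    and "C1_on MM n"
    and "\<epsilon> > 0"
    and "\<alpha> \<in> Linfty (Sigma_measure n)"
    and "\<alpha>\<^sub>0 > 0" and "\<And>z. z \<in> Omega n \<Longrightarrow> \<alpha> z \<ge> \<alpha>\<^sub>0"
    and "f \<in> L2_sym_tensor n m"
    and "\<phi>h \<in> H1 n"
    and "has_trace n (bd_Omega_plus n) \<phi>h \<phi>"
    and "(SUP x\<in>MM. gnorm n x (ggrad n n x) / n x) < \<alpha>\<^sub>0"
  shows "\<exists>u\<in>H10 n. (\<forall>v\<in>H10 n. a_form n \<alpha> \<epsilon> u v = b_form n \<alpha> \<epsilon> m f \<phi>h v) \<and>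
           (\<forall>w\<in>H10 n. (\<forall>v\<in>H10 n. a_form n \<alpha> \<epsilon> w v = b_form n \<alpha> \<epsilon> m f \<phi>h v) \<longrightarrow>
              (AE z in Sigma_measure n. w z = u z))"
proof -
  interpret refractive_index n c\<^sub>n using assms(1-3) by unfold_locales
  show ?thesis using assms(4-9) by (rule variational_problem)
qed

end
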